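(* Let $T>0$ and let $b:[0,T]\times\mathbb{R}^d\to\mathbb{R}^d$ be a measurable vector field for which there exist nonnegative $C_0,C_1\in L^1([0,T])$ such that $|b(t,y)|\le C_0(t)(1+|y|)$ for a.e. $(t,y)$, and $x\mapsto b(t,x)+C_1(t)x$ is increasing for a.e. $t\in[0,T]$. Assume that $f$ and $|f|$ are both distributional solutions of $$\partial_tf+\operatorname{div}(b(t,x)f)=0\ \text{ in }(0,T)\times\mathbb{R}^d.$$ Then $f$ is the unique duality solution of this equation; that is, $f(t,\cdot)=S^*(t,0)f(0,\cdot)$ for all $t\in[0,T]$.
   Context: For $x,y\in\mathbb{R}^n$, $x\le y$ means $x_i\le y_i$ for all $i$; a map is increasing if it preserves this order. $b_*(t,\cdot),b^*(t,\cdot)$ are the coordinatewise lower/upper semicontinuous envelopes of $b(t,\cdot)$. Regular Lagrangian flow of $b$: for every $s$ and a.e. $x$, $[s,T]\ni t\mapsto\phi_{t,s}(x)$ is the unique absolutely continuous solution of $\partial_t\phi_{t,s}(x)\in\prod_{i=1}^d[b^i_*(t,\phi_{t,s}(x)),b^{i,*}(t,\phi_{t,s}(x))]$ for a.e. $t\in[s,T]$, $\phi_{s,s}(x)=x$. The operators $S(s,t)\bar u=\bar u\circ\phi_{t,s}$, $0\le s\le t\le T$, are continuous on $L^q_{\mathrm{loc}}(\mathbb{R}^d)$, $1\le q\le\infty$. $S^*(t,s)$ is the adjoint of $S(s,t)$: $\int\bar u\,S^*(t,s)h\,dx=\int(S(s,t)\bar u)\,h\,dx$ for compactly supported test functions $\bar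 u$. The function $S^*(t,0)f_0$ is called the duality solution with initial datum $f_0$. Distributional solutions are taken in the class $C([0,T],L^p_{\mathrm{loc}}(\mathbb{R}^d))$ for some $1\le p\le\infty$ (with the local weak-$\star$ topology if $p=\infty$). *)

theory Defs
  imports "HOL-Analysis.Analysis"
begin

section \<open>Test functions\<close>

text \<open>On a finite-dimensional space, \<^term>\<open>C_k\<close> is the class of functions of class
  \<open>C\<^sup>k\<close>: all iterated directional derivatives of order at most \<open>k\<close> exist and are continuous.\<close>

primrec C_k :: "nat \<Rightarrow> ('a::real_normed_vector \<Rightarrow> real) \<Rightarrow> bool" where
  "C_k 0 f \<longleftrightarrow> continuous_on UNIV f"
| "C_k (Suc k) f \<longleftrightarrow>
     (\<forall>x. f differentiable (at x)) \<and> (\<forall>v. C_k k (\<lambda>x. frechet_derivative f (at x) v))"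

definition test_fun :: "'a::real_normed_vector set \<Rightarrow> ('a \<Rightarrow> real) \<Rightarrow> bool" where
  "test_fun U \<psi> \<longleftrightarrow>
     (\<forall>k. C_k k \<psi>) \<and> compact (closure {z. \<psi> z \<noteq> 0}) \<and> closure {z. \<psi> z \<noteq> 0} \<subseteq> U"


section \<open>Local Lebesgue spaces\<close>

definition Lp_loc :: "ereal \<Rightarrow> ('a::euclidean_space \<Rightarrow> real) \<Rightarrow> bool" where
  "Lp_loc p g \<longleftrightarrow> g \<in> borel_measurable lebesgue \<and>
     (\<forall>K. compact K \<longrightarrow>
        (if p = \<infinity> then (\<exists>M. AE x in lebesgue. x \<in> K \<longrightarrow> \<bar>g x\<bar> \<le> M)
         else set_integrable lebesgue K (\<lambda>x. \<bar>g x\<bar> powr real_of_ereal p)))"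

text \<open>The class \<open>C([0,T], L\<^sup>p\<^sub>l\<^sub>o\<^sub>c)\<close>. For \<open>p = \<infinity>\<close> continuity refers to the local weak-star topology, that is,
  to testing against compactly supported integrable functions.\<close>

definition C_Lp_loc :: "real \<Rightarrow> ereal \<Rightarrow> (real \<Rightarrow> 'a::euclidean_space \<Rightarrow> real) \<Rightarrow> bool" where
  "C_Lp_loc T p f \<longleftrightarrow> (\<forall>t\<in>{0..T}. Lp_loc p (f t)) \<and>
     (if p = \<infinity> then
        (\<forall>h. integrable lebesgue h \<and> bounded {x. h x \<noteq> 0} \<longrightarrow>
             continuous_on {0..T} (\<lambda>t. LINT x|lebesgue. f t x * h x))
      else
        (\<forall>K. compact K \<longrightarrow> (\<forall>t0\<in>{0..T}.
             ((\<lambda>t. LINT x:K|lebesgue. \<bar>f t x - f t0 x\<bar> powr real_of_ereal p) \<longlongrightarrow> 0)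
               (at t0 within {0..T}))))"


section \<open>Distributional solutions\<close>

text \<open>Distributional solutions of \<open>\<partial>\<^sub>t f + div (b f) = 0\<close> in \<open>(0,T) \<times> \<real>\<^sup>d\<close>. The derivative of the
  test function \<open>\<psi>\<close> at \<open>(t,x)\<close> in the direction \<open>(1, b t x)\<close> is \<open>\<partial>\<^sub>t \<psi> + b \<bullet> \<nabla>\<psi>\<close>. The space-time
  integral is iterated, because an element of \<open>C([0,T], L\<^sup>p\<^sub>l\<^sub>o\<^sub>c)\<close> is given by one equivalence
  class in \<open>x\<close> for each \<open>t\<close>; no jointly measurable representative has to be chosen.\<close>

definition distributional_solution ::
    "real \<Rightarrow> (real \<Rightarrow> real^'d \<Rightarrow> real^'d) \<Rightarrow> (real \<Rightarrow> real^'d \<Rightarrow> real) \<Rightarrow> bool" where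
  "distributional_solution T b f \<longleftrightarrow>
     (\<exists>p\<ge>1. C_Lp_loc T p f) \<and>
     (\<forall>\<psi>. test_fun ({0<..<T} \<times> UNIV) \<psi> \<longrightarrow>
        (LINT t|lebesgue_on {0..T}. LINT x|lebesgue.
            f t x * frechet_derivative \<psi> (at (t, x)) (1, b t x)) = 0)"


section \<open>The regular Lagrangian flow\<close>

definition absolutely_continuous_on ::
    "real \<Rightarrow> real \<Rightarrow> (real \<Rightarrow> 'a::metric_space) \<Rightarrow> bool" where
  "absolutely_continuous_on s T \<gamma> \<longleftrightarrow>
     (\<forall>\<epsilon>>0. \<exists>\<delta>>0. \<forall>D :: (real \<times> real) set.
        finite D \<and> (\<forall>(u, v)\<in>D. s \<le> u \<and> u \<le> v \<and> v \<le> T) \<and>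
        pairwise (\<lambda>(u, v) (u', v'). {u<..<v} \<inter> {u'<..<v'} = {}) D \<and>
        (\<Sum>(u, v)\<in>D. v - u) < \<delta>
        \<longrightarrow> (\<Sum>(u, v)\<in>D. dist (\<gamma> u) (\<gamma> v)) < \<epsilon>)"

text \<open>Coordinatewise semicontinuous envelopes of \<open>b t\<close>. The filter is \<^term>\<open>nhds x\<close>, so the value at
  \<open>x\<close> itself is taken into account.\<close>

definition lower_env :: "('a::topological_space \<Rightarrow> real^'d) \<Rightarrow> 'd \<Rightarrow> 'a \<Rightarrow> ereal" where
  "lower_env g i x = Liminf (nhds x) (\<lambda>y. ereal (g y $ i))"

definition upper_env :: "('a::topological_space \<Rightarrow> real^'d) \<Rightarrow> 'd \<Rightarrow> 'a \<Rightarrow> ereal" where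
  "upper_env g i x = Limsup (nhds x) (\<lambda>y. ereal (g y $ i))"

definition inclusion_solution ::
    "real \<Rightarrow> (real \<Rightarrow> real^'d \<Rightarrow> real^'d) \<Rightarrow> real \<Rightarrow> real^'d \<Rightarrow> (real \<Rightarrow> real^'d) \<Rightarrow> bool" where
  "inclusion_solution T b s x \<gamma> \<longleftrightarrow>
     absolutely_continuous_on s T \<gamma> \<and> \<gamma> s = x \<and>
     (AE t in lebesgue_on {s..T}. \<exists>v. (\<gamma> has_vector_derivative v) (at t within {s..T}) \<and>
        (\<forall>i. lower_env (b t) i (\<gamma> t) \<le> ereal (v $ i) \<and> ereal (v $ i) \<le> upper_env (b t) i (\<gamma> t)))"

text \<open>\<open>\<phi> t s x\<close> is the position at time \<open>t\<close> of the trajectory that starts from \<open>x\<close> at time \<open>s\<close>.\<close>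

definition regular_lagrangian_flow ::
    "real \<Rightarrow> (real \<Rightarrow> real^'d \<Rightarrow> real^'d) \<Rightarrow> (real \<Rightarrow> real \<Rightarrow> real^'d \<Rightarrow> real^'d) \<Rightarrow> bool" where
  "regular_lagrangian_flow T b \<phi> \<longleftrightarrow>
     (\<forall>s\<in>{0..T}. AE x in lebesgue.
        inclusion_solution T b s x (\<lambda>t. \<phi> t s x) \<and>
        (\<forall>\<gamma>. inclusion_solution T b s x \<gamma> \<longrightarrow> (\<forall>t\<in>{s..T}. \<gamma> t = \<phi> t s x)))"


section \<open>Duality solutions\<close>

definition flow_op ::
    "(real \<Rightarrow> real \<Rightarrow> 'a \<Rightarrow> 'a) \<Rightarrow> real \<Rightarrow> real \<Rightarrow> ('a \<Rightarrow> real) \<Rightarrow> 'a \<Rightarrow> real" where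
  "flow_op \<phi> s t u = u \<circ> \<phi> t s"

text \<open>\<open>is_adjoint \<phi> t s h g\<close> states \<open>g = S\<^sup>*(t,s) h\<close>, where \<open>S(s,t)\<close> is \<^term>\<open>flow_op \<phi> s t\<close>. This
  determines \<open>g\<close> up to a null set.\<close>

definition is_adjoint ::
    "(real \<Rightarrow> real \<Rightarrow> 'a \<Rightarrow> 'a) \<Rightarrow> real \<Rightarrow> real \<Rightarrow> ('a \<Rightarrow> real) \<Rightarrow> ('a::euclidean_space \<Rightarrow> real) \<Rightarrow> bool"
  where
  "is_adjoint \<phi> t s h g \<longleftrightarrow> Lp_loc 1 g \<and>
     (\<forall>u. test_fun UNIV u \<longrightarrow>
        integrable lebesgue (\<lambda>x. flow_op \<phi> s t u x * h x) \<and>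
        (LINT x|lebesgue. u x * g x) = (LINT x|lebesgue. flow_op \<phi> s t u x * h x))"

definition duality_solution ::
    "real \<Rightarrow> (real \<Rightarrow> real \<Rightarrow> 'a \<Rightarrow> 'a) \<Rightarrow> ('a::euclidean_space \<Rightarrow> real) \<Rightarrow> (real \<Rightarrow> 'a \<Rightarrow> real) \<Rightarrow> bool"
  where
  "duality_solution T \<phi> f0 f \<longleftrightarrow> (\<forall>t\<in>{0..T}. is_adjoint \<phi> t 0 f0 (f t))"

end

theory Submission
  imports Defs "HOL-Complex_Analysis.Complex_Analysis"
begin

text \<open>The theorem is a superposition principle in which the trajectories are constructed by hand. A
nonnegative weak solution \<open>f\<close> of \<open>\<partial>\<^sub>t f + div (b f) = 0\<close> is a density that moves with velocity \<open>b\<close>, and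
the task is to show that it is transported by the flow \<open>\<phi>\<close>, that is
\<open>\<integral> u (x) f (t, x) dx = \<integral> u (\<phi> t 0 x) f (0, x) dx\<close> for test functions \<open>u\<close>. The field \<open>b\<close> is too rough for its
mollification to be compared with it along \<open>f\<close>, and so the solution is mollified instead. With
\<open>a = f + \<sigma>\<close> for a constant \<open>\<sigma> > 0\<close> and a mollifier \<open>\<rho>\<close>, put \<open>g = \<rho> * a\<close>, \<open>J = \<rho> * (a b)\<close> and
\<open>v = J / g\<close>. The field \<open>v\<close> is continuously differentiable in space, and \<open>g\<close> solves its continuity
equation up to an error proportional to \<open>\<sigma>\<close>. The value of \<open>v\<close> at a point is a weighted mean of the
values of \<open>b\<close> near it, with positive weights, so it lies in the convex hull of those values.

For such a regular field the density \<open>g\<close> is transported, up to small errors, along Euler polygons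
(lemma \<open>euler_estimate\<close>); the error of each step is quadratic in the integral of the growth bound over it, apart from the
part proportional to \<open>\<sigma>\<close>. As the mollification radius, \<open>\<sigma>\<close> and the mesh width tend to zero, the
polygons that start near \<open>x\<close> are equicontinuous, and each of their limit points solves the
differential inclusion: the velocities lie in convex hulls of values of \<open>b\<close> on shrinking balls, and
in the limit the coordinates of such hulls are bounded by the semicontinuous envelopes. Since for
almost every \<open>x\<close> the inclusion has only the solution \<open>t \<mapsto> \<phi> t 0 x\<close>, the whole sequence of polygons converges to it
(lemma \<open>approximate_paths_converge\<close>). Dominated convergence then gives the transport identity for
every nonnegative weak solution (lemma \<open>weak_solution_transported\<close>).

Linearity extends the identity to signed solutions. As both \<open>f\<close> and \<open>|f|\<close> are solutions, so are
\<open>(|f| + f) / 2\<close> and \<open>(|f| - f) / 2\<close>, which are nonnegative and have difference \<open>f\<close>. A duality solution is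
unique because test functions separate locally integrable functions.\<close>

section \<open>Smooth functions and mollifiers\<close>

text \<open>An inductively generated class of infinitely differentiable functions. Its rules are chosen so that
the directional derivatives of a member are members again, which gives \<^const>\<open>C_k\<close> for all \<open>k\<close> without
computing iterated derivatives. The rule for compositions carries the whole sequence of
derivatives of the outer function, because otherwise the chain rule would lead out of the class.\<close>

inductive smooth :: "('a::euclidean_space \<Rightarrow> real) \<Rightarrow> bool" where
  const: "smooth (\<lambda>x. c)"
| linear: "bounded_linear l \<Longrightarrow> smooth l"
| add: "smooth p \<Longrightarrow> smooth q \<Longrightarrow> smooth (\<lambda>x. p x + q x)"
| mult: "smooth p \<Longrightarrow> smooth q \<Longrightarrow> smooth (\<lambda>x. p x * q x)"
| comp: "(\<And>n t. (S n has_real_derivative S (Suc n) t) (at t)) \<Longrightarrow> smooth q \<Longrightarrow> smooth (\<lambda>x. S 0 (q x))"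

lemma smooth_derivative:
  assumes "smooth f"
  shows "\<exists>f'. (\<forall>x. (f has_derivative f' x) (at x)) \<and> (\<forall>v. smooth (\<lambda>x. f' x v))"
  using assms
proof induction
  case (const c)
  show ?case by (rule exI[of _ "\<lambda>x v. 0"]) (auto intro: smooth.const)
next
  case (linear l)
  then show ?case
    by (intro exI[of _ "\<lambda>x. l"]) (auto intro: smooth.const bounded_linear_imp_has_derivative)
next
  case (add p q)
  then obtain p' q' where
    "\<forall>x. (p has_derivative p' x) (at x)" "\<forall>v. smooth (\<lambda>x. p' x v)"
    "\<forall>x. (q has_derivative q' x) (at x)" "\<forall>v. smooth (\<lambda>x. q' x v)" by blast
  then show ?case
    by (intro exI[of _ "\<lambda>x v. p' x v + q' x v"]) (auto intro: smooth.add has_derivative_add)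
next
  case (mult p q)
  then obtain p' q' where
    *: "\<forall>x. (p has_derivative p' x) (at x)" "\<forall>v. smooth (\<lambda>x. p' x v)"
    "\<forall>x. (q has_derivative q' x) (at x)" "\<forall>v. smooth (\<lambda>x. q' x v)" by blast
  with mult(1,2) show ?case
    by (intro exI[of _ "\<lambda>x v. p x * q' x v + p' x v * q x"])
       (auto intro!: smooth.add smooth.mult has_derivative_mult)
next
  case (comp S q)
  then obtain q' where
    *: "\<forall>x. (q has_derivative q' x) (at x)" "\<forall>v. smooth (\<lambda>x. q' x v)" by blast
  have "smooth (\<lambda>x. S 1 (q x))"
    using smooth.comp[of "\<lambda>n. S (Suc n)" q] comp by simp
  moreover have "((\<lambda>x. S 0 (q x)) has_derivative (\<lambda>v. S 1 (q x) * q' x v)) (at x)" for x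
    using has_derivative_compose[OF *(1)[rule_format, of x], of "S 0" "\<lambda>v. S 1 (q x) * v"]
      comp(1)[of 0 "q x"] by (simp add: has_field_derivative_def)
  ultimately show ?case using *
    by (intro exI[of _ "\<lambda>x v. S 1 (q x) * q' x v"]) (auto intro: smooth.mult)
qed

lemma smooth_continuous: "smooth f \<Longrightarrow> continuous_on A f"
  using smooth_derivative[of f] by (meson continuous_at_imp_continuous_on has_derivative_continuous)

lemma smooth_C_k: "smooth f \<Longrightarrow> C_k k f"
proof (induction k arbitrary: f)
  case 0
  then show ?case by (simp add: smooth_continuous)
next
  case (Suc k)
  obtain f' where f': "\<forall>x. (f has_derivative f' x) (at x)" "\<forall>v. smooth (\<lambda>x. f' x v)"
    using smooth_derivative[OF Suc.prems] by blast
  have "frechet_derivative f (at x) = f' x" for x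
    using f'(1) by (metis frechet_derivative_at)
  with f' Suc.IH show ?case by (auto simp: differentiable_def)
qed

lemma smooth_gradient:
  fixes f :: "'a::euclidean_space \<Rightarrow> real"
  assumes "smooth f"
  obtains G where "\<And>x. (f has_derivative (\<lambda>v. G x \<bullet> v)) (at x)" "continuous_on UNIV G"
    "\<And>v. smooth (\<lambda>x. G x \<bullet> v)"
proof -
  obtain f' where f': "\<And>x. (f has_derivative f' x) (at x)" "\<And>v. smooth (\<lambda>x. f' x v)"
    using smooth_derivative[OF assms] by blast
  define G where "G x = (\<Sum>i\<in>Basis. f' x i *\<^sub>R i)" for x
  have G: "G x \<bullet> v = f' x v" for x v
  proof -
    interpret bounded_linear "f' x" using f'(1) by (rule has_derivative_bounded_linear)
    have "f' x v = f' x (\<Sum>i\<in>Basis. (v \<bullet> i) *\<^sub>R i)" by (simp add: euclidean_representation)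
    also have "\<dots> = G x \<bullet> v"
      by (simp add: sum scaleR G_def inner_sum_left inner_sum_right inner_commute mult.commute)
    finally show ?thesis by simp
  qed
  show ?thesis
  proof
    show "(f has_derivative (\<lambda>v. G x \<bullet> v)) (at x)" for x using f' G by simp
    show "continuous_on UNIV G" unfolding G_def
      by (intro continuous_intros smooth_continuous f')
    show "smooth (\<lambda>x. G x \<bullet> v)" for v using f' G by simp
  qed
qed

lemma smooth_affine:
  assumes "smooth q" and l: "bounded_linear l"
  shows "smooth (\<lambda>z. q (a + l z))"
  using assms(1)
proof induction
  case (const c) show ?case by (rule smooth.const)
next
  case (linear k)
  have "bounded_linear (\<lambda>z. k (l z))" using bounded_linear_compose[OF linear l] .
  then show ?case
    using smooth.add[OF smooth.const[of "k a"] smooth.linear[of "\<lambda>z. k (l z)"]]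
      linear_add[OF bounded_linear.linear[OF linear]] by simp
next
  case (add p q) then show ?case by (intro smooth.add)
next
  case (mult p q) then show ?case by (intro smooth.mult)
next
  case (comp S q) then show ?case using smooth.comp[of S "\<lambda>z. q (a + l z)"] by simp
qed

lemma smooth_sum: "(\<And>i. i \<in> I \<Longrightarrow> smooth (q i)) \<Longrightarrow> smooth (\<lambda>x. \<Sum>i\<in>I. q i x)"
  by (induction I rule: infinite_finite_induct) (auto intro: smooth.const smooth.add)

lemma smooth_norm_sq: "smooth (\<lambda>x::'a::euclidean_space. x \<bullet> x)"
proof -
  have "smooth (\<lambda>x::'a. \<Sum>i\<in>Basis. (x \<bullet> i) * (x \<bullet> i))"
    by (intro smooth_sum smooth.mult smooth.linear bounded_linear_inner_left)
  then show ?thesis by (simp add: euclidean_inner[symmetric])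
qed

text \<open>Admitting every polynomial \<open>P\<close> makes the family closed under
differentiation.\<close>

definition flat :: "real poly \<Rightarrow> real \<Rightarrow> real" where
  "flat P t = (if t > 0 then poly P (1 / t) * exp (- (1 / t)) else 0)"

definition flat_deriv :: "real poly \<Rightarrow> real poly" where
  "flat_deriv P = [:0, 0, 1:] * (P - pderiv P)"

lemma poly_exp_decay: "((\<lambda>y. poly P y * exp (- y)) \<longlongrightarrow> 0) at_top" for P :: "real poly"
proof -
  have "((\<lambda>y. \<Sum>i\<le>degree P. coeff P i * (y ^ i / exp y)) \<longlongrightarrow> (\<Sum>i\<le>degree P. coeff P i * 0)) at_top"
    by (intro tendsto_sum tendsto_mult tendsto_const tendsto_power_div_exp_0)
  then show ?thesis by (simp add: poly_altdef exp_minus field_simps sum_divide_distrib)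
qed

lemma flat_has_derivative: "(flat P has_real_derivative flat (flat_deriv P) t) (at t)"
proof -
  consider "t > 0" | "t < 0" | "t = 0" by linarith
  then show ?thesis
  proof cases
    case 1
    have "((\<lambda>t. poly P (1 / t) * exp (- (1 / t))) has_real_derivative flat (flat_deriv P) t) (at t)"
      using 1 by (auto intro!: derivative_eq_intros DERIV_chain2[OF poly_DERIV]
          simp: flat_def flat_deriv_def field_simps power2_eq_square)
    then show ?thesis
      by (rule has_field_derivative_transform_within_open[where S="{0<..}"]) (use 1 in \<open>auto simp: flat_def\<close>)
  next
    case 2
    have "((\<lambda>t. 0) has_real_derivative flat (flat_deriv P) t) (at t)" using 2 by (simp add: flat_def)
    then show ?thesis
      by (rule has_field_derivative_transform_within_open[where S="{..<0}"]) (use 2 in \<open>auto simp: flat_def\<close>)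
  next
    case 3
    have "((\<lambda>h. poly (pCons 0 P) (inverse h) * exp (- inverse h)) \<longlongrightarrow> 0) (at_right 0)"
      using filterlim_compose[OF poly_exp_decay filterlim_inverse_at_top_right] .
    then have "((\<lambda>h. flat P h / h) \<longlongrightarrow> 0) (at_right 0)"
      by (rule Lim_transform_eventually)
        (auto simp: eventually_at_right_field flat_def divide_simps intro!: exI[of _ 1])
    moreover have "((\<lambda>h. flat P h / h) \<longlongrightarrow> 0) (at_left 0)"
      by (rule tendsto_eventually) (auto simp: eventually_at_left_field flat_def intro!: exI[of _ "-1"])
    ultimately have "((\<lambda>h. flat P h / h) \<longlongrightarrow> 0) (at 0)"
      by (simp add: filterlim_at_split)
    then show ?thesis using 3 by (simp add: has_field_derivative_iff flat_def)
  qed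
qed

lemma smooth_flat: "smooth q \<Longrightarrow> smooth (\<lambda>x. flat P (q x))"
  using smooth.comp[of "\<lambda>n. flat ((flat_deriv ^^ n) P)" q] flat_has_derivative by simp

lemma integrable_continuous_bounded_support:
  fixes q :: "'a::euclidean_space \<Rightarrow> 'b::euclidean_space"
  assumes "continuous_on UNIV q" "\<And>x. R \<le> norm x \<Longrightarrow> q x = 0"
  shows "integrable lborel q"
proof -
  have "integrable lborel (\<lambda>x. indicator (cball 0 R) x *\<^sub>R q x)"
    by (rule borel_integrable_compact) (auto intro: continuous_on_subset assms(1))
  moreover have "(\<lambda>x. indicator (cball 0 R) x *\<^sub>R q x) = q"
    using assms(2) by (auto simp: indicator_def fun_eq_iff)
  ultimately show ?thesis by simp
qed

lemma mollifier_exists: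
  assumes "0 < \<delta>"
  obtains \<rho> :: "'a::euclidean_space \<Rightarrow> real"
  where "smooth \<rho>" "\<And>x. 0 \<le> \<rho> x" "\<And>x. \<delta> \<le> norm x \<Longrightarrow> \<rho> x = 0" "integral\<^sup>L lborel \<rho> = 1"
proof -
  define q where "q x = flat 1 (\<delta>\<^sup>2 - x \<bullet> x)" for x :: 'a
  have q: "smooth q" unfolding q_def
    using smooth.add[OF smooth.const[of "\<delta>\<^sup>2"] smooth.mult[OF smooth.const[of "-1"] smooth_norm_sq]]
    by (intro smooth_flat) simp
  have q0: "0 \<le> q x" for x by (simp add: q_def flat_def)
  have q_out: "q x = 0" if "\<delta> \<le> norm x" for x
  proof -
    have "\<delta>\<^sup>2 \<le> (norm x)\<^sup>2" using that assms by (intro power_mono) auto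
    then show ?thesis by (simp add: q_def flat_def dot_square_norm)
  qed
  have q_in: "q x > 0" if "x \<in> ball 0 \<delta>" for x
  proof -
    have "(norm x)\<^sup>2 < \<delta>\<^sup>2" using that by (intro power_strict_mono) auto
    then show ?thesis by (simp add: q_def flat_def dot_square_norm)
  qed
  have int: "integrable lborel q"
    by (rule integrable_continuous_bounded_support[of _ \<delta>])
      (auto intro: smooth_continuous q q_out)
  define Z where "Z = integral\<^sup>L lborel q"
  have "Z > 0"
  proof (rule ccontr)
    assume "\<not> Z > 0"
    then have "Z = 0" using Bochner_Integration.integral_nonneg[of lborel q] q0 by (simp add: Z_def order.antisym)
    then have "AE x in lborel. q x = 0"
      using integral_nonneg_eq_0_iff_AE[OF int] q0 by (simp add: Z_def)
    then have "AE x in lborel. x \<notin> ball (0::'a) \<delta>" by eventually_elim (use q_in in force)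
    then have "emeasure lborel (ball (0::'a) \<delta>) = 0"
      by (subst (asm) AE_iff_measurable[OF _ refl]) (auto simp: ball_def)
    then show False using assms content_ball_pos[of \<delta> "0::'a"] by (simp add: measure_def)
  qed
  show ?thesis
  proof
    show "smooth (\<lambda>x. (1 / Z) * q x)" by (intro smooth.mult smooth.const q)
  qed (use q0 q_out \<open>Z > 0\<close> in \<open>auto simp: Z_def\<close>)
qed

lemma smooth_deriv:
  fixes f :: "real \<Rightarrow> real"
  assumes "smooth f"
  shows "smooth (deriv f)" "(f has_real_derivative deriv f x) (at x)"
proof -
  obtain f' where f': "\<And>x. (f has_derivative f' x) (at x)" "\<And>v. smooth (\<lambda>x. f' x v)"
    using smooth_derivative[OF assms] by blast
  have *: "(f has_real_derivative f' x 1) (at x)" for x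
  proof -
    interpret bounded_linear "f' x" using f'(1) by (rule has_derivative_bounded_linear)
    have "f' x = (*) (f' x 1)"
    proof
      show "f' x v = f' x 1 * v" for v using scaleR[of v 1] by (simp add: mult.commute)
    qed
    then show ?thesis using f'(1)[of x] by (simp add: has_field_derivative_def)
  qed
  then have "deriv f = (\<lambda>x. f' x 1)" by (intro ext DERIV_imp_deriv)
  then show "smooth (deriv f)" "(f has_real_derivative deriv f x) (at x)"
    using f'(2)[of 1] *[of x] by simp_all
qed

text \<open>The sequence \<open>\<theta>, \<eta>, \<eta>', \<dots>\<close> consists of successive derivatives, so it qualifies for the composition
rule with the identity as inner function.\<close>

lemma smooth_antiderivative:
  fixes \<eta> \<theta> :: "real \<Rightarrow> real"
  assumes "smooth \<eta>" and \<theta>: "\<And>t. (\<theta> has_real_derivative \<eta> t) (at t)"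
  shows "smooth \<theta>"
proof -
  have sm: "smooth ((deriv ^^ n) \<eta>)" for n by (induction n) (auto intro: smooth_deriv assms)
  have "(case_nat \<theta> (\<lambda>n. (deriv ^^ n) \<eta>) n has_real_derivative case_nat \<theta> (\<lambda>n. (deriv ^^ n) \<eta>) (Suc n) t) (at t)" for n t
    by (cases n) (auto intro: \<theta> smooth_deriv(2)[OF sm])
  from smooth.comp[of "case_nat \<theta> (\<lambda>n. (deriv ^^ n) \<eta>)" "\<lambda>x. x", OF this]
  show ?thesis by (simp add: smooth.linear)
qed

lemma test_fun_smooth:
  assumes "smooth \<psi>" "compact K" "K \<subseteq> U" and 0: "\<And>z. z \<notin> K \<Longrightarrow> \<psi> z = 0"
  shows "test_fun U \<psi>"
proof -
  have "closure {z. \<psi> z \<noteq> 0} \<subseteq> K"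
    by (rule closure_minimal) (use 0 compact_imp_closed[OF assms(2)] in auto)
  moreover from this have "compact (closure {z. \<psi> z \<noteq> 0})"
    by (meson assms(2) bounded_subset closed_closure compact_eq_bounded_closed)
  ultimately show ?thesis
    unfolding test_fun_def using smooth_C_k[OF assms(1)] assms(3) by blast
qed

section \<open>Absolutely continuous functions of one real variable\<close>

lemma set_integral_Icc_split:
  fixes k :: "real \<Rightarrow> 'b::{banach, second_countable_topology}"
  assumes "integrable lborel k" "a \<le> b" "b \<le> c"
  shows "(LINT r:{a..c}|lborel. k r) = (LINT r:{a..b}|lborel. k r) + (LINT r:{b..c}|lborel. k r)"
proof -
  have "(LINT r:{a..c}|lborel. k r) = (LINT r:{a..b} \<union> {b<..c}|lborel. k r)"
    using assms(2,3) by (simp add: ivl_disj_un)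
  also have "\<dots> = (LINT r:{a..b}|lborel. k r) + (LINT r:{b<..c}|lborel. k r)"
    by (rule set_integral_Un) (auto intro: integrable_mult_indicator assms simp: set_integrable_def)
  also have "(LINT r:{b<..c}|lborel. k r) = (LINT r:{b..c}|lborel. k r)"
    unfolding set_lebesgue_integral_def
    using AE_lborel_singleton[of b]
    by (intro integral_cong_AE) (use assms(1) in \<open>auto simp: indicator_def elim!: eventually_mono\<close>)
  finally show ?thesis .
qed

lemma set_integrable_of_integrable:
  "integrable M k \<Longrightarrow> A \<in> sets M \<Longrightarrow> set_integrable M A k"
  for k :: "'a \<Rightarrow> 'b::{banach, second_countable_topology}"
  unfolding set_integrable_def by (rule integrable_mult_indicator)

lemma set_integral_nonneg_mono:
  fixes k :: "'a \<Rightarrow> real"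
  assumes "integrable M k" "\<And>r. 0 \<le> k r" "A \<in> sets M" "B \<in> sets M" "A \<subseteq> B"
  shows "(LINT r:A|M. k r) \<le> (LINT r:B|M. k r)"
  unfolding set_lebesgue_integral_def
  by (intro integral_mono integrable_mult_indicator assms) (use assms in \<open>auto simp: indicator_def\<close>)

lemma set_integral_absolutely_continuous:
  fixes k :: "'a \<Rightarrow> real"
  assumes k: "integrable M k" "\<And>r. 0 \<le> k r" and "0 < \<epsilon>"
  shows "\<exists>\<delta>>0. \<forall>A\<in>sets M. emeasure M A < ennreal \<delta> \<longrightarrow> (LINT r:A|M. k r) < \<epsilon>"
proof -
  have [measurable]: "k \<in> borel_measurable M" using k by auto
  have int: "integrable M (\<lambda>r. min (k r) (real n))" for n
    by (rule Bochner_Integration.integrable_bound[OF k(1)]) (use k(2) in auto)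
  have "(\<lambda>n. LINT r|M. min (k r) (real n)) \<longlonglongrightarrow> (LINT r|M. k r)"
  proof (rule integral_dominated_convergence[where w=k])
    have "(\<lambda>n. min (k r) (real n)) \<longlonglongrightarrow> k r" for r
    proof (rule tendsto_eventually)
      obtain m where "k r \<le> real m" using real_arch_simple by blast
      then have "min (k r) (real n) = k r" if "n \<ge> m" for n
        using that by (intro min_absorb1) (meson of_nat_mono order_trans)
      then show "\<forall>\<^sub>F n in sequentially. min (k r) (real n) = k r"
        by (auto simp: eventually_sequentially)
    qed
    then show "AE x in M. (\<lambda>n. min (k x) (real n)) \<longlonglongrightarrow> k x" by simp
  qed (use k in auto)
  then have "eventually (\<lambda>n. dist (LINT r|M. min (k r) (real n)) (LINT r|M. k r) < \<epsilon> / 2) sequentially"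
    using \<open>0 < \<epsilon>\<close> by (intro tendstoD) auto
  then obtain n where n: "dist (LINT r|M. min (k r) (real n)) (LINT r|M. k r) < \<epsilon> / 2"
    by (auto simp: eventually_sequentially)
  show ?thesis
  proof (intro exI[of _ "\<epsilon> / (2 * (real n + 1))"] conjI ballI impI)
    fix A assume A[measurable]: "A \<in> sets M" and small: "emeasure M A < ennreal (\<epsilon> / (2 * (real n + 1)))"
    have fin: "emeasure M A < \<infinity>" using order_less_trans[OF small ennreal_less_top] by simp
    then have mA: "measure M A < \<epsilon> / (2 * (real n + 1))"
      using small \<open>0 < \<epsilon>\<close> by (simp add: emeasure_eq_ennreal_measure less_top ennreal_less_iff)
    have "(LINT r:A|M. k r) \<le> (LINT r|M. (k r - min (k r) (real n)) + real n * indicator A r)"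
      unfolding set_lebesgue_integral_def
    proof (rule integral_mono)
      show "integrable M (\<lambda>r. (k r - min (k r) (real n)) + real n * indicator A r)"
        using k(1) int fin by (auto intro!: Bochner_Integration.integrable_add Bochner_Integration.integrable_diff)
      show "integrable M (\<lambda>r. indicator A r *\<^sub>R k r)" by (intro integrable_mult_indicator k A)
    qed (use k(2) in \<open>auto simp: indicator_def\<close>)
    also have "\<dots> = ((LINT r|M. k r) - (LINT r|M. min (k r) (real n))) + real n * measure M A"
      using k(1) int[of n] fin by (subst Bochner_Integration.integral_add) auto
    also have "\<dots> < \<epsilon> / 2 + \<epsilon> / 2"
    proof (rule add_less_le_mono)
      have "real n * measure M A \<le> real n * (\<epsilon> / (2 * (real n + 1)))"
        using mA by (intro mult_left_mono) auto
      also have "\<dots> \<le> \<epsilon> / 2" using \<open>0 < \<epsilon>\<close> by (simp add: field_simps)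
      finally show "real n * measure M A \<le> \<epsilon> / 2" .
      show "(LINT r|M. k r) - (LINT r|M. min (k r) (real n)) < \<epsilon> / 2"
        using n unfolding dist_real_def by linarith
    qed
    finally show "(LINT r:A|M. k r) < \<epsilon>" by simp
  qed (use \<open>0 < \<epsilon>\<close> in auto)
qed

lemma set_integral_Icc_small:
  fixes k :: "real \<Rightarrow> real"
  assumes k: "integrable lborel k" "\<And>r. 0 \<le> k r" and "0 < \<epsilon>"
  shows "\<exists>\<delta>>0. \<forall>s t. t - s < \<delta> \<longrightarrow> (LINT r:{s..t}|lborel. k r) < \<epsilon>"
proof -
  obtain \<delta> where \<delta>: "\<delta> > 0" "\<And>A. A \<in> sets lborel \<Longrightarrow> emeasure lborel A < ennreal \<delta> \<Longrightarrow> (LINT r:A|lborel. k r) < \<epsilon>"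
    using set_integral_absolutely_continuous[OF k \<open>0 < \<epsilon>\<close>] by blast
  have "(LINT r:{s..t}|lborel. k r) < \<epsilon>" if "t - s < \<delta>" for s t
    using that \<delta>(1) by (intro \<delta>(2)) (auto simp: emeasure_lborel_Icc_eq ennreal_less_iff)
  then show ?thesis using \<delta>(1) by blast
qed

lemma set_integral_atMost_diff:
  fixes k :: "real \<Rightarrow> 'b::{banach, second_countable_topology}"
  assumes k: "integrable lborel k" and "s \<le> t"
  shows "(LINT r:{..t}|lborel. k r) - (LINT r:{..s}|lborel. k r) = (LINT r:{s..t}|lborel. k r)"
proof -
  have "(LINT r:{..t}|lborel. k r) = (LINT r:{..s} \<union> {s<..t}|lborel. k r)"
    using assms(2) by (simp add: ivl_disj_un)
  also have "\<dots> = (LINT r:{..s}|lborel. k r) + (LINT r:{s<..t}|lborel. k r)"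
    by (rule set_integral_Un) (auto intro: set_integrable_of_integrable k)
  also have "(LINT r:{s<..t}|lborel. k r) = (LINT r:{s..t}|lborel. k r)"
    unfolding set_lebesgue_integral_def
    using AE_lborel_singleton[of s]
    by (intro integral_cong_AE) (use k in \<open>auto simp: indicator_def elim!: eventually_mono\<close>)
  finally show ?thesis by simp
qed

lemma continuous_of_integral_modulus:
  fixes k :: "real \<Rightarrow> real" and \<gamma> :: "real \<Rightarrow> 'b::real_normed_vector"
  assumes k: "integrable lborel k" "\<And>r. 0 \<le> k r"
    and \<gamma>: "\<And>s t. s \<le> t \<Longrightarrow> norm (\<gamma> t - \<gamma> s) \<le> (LINT r:{s..t}|lborel. k r)"
  shows "continuous_on UNIV \<gamma>"
  unfolding continuous_on_iff
proof (intro ballI allI impI)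
  fix x \<epsilon> :: real assume "0 < \<epsilon>"
  obtain \<delta> where \<delta>: "\<delta> > 0" "\<And>s t. t - s < \<delta> \<Longrightarrow> (LINT r:{s..t}|lborel. k r) < \<epsilon>"
    using set_integral_Icc_small[OF k \<open>0 < \<epsilon>\<close>] by blast
  have "dist (\<gamma> y) (\<gamma> x) < \<epsilon>" if "dist y x < \<delta>" for y
    using \<gamma>[of x y] \<gamma>[of y x] \<delta>(2)[of y x] \<delta>(2)[of x y] that
    by (cases "x \<le> y") (auto simp: dist_norm norm_minus_commute)
  then show "\<exists>d>0. \<forall>x'\<in>UNIV. dist x' x < d \<longrightarrow> dist (\<gamma> x') (\<gamma> x) < \<epsilon>" using \<delta>(1) by blast
qed

text \<open>With \<open>K\<close> the primitive of \<open>k\<close>, the functions \<open>K + \<gamma>\<close> and \<open>K - \<gamma>\<close> are nondecreasing and continuous. The sum of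
their Stieltjes measures has density \<open>2 k\<close>, so each of them is absolutely continuous, and the
Radon-Nikodym density of the first one yields the density of \<open>\<gamma>\<close>.\<close>

lemma density_of_dominated_path:
  fixes k \<gamma> :: "real \<Rightarrow> real"
  assumes k: "integrable lborel k" "\<And>r. 0 \<le> k r"
    and \<gamma>: "\<And>s t. s \<le> t \<Longrightarrow> \<bar>\<gamma> t - \<gamma> s\<bar> \<le> (LINT r:{s..t}|lborel. k r)"
  obtains h where "integrable lborel h" "\<And>s t. s \<le> t \<Longrightarrow> \<gamma> t - \<gamma> s = (LINT r:{s..t}|lborel. h r)"
proof -
  have [measurable]: "k \<in> borel_measurable borel" using k by auto
  define K where "K t = (LINT r:{..t}|lborel. k r)" for t
  have Kd: "K t - K s = (LINT r:{s..t}|lborel. k r)" if "s \<le> t" for s t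
    using set_integral_atMost_diff[OF k(1) that] by (simp add: K_def)
  have I0: "0 \<le> (LINT r:{s..t}|lborel. k r)" for s t
    unfolding set_lebesgue_integral_def by (rule Bochner_Integration.integral_nonneg) (simp add: k)
  have K_cont: "continuous_on UNIV K"
    by (rule continuous_of_integral_modulus[OF k]) (use Kd I0 in simp)
  have \<gamma>_cont: "continuous_on UNIV \<gamma>"
    by (rule continuous_of_integral_modulus[OF k]) (use \<gamma> in simp)
  define F where "F t = K t + \<gamma> t" for t
  define G where "G t = K t - \<gamma> t" for t
  have mono: "s \<le> t \<Longrightarrow> F s \<le> F t" "s \<le> t \<Longrightarrow> G s \<le> G t" for s t
    using \<gamma>[of s t] Kd[of s t] by (auto simp: F_def G_def)
  have cont: "continuous (at_right a) F" "continuous (at_right a) G" for a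
    unfolding F_def[abs_def] G_def[abs_def]
    using K_cont \<gamma>_cont
    by (auto intro!: continuous_intros simp: continuous_on_eq_continuous_within intro: continuous_within_subset)
  let ?F = "interval_measure F" and ?G = "interval_measure G"
  define M where "M = density lborel (\<lambda>r. ennreal (2 * k r))"
  have eF: "emeasure ?F {a<..b} = ennreal (F b - F a)" if "a \<le> b" for a b
    using emeasure_interval_measure_Ioc_eq[of F a b, OF mono(1) cont(1)] that by simp
  have eG: "emeasure ?G {a<..b} = ennreal (G b - G a)" if "a \<le> b" for a b
    using emeasure_interval_measure_Ioc_eq[of G a b, OF mono(2) cont(2)] that by simp
  have Ioc_Icc: "(LINT r:{a<..b}|lborel. q r) = (LINT r:{a..b}|lborel. q r)" if "q \<in> borel_measurable borel" for a b and q :: "real \<Rightarrow> real"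
    unfolding set_lebesgue_integral_def
    using AE_lborel_singleton[of a] that
    by (intro integral_cong_AE) (auto simp: indicator_def elim!: eventually_mono)
  have eM: "emeasure M {a<..b} = ennreal (2 * (K b - K a))" if "a \<le> b" for a b
  proof -
    have "emeasure M {a<..b} = (\<integral>\<^sup>+ r. ennreal (2 * (indicator {a<..b} r *\<^sub>R k r)) \<partial>lborel)"
      unfolding M_def by (subst emeasure_density) (auto intro!: nn_integral_cong simp: indicator_def)
    also have "\<dots> = ennreal (LINT r|lborel. 2 * (indicator {a<..b} r *\<^sub>R k r))"
    proof (rule nn_integral_eq_integral)
      show "integrable lborel (\<lambda>r. 2 * (indicator {a<..b} r *\<^sub>R k r))"
        by (intro integrable_mult_right integrable_mult_indicator k(1)) simp
    qed (use k(2) in \<open>auto simp: indicator_def\<close>)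
    also have "(LINT r|lborel. 2 * (indicator {a<..b} r *\<^sub>R k r)) = 2 * (K b - K a)"
      using Ioc_Icc[of k a b] Kd[OF that] by (simp add: set_lebesgue_integral_def)
    finally show ?thesis .
  qed
  have sum_Ioc: "emeasure ?F {a<..b} + emeasure ?G {a<..b} = emeasure M {a<..b}" for a b
  proof (cases "a \<le> b")
    case True
    then show ?thesis using mono[OF True]
      by (simp add: eF eG eM ennreal_plus[symmetric] del: ennreal_plus) (simp add: F_def G_def)
  qed auto
  have setsM [simp]: "sets M = sets borel" "space M = UNIV" by (simp_all add: M_def)
  have UN: "(\<Union>n. {- real n<..real n}) = (UNIV::real set)"
  proof -
    have "\<exists>n. - real n < x \<and> x \<le> real n" for x :: real
    proof -
      obtain n where "\<bar>x\<bar> < real n" using reals_Archimedean2 by blast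
      then show ?thesis by (intro exI[of _ n]) linarith
    qed
    then show ?thesis by auto
  qed
  have inc: "incseq (\<lambda>n. {- real n<..real n})" by (auto simp: incseq_def)
  have sum_UNIV: "emeasure ?F UNIV + emeasure ?G UNIV = emeasure M UNIV"
  proof (rule LIMSEQ_unique)
    show "(\<lambda>n. emeasure M {- real n<..real n}) \<longlonglongrightarrow> emeasure M UNIV"
      using Lim_emeasure_incseq[of "\<lambda>n. {- real n<..real n}" M] inc UN by (simp add: image_subset_iff)
    have "(\<lambda>n. emeasure ?F {- real n<..real n} + emeasure ?G {- real n<..real n}) \<longlonglongrightarrow> emeasure ?F UNIV + emeasure ?G UNIV"
      using Lim_emeasure_incseq[of "\<lambda>n. {- real n<..real n}" ?F] Lim_emeasure_incseq[of "\<lambda>n. {- real n<..real n}" ?G] inc UN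
      by (intro tendsto_add) (simp_all add: image_subset_iff)
    then show "(\<lambda>n. emeasure M {- real n<..real n}) \<longlonglongrightarrow> emeasure ?F UNIV + emeasure ?G UNIV"
      by (simp add: sum_Ioc)
  qed
  have M_fin: "emeasure M UNIV < \<infinity>"
  proof -
    have "emeasure M UNIV = (\<integral>\<^sup>+ r. ennreal (2 * k r) \<partial>lborel)"
      unfolding M_def by (subst emeasure_density) auto
    also have "\<dots> < \<infinity>" using k integrable_mult_right[OF k(1), of 2]
      by (subst nn_integral_eq_integral) auto
    finally show ?thesis .
  qed
  have "emeasure ?F UNIV \<le> emeasure M UNIV" unfolding sum_UNIV[symmetric] by simp
  with M_fin have FG_fin: "emeasure ?F UNIV < \<infinity>" by simp
  have sum_all: "emeasure ?F A + emeasure ?G A = emeasure M A" if "A \<in> sets borel" for A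
  proof -
    have "A \<in> sigma_sets UNIV (range (\<lambda>(a, b). {a<..b::real}))"
      using that by (simp add: borel_sigma_sets_Ioc)
    then show ?thesis
    proof (induction rule: sigma_sets_induct_disjoint[rotated 2, consumes 1, case_names basic empty compl union closed Int])
      case (basic A) then show ?case using sum_Ioc by auto
    next
      case empty show ?case by simp
    next
      case (compl A)
      then have A: "A \<in> sets borel" by (simp add: borel_sigma_sets_Ioc)
      have split: "emeasure N (UNIV - A) + emeasure N A = emeasure N UNIV"
        if "sets N = sets borel" for N :: "real measure"
        using plus_emeasure[of "UNIV - A" N A] that A by auto
      have "emeasure M A \<noteq> \<infinity>"
        using emeasure_space[of M A] M_fin by auto
      moreover have "emeasure M A + (emeasure ?F (UNIV - A) + emeasure ?G (UNIV - A))
          = emeasure M A + emeasure M (UNIV - A)"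
      proof -
        have "emeasure M A + (emeasure ?F (UNIV - A) + emeasure ?G (UNIV - A))
          = (emeasure ?F (UNIV - A) + emeasure ?F A) + (emeasure ?G (UNIV - A) + emeasure ?G A)"
          unfolding compl.IH[symmetric] by (simp only: ac_simps)
        also have "\<dots> = emeasure M UNIV" by (simp only: split sets_interval_measure sum_UNIV)
        also have "\<dots> = emeasure M (UNIV - A) + emeasure M A" by (simp only: split setsM)
        finally show ?thesis by (simp only: add.commute)
      qed
      ultimately show ?case
        unfolding ennreal_add_left_cancel by simp
    next
      case (union A)
      then have A: "range A \<subseteq> sets borel" by (auto simp: borel_sigma_sets_Ioc)
      have N: "(\<Sum>i. emeasure N (A i)) = emeasure N (\<Union>i. A i)" if "sets N = sets borel" for N :: "real measure"
        using that A union by (intro suminf_emeasure) auto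
      have "emeasure ?F (\<Union>i. A i) + emeasure ?G (\<Union>i. A i) = (\<Sum>i. emeasure ?F (A i) + emeasure ?G (A i))"
        by (subst suminf_add[symmetric]) (simp_all only: summableI N sets_interval_measure)
      also have "\<dots> = emeasure M (\<Union>i. A i)" by (simp only: union.IH N setsM)
      finally show ?case .
    qed (auto simp: Int_stable_def image_iff split_beta)
  qed
  have "absolutely_continuous lborel ?F"
  proof -
    have "emeasure ?F A = 0" if "A \<in> null_sets lborel" for A
    proof -
      have "absolutely_continuous lborel M" unfolding M_def by (rule absolutely_continuousI_density) simp
      then have "emeasure M A = 0" using that by (auto simp: absolutely_continuous_def null_sets_def)
      then show ?thesis using sum_all[of A] that by (auto simp: null_sets_def)
    qed
    then show ?thesis by (auto simp: absolutely_continuous_def null_sets_def)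
  qed
  then obtain \<phi> where \<phi>[measurable]: "\<phi> \<in> borel_measurable lborel" and dens: "density lborel \<phi> = ?F"
    using sigma_finite_measure.Radon_Nikodym[OF sigma_finite_lborel, of ?F] by auto
  have \<phi>_fin: "(\<integral>\<^sup>+ r. \<phi> r \<partial>lborel) < \<infinity>"
  proof -
    have "(\<integral>\<^sup>+ r. \<phi> r \<partial>lborel) = emeasure (density lborel \<phi>) UNIV" by (subst emeasure_density) auto
    then show ?thesis using FG_fin dens by simp
  qed
  then have \<phi>_AE: "AE r in lborel. \<phi> r \<noteq> \<infinity>" by (intro nn_integral_noteq_infinite) auto
  define h0 where "h0 r = enn2real (\<phi> r)" for r
  have [measurable]: "h0 \<in> borel_measurable borel" unfolding h0_def using \<phi> by simp
  have h0_AE: "AE r in lborel. ennreal (h0 r) = \<phi> r"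
    using \<phi>_AE by eventually_elim (auto simp: h0_def less_top)
  have h0_int: "integrable lborel h0"
  proof (rule integrableI_nonneg)
    have "(\<integral>\<^sup>+ r. ennreal (h0 r) \<partial>lborel) = (\<integral>\<^sup>+ r. \<phi> r \<partial>lborel)" by (rule nn_integral_cong_AE[OF h0_AE])
    then show "(\<integral>\<^sup>+ r. ennreal (h0 r) \<partial>lborel) < \<infinity>" using \<phi>_fin by simp
  qed (auto simp: h0_def)
  have Fd: "F t - F s = (LINT r:{s..t}|lborel. h0 r)" if "s \<le> t" for s t
  proof -
    have "ennreal (F t - F s) = emeasure (density lborel \<phi>) {s<..t}" using eF[OF that] dens by simp
    also have "\<dots> = (\<integral>\<^sup>+ r. \<phi> r * indicator {s<..t} r \<partial>lborel)" by (subst emeasure_density) auto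
    also have "\<dots> = (\<integral>\<^sup>+ r. ennreal (indicator {s<..t} r *\<^sub>R h0 r) \<partial>lborel)"
      using h0_AE by (intro nn_integral_cong_AE) (auto elim!: eventually_mono simp: indicator_def)
    also have "\<dots> = ennreal (LINT r|lborel. indicator {s<..t} r *\<^sub>R h0 r)"
    proof (rule nn_integral_eq_integral)
      show "integrable lborel (\<lambda>r. indicator {s<..t} r *\<^sub>R h0 r)"
        by (intro integrable_mult_indicator h0_int) simp
    qed (simp add: h0_def indicator_def)
    finally have "ennreal (F t - F s) = ennreal (LINT r:{s<..t}|lborel. h0 r)"
      by (simp only: set_lebesgue_integral_def)
    moreover have "0 \<le> (LINT r:{s<..t}|lborel. h0 r)"
      unfolding set_lebesgue_integral_def
      by (rule Bochner_Integration.integral_nonneg) (simp add: h0_def indicator_def)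
    ultimately have "F t - F s = (LINT r:{s<..t}|lborel. h0 r)"
      using mono(1)[OF that] by (subst (asm) ennreal_inj) auto
    then show ?thesis by (simp add: Ioc_Icc)
  qed
  show ?thesis
  proof
    show "integrable lborel (\<lambda>r. h0 r - k r)" using h0_int k(1) by simp
    show "\<gamma> t - \<gamma> s = (LINT r:{s..t}|lborel. h0 r - k r)" if "s \<le> t" for s t
      using Fd[OF that] Kd[OF that] set_integral_diff(2)[of lborel "{s..t}" h0 k]
      by (simp add: F_def set_integrable_of_integrable h0_int k(1))
  qed
qed

lemma lebesgue_differentiation_right:
  fixes h :: "real \<Rightarrow> real"
  assumes "integrable lborel h"
  shows "AE t in lborel. \<forall>e>0. \<exists>d>0. \<forall>z. 0 < z \<and> z < d \<longrightarrow> \<bar>(LINT r:{t..t + z}|lborel. h r) / z - h t\<bar> < e"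
proof -
  have int: "(h integrable_on cbox a b)" "(LINT r:{a..b}|lborel. h r) = integral {a..b} h" for a b
    using set_borel_integral_eq_integral[of "{a..b}" h] set_integrable_of_integrable[OF assms] by auto
  obtain N where N: "negligible N" "\<And>x e. \<lbrakk>x \<notin> N; 0 < e\<rbrakk> \<Longrightarrow>
               \<exists>d>0. \<forall>z. 0 < z \<and> z < d \<longrightarrow> norm(integral (cbox x (x + z *\<^sub>R One)) h /\<^sub>R z ^ DIM(real) - h x) < e"
    using integrable_ccontinuous_explicit[of h, OF int(1)] by blast
  have "AE t in lebesgue. t \<notin> N" using N(1) by (intro AE_not_in) (simp add: negligible_iff_null_sets)
  then have "AE t in lebesgue. \<forall>e>0. \<exists>d>0. \<forall>z. 0 < z \<and> z < d \<longrightarrow> \<bar>(LINT r:{t..t + z}|lborel. h r) / z - h t\<bar> < e"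
    by eventually_elim (use N(2) in \<open>simp add: int(2) divide_inverse mult.commute\<close>)
  then show ?thesis by (rule AE_completion_iff[THEN iffD1])
qed

lemma AE_lborel_uminus:
  fixes P :: "real \<Rightarrow> bool"
  assumes "AE t in lborel. P t"
  shows "AE t in lborel. P (- t)"
proof -
  obtain N where "\<And>t. t \<in> space lborel - N \<Longrightarrow> P t" and N2: "N \<in> null_sets lborel"
    using AE_E3[OF assms] by metis
  then have N1: "P t" if "t \<notin> N" for t using that by simp
  have "emeasure lborel (uminus -` N) = emeasure (distr lborel borel uminus) N"
    using N2 by (subst emeasure_distr) auto
  also have "\<dots> = 0" using N2 unfolding lborel_distr_uminus by auto
  finally have "uminus -` N \<in> null_sets lborel"
    using N2 measurable_sets[of uminus lborel borel N] by (simp add: null_sets_def)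
  then have "AE t in lborel. t \<notin> uminus -` N" by (rule AE_not_in)
  then show ?thesis by eventually_elim (use N1 in simp)
qed

lemma lebesgue_differentiation_left:
  fixes h :: "real \<Rightarrow> real"
  assumes h: "integrable lborel h"
  shows "AE t in lborel. \<forall>e>0. \<exists>d>0. \<forall>z. 0 < z \<and> z < d \<longrightarrow> \<bar>(LINT r:{t - z..t}|lborel. h r) / z - h t\<bar> < e"
proof -
  have h': "integrable lborel (\<lambda>r. h (- r))"
    using lborel_integrable_real_affine[OF h, of "-1" 0] by simp
  have refl: "(LINT r:{t..t + z}|lborel. h (- r)) = (LINT r:{- t - z..- t}|lborel. h r)" for t z
    using lborel_integral_real_affine[of "-1" "\<lambda>r. indicator {- t - z..- t} r *\<^sub>R h r" 0]
    unfolding set_lebesgue_integral_def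
    by (auto intro!: Bochner_Integration.integral_cong simp: indicator_def)
  have "AE t in lborel. \<forall>e>0. \<exists>d>0. \<forall>z. 0 < z \<and> z < d \<longrightarrow> \<bar>(LINT r:{- t - z..- t}|lborel. h r) / z - h (- t)\<bar> < e"
    using lebesgue_differentiation_right[OF h'] by (simp add: refl)
  from AE_lborel_uminus[OF this] show ?thesis by simp
qed

text \<open>Differentiating means over intervals to the right of a point gives the right derivative; reflection supplies the left one.\<close>

lemma lebesgue_differentiation:
  fixes h \<gamma> :: "real \<Rightarrow> real"
  assumes h: "integrable lborel h"
    and \<gamma>: "\<And>s t. s \<le> t \<Longrightarrow> \<gamma> t - \<gamma> s = (LINT r:{s..t}|lborel. h r)"
  shows "AE t in lborel. (\<gamma> has_real_derivative h t) (at t)"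
  using lebesgue_differentiation_right[OF h] lebesgue_differentiation_left[OF h]
proof eventually_elim
  case (elim t)
  have "((\<lambda>z. (\<gamma> (t + z) - \<gamma> t) / z) \<longlongrightarrow> h t) (at 0)"
  proof (rule LIM_I)
    fix e :: real assume "0 < e"
    obtain d1 where d1: "d1 > 0" "\<And>z. 0 < z \<Longrightarrow> z < d1 \<Longrightarrow> \<bar>(LINT r:{t..t + z}|lborel. h r) / z - h t\<bar> < e"
      using elim(1) \<open>0 < e\<close> by blast
    obtain d2 where d2: "d2 > 0" "\<And>z. 0 < z \<Longrightarrow> z < d2 \<Longrightarrow> \<bar>(LINT r:{t - z..t}|lborel. h r) / z - h t\<bar> < e"
      using elim(2) \<open>0 < e\<close> by blast
    have "\<bar>(\<gamma> (t + z) - \<gamma> t) / z - h t\<bar> < e" if "z \<noteq> 0" "\<bar>z\<bar> < min d1 d2" for z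
    proof (cases "z > 0")
      case True then show ?thesis using d1(2)[of z] \<gamma>[of t "t + z"] that by simp
    next
      case False
      then have "(\<gamma> (t + z) - \<gamma> t) / z = (\<gamma> t - \<gamma> (t - (- z))) / (- z)"
        using that(1) by (simp add: field_simps)
      then show ?thesis using d2(2)[of "- z"] \<gamma>[of "t + z" t] that False by simp
    qed
    then show "\<exists>s>0. \<forall>z. z \<noteq> 0 \<and> norm (z - 0) < s \<longrightarrow> norm ((\<gamma> (t + z) - \<gamma> t) / z - h t) < e"
      using d1(1) d2(1) by (intro exI[of _ "min d1 d2"]) auto
  qed
  then show ?case by (simp add: DERIV_def)
qed

lemma sum_disjoint_Icc_le:
  fixes k :: "real \<Rightarrow> real"
  assumes k: "integrable lborel k" "\<And>r. 0 \<le> k r" and "finite D"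
    and D: "\<And>u v. (u, v) \<in> D \<Longrightarrow> u \<le> v"
    and disj: "pairwise (\<lambda>(u, v) (u', v'). {u<..<v} \<inter> {u'<..<v'} = {}) D"
  shows "(\<Sum>(u, v)\<in>D. LINT r:{u..v}|lborel. k r) = (LINT r:(\<Union>(u, v)\<in>D. {u<..<v})|lborel. k r)"
proof -
  have open_closed: "(LINT r:{u..v}|lborel. k r) = (LINT r:{u<..<v}|lborel. k r)" for u v
    unfolding set_lebesgue_integral_def
    using AE_lborel_singleton[of u] AE_lborel_singleton[of v] k
    by (intro integral_cong_AE) (auto simp: indicator_def)
  have "(LINT r:(\<Union>p\<in>D. {fst p<..<snd p})|lborel. k r) = (\<Sum>p\<in>D. LINT r:{fst p<..<snd p}|lborel. k r)"
  proof (rule set_integral_finite_Union)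
    show "disjoint_family_on (\<lambda>p. {fst p<..<snd p}) D"
      using disj by (auto simp: disjoint_family_on_def pairwise_def split_beta)
  qed (use \<open>finite D\<close> k in \<open>auto intro: set_integrable_of_integrable\<close>)
  then show ?thesis by (simp add: split_beta open_closed)
qed

text \<open>Disjoint intervals of small total length carry little of the integral of \<open>c\<close>, by the absolute
continuity of the integral.\<close>

lemma absolutely_continuous_of_integral_modulus:
  fixes k :: "real \<Rightarrow> real" and \<gamma> :: "real \<Rightarrow> 'b::real_normed_vector"
  assumes k: "integrable lborel k" "\<And>r. 0 \<le> k r"
    and \<gamma>: "\<And>u v. s \<le> u \<Longrightarrow> u \<le> v \<Longrightarrow> v \<le> T \<Longrightarrow> norm (\<gamma> v - \<gamma> u) \<le> (LINT r:{u..v}|lborel. k r)"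
  shows "absolutely_continuous_on s T \<gamma>"
  unfolding absolutely_continuous_on_def
proof (intro allI impI)
  fix \<epsilon> :: real assume "0 < \<epsilon>"
  obtain \<delta> where \<delta>: "\<delta> > 0" "\<And>A. A \<in> sets lborel \<Longrightarrow> emeasure lborel A < ennreal \<delta> \<Longrightarrow> (LINT r:A|lborel. k r) < \<epsilon>"
    using set_integral_absolutely_continuous[OF k \<open>0 < \<epsilon>\<close>] by blast
  have "(\<Sum>(u, v)\<in>D. dist (\<gamma> u) (\<gamma> v)) < \<epsilon>"
    if D: "finite D" "\<forall>(u, v)\<in>D. s \<le> u \<and> u \<le> v \<and> v \<le> T"
      "pairwise (\<lambda>(u, v) (u', v'). {u<..<v} \<inter> {u'<..<v'} = {}) D" "(\<Sum>(u, v)\<in>D. v - u) < \<delta>" for D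
  proof -
    have "(\<Sum>(u, v)\<in>D. dist (\<gamma> u) (\<gamma> v)) \<le> (\<Sum>(u, v)\<in>D. LINT r:{u..v}|lborel. k r)"
      using D(2) \<gamma> by (intro sum_mono) (auto simp: dist_norm norm_minus_commute)
    also have "\<dots> = (LINT r:(\<Union>(u, v)\<in>D. {u<..<v})|lborel. k r)"
      using D by (intro sum_disjoint_Icc_le k) auto
    also have "\<dots> < \<epsilon>"
    proof (rule \<delta>(2))
      have "emeasure lborel (\<Union>(u, v)\<in>D. {u<..<v}) \<le> (\<Sum>p\<in>D. emeasure lborel {fst p<..<snd p})"
        using D(1) emeasure_subadditive_finite[of D "\<lambda>p. {fst p<..<snd p}" lborel] by (simp add: split_beta image_subset_iff)
      also have "\<dots> = (\<Sum>p\<in>D. ennreal (snd p - fst p))"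
        using D(2) by (intro sum.cong) auto
      also have "\<dots> = ennreal (\<Sum>p\<in>D. snd p - fst p)"
        using D(2) by (intro sum_ennreal) auto
      also have "\<dots> < ennreal \<delta>"
        using D(2,4) \<delta>(1) by (intro ennreal_lessI) (auto simp: split_beta)
      finally show "emeasure lborel (\<Union>(u, v)\<in>D. {u<..<v}) < ennreal \<delta>" .
    qed (use D(1) in \<open>auto intro!: sets.finite_UN\<close>)
    finally show ?thesis .
  qed
  then show "\<exists>\<delta>>0. \<forall>D. finite D \<and> (\<forall>(u, v)\<in>D. s \<le> u \<and> u \<le> v \<and> v \<le> T) \<and>
        pairwise (\<lambda>(u, v) (u', v'). {u<..<v} \<inter> {u'<..<v'} = {}) D \<and>
        (\<Sum>(u, v)\<in>D. v - u) < \<delta> \<longrightarrow> (\<Sum>(u, v)\<in>D. dist (\<gamma> u) (\<gamma> v)) < \<epsilon>"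
    using \<delta>(1) by blast
qed

section \<open>Differentiation under the integral sign and convolutions\<close>

lemma directional_derivative_limit:
  fixes f :: "'a::real_normed_vector \<Rightarrow> 'b::real_normed_vector"
  assumes "(f has_derivative f') (at y)"
  shows "((\<lambda>h. (f (y + h *\<^sub>R w) - f y) /\<^sub>R h) \<longlongrightarrow> f' w) (at 0)"
proof -
  interpret bounded_linear f' using assms(1) by (rule has_derivative_bounded_linear)
  have "((\<lambda>h. f (y + h *\<^sub>R w)) has_derivative (\<lambda>h. f' (h *\<^sub>R w))) (at 0)"
    by (rule has_derivative_compose[of "\<lambda>h. y + h *\<^sub>R w" "\<lambda>h. h *\<^sub>R w" 0 UNIV f f'])
      (use assms in \<open>auto intro!: derivative_eq_intros\<close>)
  then have "((\<lambda>h. norm (f (y + h *\<^sub>R w) - f y - h *\<^sub>R f' w) / norm h) \<longlongrightarrow> 0) (at 0)"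
    by (simp add: has_derivative_at scaleR)
  then have "((\<lambda>h. norm ((f (y + h *\<^sub>R w) - f y) /\<^sub>R h - f' w)) \<longlongrightarrow> 0) (at 0)"
  proof (rule Lim_transform_eventually)
    have "norm (f (y + h *\<^sub>R w) - f y - h *\<^sub>R f' w) / norm h = norm ((f (y + h *\<^sub>R w) - f y) /\<^sub>R h - f' w)"
      if "h \<noteq> 0" for h
    proof -
      have "(f (y + h *\<^sub>R w) - f y) /\<^sub>R h - f' w = (f (y + h *\<^sub>R w) - f y - h *\<^sub>R f' w) /\<^sub>R h"
        using that by (simp add: scaleR_right_diff_distrib)
      then show ?thesis by (simp add: divide_inverse mult.commute)
    qed
    then show "\<forall>\<^sub>F h in at 0. norm (f (y + h *\<^sub>R w) - f y - h *\<^sub>R f' w) / norm h = norm ((f (y + h *\<^sub>R w) - f y) /\<^sub>R h - f' w)"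
      by (auto simp: eventually_at intro!: exI[of _ 1])
  qed
  then show ?thesis
    by (simp add: tendsto_norm_zero_iff Lim_null[symmetric])
qed

lemma has_derivative_integral_dominated:
  fixes F :: "'r \<Rightarrow> 'a::euclidean_space \<Rightarrow> 'b::euclidean_space"
  assumes int: "\<And>y. integrable M (\<lambda>r. F r y)"
    and der: "\<And>r. (F r has_derivative F' r) (at y)"
    and e: "0 < e" and lip: "\<And>r y'. dist y' y < e \<Longrightarrow> norm (F r y' - F r y) \<le> L r * norm (y' - y)"
    and L: "integrable M L"
  shows "((\<lambda>y. LINT r|M. F r y) has_derivative (\<lambda>w. LINT r|M. F' r w)) (at y)"
    and "\<And>w. integrable M (\<lambda>r. F' r w)"
proof -
  have bl: "bounded_linear (F' r)" for r using der by (rule has_derivative_bounded_linear)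
  have bound: "norm (F' r w) \<le> L r * norm w" for r w
  proof (cases "w = 0")
    case True then show ?thesis using bl by (simp add: linear_simps)
  next
    case False
    have "eventually (\<lambda>h. norm ((F r (y + h *\<^sub>R w) - F r y) /\<^sub>R h) \<le> L r * norm w) (at 0)"
      unfolding eventually_at
    proof (intro exI[of _ "e / norm w"] conjI ballI impI)
      fix h :: real assume h: "h \<noteq> 0 \<and> dist h 0 < e / norm w"
      then have "norm (F r (y + h *\<^sub>R w) - F r y) \<le> L r * norm (h *\<^sub>R w)"
        using lip[of "y + h *\<^sub>R w"] False by (simp add: dist_norm field_simps)
      then show "norm ((F r (y + h *\<^sub>R w) - F r y) /\<^sub>R h) \<le> L r * norm w"
        using h by (simp add: inverse_eq_divide divide_le_eq ac_simps)
    qed (use False e in auto)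
    then show ?thesis
      using tendsto_norm[OF directional_derivative_limit[OF der]] by (intro tendsto_upperbound) auto
  qed
  have meas: "(\<lambda>r. F' r w) \<in> borel_measurable M" for w
  proof (rule borel_measurable_LIMSEQ_metric)
    show "(\<lambda>r. (F r (y + inverse (real (Suc n)) *\<^sub>R w) - F r y) /\<^sub>R inverse (real (Suc n))) \<in> borel_measurable M" for n
      using int by (intro borel_measurable_scaleR borel_measurable_diff) auto
    have "filterlim (\<lambda>n. inverse (real (Suc n))) (at 0) sequentially"
      unfolding filterlim_at using LIMSEQ_inverse_real_of_nat by auto
    from filterlim_compose[OF directional_derivative_limit[OF der] this]
    show "(\<lambda>n. (F r (y + inverse (real (Suc n)) *\<^sub>R w) - F r y) /\<^sub>R inverse (real (Suc n))) \<longlonglongrightarrow> F' r w" for r .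
  qed
  show int': "integrable M (\<lambda>r. F' r w)" for w
    by (rule Bochner_Integration.integrable_bound[of _ "\<lambda>r. L r * norm w"])
      (use L meas in \<open>auto intro!: AE_I2 order_trans[OF bound] abs_ge_self\<close>)
  have lin: "linear (\<lambda>w. LINT r|M. F' r w)"
    using int' bl by (intro linearI) (simp_all add: linear_simps)
  show "((\<lambda>y. LINT r|M. F r y) has_derivative (\<lambda>w. LINT r|M. F' r w)) (at y)"
    unfolding has_derivative_iff_norm
  proof
    show "bounded_linear (\<lambda>w. LINT r|M. F' r w)" using lin by (simp add: linear_conv_bounded_linear)
    show "((\<lambda>z. norm ((LINT r|M. F r z) - (LINT r|M. F r y) - (LINT r|M. F' r (z - y))) / norm (z - y)) \<longlongrightarrow> 0) (at y)"
      unfolding tendsto_at_iff_sequentially comp_def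
    proof (intro allI impI)
      fix X :: "nat \<Rightarrow> 'a" assume X: "\<forall>i. X i \<in> UNIV - {y}" "X \<longlonglongrightarrow> y"
      define Q where "Q n r = norm (F r (X n) - F r y - F' r (X n - y)) / norm (X n - y)" for n r
      have Q_int: "integrable M (Q n)" for n
        unfolding Q_def using int int' by (intro integrable_divide integrable_norm Bochner_Integration.integrable_diff)
      obtain N where N: "\<And>n. n \<ge> N \<Longrightarrow> dist (X n) y < e"
        using X(2) e by (auto simp: lim_sequentially)
      have "(\<lambda>n. LINT r|M. Q (n + N) r) \<longlonglongrightarrow> (LINT r|M. (0::real))"
      proof (rule integral_dominated_convergence[where w="\<lambda>r. 2 * L r"])
        have "(\<lambda>n. Q n r) \<longlonglongrightarrow> 0" for r
        proof -
          have "filterlim X (at y) sequentially" using X unfolding filterlim_at by auto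
          moreover have "((\<lambda>z. norm (F r z - F r y - F' r (z - y)) / norm (z - y)) \<longlongrightarrow> 0) (at y)"
            using der[of r] by (simp add: has_derivative_iff_norm)
          ultimately show ?thesis unfolding Q_def by (rule filterlim_compose[rotated])
        qed
        then show "AE r in M. (\<lambda>n. Q (n + N) r) \<longlonglongrightarrow> 0" by (intro AE_I2 LIMSEQ_ignore_initial_segment)
        have "norm (Q (n + N) r) \<le> 2 * L r" for n r
        proof -
          let ?z = "X (n + N)"
          have "norm (F r ?z - F r y - F' r (?z - y)) \<le> norm (F r ?z - F r y) + norm (F' r (?z - y))"
            by (rule norm_triangle_ineq4)
          also have "\<dots> \<le> 2 * L r * norm (?z - y)"
            using lip[of ?z r] N[of "n + N"] bound[of r "?z - y"] by simp
          finally show ?thesis using X(1) by (auto simp: Q_def divide_le_eq)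
        qed
        then show "AE r in M. norm (Q (n + N) r) \<le> 2 * L r" for n by simp
      qed (use L Q_int in auto)
      then have "(\<lambda>n. LINT r|M. Q n r) \<longlonglongrightarrow> 0" by (simp add: LIMSEQ_offset)
      then show "(\<lambda>n. norm ((LINT r|M. F r (X n)) - (LINT r|M. F r y) - (LINT r|M. F' r (X n - y))) / norm (X n - y)) \<longlonglongrightarrow> 0"
      proof (rule Lim_null_comparison[rotated], intro always_eventually allI)
        fix n
        have "(LINT r|M. F r (X n)) - (LINT r|M. F r y) - (LINT r|M. F' r (X n - y))
          = (LINT r|M. F r (X n) - F r y - F' r (X n - y))"
          using int int' by simp
        also have "norm \<dots> \<le> (LINT r|M. norm (F r (X n) - F r y - F' r (X n - y)))"
          by (rule integral_norm_bound)
        finally show "norm (norm ((LINT r|M. F r (X n)) - (LINT r|M. F r y) - (LINT r|M. F' r (X n - y))) / norm (X n - y)) \<le> (LINT r|M. Q n r)"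
          by (simp add: Q_def divide_right_mono)
      qed
    qed
  qed
qed

lemma continuous_integral_dominated:
  fixes F :: "'r \<Rightarrow> 'a::euclidean_space \<Rightarrow> 'b::euclidean_space"
  assumes meas: "\<And>y. (\<lambda>r. F r y) \<in> borel_measurable M"
    and cont: "\<And>r. continuous_on UNIV (F r)"
    and bound: "\<And>r R y. norm y \<le> R \<Longrightarrow> norm (F r y) \<le> L R r"
    and L: "\<And>R. integrable M (L R)"
  shows "continuous_on UNIV (\<lambda>y. LINT r|M. F r y)"
  unfolding continuous_on_sequentially comp_def
proof (intro ballI allI impI)
  fix X :: "nat \<Rightarrow> 'a" and y assume X: "(\<forall>n. X n \<in> UNIV) \<and> X \<longlonglongrightarrow> y"
  then obtain R where R: "\<And>n. norm (X n) \<le> R" using convergent_imp_Bseq[of X] unfolding Bseq_def convergent_def by auto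
  show "(\<lambda>n. LINT r|M. F r (X n)) \<longlonglongrightarrow> (LINT r|M. F r y)"
  proof (rule integral_dominated_convergence[where w="L R"])
    show "AE r in M. (\<lambda>n. F r (X n)) \<longlonglongrightarrow> F r y"
      using cont X by (auto simp: continuous_on_sequentially comp_def)
  qed (use meas L bound R in auto)
qed

lemma has_derivative_imp_lipschitz:
  fixes f :: "'a::euclidean_space \<Rightarrow> 'b::euclidean_space"
  assumes "\<And>y. y \<in> S \<Longrightarrow> (f has_derivative f' y) (at y)" "\<And>y w. y \<in> S \<Longrightarrow> norm (f' y w) \<le> L * norm w"
    and "convex S" "y \<in> S" "y' \<in> S" "0 \<le> L"
  shows "norm (f y' - f y) \<le> L * norm (y' - y)"
proof (rule differentiable_bound[of S f f' L y' y])
  show "onorm (f' x) \<le> L" if "x \<in> S" for x by (rule onorm_bound) (use assms that in auto)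
qed (use assms in \<open>auto intro: has_derivative_at_withinI\<close>)

text \<open>The composition \<open>u \<circ> \<gamma>\<close> is dominated in the sense of \<open>density_of_dominated_path\<close>, hence it is the primitive
of its derivative, which almost everywhere is given by the classical chain rule.\<close>

lemma chain_rule_primitive:
  fixes u :: "'e::euclidean_space \<Rightarrow> real" and h \<gamma> :: "real \<Rightarrow> 'e"
  assumes u: "\<And>x. (u has_derivative (\<lambda>v. G x \<bullet> v)) (at x)" and G: "continuous_on UNIV G"
    and h: "integrable lborel h" and \<gamma>: "\<And>a b. a \<le> b \<Longrightarrow> \<gamma> b - \<gamma> a = (LINT r:{a..b}|lborel. h r)"
    and "a \<le> b"
  shows "u (\<gamma> b) - u (\<gamma> a) = (LINT r:{a..b}|lborel. G (\<gamma> r) \<bullet> h r)"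
proof -
  have nh: "integrable lborel (\<lambda>r. norm (h r))" using h by simp
  have le: "norm (\<gamma> t - \<gamma> s) \<le> (LINT r:{s..t}|lborel. norm (h r))" if "s \<le> t" for s t
  proof -
    have "norm (LINT r|lborel. indicator {s..t} r *\<^sub>R h r) \<le> (LINT r|lborel. norm (indicator {s..t} r *\<^sub>R h r))"
      by (rule integral_norm_bound)
    then show ?thesis using \<gamma>[OF that] by (simp add: set_lebesgue_integral_def)
  qed
  have bnd: "norm (\<gamma> r - \<gamma> a) \<le> (LINT r|lborel. norm (h r))" for r
  proof -
    have *: "(LINT r:{s..t}|lborel. norm (h r)) \<le> (LINT r|lborel. norm (h r))" for s t
      using set_integral_nonneg_mono[OF nh, of "{s..t}" UNIV] by (simp add: set_lebesgue_integral_def)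
    show ?thesis
      using le[of a r] le[of r a] *[of a r] *[of r a] by (cases "a \<le> r") (auto simp: norm_minus_commute)
  qed
  define S where "S = cball (\<gamma> a) (LINT r|lborel. norm (h r))"
  have S: "\<gamma> r \<in> S" for r using bnd[of r] by (simp add: S_def dist_norm norm_minus_commute)
  have "bounded (G ` S)" unfolding S_def
    by (intro compact_imp_bounded compact_continuous_image continuous_on_subset[OF G]) auto
  then obtain L where L: "L > 0" "\<And>x. x \<in> S \<Longrightarrow> norm (G x) \<le> L" by (auto simp: bounded_pos)
  have Lip: "\<bar>u (\<gamma> t) - u (\<gamma> s)\<bar> \<le> L * norm (\<gamma> t - \<gamma> s)" for s t
    using has_derivative_imp_lipschitz[of S u "\<lambda>x v. G x \<bullet> v" L "\<gamma> s" "\<gamma> t"] u S L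
    by (force simp: S_def intro: order_trans[OF Cauchy_Schwarz_ineq2] mult_right_mono)
  obtain w where w: "integrable lborel w" "\<And>s t. s \<le> t \<Longrightarrow> u (\<gamma> t) - u (\<gamma> s) = (LINT r:{s..t}|lborel. w r)"
  proof (rule density_of_dominated_path[of "\<lambda>r. L * norm (h r)" "\<lambda>t. u (\<gamma> t)"])
    show "\<bar>u (\<gamma> t) - u (\<gamma> s)\<bar> \<le> (LINT r:{s..t}|lborel. L * norm (h r))" if "s \<le> t" for s t
      using order_trans[OF Lip[of t s] mult_left_mono[OF le[OF that], of L]] L(1) by simp
  qed (use nh L in auto)
  have "AE r in lborel. \<forall>i\<in>Basis. ((\<lambda>t. \<gamma> t \<bullet> i) has_real_derivative h r \<bullet> i) (at r)"
  proof (rule AE_finite_allI[OF finite_Basis])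
    fix i :: 'e assume "i \<in> Basis"
    show "AE r in lborel. ((\<lambda>t. \<gamma> t \<bullet> i) has_real_derivative h r \<bullet> i) (at r)"
    proof (rule lebesgue_differentiation)
      show "\<gamma> t \<bullet> i - \<gamma> s \<bullet> i = (LINT r:{s..t}|lborel. h r \<bullet> i)" if "s \<le> t" for s t
      proof -
        have "(LINT r:{s..t}|lborel. h r \<bullet> i) = (LINT r|lborel. (indicator {s..t} r *\<^sub>R h r) \<bullet> i)"
          by (simp add: set_lebesgue_integral_def)
        also have "\<dots> = (LINT r:{s..t}|lborel. h r) \<bullet> i"
          unfolding set_lebesgue_integral_def
          by (rule integral_inner_left) (intro integrable_mult_indicator h, simp)
        finally show ?thesis using \<gamma>[OF that] by (simp flip: inner_diff_left)
      qed
    qed (use h in simp)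
  qed
  moreover have "AE r in lborel. ((\<lambda>t. u (\<gamma> t)) has_real_derivative w r) (at r)"
    by (rule lebesgue_differentiation[OF w])
  ultimately have "AE r in lborel. w r = G (\<gamma> r) \<bullet> h r"
  proof eventually_elim
    case (elim r)
    have "(\<gamma> has_derivative (\<lambda>v. v *\<^sub>R h r)) (at r)"
      using elim(1) by (subst has_derivative_componentwise_within)
        (auto simp: has_field_derivative_def mult_commute_abs)
    from has_derivative_compose[OF this u]
    have "((\<lambda>t. u (\<gamma> t)) has_real_derivative G (\<gamma> r) \<bullet> h r) (at r)"
      by (simp add: has_field_derivative_def mult_commute_abs)
    then show ?case using elim(2) DERIV_unique by blast
  qed
  moreover have "(\<lambda>r. G (\<gamma> r) \<bullet> h r) \<in> borel_measurable lborel"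
  proof -
    have "continuous_on UNIV \<gamma>" by (rule continuous_of_integral_modulus[OF nh _ le]) auto
    then have "continuous_on UNIV (\<lambda>r. G (\<gamma> r))" using G continuous_on_compose2 by blast
    then have "(\<lambda>r. G (\<gamma> r)) \<in> borel_measurable borel" by (rule borel_measurable_continuous_onI)
    then show ?thesis using h by simp
  qed
  ultimately have "(LINT r:{a..b}|lborel. w r) = (LINT r:{a..b}|lborel. G (\<gamma> r) \<bullet> h r)"
    unfolding set_lebesgue_integral_def using w(1)
    by (intro integral_cong_AE) (auto elim!: eventually_mono)
  then show ?thesis using w(2)[OF \<open>a \<le> b\<close>] by simp
qed

lemma Fubini_dominated:
  fixes \<Phi> :: "'a::euclidean_space \<Rightarrow> 'b::euclidean_space \<Rightarrow> real"
  assumes meas: "(\<lambda>(y, x). \<Phi> y x) \<in> borel_measurable (lborel \<Otimes>\<^sub>M lborel)"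
    and bound: "\<And>y x. \<bar>\<Phi> y x\<bar> \<le> \<alpha> y * \<beta> x"
    and \<alpha>: "integrable lborel \<alpha>" and \<beta>: "integrable lborel \<beta>"
  shows "(LINT y|lborel. LINT x|lborel. \<Phi> y x) = (LINT x|lborel. LINT y|lborel. \<Phi> y x)"
    and "integrable lborel (\<lambda>y. LINT x|lborel. \<Phi> y x)"
    and "integrable lborel (\<lambda>x. LINT y|lborel. \<Phi> y x)"
    and "\<And>y. integrable lborel (\<Phi> y)"
proof -
  have m1: "\<Phi> y \<in> borel_measurable lborel" for y
    using measurable_Pair2[OF meas, of y] by simp
  show i1: "integrable lborel (\<Phi> y)" for y
    by (rule Bochner_Integration.integrable_bound[of _ "\<lambda>x. \<alpha> y * \<beta> x"])
      (use m1 \<beta> in \<open>auto intro!: AE_I2 order_trans[OF bound abs_ge_self]\<close>)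
  have i: "integrable (lborel \<Otimes>\<^sub>M lborel) (\<lambda>(y, x). \<Phi> y x)"
  proof (rule lborel_pair.Fubini_integrable[OF meas])
    have "(\<lambda>(y, x). norm (\<Phi> y x)) \<in> borel_measurable (lborel \<Otimes>\<^sub>M lborel)"
      using meas by measurable
    then have nm: "(\<lambda>y. LINT x|lborel. norm (\<Phi> y x)) \<in> borel_measurable lborel"
      by (rule lborel.borel_measurable_lebesgue_integral)
    show "integrable lborel (\<lambda>y. LINT x|lborel. norm (case (y, x) of (y, x) \<Rightarrow> \<Phi> y x))"
    proof (rule Bochner_Integration.integrable_bound[of _ "\<lambda>y. \<alpha> y * (LINT x|lborel. \<beta> x)"])
      have "(LINT x|lborel. \<bar>\<Phi> y x\<bar>) \<le> (LINT x|lborel. \<alpha> y * \<beta> x)" for y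
        by (intro integral_mono) (use i1 \<beta> bound in auto)
      moreover have "0 \<le> (LINT x|lborel. \<bar>\<Phi> y x\<bar>)" for y
        by (rule Bochner_Integration.integral_nonneg) simp
      ultimately show "AE y in lborel. norm (LINT x|lborel. norm (case (y, x) of (y, x) \<Rightarrow> \<Phi> y x))
          \<le> norm (\<alpha> y * (LINT x|lborel. \<beta> x))"
        by (intro AE_I2) (simp, meson abs_ge_self order_trans)
    qed (use \<alpha> nm in simp_all)
  qed (use i1 in auto)
  show "(LINT y|lborel. LINT x|lborel. \<Phi> y x) = (LINT x|lborel. LINT y|lborel. \<Phi> y x)"
    using lborel_pair.Fubini_integral[OF i] by simp
  show "integrable lborel (\<lambda>y. LINT x|lborel. \<Phi> y x)"
    using lborel_pair.integrable_fst'[OF i] by simp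
  show "integrable lborel (\<lambda>x. LINT y|lborel. \<Phi> y x)"
    using lborel_pair.integrable_snd[OF i] by simp
qed

definition locally_integrable :: "('a::euclidean_space \<Rightarrow> 'b::euclidean_space) \<Rightarrow> bool" where
  "locally_integrable h \<longleftrightarrow> (\<forall>R. set_integrable lborel (cball 0 R) h)"

lemma locally_integrable_measurable:
  fixes h :: "'a::euclidean_space \<Rightarrow> 'b::euclidean_space"
  assumes "locally_integrable h"
  shows "h \<in> borel_measurable borel"
proof (rule borel_measurable_LIMSEQ_metric)
  show "(\<lambda>x. indicator (cball 0 (real n)) x *\<^sub>R h x) \<in> borel_measurable borel" for n
    using assms unfolding locally_integrable_def set_integrable_def by (simp add: borel_measurable_integrable[of lborel, simplified])
  show "(\<lambda>n. indicator (cball 0 (real n)) x *\<^sub>R h x) \<longlonglongrightarrow> h x" for x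
  proof (rule tendsto_eventually)
    obtain m where "norm x \<le> real m" using real_arch_simple by blast
    then have "indicator (cball 0 (real n)) x *\<^sub>R h x = h x" if "n \<ge> m" for n
    proof -
      have "norm x \<le> real n" using that \<open>norm x \<le> real m\<close> by (meson of_nat_mono order_trans)
      then show ?thesis by simp
    qed
    then show "\<forall>\<^sub>F n in sequentially. indicator (cball 0 (real n)) x *\<^sub>R h x = h x"
      by (auto simp: eventually_sequentially)
  qed
qed

lemma kernel_bounded:
  fixes k :: "'a::euclidean_space \<Rightarrow> 'b::real_normed_vector"
  assumes "continuous_on UNIV k" "\<And>z. \<delta> \<le> norm z \<Longrightarrow> k z = 0"
  obtains M where "M > 0" "\<And>z. norm (k z) \<le> M"
proof -
  have "bounded (k ` cball 0 \<delta>)"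
    by (intro compact_imp_bounded compact_continuous_image continuous_on_subset[OF assms(1)]) auto
  then obtain M where M: "M > 0" "\<And>x. x \<in> cball 0 \<delta> \<Longrightarrow> norm (k x) \<le> M" by (auto simp: bounded_pos)
  have "norm (k z) \<le> M" for z
    using M(2)[of z] assms(2)[of z] M(1) by (cases "norm z \<le> \<delta>") auto
  then show ?thesis using that M by blast
qed

lemma kernel_dominated:
  fixes k :: "'a::euclidean_space \<Rightarrow> real" and h :: "'a \<Rightarrow> 'b::euclidean_space"
  assumes "\<And>z. \<delta> \<le> norm z \<Longrightarrow> k z = 0" "\<And>z. \<bar>k z\<bar> \<le> M" "norm y \<le> R" "R + \<delta> \<le> R'"
  shows "norm (k (y - x) *\<^sub>R h x) \<le> M * norm (indicator (cball 0 R') x *\<^sub>R h x)"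
proof (cases "norm x \<le> R'")
  case True then show ?thesis using assms(2) by (simp add: mult_right_mono)
next
  case False
  have "norm x \<le> norm (y - x) + norm y" using norm_triangle_ineq2[of x y] by (simp add: norm_minus_commute)
  then have "k (y - x) = 0" using False assms by (intro assms(1)) linarith
  then show ?thesis using False by simp
qed

lemma set_integrable_norm_cball:
  "locally_integrable h \<Longrightarrow> integrable lborel (\<lambda>x. norm (indicator (cball 0 R) x *\<^sub>R h x))"
  unfolding locally_integrable_def set_integrable_def by (intro integrable_norm) blast

lemma conv_integrable:
  fixes k :: "'a::euclidean_space \<Rightarrow> real" and h :: "'a \<Rightarrow> 'b::euclidean_space"
  assumes k: "continuous_on UNIV k" "\<And>z. \<delta> \<le> norm z \<Longrightarrow> k z = 0" and h: "locally_integrable h"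
  shows "integrable lborel (\<lambda>x. k (y - x) *\<^sub>R h x)"
proof -
  obtain M where M: "M > 0" "\<And>z. \<bar>k z\<bar> \<le> M" using kernel_bounded[OF k] by auto
  have "continuous_on UNIV (\<lambda>x. k (y - x))" by (intro continuous_on_compose2[OF k(1)] continuous_intros) auto
  then have "(\<lambda>x. k (y - x)) \<in> borel_measurable borel" by (rule borel_measurable_continuous_onI)
  then have m: "(\<lambda>x. k (y - x) *\<^sub>R h x) \<in> borel_measurable lborel"
    using locally_integrable_measurable[OF h] by simp
  show ?thesis
  proof (rule Bochner_Integration.integrable_bound)
    show "integrable lborel (\<lambda>x. M * norm (indicator (cball 0 (norm y + \<delta>)) x *\<^sub>R h x))"
      by (intro integrable_mult_right set_integrable_norm_cball h)
    show "AE x in lborel. norm (k (y - x) *\<^sub>R h x) \<le> norm (M * norm (indicator (cball 0 (norm y + \<delta>)) x *\<^sub>R h x))"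
      using kernel_dominated[where k=k and \<delta>=\<delta> and M=M and y=y and R="norm y" and R'="norm y + \<delta>" and h=h, OF k(2) M(2)] M(1)
      by (intro AE_I2) (simp add: abs_mult)
  qed (fact m)
qed

lemma conv_bound:
  fixes k :: "'a::euclidean_space \<Rightarrow> real" and h :: "'a \<Rightarrow> 'b::euclidean_space"
  assumes k: "continuous_on UNIV k" "\<And>z. \<delta> \<le> norm z \<Longrightarrow> k z = 0" and M: "\<And>z. \<bar>k z\<bar> \<le> M"
    and h: "locally_integrable h" and "norm y + \<delta> \<le> R"
  shows "norm (LINT x|lborel. k (y - x) *\<^sub>R h x) \<le> M * (LINT x:cball 0 R|lborel. norm (h x))"
proof -
  have "norm (LINT x|lborel. k (y - x) *\<^sub>R h x) \<le> (LINT x|lborel. norm (k (y - x) *\<^sub>R h x))"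
    by (rule integral_norm_bound)
  also have "\<dots> \<le> (LINT x|lborel. M * norm (indicator (cball 0 R) x *\<^sub>R h x))"
    by (intro integral_mono integrable_norm conv_integrable[OF k h] integrable_mult_right set_integrable_norm_cball h
        kernel_dominated[where k=k and \<delta>=\<delta> and M=M and y=y and R="norm y" and R'=R and h=h, OF k(2) M]) (use assms in auto)
  finally show ?thesis by (simp add: set_lebesgue_integral_def)
qed

lemma conv_continuous:
  fixes k :: "'a::euclidean_space \<Rightarrow> real" and h :: "'a \<Rightarrow> 'b::euclidean_space"
  assumes k: "continuous_on UNIV k" "\<And>z. \<delta> \<le> norm z \<Longrightarrow> k z = 0" and h: "locally_integrable h"
  shows "continuous_on UNIV (\<lambda>y. LINT x|lborel. k (y - x) *\<^sub>R h x)"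
proof -
  obtain M where M: "M > 0" "\<And>z. \<bar>k z\<bar> \<le> M" using kernel_bounded[OF k] by auto
  show ?thesis
  proof (rule continuous_integral_dominated)
    show "norm (k (y - x) *\<^sub>R h x) \<le> M * norm (indicator (cball 0 (R + \<delta>)) x *\<^sub>R h x)" if "norm y \<le> R" for x R y
      using kernel_dominated[where k=k and \<delta>=\<delta> and M=M and y=y and R=R and R'="R + \<delta>" and h=h, OF k(2) M(2) that] by blast
    show "continuous_on UNIV (\<lambda>y. k (y - x) *\<^sub>R h x)" for x
      by (intro continuous_intros continuous_on_compose2[OF k(1)]) auto
    show "integrable lborel (\<lambda>x. M * norm (indicator (cball 0 (R + \<delta>)) x *\<^sub>R h x))" for R
      by (intro integrable_mult_right set_integrable_norm_cball h)
    show "(\<lambda>x. k (y - x) *\<^sub>R h x) \<in> borel_measurable lborel" for y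
      using conv_integrable[OF k h] by (rule borel_measurable_integrable)
  qed
qed

lemma conv_has_derivative:
  fixes k :: "'a::euclidean_space \<Rightarrow> real" and h :: "'a \<Rightarrow> 'b::euclidean_space"
  assumes k': "\<And>z. (k has_derivative (\<lambda>v. G z \<bullet> v)) (at z)" and G: "continuous_on UNIV G"
    and k: "\<And>z. \<delta> \<le> norm z \<Longrightarrow> k z = 0" and G0: "\<And>z. \<delta> \<le> norm z \<Longrightarrow> G z = 0" and h: "locally_integrable h"
  shows "((\<lambda>y. LINT x|lborel. k (y - x) *\<^sub>R h x) has_derivative (\<lambda>v. LINT x|lborel. (G (y - x) \<bullet> v) *\<^sub>R h x)) (at y)"
proof -
  obtain M where M: "M > 0" "\<And>z. norm (G z) \<le> M" using kernel_bounded[OF G G0] by auto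
  have kc: "continuous_on UNIV k" using k' has_derivative_continuous continuous_at_imp_continuous_on by blast
  have Lip: "\<bar>k z' - k z\<bar> \<le> M * norm (z' - z)" for z z'
  proof -
    have "norm (G x \<bullet> v) \<le> M * norm v" for x v
      using order_trans[OF Cauchy_Schwarz_ineq2[of "G x" v] mult_right_mono[OF M(2)[of x] norm_ge_zero]] by simp
    then show ?thesis
      using has_derivative_imp_lipschitz[of UNIV k "\<lambda>x v. G x \<bullet> v" M z z'] k' M(1) by simp
  qed
  show ?thesis
  proof (rule has_derivative_integral_dominated(1)[where e=1 and L="\<lambda>x. M * norm (indicator (cball 0 (norm y + 1 + \<delta>)) x *\<^sub>R h x)"])
    show "integrable lborel (\<lambda>x. k (y - x) *\<^sub>R h x)" for y by (rule conv_integrable[OF kc k h])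
    show "((\<lambda>y. k (y - x) *\<^sub>R h x) has_derivative (\<lambda>v. (G (y - x) \<bullet> v) *\<^sub>R h x)) (at y)" for x
    proof -
      have "((\<lambda>y. y - x) has_derivative (\<lambda>v. v)) (at y)" by (auto intro!: derivative_eq_intros)
      from has_derivative_compose[OF this k'] show ?thesis by (intro has_derivative_scaleR_left) simp
    qed
    show "norm (k (y' - x) *\<^sub>R h x - k (y - x) *\<^sub>R h x)
        \<le> M * norm (indicator (cball 0 (norm y + 1 + \<delta>)) x *\<^sub>R h x) * norm (y' - y)" if y': "dist y' y < 1" for x y'
    proof (cases "norm x \<le> norm y + 1 + \<delta>")
      case True
      have "norm (k (y' - x) *\<^sub>R h x - k (y - x) *\<^sub>R h x) = \<bar>k (y' - x) - k (y - x)\<bar> * norm (h x)"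
        by (simp flip: scaleR_diff_left)
      also have "\<dots> \<le> (M * norm (y' - y)) * norm (h x)"
        using Lip[of "y' - x" "y - x"] by (intro mult_right_mono) auto
      finally show ?thesis using True by (simp add: ac_simps)
    next
      case False
      have "norm x \<le> norm (y - x) + norm y" "norm x \<le> norm (y' - x) + norm y'" "norm y' \<le> norm y + 1"
        using norm_triangle_ineq2[of x y] norm_triangle_ineq2[of x y'] norm_triangle_ineq2[of y' y] y'
        by (simp_all add: norm_minus_commute dist_norm)
      then have "k (y - x) = 0" "k (y' - x) = 0" using False by (auto intro!: k)
      then show ?thesis using M by simp
    qed
    show "integrable lborel (\<lambda>x. M * norm (indicator (cball 0 (norm y + 1 + \<delta>)) x *\<^sub>R h x))"
      by (intro integrable_mult_right set_integrable_norm_cball h)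
  qed simp
qed

lemma lborel_integral_translate:
  fixes F :: "'a::euclidean_space \<Rightarrow> 'b::euclidean_space"
  assumes "F \<in> borel_measurable borel"
  shows "(LINT y|lborel. F (c + y)) = (LINT y|lborel. F y)"
proof -
  have "(LINT y|lborel. F y) = (LINT y|distr lborel borel ((+) c). F y)" by (simp add: lborel_distr_plus)
  also have "\<dots> = (LINT y|lborel. F (c + y))" using assms by (subst integral_distr) auto
  finally show ?thesis by simp
qed

text \<open>The integral of \<open>F\<close> is invariant under translation by \<open>h w\<close>; differentiate in \<open>h\<close>.\<close>

lemma integral_directional_derivative_zero:
  fixes F :: "'a::euclidean_space \<Rightarrow> real"
  assumes F': "\<And>z. (F has_derivative F' z) (at z)" and cont: "continuous_on UNIV (\<lambda>z. F' z w)"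
    and F: "\<And>z. R \<le> norm z \<Longrightarrow> F z = 0" and F'0: "\<And>z. R \<le> norm z \<Longrightarrow> F' z w = 0"
  shows "(LINT y|lborel. F' y w) = 0"
proof -
  have Fc: "continuous_on UNIV F" using F' has_derivative_continuous continuous_at_imp_continuous_on by blast
  obtain C where C: "C > 0" "\<And>z. norm (F' z w) \<le> C" using kernel_bounded[OF cont F'0] by auto
  have der: "((\<lambda>h. F (y + h *\<^sub>R w)) has_derivative (\<lambda>h. h * F' (y + a *\<^sub>R w) w)) (at a)" for y and a :: real
  proof -
    interpret bounded_linear "F' (y + a *\<^sub>R w)" using F' by (rule has_derivative_bounded_linear)
    have "((\<lambda>h. F (y + h *\<^sub>R w)) has_derivative (\<lambda>h. F' (y + a *\<^sub>R w) (h *\<^sub>R w))) (at a)"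
      by (rule has_derivative_compose[of "\<lambda>h. y + h *\<^sub>R w" "\<lambda>h. h *\<^sub>R w" a UNIV F, OF _ F'])
        (auto intro!: derivative_eq_intros)
    then show ?thesis by (simp add: scaleR)
  qed
  have "((\<lambda>h. LINT y|lborel. F (y + h *\<^sub>R w)) has_derivative (\<lambda>h. LINT y|lborel. h * F' (y + 0 *\<^sub>R w) w)) (at (0::real))"
  proof (rule has_derivative_integral_dominated(1)[where e=1 and L="\<lambda>y. C * indicator (cball 0 (R + norm w)) y"])
    show "integrable lborel (\<lambda>y. F (y + h *\<^sub>R w))" for h :: real
    proof (rule integrable_continuous_bounded_support[of _ "R + norm (h *\<^sub>R w)"])
      show "continuous_on UNIV (\<lambda>y. F (y + h *\<^sub>R w))" by (intro continuous_on_compose2[OF Fc] continuous_intros) auto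
      show "F (y + h *\<^sub>R w) = 0" if "R + norm (h *\<^sub>R w) \<le> norm y" for y
        using that norm_triangle_ineq2[of y "- (h *\<^sub>R w)"] by (intro F) (simp del: norm_scaleR)
    qed
    show "norm (F (y + h *\<^sub>R w) - F (y + 0 *\<^sub>R w)) \<le> C * indicator (cball 0 (R + norm w)) y * norm (h - 0)"
      if "dist h 0 < 1" for y and h :: real
    proof (cases "norm y \<le> R + norm w")
      case True
      have "norm (F (y + h *\<^sub>R w) - F (y + 0 *\<^sub>R w)) \<le> C * norm (h - 0)"
      proof (rule has_derivative_imp_lipschitz[of UNIV "\<lambda>h. F (y + h *\<^sub>R w)" "\<lambda>a h. h * F' (y + a *\<^sub>R w) w", OF der])
        show "norm (v * F' (y + a *\<^sub>R w) w) \<le> C * norm v" for a v :: real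
          using mult_right_mono[OF C(2)[of "y + a *\<^sub>R w"] abs_ge_zero[of v]] by (simp add: abs_mult mult.commute)
      qed (use C(1) in auto)
      then show ?thesis using True by simp
    next
      case False
      have "norm (h *\<^sub>R w) \<le> norm w" using that by (simp add: mult_left_le_one_le)
      then have "R \<le> norm (y + h *\<^sub>R w)" using False norm_triangle_ineq2[of y "- (h *\<^sub>R w)"] by simp
      moreover have "R \<le> norm y" using False norm_ge_zero[of w] by linarith
      ultimately show ?thesis using F False by simp
    qed
    show "integrable lborel (\<lambda>y::'a. C * indicator (cball 0 (R + norm w)) y)"
      by (intro integrable_mult_right integrable_real_indicator emeasure_bounded_finite) auto
    show "((\<lambda>h. F (y + h *\<^sub>R w)) has_derivative (\<lambda>h. h * F' (y + 0 *\<^sub>R w) w)) (at 0)" for y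
      by (rule der)
  qed simp
  moreover have "(LINT y|lborel. F (y + h *\<^sub>R w)) = (LINT y|lborel. F y)" for h :: real
    using lborel_integral_translate[of F "h *\<^sub>R w"] borel_measurable_continuous_onI[OF Fc] by (simp add: add.commute)
  ultimately have "(\<lambda>h::real. LINT y|lborel. h * F' y w) = (\<lambda>h. 0)"
    using has_derivative_unique[OF _ has_derivative_const] by fastforce
  from fun_cong[OF this, of 1] show ?thesis by simp
qed

text \<open>The integral on the left is \<open>\<integral> U div (k * h)\<close> with the derivative placed on the kernel, so only \<open>k\<close> and \<open>U\<close> need to be
differentiable.\<close>

lemma conv_integration_by_parts:
  fixes k U :: "'a::euclidean_space \<Rightarrow> real" and h :: "'a \<Rightarrow> 'a"
  assumes k': "\<And>z. (k has_derivative (\<lambda>v. G z \<bullet> v)) (at z)" and G: "continuous_on UNIV G"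
    and k0: "\<And>z. \<delta> \<le> norm z \<Longrightarrow> k z = 0" and G0: "\<And>z. \<delta> \<le> norm z \<Longrightarrow> G z = 0" and h: "locally_integrable h"
    and U': "\<And>z. (U has_derivative (\<lambda>v. GU z \<bullet> v)) (at z)" and GU: "continuous_on UNIV GU"
    and U0: "\<And>z. R \<le> norm z \<Longrightarrow> U z = 0" and GU0: "\<And>z. R \<le> norm z \<Longrightarrow> GU z = 0"
  shows "(LINT y|lborel. U y * (LINT x|lborel. G (y - x) \<bullet> h x)) = - (LINT y|lborel. GU y \<bullet> (LINT x|lborel. k (y - x) *\<^sub>R h x))"
proof -
  have kc: "continuous_on UNIV k" using k' has_derivative_continuous continuous_at_imp_continuous_on by blast
  have Uc: "continuous_on UNIV U" using U' has_derivative_continuous continuous_at_imp_continuous_on by blast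
  note [measurable] = borel_measurable_continuous_onI[OF kc] borel_measurable_continuous_onI[OF Uc]
    borel_measurable_continuous_onI[OF G] borel_measurable_continuous_onI[OF GU] locally_integrable_measurable[OF h]
  obtain M where M: "M > 0" "\<And>z. \<bar>k z\<bar> \<le> M" using kernel_bounded[OF kc k0] by auto
  obtain M1 where M1: "M1 > 0" "\<And>z. norm (G z) \<le> M1" using kernel_bounded[OF G G0] by auto
  obtain N where N: "N > 0" "\<And>z. \<bar>U z\<bar> \<le> N" using kernel_bounded[OF Uc U0] by auto
  obtain N1 where N1: "N1 > 0" "\<And>z. norm (GU z) \<le> N1" using kernel_bounded[OF GU GU0] by auto
  define \<beta> where "\<beta> x = norm (indicator (cball 0 (R + \<delta>)) x *\<^sub>R h x)" for x
  have \<beta>: "integrable lborel \<beta>" unfolding \<beta>_def by (rule set_integrable_norm_cball[OF h])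
  have ind: "integrable lborel (\<lambda>y::'a. c * indicator (cball 0 R) y)" for c :: real
    by (intro integrable_mult_right integrable_real_indicator emeasure_bounded_finite) auto
  have far: "norm x \<le> R + \<delta>" if "norm y < R" "norm (y - x) < \<delta>" for x y :: 'a
    using that norm_triangle_ineq2[of x y] by (simp add: norm_minus_commute)
  have b1: "\<bar>U y * (G (y - x) \<bullet> h x)\<bar> \<le> (N * M1 * indicator (cball 0 R) y) * \<beta> x" for y x
  proof (cases "norm y < R \<and> norm (y - x) < \<delta>")
    case True
    have "\<bar>G (y - x) \<bullet> h x\<bar> \<le> M1 * norm (h x)"
      using M1 by (intro order_trans[OF Cauchy_Schwarz_ineq2] mult_right_mono) auto
    then have "\<bar>U y\<bar> * \<bar>G (y - x) \<bullet> h x\<bar> \<le> N * (M1 * norm (h x))" using N by (intro mult_mono) auto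
    then show ?thesis using True far[of y x] by (simp add: \<beta>_def abs_mult)
  next
    case False
    then have "U y = 0 \<or> G (y - x) = 0" using U0 G0 by (meson not_less)
    then show ?thesis using N M1 by (auto simp: \<beta>_def)
  qed
  have b2: "\<bar>GU y \<bullet> (k (y - x) *\<^sub>R h x)\<bar> \<le> (N1 * M * indicator (cball 0 R) y) * \<beta> x" for y x
  proof (cases "norm y < R \<and> norm (y - x) < \<delta>")
    case True
    have "\<bar>GU y \<bullet> h x\<bar> \<le> N1 * norm (h x)"
      using N1 by (intro order_trans[OF Cauchy_Schwarz_ineq2] mult_right_mono) auto
    then have "\<bar>k (y - x)\<bar> * \<bar>GU y \<bullet> h x\<bar> \<le> M * (N1 * norm (h x))" using M by (intro mult_mono) auto
    then show ?thesis using True far[of y x] by (simp add: \<beta>_def abs_mult ac_simps)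
  next
    case False
    then have "GU y = 0 \<or> k (y - x) = 0" using GU0 k0 by (meson not_less)
    then show ?thesis using N1 M by (auto simp: \<beta>_def)
  qed
  have parts: "(LINT y|lborel. U y * (G (y - x) \<bullet> w)) = - (LINT y|lborel. (GU y \<bullet> w) * k (y - x))" for x w
  proof -
    have c1: "continuous_on UNIV (\<lambda>y. U y * (G (y - x) \<bullet> w))"
      by (intro continuous_intros Uc continuous_on_compose2[OF G]) auto
    have c2: "continuous_on UNIV (\<lambda>y. (GU y \<bullet> w) * k (y - x))"
      by (intro continuous_intros GU continuous_on_compose2[OF kc]) auto
    have "(LINT y|lborel. U y * (G (y - x) \<bullet> w) + (GU y \<bullet> w) * k (y - x)) = 0"
    proof (rule integral_directional_derivative_zero[of "\<lambda>y. U y * k (y - x)" "\<lambda>y v. U y * (G (y - x) \<bullet> v) + (GU y \<bullet> v) * k (y - x)" w R])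
      show "((\<lambda>y. U y * k (y - x)) has_derivative (\<lambda>v. U y * (G (y - x) \<bullet> v) + (GU y \<bullet> v) * k (y - x))) (at y)" for y
      proof -
        have "((\<lambda>y. y - x) has_derivative (\<lambda>v. v)) (at y)" by (auto intro!: derivative_eq_intros)
        from has_derivative_compose[OF this k'] show ?thesis by (intro has_derivative_mult U') simp
      qed
    qed (use c1 c2 U0 GU0 in \<open>auto intro: continuous_on_add\<close>)
    moreover have "integrable lborel (\<lambda>y. U y * (G (y - x) \<bullet> w))" "integrable lborel (\<lambda>y. (GU y \<bullet> w) * k (y - x))"
      by (rule integrable_continuous_bounded_support[of _ R], use c1 c2 U0 GU0 in auto)+
    ultimately show ?thesis by simp
  qed
  have "(LINT y|lborel. U y * (LINT x|lborel. G (y - x) \<bullet> h x)) = (LINT y|lborel. LINT x|lborel. U y * (G (y - x) \<bullet> h x))"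
    by simp
  also have "\<dots> = (LINT x|lborel. LINT y|lborel. U y * (G (y - x) \<bullet> h x))"
    by (rule Fubini_dominated(1)[OF _ b1 ind \<beta>]) measurable
  also have "\<dots> = (LINT x|lborel. - (LINT y|lborel. GU y \<bullet> (k (y - x) *\<^sub>R h x)))"
    using parts by (simp add: mult.commute)
  also have "\<dots> = - (LINT x|lborel. LINT y|lborel. GU y \<bullet> (k (y - x) *\<^sub>R h x))" by simp
  also have "(LINT x|lborel. LINT y|lborel. GU y \<bullet> (k (y - x) *\<^sub>R h x)) = (LINT y|lborel. LINT x|lborel. GU y \<bullet> (k (y - x) *\<^sub>R h x))"
    by (rule Fubini_dominated(1)[OF _ b2 ind \<beta>, symmetric]) measurable
  also have "\<dots> = (LINT y|lborel. GU y \<bullet> (LINT x|lborel. k (y - x) *\<^sub>R h x))"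
    by (intro Bochner_Integration.integral_cong refl integral_inner_right conv_integrable[OF kc k0 h])
  finally show ?thesis .
qed

section \<open>Transport by Euler steps of a regular field\<close>

text \<open>A density \<open>g\<close> whose time derivative \<open>D\<close> equals \<open>- div (g v)\<close> tested against \<open>U\<close>, up to the error \<open>\<eta>\<close> in
assumption \<open>parts\<close>. The velocity is differentiable in space, while in time it is merely integrable, with
modulus \<open>c\<close>. The growth bound has the weight \<open>2 + norm y\<close> rather than \<open>1 + norm y\<close> because averages over
balls of radius at most \<open>1\<close> are to satisfy it.\<close>

locale regular_transport =
  fixes c :: "real \<Rightarrow> real" and g D :: "real \<Rightarrow> 'a::euclidean_space \<Rightarrow> real"
    and v :: "real \<Rightarrow> 'a \<Rightarrow> 'a" and v' :: "real \<Rightarrow> 'a \<Rightarrow> 'a \<Rightarrow> 'a"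
    and L N K \<eta> :: "real \<Rightarrow> real"
  assumes c_int: "integrable lborel c" and c_nonneg: "0 \<le> c r"
    and g_meas: "case_prod g \<in> borel_measurable (lborel \<Otimes>\<^sub>M lborel)"
    and D_meas: "case_prod D \<in> borel_measurable (lborel \<Otimes>\<^sub>M lborel)"
    and v_meas: "case_prod v \<in> borel_measurable (lborel \<Otimes>\<^sub>M lborel)"
    and g_nonneg: "0 \<le> g r y" and g_bound: "norm y \<le> R \<Longrightarrow> g r y \<le> N R"
    and D_bound: "norm y \<le> R \<Longrightarrow> \<bar>D r y\<bar> \<le> K R * c r" and K_nonneg: "0 \<le> K R"
    and v_growth: "norm (v r y) \<le> c r * (2 + norm y)"
    and v_deriv: "(v r has_derivative v' r y) (at y)"
    and v'_cont: "continuous_on UNIV (\<lambda>y. v' r y w)"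
    and v'_bound: "norm y \<le> R \<Longrightarrow> norm (v' r y w) \<le> L R * c r * norm w" and L_nonneg: "0 \<le> L R"
    and balance: "s \<le> t \<Longrightarrow> g t y - g s y = (LINT r:{s..t}|lborel. D r y)"
    and parts: "\<lbrakk>\<And>z. (U has_derivative (\<lambda>w. GU z \<bullet> w)) (at z); continuous_on UNIV GU;
        \<And>z. R \<le> norm z \<Longrightarrow> U z = 0; \<And>z. R \<le> norm z \<Longrightarrow> GU z = 0; \<And>z. \<bar>U z\<bar> \<le> M\<rbrakk>
      \<Longrightarrow> \<bar>(LINT y|lborel. U y * D r y) - (LINT y|lborel. (GU y \<bullet> v r y) * g r y)\<bar> \<le> \<eta> R * M * c r"
begin

definition V :: "real \<Rightarrow> 'a \<Rightarrow> 'a" where "V r y = (LINT q:{..r}|lborel. v q y)"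
definition V' :: "real \<Rightarrow> 'a \<Rightarrow> 'a \<Rightarrow> 'a" where "V' r y w = (LINT q:{..r}|lborel. v' q y w)"

lemma v_sect: "(\<lambda>q. v q y) \<in> borel_measurable borel"
  using measurable_Pair1[OF v_meas, of y] by simp

lemma D_sect: "(\<lambda>q. D q y) \<in> borel_measurable borel"
  using measurable_Pair1[OF D_meas, of y] by simp

lemma v_int: "integrable lborel (\<lambda>q. v q y)"
  by (rule Bochner_Integration.integrable_bound[of _ "\<lambda>q. c q * (2 + norm y)"])
    (use c_int v_sect in \<open>auto intro!: AE_I2 order_trans[OF v_growth abs_ge_self]\<close>)

lemma D_int: "integrable lborel (\<lambda>q. D q y)"
proof (rule Bochner_Integration.integrable_bound[of _ "\<lambda>q. K (norm y) * c q"])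
  show "AE q in lborel. norm (D q y) \<le> norm (K (norm y) * c q)"
    using order_trans[OF D_bound[OF order_refl] abs_ge_self] by simp
qed (use c_int D_sect in auto)

lemma v_lipschitz:
  assumes "norm y \<le> R" "norm y' \<le> R"
  shows "norm (v r y' - v r y) \<le> L R * c r * norm (y' - y)"
  by (rule has_derivative_imp_lipschitz[of "cball 0 R" "v r" "v' r"])
    (use assms v_deriv v'_bound L_nonneg c_nonneg in auto)

lemma has_derivative_V: "(V r has_derivative V' r y) (at y)" and v'_int: "integrable lborel (\<lambda>q. v' q y w)"
proof -
  have L_int: "integrable lborel (\<lambda>q. L (norm y + 1) * c q)" using c_int by simp
  have near: "norm y' \<le> norm y + 1" if "dist y' y < 1" for y'
    using that norm_triangle_ineq2[of y' y] by (simp add: dist_norm)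
  have "((\<lambda>y. LINT q|lborel. indicator {..r} q *\<^sub>R v q y) has_derivative (\<lambda>w. LINT q|lborel. indicator {..r} q *\<^sub>R v' q y w)) (at y)"
  proof (rule has_derivative_integral_dominated(1)[OF _ _ _ _ L_int])
    show "integrable lborel (\<lambda>q. indicator {..r} q *\<^sub>R v q y)" for y
      by (intro integrable_mult_indicator v_int) auto
    show "((\<lambda>y. indicator {..r} q *\<^sub>R v q y) has_derivative (\<lambda>w. indicator {..r} q *\<^sub>R v' q y w)) (at y)" for q
      by (intro has_derivative_scaleR_right v_deriv)
    show "norm (indicator {..r} q *\<^sub>R v q y' - indicator {..r} q *\<^sub>R v q y) \<le> L (norm y + 1) * c q * norm (y' - y)"
      if "dist y' y < 1" for q y'
      using v_lipschitz[of y "norm y + 1" y' q] near[OF that] L_nonneg c_nonneg by (auto simp: indicator_def)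
  qed simp
  then show "(V r has_derivative V' r y) (at y)"
    by (simp add: V_def[abs_def] V'_def[abs_def] set_lebesgue_integral_def)
  show "integrable lborel (\<lambda>q. v' q y w)"
  proof (rule has_derivative_integral_dominated(2)[OF v_int _ _ _ L_int])
    show "(v q has_derivative v' q y) (at y)" for q by (rule v_deriv)
    show "norm (v q y' - v q y) \<le> L (norm y + 1) * c q * norm (y' - y)"
      if "dist y' y < 1" for q y'
      using v_lipschitz[of y "norm y + 1" y' q] near[OF that] by auto
  qed simp
qed

lemma V'_cont: "continuous_on UNIV (\<lambda>y. V' r y w)"
  unfolding V'_def set_lebesgue_integral_def
proof (rule continuous_integral_dominated)
  show "norm (indicator {..r} q *\<^sub>R v' q y w) \<le> L R * c q * norm w" if "norm y \<le> R" for q R y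
    using v'_bound[OF that, of q w] L_nonneg[of R] c_nonneg[of q] by (auto simp: indicator_def)
  show "integrable lborel (\<lambda>q. L R * c q * norm w)" for R using c_int by simp
  show "(\<lambda>q. indicator {..r} q *\<^sub>R v' q y w) \<in> borel_measurable lborel" for y
    using v'_int[of y w] by simp
qed (intro continuous_intros v'_cont)

lemma V_meas: "case_prod V \<in> borel_measurable (lborel \<Otimes>\<^sub>M lborel)"
proof -
  note [measurable] = v_meas
  have "(\<lambda>(z, q). indicator {..fst z} q *\<^sub>R v q (snd z)) \<in> borel_measurable ((lborel \<Otimes>\<^sub>M lborel) \<Otimes>\<^sub>M lborel)"
  proof -
    have m: "(\<lambda>p::(real \<times> 'a) \<times> real. case_prod v (snd p, snd (fst p))) \<in> borel_measurable ((lborel \<Otimes>\<^sub>M lborel) \<Otimes>\<^sub>M lborel)"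
      by (rule measurable_compose[OF _ v_meas]) measurable
    have "(\<lambda>p::(real \<times> 'a) \<times> real. if snd p \<le> fst (fst p) then case_prod v (snd p, snd (fst p)) else 0) \<in> borel_measurable ((lborel \<Otimes>\<^sub>M lborel) \<Otimes>\<^sub>M lborel)"
      using m by measurable
    then show ?thesis by (rule measurable_cong[THEN iffD1, rotated]) (auto simp: indicator_def)
  qed
  from lborel.borel_measurable_lebesgue_integral[OF this] show ?thesis
    by (simp add: V_def set_lebesgue_integral_def split_beta')
qed

lemma V_diff: "s \<le> t \<Longrightarrow> V t y - V s y = (LINT q:{s..t}|lborel. v q y)"
  unfolding V_def by (rule set_integral_atMost_diff[OF v_int])

lemma set_integral_norm_le:
  fixes f :: "real \<Rightarrow> 'a"
  assumes "integrable lborel f" "\<And>q. norm (f q) \<le> c q * C"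
  shows "norm (LINT q:{s..t}|lborel. f q) \<le> (LINT q:{s..t}|lborel. c q) * C"
proof -
  have "norm (LINT q:{s..t}|lborel. f q) \<le> (LINT q|lborel. norm (indicator {s..t} q *\<^sub>R f q))"
    unfolding set_lebesgue_integral_def by (rule integral_norm_bound)
  also have "\<dots> \<le> (LINT q|lborel. (indicator {s..t} q *\<^sub>R c q) * C)"
    by (intro integral_mono integrable_norm integrable_mult_left integrable_mult_indicator assms c_int)
      (use assms(2) in \<open>auto simp: indicator_def\<close>)
  finally show ?thesis by (simp add: set_lebesgue_integral_def)
qed

lemma V_diff_bound: "s \<le> t \<Longrightarrow> norm (V t y - V s y) \<le> (LINT q:{s..t}|lborel. c q) * (2 + norm y)"
  using set_integral_norm_le[OF v_int v_growth] by (simp add: V_diff)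

lemma V'_diff_bound:
  assumes "s \<le> t" "norm y \<le> R"
  shows "norm (V' t y w - V' s y w) \<le> (LINT q:{s..t}|lborel. c q) * (L R * norm w)"
proof -
  have "V' t y w - V' s y w = (LINT q:{s..t}|lborel. v' q y w)"
    unfolding V'_def by (rule set_integral_atMost_diff[OF v'_int assms(1)])
  then show ?thesis
    using set_integral_norm_le[OF v'_int, of y w "L R * norm w"] v'_bound[OF assms(2)] by (simp add: ac_simps)
qed

text \<open>One Euler step from time \<open>s\<close> to time \<open>t\<close>: the velocity is evaluated at the starting point \<open>y\<close> but at
all times between \<open>s\<close> and \<open>t\<close>.\<close>

definition X :: "real \<Rightarrow> real \<Rightarrow> 'a \<Rightarrow> 'a" where "X s t y = y + V t y - V s y"

text \<open>A step of weight \<open>w\<close> changes \<open>2 + norm y\<close> by a factor of at least \<open>1 - w\<close>, and \<open>(1 + 2 w) (1 - w) \<ge> 1\<close> for \<open>w \<le> 1 / 2\<close>.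
The constant \<open>\<rho>\<close> is thus the radius, shifted by \<open>2\<close>, of a ball containing the support of a test function, and
the support of its pull-back grows by the factor \<open>1 + 2 w\<close>.\<close>

lemma X_far:
  assumes "s \<le> t" and w: "(LINT q:{s..t}|lborel. c q) \<le> w" "w \<le> 1 / 2"
  shows "\<rho> * (1 + 2 * w) \<le> 2 + norm y \<Longrightarrow> \<rho> \<le> 2 + norm (X s t y)"
    and "\<rho> * (1 + 2 * w) < 2 + norm y \<Longrightarrow> \<rho> < 2 + norm (X s t y)"
proof -
  have w0: "0 \<le> w"
  proof -
    have "0 \<le> (LINT q:{s..t}|lborel. c q)" unfolding set_lebesgue_integral_def
      by (intro Bochner_Integration.integral_nonneg) (simp add: c_nonneg)
    then show ?thesis using w by simp
  qed
  have "norm y \<le> norm (X s t y) + norm (V t y - V s y)"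
    using norm_triangle_ineq4[of "X s t y" "V t y - V s y"] by (simp add: X_def)
  also have "norm (V t y - V s y) \<le> w * (2 + norm y)"
    by (rule order_trans[OF V_diff_bound[OF assms(1)] mult_right_mono[OF w(1)]]) simp
  finally have far: "(2 + norm y) * (1 - w) \<le> 2 + norm (X s t y)" by (simp add: algebra_simps)
  have one: "1 \<le> (1 + 2 * w) * (1 - w)"
  proof -
    have "w * (2 * w) \<le> w * 1" using w w0 by (intro mult_left_mono) auto
    then show ?thesis by (simp add: algebra_simps)
  qed
  have ge: "\<rho> \<le> \<rho> * (1 + 2 * w) * (1 - w)" if "0 \<le> \<rho>"
    using mult_left_mono[OF one that] by (simp add: mult.assoc)
  show "\<rho> \<le> 2 + norm (X s t y)" if "\<rho> * (1 + 2 * w) \<le> 2 + norm y"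
  proof (cases "0 \<le> \<rho>")
    case True
    have "\<rho> * (1 + 2 * w) * (1 - w) \<le> (2 + norm y) * (1 - w)" using that w by (intro mult_right_mono) auto
    then show ?thesis using ge[OF True] far by linarith
  qed (use norm_ge_zero[of "X s t y"] in linarith)
  show "\<rho> < 2 + norm (X s t y)" if "\<rho> * (1 + 2 * w) < 2 + norm y"
  proof (cases "0 \<le> \<rho>")
    case True
    have "\<rho> * (1 + 2 * w) * (1 - w) < (2 + norm y) * (1 - w)" using that w by (intro mult_strict_right_mono) auto
    then show ?thesis using ge[OF True] far by linarith
  qed (use norm_ge_zero[of "X s t y"] in linarith)
qed

end

lemma gradient_zero_outside:
  fixes u :: "'a::euclidean_space \<Rightarrow> real"
  assumes u: "(u has_derivative (\<lambda>w. G \<bullet> w)) (at x)" and 0: "\<And>x. \<rho> \<le> 2 + norm x \<Longrightarrow> u x = 0" and "\<rho> < 2 + norm x"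
  shows "G = 0"
proof -
  have "open {x::'a. \<rho> < 2 + norm x}" by (intro open_Collect_less continuous_intros)
  then have "(u has_derivative (\<lambda>w. 0)) (at x)"
    by (rule has_derivative_transform_within_open[OF has_derivative_const[of 0]]) (use assms in auto)
  then have "(\<lambda>w. G \<bullet> w) = (\<lambda>w. 0)" using has_derivative_unique[OF u] by blast
  from fun_cong[OF this, of G] show ?thesis by simp
qed

context regular_transport
begin

text \<open>The gradient of \<open>y \<mapsto> u (X s t y)\<close> when \<open>G\<close> is the gradient of \<open>u\<close>.\<close>

definition grad_pullback :: "('a \<Rightarrow> 'a) \<Rightarrow> real \<Rightarrow> real \<Rightarrow> 'a \<Rightarrow> 'a" where
  "grad_pullback G s t y = (\<Sum>i\<in>Basis. (G (X s t y) \<bullet> (i + V' t y i - V' s y i)) *\<^sub>R i)"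

context
  fixes u :: "'a \<Rightarrow> real" and G :: "'a \<Rightarrow> 'a" and \<Lambda> M \<rho> R w s t :: real
  assumes u: "\<And>x. (u has_derivative (\<lambda>v. G x \<bullet> v)) (at x)" and G_cont: "continuous_on UNIV G"
    and G_bound: "\<And>x. norm (G x) \<le> \<Lambda>" and u_bound: "\<And>x. \<bar>u x\<bar> \<le> M"
    and u0: "\<And>x. \<rho> \<le> 2 + norm x \<Longrightarrow> u x = 0"
    and st: "s \<le> t" and w: "(LINT q:{s..t}|lborel. c q) \<le> w" "w \<le> 1 / 2" and R: "\<rho> * (1 + 2 * w) \<le> 2 + R"
begin

lemma grad_pullback_inner:
  "grad_pullback G s t y \<bullet> z = G (X s t y) \<bullet> (z + V' t y z - V' s y z)"
proof -
  interpret t: bounded_linear "V' t y" using has_derivative_V by (rule has_derivative_bounded_linear)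
  interpret s: bounded_linear "V' s y" using has_derivative_V by (rule has_derivative_bounded_linear)
  have "linear (\<lambda>z. G (X s t y) \<bullet> (z + V' t y z - V' s y z))"
    by (intro linearI) (simp_all add: t.add s.add t.scaleR s.scaleR inner_simps algebra_simps)
  then interpret linear "\<lambda>z. G (X s t y) \<bullet> (z + V' t y z - V' s y z)" .
  have "G (X s t y) \<bullet> (z + V' t y z - V' s y z) =
      (\<Sum>i\<in>Basis. (z \<bullet> i) *\<^sub>R (G (X s t y) \<bullet> (i + V' t y i - V' s y i)))"
    using sum[of "\<lambda>i. (z \<bullet> i) *\<^sub>R i" Basis] by (simp only: euclidean_representation scale)
  then show ?thesis
    by (simp add: grad_pullback_def inner_sum_left inner_sum_right inner_commute mult.commute)
qed

lemma pullback_has_derivative: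
  "((\<lambda>y. u (X s t y)) has_derivative (\<lambda>z. grad_pullback G s t y \<bullet> z)) (at y)"
proof -
  have "((\<lambda>y. X s t y) has_derivative (\<lambda>z. z + V' t y z - V' s y z)) (at y)"
    unfolding X_def by (intro derivative_intros has_derivative_V)
  from has_derivative_compose[OF this u] show ?thesis by (simp only: grad_pullback_inner)
qed

lemma X_cont: "continuous_on UNIV (X s t)"
  unfolding X_def using has_derivative_continuous[OF has_derivative_V]
  by (intro continuous_intros continuous_at_imp_continuous_on) auto

lemma grad_pullback_cont: "continuous_on UNIV (grad_pullback G s t)"
  unfolding grad_pullback_def
  by (intro continuous_intros V'_cont continuous_on_compose2[OF G_cont X_cont]) auto

lemma pullback_zero: "\<rho> * (1 + 2 * w) \<le> 2 + norm y \<Longrightarrow> u (X s t y) = 0"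
  using u0 X_far(1)[OF st w] by blast

lemma G_X_zero: "R < norm y \<Longrightarrow> G (X s t y) = 0"
proof -
  assume "R < norm y"
  then have far: "\<rho> < 2 + norm (X s t y)" using X_far(2)[OF st w, of \<rho> y] R by simp
  show ?thesis by (rule gradient_zero_outside[where \<rho>=\<rho> and u=u, OF u u0 far])
qed

lemma grad_pullback_bound: "norm (grad_pullback G s t y) \<le> \<Lambda> * (1 + L R * w)"
proof (cases "R < norm y")
  case True
  have "0 \<le> (LINT q:{s..t}|lborel. c q)" unfolding set_lebesgue_integral_def
      by (intro Bochner_Integration.integral_nonneg) (simp add: c_nonneg)
  moreover have "0 \<le> \<Lambda>" using G_bound norm_ge_zero order_trans by blast
  ultimately show ?thesis using G_X_zero[OF True] L_nonneg[of R] w by (simp add: grad_pullback_def)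
next
  case False
  define z where "z = grad_pullback G s t y"
  have \<Lambda>0: "0 \<le> \<Lambda>" using G_bound norm_ge_zero order_trans by blast
  have "norm z * norm z = G (X s t y) \<bullet> (z + V' t y z - V' s y z)"
    using grad_pullback_inner[of y z] by (simp add: z_def power2_norm_eq_inner[symmetric] power2_eq_square[symmetric])
  also have "\<dots> \<le> norm (G (X s t y)) * norm (z + V' t y z - V' s y z)" by (rule norm_cauchy_schwarz)
  also have "\<dots> \<le> \<Lambda> * ((1 + L R * w) * norm z)"
  proof (intro mult_mono G_bound \<Lambda>0)
    have "norm (z + V' t y z - V' s y z) \<le> norm z + norm (V' t y z - V' s y z)"
      by (metis add_diff_eq norm_triangle_ineq)
    also have "norm (V' t y z - V' s y z) \<le> w * (L R * norm z)"
      using V'_diff_bound[OF st, of y R z] mult_right_mono[OF w(1), of "L R * norm z"] False L_nonneg[of R] by simp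
    finally show "norm (z + V' t y z - V' s y z) \<le> (1 + L R * w) * norm z" by (simp add: algebra_simps)
  qed simp
  finally have "norm z * norm z \<le> (\<Lambda> * (1 + L R * w)) * norm z" by (simp add: ac_simps)
  then have "norm z = 0 \<or> norm z \<le> \<Lambda> * (1 + L R * w)" by (simp add: mult_le_cancel_right) linarith
  moreover have "0 \<le> \<Lambda> * (1 + L R * w)"
  proof -
    have "0 \<le> (LINT q:{s..t}|lborel. c q)" unfolding set_lebesgue_integral_def
      by (intro Bochner_Integration.integral_nonneg) (simp add: c_nonneg)
    then show ?thesis using \<Lambda>0 L_nonneg[of R] w by simp
  qed
  ultimately show ?thesis unfolding z_def by auto
qed

end

text \<open>For fixed \<open>y\<close> the point \<open>X r t y\<close> moves from \<open>X s t y\<close> at \<open>r = s\<close> to \<open>y\<close> at \<open>r = t\<close>, with velocity \<open>- v r y\<close>.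
The identity is the fundamental theorem of calculus for \<open>u (X r t y) g r y\<close> along this motion.\<close>

lemma transport_along_path:
  fixes u :: "'a \<Rightarrow> real"
  assumes u: "\<And>x. (u has_derivative (\<lambda>v. G x \<bullet> v)) (at x)" and G: "continuous_on UNIV G" and "s \<le> t"
  shows "u y * g t y - u (X s t y) * g s y =
    (LINT r:{s..t}|lborel. u (X r t y) * D r y - (G (X r t y) \<bullet> v r y) * g r y)"
proof -
  let ?\<Psi> = "\<lambda>p::'a \<times> real. u (fst p) * snd p" and ?G = "\<lambda>p::'a \<times> real. (snd p *\<^sub>R G (fst p), u (fst p))"
  let ?h = "\<lambda>r. (- v r y, D r y)" and ?\<gamma> = "\<lambda>r. (X r t y, g r y)"
  have uc: "continuous_on UNIV u" using u has_derivative_continuous continuous_at_imp_continuous_on by blast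
  have h: "integrable lborel ?h"
  proof -
    have "integrable lborel (\<lambda>r. (- v r y, 0) + (0::'a, D r y))"
      using v_int[of y] D_int[of y]
      by (intro Bochner_Integration.integrable_add
          integrable_bounded_linear[OF bounded_linear_Pair[OF bounded_linear_minus[OF bounded_linear_ident] bounded_linear_zero]]
          integrable_bounded_linear[OF bounded_linear_Pair[OF bounded_linear_zero bounded_linear_ident]])
    then show ?thesis by simp
  qed
  have "?\<Psi> (?\<gamma> t) - ?\<Psi> (?\<gamma> s) = (LINT r:{s..t}|lborel. ?G (?\<gamma> r) \<bullet> ?h r)"
  proof (rule chain_rule_primitive[OF _ _ h _ \<open>s \<le> t\<close>])
    show "(?\<Psi> has_derivative (\<lambda>z. ?G p \<bullet> z)) (at p)" for p
    proof -
      have "((\<lambda>p::'a \<times> real. u (fst p)) has_derivative (\<lambda>z. G (fst p) \<bullet> fst z)) (at p)"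
        by (rule has_derivative_compose[OF has_derivative_fst[OF has_derivative_ident] u])
      then have "(?\<Psi> has_derivative (\<lambda>z. u (fst p) * snd z + (G (fst p) \<bullet> fst z) * snd p)) (at p)"
        by (intro has_derivative_mult has_derivative_snd has_derivative_ident)
      then show ?thesis by (simp add: inner_prod_def algebra_simps)
    qed
    show "continuous_on UNIV ?G"
      by (intro continuous_intros continuous_on_compose2[OF G] continuous_on_compose2[OF uc]) auto
    show "?\<gamma> b - ?\<gamma> a = (LINT r:{a..b}|lborel. ?h r)" if "a \<le> b" for a b
    proof (rule prod_eqI)
      have hi: "integrable lborel (\<lambda>r. indicator {a..b} r *\<^sub>R ?h r)" by (rule integrable_mult_indicator[OF _ h]) simp
      show "fst (?\<gamma> b - ?\<gamma> a) = fst (LINT r:{a..b}|lborel. ?h r)"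
        using V_diff[OF that, of y] integral_bounded_linear[OF bounded_linear_fst hi]
        by (simp add: X_def set_lebesgue_integral_def) (metis minus_diff_eq)
      show "snd (?\<gamma> b - ?\<gamma> a) = snd (LINT r:{a..b}|lborel. ?h r)"
        using balance[OF that, of y] integral_bounded_linear[OF bounded_linear_snd hi]
        by (simp add: set_lebesgue_integral_def)
    qed
  qed
  then show ?thesis by (simp add: X_def inner_prod_def algebra_simps)
qed

lemma c_integral_mono:
  assumes "s \<le> r" "t \<le> T" shows "(LINT q:{r..t}|lborel. c q) \<le> (LINT q:{s..T}|lborel. c q)"
  by (rule set_integral_nonneg_mono[OF c_int c_nonneg]) (use assms in auto)

lemma c_integral_nonneg: "0 \<le> (LINT q:{s..t}|lborel. c q)"
  unfolding set_lebesgue_integral_def by (intro Bochner_Integration.integral_nonneg) (simp add: c_nonneg)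

lemma g_int: "(\<And>y. R < norm y \<Longrightarrow> q y = 0) \<Longrightarrow> q \<in> borel_measurable borel \<Longrightarrow> (\<And>y. \<bar>q y\<bar> \<le> C)
  \<Longrightarrow> integrable lborel (\<lambda>y. q y * g r y)"
proof (rule Bochner_Integration.integrable_bound[of _ "\<lambda>y. C * N R * indicator (cball 0 R) y"])
  assume q: "\<And>y. R < norm y \<Longrightarrow> q y = 0" "q \<in> borel_measurable borel" "\<And>y. \<bar>q y\<bar> \<le> C"
  show "integrable lborel (\<lambda>y::'a. C * N R * indicator (cball 0 R) y)"
    by (intro integrable_mult_right integrable_real_indicator emeasure_bounded_finite) auto
  show "(\<lambda>y. q y * g r y) \<in> borel_measurable lborel"
    using q(2) measurable_Pair2[OF g_meas, of r] by simp
  have "norm (q y * g r y) \<le> norm (C * N R * indicator (cball 0 R) y)" for y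
  proof (cases "norm y \<le> R")
    case True
    then have "\<bar>q y\<bar> * \<bar>g r y\<bar> \<le> C * N R"
      using q(3)[of y] g_bound[OF True, of r] g_nonneg[of r y] by (intro mult_mono) auto
    also have "\<dots> \<le> \<bar>C * N R\<bar>" by (rule abs_ge_self)
    finally show ?thesis using True by (simp add: abs_mult)
  qed (use q(1)[of y] in auto)
  then show "AE y in lborel. norm (q y * g r y) \<le> norm (C * N R * indicator (cball 0 R) y)" by simp
qed

definition mass :: "real \<Rightarrow> real" where "mass R = N R * measure lborel (cball 0 R :: 'a set)"

lemma weighted_integral_bound:
  assumes "\<And>y. R < norm y \<Longrightarrow> q y = 0" "q \<in> borel_measurable borel" "\<And>y. norm y \<le> R \<Longrightarrow> \<bar>q y\<bar> \<le> C"
  shows "\<bar>LINT y|lborel. q y * g r y\<bar> \<le> C * mass R"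
proof -
  have fin: "emeasure lborel (cball 0 R :: 'a set) < \<infinity>" by (rule emeasure_bounded_finite) simp
  have "norm (LINT y|lborel. q y * g r y) \<le> (LINT y::'a|lborel. C * N R * indicator (cball 0 R) y)"
  proof (rule Bochner_Integration.integral_norm_bound_integral)
    have "\<bar>q y\<bar> \<le> max C 0" for y using assms(1)[of y] assms(3)[of y] by (cases "norm y \<le> R") auto
    then show "integrable lborel (\<lambda>y. q y * g r y)" using assms by (intro g_int[of R q "max C 0"]) auto
    show "integrable lborel (\<lambda>y::'a. C * N R * indicator (cball 0 R) y)"
      by (intro integrable_mult_right integrable_real_indicator fin) auto
    show "norm (q y * g r y) \<le> C * N R * indicator (cball 0 R) y" for y
    proof (cases "norm y \<le> R")
      case True
      then have "\<bar>q y\<bar> * \<bar>g r y\<bar> \<le> C * N R"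
        using assms(3)[OF True] g_bound[OF True, of r] g_nonneg[of r y] by (intro mult_mono) auto
      then show ?thesis using True by (simp add: abs_mult)
    qed (use assms(1)[of y] in auto)
  qed
  also have "\<dots> = C * mass R" using fin by (simp add: mass_def)
  finally show ?thesis by simp
qed

text \<open>Integrating \<open>transport_along_path\<close> over \<open>y\<close> would give zero by \<open>parts\<close>, up to \<open>\<eta>\<close>, if \<open>G (X r t y)\<close> were the
gradient of the pulled-back test function. The two differ by the derivative of \<open>X r t\<close> minus the identity,
which is of order \<open>w\<close>; after integration over the time step the error becomes quadratic in \<open>w\<close>.\<close>

lemma step_estimate:
  fixes u :: "'a \<Rightarrow> real"
  assumes u: "\<And>x. (u has_derivative (\<lambda>v. G x \<bullet> v)) (at x)" and G: "continuous_on UNIV G"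
    and G_bound: "\<And>x. norm (G x) \<le> \<Lambda>" and u_bound: "\<And>x. \<bar>u x\<bar> \<le> M"
    and u0: "\<And>x. \<rho> \<le> 2 + norm x \<Longrightarrow> u x = 0"
    and st: "s \<le> t" and w_def: "w = (LINT q:{s..t}|lborel. c q)" and w: "w \<le> 1 / 2" and R: "\<rho> * (1 + 2 * w) \<le> 2 + R"
  shows "\<bar>(LINT y|lborel. u y * g t y) - (LINT y|lborel. u (X s t y) * g s y)\<bar>
      \<le> w * (\<Lambda> * L R * w * (2 + R) * mass R + \<eta> (R + 1) * M)"
proof -
  have uc: "continuous_on UNIV u" using u has_derivative_continuous continuous_at_imp_continuous_on by blast
  note [measurable] = borel_measurable_continuous_onI[OF uc] borel_measurable_continuous_onI[OF G] V_meas v_meas D_meas g_meas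
  have w0: "0 \<le> w" by (simp add: w_def c_integral_nonneg)
  have \<Lambda>0: "0 \<le> \<Lambda>" using G_bound norm_ge_zero order_trans by blast
  have M0: "0 \<le> M" using u_bound abs_ge_zero order_trans by blast
  have wr: "(LINT q:{r..t}|lborel. c q) \<le> w" if "s \<le> r" for r unfolding w_def using that by (intro c_integral_mono) auto
  have X_tt: "X t t y = y" for y by (simp add: X_def)
  have pz: "u (X r t y) = 0" if "r \<le> t" "s \<le> r" "\<rho> * (1 + 2 * w) \<le> 2 + norm y" for r y
    by (rule pullback_zero[OF u G G_bound u_bound u0 that(1) wr[OF that(2)] w R that(3)])
  have gz: "G (X r t y) = 0" if "r \<le> t" "s \<le> r" "R < norm y" for r y
    by (rule G_X_zero[OF u G G_bound u_bound u0 that(1) wr[OF that(2)] w R that(3)])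
  have uX0: "u (X r t y) = 0" if "s \<le> r" "r \<le> t" "R < norm y" for r y
    using pz[of r y] that R by simp
  have Vsec: "V r \<in> borel_measurable borel" for r using measurable_Pair2[OF V_meas, of r] by simp
  have Xsec [measurable]: "X a b \<in> borel_measurable borel" for a b
    unfolding X_def[abs_def] using Vsec by simp
  define \<Phi> where "\<Phi> y r = indicator {s..t} r * (u (X r t y) * D r y - (G (X r t y) \<bullet> v r y) * g r y)" for y r
  define C where "C = M * K R + \<Lambda> * (2 + R) * N R"
  have \<Phi>_bound: "\<bar>\<Phi> y r\<bar> \<le> (C * indicator (cball 0 R) y) * c r" for y r
  proof (cases "r \<in> {s..t} \<and> norm y \<le> R")
    case True
    have "\<bar>u (X r t y)\<bar> * \<bar>D r y\<bar> \<le> M * (K R * c r)"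
      using D_bound[of y R r] True u_bound M0 by (intro mult_mono) auto
    moreover have "\<bar>G (X r t y) \<bullet> v r y\<bar> * \<bar>g r y\<bar> \<le> (\<Lambda> * (c r * (2 + R))) * N R"
    proof (rule mult_mono)
      have "norm (v r y) \<le> c r * (2 + R)"
        using v_growth[of r y] mult_left_mono[of "2 + norm y" "2 + R" "c r"] True c_nonneg[of r] by auto
      then show "\<bar>G (X r t y) \<bullet> v r y\<bar> \<le> \<Lambda> * (c r * (2 + R))"
        using \<Lambda>0 G_bound by (intro order_trans[OF Cauchy_Schwarz_ineq2] mult_mono) auto
      have "0 \<le> 2 + R" using True norm_ge_zero[of y] by linarith
      then show "0 \<le> \<Lambda> * (c r * (2 + R))" using \<Lambda>0 c_nonneg[of r] by simp
    qed (use True g_bound[of y R r] g_nonneg[of r y] in auto)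
    ultimately have "\<bar>u (X r t y) * D r y - (G (X r t y) \<bullet> v r y) * g r y\<bar> \<le> M * (K R * c r) + (\<Lambda> * (c r * (2 + R))) * N R"
      by (intro order_trans[OF abs_triangle_ineq4] add_mono) (simp_all add: abs_mult)
    also have "\<dots> = C * c r" by (simp add: C_def algebra_simps)
    finally show ?thesis using True by (simp add: \<Phi>_def)
  next
    case False
    then have "\<Phi> y r = 0" using uX0[of r y] gz[of r y] by (auto simp: \<Phi>_def indicator_def)
    moreover have "0 \<le> C" if "norm y \<le> R"
    proof -
      have "0 \<le> 2 + R" using that norm_ge_zero[of y] by linarith
      moreover have "0 \<le> N R" using order_trans[OF g_nonneg g_bound[OF that]] .
      ultimately show ?thesis using M0 \<Lambda>0 K_nonneg[of R] by (simp add: C_def)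
    qed
    ultimately show ?thesis using c_nonneg[of r] by (cases "norm y \<le> R") auto
  qed
  have \<Phi>_meas: "(\<lambda>(y, r). \<Phi> y r) \<in> borel_measurable (lborel \<Otimes>\<^sub>M lborel)"
  proof -
    have sw: "(\<lambda>p::'a \<times> real. case_prod q (snd p, fst p)) \<in> borel_measurable (lborel \<Otimes>\<^sub>M lborel)"
      if "case_prod q \<in> borel_measurable (lborel \<Otimes>\<^sub>M lborel)" for q :: "real \<Rightarrow> 'a \<Rightarrow> 'z::topological_space"
      by (rule measurable_compose[OF _ that]) measurable
    have Xm: "(\<lambda>p::'a \<times> real. X (snd p) t (fst p)) \<in> borel_measurable (lborel \<Otimes>\<^sub>M lborel)"
      unfolding X_def using sw[OF V_meas] Vsec[of t] by simp
    have "(\<lambda>p::'a \<times> real. indicator {s..t} (snd p) * (u (X (snd p) t (fst p)) * D (snd p) (fst p)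
        - (G (X (snd p) t (fst p)) \<bullet> v (snd p) (fst p)) * g (snd p) (fst p))) \<in> borel_measurable (lborel \<Otimes>\<^sub>M lborel)"
      using Xm sw[OF v_meas] sw[OF D_meas] sw[OF g_meas] by simp
    then show ?thesis by (simp add: \<Phi>_def split_beta')
  qed
  have C_int: "integrable lborel (\<lambda>y::'a. C * indicator (cball 0 R) y)"
    by (intro integrable_mult_right integrable_real_indicator emeasure_bounded_finite) auto
  note fub = Fubini_dominated[OF \<Phi>_meas \<Phi>_bound C_int c_int]
  have "(LINT y|lborel. u y * g t y) - (LINT y|lborel. u (X s t y) * g s y) = (LINT y|lborel. u y * g t y - u (X s t y) * g s y)"
  proof (rule Bochner_Integration.integral_diff[symmetric])
    show "integrable lborel (\<lambda>y. u y * g t y)"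
      using uX0[of t] st by (intro g_int[of R u M]) (auto simp: X_tt u_bound)
    show "integrable lborel (\<lambda>y. u (X s t y) * g s y)"
      using uX0[of s] st by (intro g_int[of R _ M]) (auto simp: u_bound)
  qed
  also have "\<dots> = (LINT y|lborel. LINT r|lborel. \<Phi> y r)"
    using transport_along_path[OF u G st] by (simp add: \<Phi>_def set_lebesgue_integral_def)
  also have "\<dots> = (LINT r|lborel. LINT y|lborel. \<Phi> y r)" by (rule fub(1))
  also have "\<bar>\<dots>\<bar> \<le> (LINT r|lborel. (indicator {s..t} r *\<^sub>R c r) * (\<Lambda> * L R * w * (2 + R) * mass R + \<eta> (R + 1) * M))"
    unfolding real_norm_def[symmetric]
  proof (rule Bochner_Integration.integral_norm_bound_integral[OF fub(3)])
    show "integrable lborel (\<lambda>r. (indicator {s..t} r *\<^sub>R c r) * (\<Lambda> * L R * w * (2 + R) * mass R + \<eta> (R + 1) * M))"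
      by (intro integrable_mult_left integrable_mult_indicator c_int) auto
    fix r
    show "norm (LINT y|lborel. \<Phi> y r) \<le> (indicator {s..t} r *\<^sub>R c r) * (\<Lambda> * L R * w * (2 + R) * mass R + \<eta> (R + 1) * M)"
    proof (cases "r \<in> {s..t}")
      case False
      then show ?thesis by (simp add: \<Phi>_def)
    next
      case True
      then have r: "s \<le> r" "r \<le> t" by auto
      let ?GU = "grad_pullback G r t"
      note pb = u G G_bound u_bound u0 r(2) wr[OF r(1)] w R
      have GU0: "?GU y = 0" if "R < norm y" for y using gz[OF r(2) r(1) that] by (simp add: grad_pullback_def)
      have GUc: "continuous_on UNIV ?GU" by (rule grad_pullback_cont[OF pb])
      have vsec: "v r \<in> borel_measurable borel" "g r \<in> borel_measurable borel" "D r \<in> borel_measurable borel"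
        using measurable_Pair2[OF v_meas, of r] measurable_Pair2[OF g_meas, of r] measurable_Pair2[OF D_meas, of r] by simp_all
      note [measurable] = vsec borel_measurable_continuous_onI[OF GUc]
      have vb: "norm (v r y) \<le> c r * (2 + R)" if "norm y \<le> R" for y
        using v_growth[of r y] mult_left_mono[of "2 + norm y" "2 + R" "c r"] that c_nonneg[of r] by auto
      have i1: "integrable lborel (\<lambda>y. (?GU y \<bullet> v r y) * g r y)"
      proof (rule g_int[of R _ "(\<Lambda> * (1 + L R * w)) * (c r * (2 + \<bar>R\<bar>))"])
        have "norm (?GU y) * norm (v r y) \<le> (\<Lambda> * (1 + L R * w)) * (c r * (2 + \<bar>R\<bar>))" for y
        proof (cases "norm y \<le> R")
          case True
          have "norm (v r y) \<le> c r * (2 + \<bar>R\<bar>)"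
            by (rule order_trans[OF vb[OF True] mult_left_mono]) (use c_nonneg[of r] in auto)
          then show ?thesis using \<Lambda>0 L_nonneg[of R] w0 by (intro mult_mono grad_pullback_bound[OF pb]) auto
        next
          case False then show ?thesis using GU0[of y] \<Lambda>0 L_nonneg[of R] w0 c_nonneg[of r] by simp
        qed
        then show "\<bar>?GU y \<bullet> v r y\<bar> \<le> (\<Lambda> * (1 + L R * w)) * (c r * (2 + \<bar>R\<bar>))" for y
          using Cauchy_Schwarz_ineq2 order_trans by blast
      qed (use GU0 in auto)
      have i2: "integrable lborel (\<lambda>y. (G (X r t y) \<bullet> v r y) * g r y)"
      proof (rule g_int[of R _ "\<Lambda> * (c r * (2 + \<bar>R\<bar>))"])
        have "norm (G (X r t y)) * norm (v r y) \<le> \<Lambda> * (c r * (2 + \<bar>R\<bar>))" for y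
        proof (cases "norm y \<le> R")
          case True
          have "norm (v r y) \<le> c r * (2 + \<bar>R\<bar>)"
            by (rule order_trans[OF vb[OF True] mult_left_mono]) (use c_nonneg[of r] in auto)
          then show ?thesis using \<Lambda>0 by (intro mult_mono G_bound) auto
        next
          case False then show ?thesis using gz[OF r(2) r(1), of y] \<Lambda>0 c_nonneg[of r] by simp
        qed
        then show "\<bar>G (X r t y) \<bullet> v r y\<bar> \<le> \<Lambda> * (c r * (2 + \<bar>R\<bar>))" for y
          using Cauchy_Schwarz_ineq2 order_trans by blast
      qed (use gz[OF r(2) r(1)] in auto)
      have i3: "integrable lborel (\<lambda>y. u (X r t y) * D r y)"
      proof (rule Bochner_Integration.integrable_bound[of _ "\<lambda>y. M * (K R * c r) * indicator (cball 0 R) y"])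
        show "integrable lborel (\<lambda>y::'a. M * (K R * c r) * indicator (cball 0 R) y)"
          by (intro integrable_mult_right integrable_real_indicator emeasure_bounded_finite) auto
        have "\<bar>u (X r t y)\<bar> * \<bar>D r y\<bar> \<le> M * (K R * c r)" if "norm y \<le> R" for y
          using D_bound[OF that, of r] u_bound M0 by (intro mult_mono) auto
        then show "AE y in lborel. norm (u (X r t y) * D r y) \<le> norm (M * (K R * c r) * indicator (cball 0 R) y)"
          using uX0[OF r] M0 K_nonneg[of R] c_nonneg[of r] by (intro AE_I2) (auto simp: abs_mult indicator_def)
      qed simp
      \<comment> \<open>The gradient of the pull-back replaces \<open>G (X r t y)\<close>, so that \<open>parts\<close> applies to the first bracket.\<close>
      have eq: "(LINT y|lborel. \<Phi> y r) = ((LINT y|lborel. u (X r t y) * D r y) - (LINT y|lborel. (?GU y \<bullet> v r y) * g r y))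
          + (LINT y|lborel. ((?GU y - G (X r t y)) \<bullet> v r y) * g r y)"
        using True i1 i2 i3 by (simp add: \<Phi>_def inner_diff_left left_diff_distrib)
      have le: "\<bar>((LINT y|lborel. u (X r t y) * D r y) - (LINT y|lborel. (?GU y \<bullet> v r y) * g r y))
          + (LINT y|lborel. ((?GU y - G (X r t y)) \<bullet> v r y) * g r y)\<bar> \<le> \<eta> (R + 1) * M * c r + (\<Lambda> * (w * (L R * (c r * (2 + R))))) * mass R"
      proof (rule order_trans[OF abs_triangle_ineq add_mono])
        show "\<bar>(LINT y|lborel. u (X r t y) * D r y) - (LINT y|lborel. (?GU y \<bullet> v r y) * g r y)\<bar> \<le> \<eta> (R + 1) * M * c r"
          by (rule parts[OF pullback_has_derivative[OF pb] GUc]) (use uX0[OF r] GU0 u_bound in auto)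
        show "\<bar>LINT y|lborel. ((?GU y - G (X r t y)) \<bullet> v r y) * g r y\<bar> \<le> (\<Lambda> * (w * (L R * (c r * (2 + R))))) * mass R"
        proof (rule weighted_integral_bound)
          show "\<bar>(?GU y - G (X r t y)) \<bullet> v r y\<bar> \<le> \<Lambda> * (w * (L R * (c r * (2 + R))))" if y: "norm y \<le> R" for y
          proof -
            have "(?GU y - G (X r t y)) \<bullet> v r y = G (X r t y) \<bullet> (V' t y (v r y) - V' r y (v r y))"
              using grad_pullback_inner[OF pb, of y "v r y"] by (simp add: inner_simps)
            also have "\<bar>\<dots>\<bar> \<le> norm (G (X r t y)) * norm (V' t y (v r y) - V' r y (v r y))" by (rule Cauchy_Schwarz_ineq2)
            also have "\<dots> \<le> \<Lambda> * (w * (L R * (c r * (2 + R))))"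
            proof (intro mult_mono G_bound \<Lambda>0)
              have "norm (V' t y (v r y) - V' r y (v r y)) \<le> (LINT q:{r..t}|lborel. c q) * (L R * norm (v r y))"
                by (rule V'_diff_bound[OF r(2) y])
              also have "\<dots> \<le> w * (L R * (c r * (2 + R)))"
                using wr[OF r(1)] vb[OF y] w0 L_nonneg[of R] by (intro mult_mono) auto
              finally show "norm (V' t y (v r y) - V' r y (v r y)) \<le> w * (L R * (c r * (2 + R)))" .
            qed simp
            finally show ?thesis .
          qed
        qed (use GU0 gz[OF r(2) r(1)] in auto)
      qed
      have arith: "e * m * a + (l * (o' * (k * (a * p)))) * q = a * (l * k * o' * p * q + e * m)" for e m a l o' k p q :: real
        by (simp add: algebra_simps)
      have ind: "indicator {s..t} r *\<^sub>R c r = c r" using True by simp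
      show ?thesis unfolding ind real_norm_def eq using le unfolding arith .
    qed
  qed
  also have "\<dots> = w * (\<Lambda> * L R * w * (2 + R) * mass R + \<eta> (R + 1) * M)"
    by (simp add: w_def set_lebesgue_integral_def)
  finally show ?thesis .
qed

primrec euler :: "real \<Rightarrow> nat \<Rightarrow> 'a \<Rightarrow> 'a" where
  "euler h 0 y = y"
| "euler h (Suc k) y = X (real k * h) (real (Suc k) * h) (euler h k y)"

text \<open>The errors of the steps add up to the total weight times the maximal weight \<open>\<omega>\<close> of a step. In the induction the
last step is absorbed into the test function, whose gradient bound and support radius grow by the factors \<open>1 + L R w\<close>
and \<open>1 + 2 w\<close>; the exponentials in the hypotheses bound the products of these factors.\<close>

lemma euler_estimate:
  fixes u :: "'a \<Rightarrow> real"
  assumes "0 \<le> h" "0 \<le> R" "0 \<le> \<eta> (R + 1)" and \<omega>: "\<omega> \<le> 1 / 2" "\<And>k. (LINT q:{real k * h..real (Suc k) * h}|lborel. c q) \<le> \<omega>"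
    and u: "\<And>x. (u has_derivative (\<lambda>v. G x \<bullet> v)) (at x)" and G: "continuous_on UNIV G"
    and "\<And>x. norm (G x) \<le> \<Lambda>" and u_bound: "\<And>x. \<bar>u x\<bar> \<le> M"
    and "\<And>x. \<rho> \<le> 2 + norm x \<Longrightarrow> u x = 0" and "0 \<le> \<rho>"
    and "\<rho> * exp (2 * (LINT q:{0..real n * h}|lborel. c q)) \<le> 2 + R"
    and "\<Lambda> * exp (L R * (LINT q:{0..real n * h}|lborel. c q)) \<le> \<Lambda>'"
  shows "\<bar>(LINT y|lborel. u y * g (real n * h) y) - (LINT y|lborel. u (euler h n y) * g 0 y)\<bar>
      \<le> (LINT q:{0..real n * h}|lborel. c q) * (\<Lambda>' * L R * \<omega> * (2 + R) * mass R + \<eta> (R + 1) * M)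
    \<and> (\<forall>y. R \<le> norm y \<longrightarrow> u (euler h n y) = 0) \<and> continuous_on UNIV (\<lambda>y. u (euler h n y))"
  using u G assms(8-)
proof (induction n arbitrary: u G \<Lambda> \<rho>)
  case 0
  have "continuous_on UNIV u" using 0(1) has_derivative_continuous continuous_at_imp_continuous_on by blast
  moreover have "(LINT q:{0..0}|lborel. c q) = 0"
    using set_integral_atMost_diff[OF c_int, of 0 0] by simp
  ultimately show ?case using 0 by auto
next
  case (Suc n)
  let ?s = "real n * h" and ?t = "real (Suc n) * h"
  define w where "w = (LINT q:{?s..?t}|lborel. c q)"
  define W where "W = (LINT q:{0..?s}|lborel. c q)"
  have st: "?s \<le> ?t" using \<open>0 \<le> h\<close> by (simp add: algebra_simps)
  have Wt: "(LINT q:{0..?t}|lborel. c q) = W + w"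
    unfolding w_def W_def using st \<open>0 \<le> h\<close> by (intro set_integral_Icc_split c_int) auto
  have w0: "0 \<le> w" "0 \<le> W" by (simp_all add: w_def W_def c_integral_nonneg)
  have w: "w \<le> \<omega>" "w \<le> 1 / 2" using \<omega>(2)[of n] \<omega>(1) by (simp_all add: w_def)
  have \<Lambda>0: "0 \<le> \<Lambda>" using Suc.prems(3) norm_ge_zero order_trans by blast
  have M0: "0 \<le> M" using Suc.prems(4) abs_ge_zero order_trans by blast
  have mass0: "0 \<le> mass R" unfolding mass_def using order_trans[OF g_nonneg g_bound[of 0 R 0]] \<open>0 \<le> R\<close> by simp
  have e1: "1 + 2 * w \<le> exp (2 * w)" and e2: "1 + L R * w \<le> exp (L R * w)"
    by (rule exp_ge_add_one_self)+
  have expW: "1 \<le> exp (2 * W)" "1 \<le> exp (L R * W)" "1 \<le> exp (L R * (W + w))" using w0 L_nonneg[of R] by auto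
  have r1: "\<rho> * (1 + 2 * w) * exp (2 * W) \<le> 2 + R"
  proof -
    have "\<rho> * (1 + 2 * w) * exp (2 * W) \<le> \<rho> * exp (2 * w) * exp (2 * W)"
      using e1 Suc.prems(6) by (intro mult_right_mono mult_left_mono) auto
    also have "\<dots> = \<rho> * exp (2 * (W + w))" by (simp add: distrib_left exp_add ac_simps)
    finally show ?thesis using Suc.prems(7) unfolding Wt by simp
  qed
  have r2: "\<Lambda> * (1 + L R * w) * exp (L R * W) \<le> \<Lambda>'"
  proof -
    have "\<Lambda> * (1 + L R * w) * exp (L R * W) \<le> \<Lambda> * exp (L R * w) * exp (L R * W)"
      using e2 \<Lambda>0 by (intro mult_right_mono mult_left_mono) auto
    also have "\<dots> = \<Lambda> * exp (L R * (W + w))" by (simp add: distrib_left exp_add ac_simps)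
    finally show ?thesis using Suc.prems(8) unfolding Wt by simp
  qed
  have R: "\<rho> * (1 + 2 * w) \<le> 2 + R"
    using r1 mult_left_mono[OF expW(1), of "\<rho> * (1 + 2 * w)"] Suc.prems(6) w0 by simp
  have \<Lambda>\<Lambda>': "\<Lambda> \<le> \<Lambda>'"
    using Suc.prems(8) mult_left_mono[OF expW(3) \<Lambda>0] unfolding Wt by simp
  note pb = Suc.prems(1-5) st w_def[symmetric, THEN eq_refl] w(2) R
  have IH: "\<bar>(LINT y|lborel. u (X ?s ?t y) * g ?s y) - (LINT y|lborel. u (X ?s ?t (euler h n y)) * g 0 y)\<bar>
      \<le> W * (\<Lambda>' * L R * \<omega> * (2 + R) * mass R + \<eta> (R + 1) * M)
    \<and> (\<forall>y. R \<le> norm y \<longrightarrow> u (X ?s ?t (euler h n y)) = 0) \<and> continuous_on UNIV (\<lambda>y. u (X ?s ?t (euler h n y)))"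
    unfolding W_def
  proof (rule Suc.IH[of "\<lambda>y. u (X ?s ?t y)" "grad_pullback G ?s ?t" "\<Lambda> * (1 + L R * w)" "\<rho> * (1 + 2 * w)"])
    show "((\<lambda>y. u (X ?s ?t y)) has_derivative (\<lambda>v. grad_pullback G ?s ?t x \<bullet> v)) (at x)" for x
      by (rule pullback_has_derivative[OF pb])
    show "continuous_on UNIV (grad_pullback G ?s ?t)" by (rule grad_pullback_cont[OF pb])
    show "norm (grad_pullback G ?s ?t x) \<le> \<Lambda> * (1 + L R * w)" for x by (rule grad_pullback_bound[OF pb])
    show "u (X ?s ?t x) = 0" if "\<rho> * (1 + 2 * w) \<le> 2 + norm x" for x by (rule pullback_zero[OF pb that])
    show "\<rho> * (1 + 2 * w) * exp (2 * (LINT q:{0..?s}|lborel. c q)) \<le> 2 + R" using r1 by (simp add: W_def)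
    show "\<Lambda> * (1 + L R * w) * exp (L R * (LINT q:{0..?s}|lborel. c q)) \<le> \<Lambda>'" using r2 by (simp add: W_def)
  qed (use Suc.prems(4,6) w0 in auto)
  have "\<bar>(LINT y|lborel. u y * g ?t y) - (LINT y|lborel. u (X ?s ?t y) * g ?s y)\<bar>
      \<le> w * (\<Lambda> * L R * w * (2 + R) * mass R + \<eta> (R + 1) * M)"
    by (rule step_estimate[OF Suc.prems(1-5) st w_def w(2) R])
  also have "\<dots> \<le> w * (\<Lambda>' * L R * \<omega> * (2 + R) * mass R + \<eta> (R + 1) * M)"
    using \<Lambda>\<Lambda>' \<Lambda>0 w w0 L_nonneg[of R] mass0 \<open>0 \<le> R\<close>
    by (intro mult_left_mono add_right_mono mult_right_mono mult_mono) auto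
  finally have "\<bar>(LINT y|lborel. u y * g ?t y) - (LINT y|lborel. u (X ?s ?t (euler h n y)) * g 0 y)\<bar>
      \<le> (W + w) * (\<Lambda>' * L R * \<omega> * (2 + R) * mass R + \<eta> (R + 1) * M)"
    using IH unfolding distrib_right by linarith
  then show ?case using IH unfolding Wt by simp
qed

end

section \<open>Limits of approximate trajectories\<close>

lemma AE_le_of_primitives_le:
  fixes w S \<xi> :: "real \<Rightarrow> real"
  assumes w: "integrable lborel w" and S: "integrable lborel S"
    and le: "\<And>a b. a \<le> b \<Longrightarrow> (LINT r:{a..b}|lborel. w r) \<le> (LINT r:{a..b}|lborel. S r)"
  shows "AE r in lborel. w r \<le> S r"
proof -
  have D: "integrable lborel (\<lambda>r. S r - w r)" using w S by simp
  define \<Psi> where "\<Psi> t = (LINT r:{..t}|lborel. S r - w r)" for t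
  have inc: "\<Psi> t - \<Psi> s = (LINT r:{s..t}|lborel. S r - w r)" if "s \<le> t" for s t
    unfolding \<Psi>_def by (rule set_integral_atMost_diff[OF D that])
  have mono: "\<Psi> s \<le> \<Psi> t" if "s \<le> t" for s t
    using inc[OF that] le[OF that] set_integral_diff(2)[of lborel "{s..t}" S w] w S
    by (simp add: set_integrable_of_integrable)
  have "AE r in lborel. (\<Psi> has_real_derivative (S r - w r)) (at r)"
    by (rule lebesgue_differentiation[OF D inc])
  then show ?thesis
  proof eventually_elim
    case (elim r)
    have "((\<lambda>h. (\<Psi> (r + h) - \<Psi> r) / h) \<longlongrightarrow> S r - w r) (at 0)" using elim by (simp add: DERIV_def)
    moreover have "eventually (\<lambda>h. 0 \<le> (\<Psi> (r + h) - \<Psi> r) / h) (at 0)"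
    proof (intro always_eventually allI)
      fix h show "0 \<le> (\<Psi> (r + h) - \<Psi> r) / h"
        using mono[of r "r + h"] mono[of "r + h" r] by (cases "0 \<le> h") (auto simp: divide_nonpos_nonpos)
    qed
    ultimately have "0 \<le> S r - w r" by (rule tendsto_lowerbound) simp
    then show ?case by simp
  qed
qed

text \<open>The velocities \<open>h n\<close> need not converge, not even after passing to a subsequence. Comparing increments with the integral of
the supremum over a tail avoids weak compactness in \<open>L\<^sup>1\<close>: the bound is stable under the limit of
the paths and can be differentiated.\<close>

lemma limit_velocity_le_sup:
  fixes h :: "nat \<Rightarrow> real \<Rightarrow> real" and \<xi> :: "nat \<Rightarrow> real \<Rightarrow> real"
  assumes c: "integrable lborel c" and h: "\<And>n. h n \<in> borel_measurable borel" and hb: "\<And>n r. \<bar>h n r\<bar> \<le> c r"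
    and inc: "\<And>n a b. a \<le> b \<Longrightarrow> \<xi> n b - \<xi> n a = (LINT r:{a..b}|lborel. h n r)"
    and lim: "\<And>t. (\<lambda>n. \<xi> n t) \<longlonglongrightarrow> \<xi>' t"
    and w: "integrable lborel w" and inc': "\<And>a b. a \<le> b \<Longrightarrow> \<xi>' b - \<xi>' a = (LINT r:{a..b}|lborel. w r)"
  shows "AE r in lborel. \<forall>n. w r \<le> (SUP m\<in>{n..}. h m r)"
  unfolding AE_all_countable
proof
  fix n
  have bdd: "bdd_above ((\<lambda>m. h m r) ` {n..})" for r
    using hb by (intro bdd_aboveI[of _ "c r"]) (auto intro: order_trans[OF abs_ge_self])
  have hi: "integrable lborel (h m)" for m
    by (rule Bochner_Integration.integrable_bound[OF c]) (use h hb in \<open>auto intro!: AE_I2 order_trans[OF hb abs_ge_self]\<close>)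
  have sup_le: "\<bar>SUP m\<in>{n..}. h m r\<bar> \<le> c r" for r
  proof -
    have "(SUP m\<in>{n..}. h m r) \<le> c r" using hb by (intro cSUP_least) (auto intro: order_trans[OF abs_ge_self])
    moreover have "h n r \<le> (SUP m\<in>{n..}. h m r)" by (rule cSUP_upper[OF _ bdd]) simp
    ultimately show ?thesis using hb[of n r] by linarith
  qed
  have S_int: "integrable lborel (\<lambda>r. SUP m\<in>{n..}. h m r)"
  proof (rule Bochner_Integration.integrable_bound[OF c])
    show "(\<lambda>r. SUP m\<in>{n..}. h m r) \<in> borel_measurable lborel"
      using bdd h by (intro borel_measurable_cSUP) auto
    show "AE r in lborel. norm (SUP m\<in>{n..}. h m r) \<le> norm (c r)"
      using order_trans[OF sup_le abs_ge_self] by simp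
  qed
  show "AE r in lborel. w r \<le> (SUP m\<in>{n..}. h m r)"
  proof (rule AE_le_of_primitives_le[OF w S_int])
    fix a b :: real assume ab: "a \<le> b"
    have "(\<lambda>m. \<xi> m b - \<xi> m a) \<longlonglongrightarrow> \<xi>' b - \<xi>' a" by (intro tendsto_diff lim)
    moreover have "\<xi> m b - \<xi> m a \<le> (LINT r:{a..b}|lborel. SUP m\<in>{n..}. h m r)" if "m \<ge> n" for m
      unfolding inc[OF ab] set_lebesgue_integral_def
      by (intro integral_mono integrable_mult_indicator hi S_int)
        (use that in \<open>auto simp: indicator_def intro!: cSUP_upper bdd\<close>)
    ultimately show "(LINT r:{a..b}|lborel. w r) \<le> (LINT r:{a..b}|lborel. SUP m\<in>{n..}. h m r)"
      unfolding inc'[OF ab, symmetric]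
      by (intro LIMSEQ_le_const2[of "\<lambda>m. \<xi> m b - \<xi> m a"]) blast+
  qed
qed

text \<open>The vector \<open>v\<close> lies in the smallest closed box that contains the values of \<open>B\<close> on the ball. This
coordinatewise hull is what the envelopes of the inclusion are able to see.\<close>

definition in_hull :: "(real^'d \<Rightarrow> real^'d) \<Rightarrow> real^'d \<Rightarrow> real \<Rightarrow> real^'d \<Rightarrow> bool" where
  "in_hull B z \<epsilon> v \<longleftrightarrow> (\<forall>i q. ((\<forall>y\<in>cball z \<epsilon>. B y $ i \<le> q) \<longrightarrow> v $ i \<le> q) \<and> ((\<forall>y\<in>cball z \<epsilon>. q \<le> B y $ i) \<longrightarrow> q \<le> v $ i))"

lemma eventually_nhds_cball:
  fixes z :: "nat \<Rightarrow> 'a::metric_space"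
  assumes "eventually P (nhds x)" "z \<longlonglongrightarrow> x" "\<epsilon> \<longlonglongrightarrow> (0::real)"
  shows "eventually (\<lambda>n. \<forall>y\<in>cball (z n) (\<epsilon> n). P y) sequentially"
proof -
  obtain d where d: "d > 0" "\<And>y. dist y x < d \<Longrightarrow> P y" using assms(1) unfolding eventually_nhds_metric by blast
  have "eventually (\<lambda>n. dist (z n) x < d / 2) sequentially" using assms(2) d(1) by (intro tendstoD) auto
  moreover have "eventually (\<lambda>n. \<epsilon> n < d / 2) sequentially" using assms(3) d(1) by (intro order_tendstoD(2)) auto
  ultimately show ?thesis
  proof eventually_elim
    case (elim n)
    then have "dist y x < d" if "y \<in> cball (z n) (\<epsilon> n)" for y
      using that dist_triangle[of y x "z n"] by (simp add: dist_commute)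
    then show ?case using d(2) by blast
  qed
qed

text \<open>Any number above the envelope bounds \<open>B\<close> on a neighbourhood of \<open>x\<close>, hence on all but finitely many of the shrinking balls,
hence the velocities and the suprema of their tails.\<close>

lemma velocity_le_upper_env:
  fixes B :: "real^'d \<Rightarrow> real^'d" and h :: "nat \<Rightarrow> real^'d"
  assumes hull: "\<And>n. in_hull B (z n) (\<epsilon> n) (h n)" and z: "z \<longlonglongrightarrow> x" "\<epsilon> \<longlonglongrightarrow> 0"
    and w: "\<And>n. w \<le> (SUP m\<in>{n..}. h m $ i)"
  shows "ereal w \<le> upper_env B i x"
proof (rule ereal_le_real)
  fix q assume "upper_env B i x \<le> ereal q"
  have "w \<le> q + e" if "e > 0" for e
  proof -
    have "upper_env B i x < ereal (q + e)" using \<open>upper_env B i x \<le> ereal q\<close> that by (simp add: le_less_trans)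
    then have "eventually (\<lambda>y. ereal (B y $ i) < ereal (q + e)) (nhds x)"
      unfolding upper_env_def by (rule Limsup_lessD)
    from eventually_nhds_cball[OF this z] have "eventually (\<lambda>n. h n $ i \<le> q + e) sequentially"
    proof eventually_elim
      case (elim n)
      then have "\<forall>y\<in>cball (z n) (\<epsilon> n). B y $ i \<le> q + e" by (auto simp: less_imp_le)
      with hull[of n] show ?case unfolding in_hull_def by blast
    qed
    then obtain n where "\<And>m. m \<ge> n \<Longrightarrow> h m $ i \<le> q + e" by (auto simp: eventually_sequentially)
    then have "(SUP m\<in>{n..}. h m $ i) \<le> q + e" by (intro cSUP_least) auto
    with w[of n] show ?thesis by linarith
  qed
  then have "w \<le> q" by (rule field_le_epsilon)
  then show "ereal w \<le> ereal q" by simp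
qed

lemma lower_env_le_velocity:
  fixes B :: "real^'d \<Rightarrow> real^'d" and h :: "nat \<Rightarrow> real^'d"
  assumes hull: "\<And>n. in_hull B (z n) (\<epsilon> n) (h n)" and z: "z \<longlonglongrightarrow> x" "\<epsilon> \<longlonglongrightarrow> 0"
    and w: "\<And>n. - w \<le> (SUP m\<in>{n..}. - (h m $ i))"
  shows "lower_env B i x \<le> ereal w"
proof -
  have "in_hull (\<lambda>y. - B y) (z n) (\<epsilon> n) (- h n)" for n
    unfolding in_hull_def
  proof (intro allI conjI impI)
    fix j q
    show "(- h n) $ j \<le> q" if "\<forall>y\<in>cball (z n) (\<epsilon> n). (- B y) $ j \<le> q"
    proof -
      have "\<forall>y\<in>cball (z n) (\<epsilon> n). - q \<le> B y $ j" using that by (auto simp: minus_le_iff)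
      with hull[of n] have "- q \<le> h n $ j" unfolding in_hull_def by blast
      then show ?thesis by simp
    qed
    show "q \<le> (- h n) $ j" if "\<forall>y\<in>cball (z n) (\<epsilon> n). q \<le> (- B y) $ j"
    proof -
      have "\<forall>y\<in>cball (z n) (\<epsilon> n). B y $ j \<le> - q" using that by (auto simp: le_minus_iff)
      with hull[of n] have "h n $ j \<le> - q" unfolding in_hull_def by blast
      then show ?thesis by simp
    qed
  qed
  from velocity_le_upper_env[OF this z, of "- w" i] w
  have "ereal (- w) \<le> upper_env (\<lambda>y. - B y) i x" by simp
  also have "upper_env (\<lambda>y. - B y) i x = - lower_env B i x"
    unfolding upper_env_def lower_env_def using ereal_Limsup_uminus[of "nhds x" "\<lambda>y. ereal (B y $ i)"] by simp
  finally show ?thesis by (simp add: ereal_uminus_le_reorder flip: uminus_ereal.simps)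
qed

text \<open>The paths \<open>X n\<close> have velocities \<open>h n\<close>, which are admissible for the inclusion not at \<open>X n r\<close> itself but near a
point \<open>Z n r\<close> close to it.\<close>

locale approximate_paths =
  fixes T :: real and b :: "real \<Rightarrow> real^'d \<Rightarrow> real^'d" and c :: "real \<Rightarrow> real"
    and h X Z :: "nat \<Rightarrow> real \<Rightarrow> real^'d" and \<epsilon> :: "nat \<Rightarrow> real" and x :: "real^'d"
  assumes T: "0 < T" and c: "integrable lborel c" and c_nonneg: "\<And>r. 0 \<le> c r" and c_zero: "\<And>r. r \<notin> {0..T} \<Longrightarrow> c r = 0"
    and h: "\<And>n. h n \<in> borel_measurable borel" and hb: "\<And>n r. norm (h n r) \<le> c r"
    and inc: "\<And>n a b. a \<le> b \<Longrightarrow> X n b - X n a = (LINT r:{a..b}|lborel. h n r)"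
    and start: "(\<lambda>n. X n 0) \<longlonglongrightarrow> x"
    and Z: "\<And>r. (\<lambda>n. Z n r - X n r) \<longlonglongrightarrow> 0" and \<epsilon>: "\<epsilon> \<longlonglongrightarrow> 0"
    and hull: "AE r in lborel. r \<in> {0..T} \<longrightarrow> (\<forall>n. in_hull (b r) (Z n r) (\<epsilon> n) (h n r))"
begin

lemma path_modulus: "a \<le> b' \<Longrightarrow> norm (X n b' - X n a) \<le> (LINT r:{a..b'}|lborel. c r)"
proof -
  assume ab: "a \<le> b'"
  have hi: "integrable lborel (h n)"
    by (rule Bochner_Integration.integrable_bound[OF c]) (use h hb in \<open>auto intro!: AE_I2 order_trans[OF hb abs_ge_self]\<close>)
  show ?thesis unfolding inc[OF ab] set_lebesgue_integral_def
  proof (rule Bochner_Integration.integral_norm_bound_integral)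
    show "integrable lborel (\<lambda>r. indicator {a..b'} r *\<^sub>R h n r)" "integrable lborel (\<lambda>r. indicator {a..b'} r *\<^sub>R c r)"
      by (intro integrable_mult_indicator hi c; simp)+
  qed (use hb c_nonneg in \<open>auto simp: indicator_def\<close>)
qed

lemma converging_subsequence:
  obtains k \<gamma> where "strict_mono (k :: nat \<Rightarrow> nat)" "\<And>t. (\<lambda>n. X (k n) t) \<longlonglongrightarrow> \<gamma> t"
proof -
  obtain B where B: "\<And>n. norm (X n 0) \<le> B"
    using convergent_imp_Bseq[of "\<lambda>n. X n 0"] start unfolding Bseq_def convergent_def by auto
  define I where "I = (LINT r|lborel. c r)"
  have I: "(LINT r:{a..b'}|lborel. c r) \<le> I" for a b'
    using set_integral_nonneg_mono[OF c c_nonneg, of "{a..b'}" UNIV] by (simp add: I_def set_lebesgue_integral_def)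
  obtain g k where g: "strict_mono (k::nat \<Rightarrow> nat)"
    "\<And>e. 0 < e \<Longrightarrow> \<exists>N. \<forall>n x. n \<ge> N \<and> x \<in> {0..T} \<longrightarrow> norm (X (k n) x - g x) < e"
  proof (rule Arzela_Ascoli[of "{0..T}" X "B + I"])
    show "norm (X n t) \<le> B + I" if "t \<in> {0..T}" for n t
      using path_modulus[of 0 t n] I[of 0 t] B[of n] norm_triangle_ineq[of "X n 0" "X n t - X n 0"] that by simp
    show "\<exists>d>0. \<forall>n y. y \<in> {0..T} \<and> norm (t - y) < d \<longrightarrow> norm (X n t - X n y) < e"
      if e: "0 < e" for t e
    proof -
      obtain d where d: "d > 0" "\<And>s t. t - s < d \<Longrightarrow> (LINT r:{s..t}|lborel. c r) < e"
        using set_integral_Icc_small[OF c c_nonneg e] by blast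
      have "norm (X n t - X n y) < e" if "norm (t - y) < d" for n y
        using path_modulus[of t y n] path_modulus[of y t n] d(2)[of t y] d(2)[of y t] that
        by (cases "t \<le> y") (auto simp: norm_minus_commute)
      then show ?thesis using d(1) by blast
    qed
  qed (use that in auto)
  define cl where "cl t = max 0 (min T t)" for t
  have cl: "cl t \<in> {0..T}" for t using T by (auto simp: cl_def)
  have const: "X n b' = X n a" if "a \<le> b'" "b' \<le> 0 \<or> T \<le> a" for a b' n
  proof -
    have "(LINT r:{a..b'}|lborel. c r) = (LINT r::real|lborel. 0)"
      unfolding set_lebesgue_integral_def
    proof (intro integral_cong_AE)
      show "AE r in lborel. indicator {a..b'} r *\<^sub>R c r = 0"
        using AE_lborel_singleton[of 0] AE_lborel_singleton[of T]
      proof eventually_elim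
        case (elim r)
        have "c r = 0" if "r \<in> {a..b'}" using elim that \<open>b' \<le> 0 \<or> T \<le> a\<close> by (intro c_zero) auto
        then show ?case by (simp add: indicator_def)
      qed
    qed (use c in auto)
    then show ?thesis using path_modulus[OF that(1), of n] by simp
  qed
  have Xcl: "X n (cl t) = X n t" for n t
  proof -
    consider "t < 0" | "T < t" | "0 \<le> t" "t \<le> T" by linarith
    then show ?thesis
    proof cases
      case 1
      then have "cl t = 0" using T by (simp add: cl_def)
      then show ?thesis using const[of t 0 n] 1 by simp
    next
      case 2
      then have "cl t = T" using T by (simp add: cl_def)
      then show ?thesis using const[of T t n] 2 by simp
    qed (simp add: cl_def)
  qed
  have "(\<lambda>n. X (k n) t) \<longlonglongrightarrow> g (cl t)" for t
    unfolding LIMSEQ_iff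
  proof (intro allI impI)
    fix e :: real assume "0 < e"
    from g(2)[OF this] obtain N where "\<forall>n x. n \<ge> N \<and> x \<in> {0..T} \<longrightarrow> norm (X (k n) x - g x) < e" by blast
    then show "\<exists>N. \<forall>n\<ge>N. norm (X (k n) t - g (cl t)) < e" using cl[of t] Xcl by metis
  qed
  from that[OF g(1) this] show ?thesis .
qed

lemma limit_is_inclusion_solution:
  assumes lim: "\<And>t. (\<lambda>n. X n t) \<longlonglongrightarrow> \<gamma> t"
  shows "inclusion_solution T b 0 x \<gamma>"
proof -
  have mod: "norm (\<gamma> b' - \<gamma> a) \<le> (LINT r:{a..b'}|lborel. c r)" if "a \<le> b'" for a b'
  proof (rule LIMSEQ_le_const2)
    show "(\<lambda>n. norm (X n b' - X n a)) \<longlonglongrightarrow> norm (\<gamma> b' - \<gamma> a)" by (intro tendsto_intros lim)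
  qed (use path_modulus[OF that] in auto)
  have "\<exists>w. integrable lborel w \<and> (\<forall>a b'. a \<le> b' \<longrightarrow> \<gamma> b' $ i - \<gamma> a $ i = (LINT r:{a..b'}|lborel. w r))" for i
  proof -
    have "\<bar>\<gamma> t $ i - \<gamma> s $ i\<bar> \<le> (LINT r:{s..t}|lborel. c r)" if "s \<le> t" for s t
      using mod[OF that] component_le_norm_cart[of "\<gamma> t - \<gamma> s" i] by simp
    from density_of_dominated_path[OF c c_nonneg, of "\<lambda>t. \<gamma> t $ i", OF this] show ?thesis by metis
  qed
  then obtain w where w: "\<And>i. integrable lborel (w i)"
    "\<And>i a b'. a \<le> b' \<Longrightarrow> \<gamma> b' $ i - \<gamma> a $ i = (LINT r:{a..b'}|lborel. w i r)" by metis
  have hi: "integrable lborel (h n)" for n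
    by (rule Bochner_Integration.integrable_bound[OF c]) (use h hb in \<open>auto intro!: AE_I2 order_trans[OF hb abs_ge_self]\<close>)
  have inc_i: "X n b' $ i - X n a $ i = (LINT r:{a..b'}|lborel. h n r $ i)" if "a \<le> b'" for n a b' i
  proof -
    have "(LINT r:{a..b'}|lborel. h n r) $ i = (LINT r|lborel. (indicator {a..b'} r *\<^sub>R h n r) $ i)"
      unfolding set_lebesgue_integral_def
      by (rule integral_bounded_linear[OF bounded_linear_vec_nth, symmetric]) (intro integrable_mult_indicator hi, simp)
    then show ?thesis using inc[OF that, of n] by (simp add: set_lebesgue_integral_def flip: vector_minus_component)
  qed
  have hmi: "(\<lambda>r. h n r $ i) \<in> borel_measurable borel" for n i
    using borel_measurable_integrable[OF integrable_bounded_linear[OF bounded_linear_vec_nth hi]] by simp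
  have hbi: "\<bar>h n r $ i\<bar> \<le> c r" for n r i using component_le_norm_cart[of "h n r" i] hb[of n r] by linarith
  have up: "AE r in lborel. \<forall>n. w i r \<le> (SUP m\<in>{n..}. h m r $ i)" for i
    by (rule limit_velocity_le_sup[OF c, where \<xi>="\<lambda>n t. X n t $ i" and \<xi>'="\<lambda>t. \<gamma> t $ i"])
      (use hmi hbi inc_i w lim in \<open>auto intro: tendsto_vec_nth\<close>)
  have low: "AE r in lborel. \<forall>n. - w i r \<le> (SUP m\<in>{n..}. - (h m r $ i))" for i
  proof (rule limit_velocity_le_sup[OF c, where \<xi>="\<lambda>n t. - (X n t $ i)" and \<xi>'="\<lambda>t. - (\<gamma> t $ i)"])
    show "- (X n b' $ i) - - (X n a $ i) = (LINT r:{a..b'}|lborel. - (h n r $ i))" if "a \<le> b'" for n a b'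
      using inc_i[OF that, of n i] by (simp add: set_lebesgue_integral_def)
    show "- (\<gamma> b' $ i) - - (\<gamma> a $ i) = (LINT r:{a..b'}|lborel. - w i r)" if "a \<le> b'" for a b'
      using w(2)[OF that, of i] by (simp add: set_lebesgue_integral_def)
  qed (use hmi hbi w lim in \<open>auto intro!: tendsto_minus tendsto_vec_nth\<close>)
  have der: "AE r in lborel. ((\<lambda>t. \<gamma> t $ i) has_real_derivative w i r) (at r)" for i
    by (rule lebesgue_differentiation[OF w])
  have up': "AE r in lborel. \<forall>i n. w i r \<le> (SUP m\<in>{n..}. h m r $ i)"
    by (rule AE_all_countable[THEN iffD2], rule allI, rule up)
  have low': "AE r in lborel. \<forall>i n. - w i r \<le> (SUP m\<in>{n..}. - (h m r $ i))"
    by (rule AE_all_countable[THEN iffD2], rule allI, rule low)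
  have der': "AE r in lborel. \<forall>i. ((\<lambda>t. \<gamma> t $ i) has_real_derivative w i r) (at r)"
    by (rule AE_all_countable[THEN iffD2], rule allI, rule der)
  have "AE r in lborel. r \<in> {0..T} \<longrightarrow> (\<exists>v. (\<gamma> has_vector_derivative v) (at r within {0..T}) \<and>
        (\<forall>i. lower_env (b r) i (\<gamma> r) \<le> ereal (v $ i) \<and> ereal (v $ i) \<le> upper_env (b r) i (\<gamma> r)))"
    using hull up' low' der'
  proof eventually_elim
    case (elim r)
    show ?case
    proof (intro impI exI[of _ "\<chi> i. w i r"] conjI allI)
      assume r: "r \<in> {0..T}"
      have "(\<gamma> has_derivative (\<lambda>v. v *\<^sub>R (\<chi> i. w i r))) (at r)"
        using elim(4) by (subst has_derivative_componentwise_within)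
          (auto simp: Basis_vec_def inner_axis has_field_derivative_def mult_commute_abs)
      then show "(\<gamma> has_vector_derivative (\<chi> i. w i r)) (at r within {0..T})"
        unfolding has_vector_derivative_def by (rule has_derivative_at_withinI)
      have Zr: "(\<lambda>n. Z n r) \<longlonglongrightarrow> \<gamma> r" using tendsto_add[OF Z[of r] lim[of r]] by simp
      have H: "in_hull (b r) (Z n r) (\<epsilon> n) (h n r)" for n using elim(1) r by blast
      show "lower_env (b r) i (\<gamma> r) \<le> ereal ((\<chi> i. w i r) $ i)" for i
        using lower_env_le_velocity[OF H Zr \<epsilon>, of "w i r" i] elim(3) by simp
      show "ereal ((\<chi> i. w i r) $ i) \<le> upper_env (b r) i (\<gamma> r)" for i
        using velocity_le_upper_env[OF H Zr \<epsilon>, of "w i r" i] elim(2) by simp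
    qed
  qed
  then have "AE r in lebesgue. r \<in> {0..T} \<longrightarrow> (\<exists>v. (\<gamma> has_vector_derivative v) (at r within {0..T}) \<and>
        (\<forall>i. lower_env (b r) i (\<gamma> r) \<le> ereal (v $ i) \<and> ereal (v $ i) \<le> upper_env (b r) i (\<gamma> r)))"
    by (rule AE_completion)
  then have "AE r in lebesgue_on {0..T}. \<exists>v. (\<gamma> has_vector_derivative v) (at r within {0..T}) \<and>
        (\<forall>i. lower_env (b r) i (\<gamma> r) \<le> ereal (v $ i) \<and> ereal (v $ i) \<le> upper_env (b r) i (\<gamma> r))"
    by (subst AE_restrict_space_iff) auto
  moreover have "absolutely_continuous_on 0 T \<gamma>"
    by (rule absolutely_continuous_of_integral_modulus[OF c c_nonneg]) (use mod in auto)
  moreover have "\<gamma> 0 = x" using LIMSEQ_unique[OF lim start] .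
  ultimately show ?thesis unfolding inclusion_solution_def by blast
qed

end

lemma approximate_paths_subseq:
  assumes "approximate_paths T b c h X Z \<epsilon> x" "strict_mono (k :: nat \<Rightarrow> nat)"
  shows "approximate_paths T b c (h \<circ> k) (X \<circ> k) (Z \<circ> k) (\<epsilon> \<circ> k) x"
proof -
  interpret approximate_paths T b c h X Z \<epsilon> x by fact
  show ?thesis
  proof
    show "(\<lambda>n. (X \<circ> k) n 0) \<longlonglongrightarrow> x" using LIMSEQ_subseq_LIMSEQ[OF start assms(2)] by (simp add: comp_def)
    show "(\<lambda>n. (Z \<circ> k) n r - (X \<circ> k) n r) \<longlonglongrightarrow> 0" for r
      using LIMSEQ_subseq_LIMSEQ[OF Z assms(2)] by (simp add: comp_def)
    show "(\<epsilon> \<circ> k) \<longlonglongrightarrow> 0" by (rule LIMSEQ_subseq_LIMSEQ[OF \<epsilon> assms(2)])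
    show "AE r in lborel. r \<in> {0..T} \<longrightarrow> (\<forall>n. in_hull (b r) ((Z \<circ> k) n r) ((\<epsilon> \<circ> k) n) ((h \<circ> k) n r))"
      using hull by eventually_elim auto
  qed (use T c c_nonneg c_zero h hb inc in auto)
qed

text \<open>Every subsequence has a further subsequence that converges to a solution of the inclusion, and there is only one such solution.\<close>

lemma approximate_paths_converge:
  assumes ap: "approximate_paths T b c h X Z \<epsilon> x"
    and unique: "\<And>\<gamma>. inclusion_solution T b 0 x \<gamma> \<Longrightarrow> \<forall>t\<in>{0..T}. \<gamma> t = \<psi> t" and t: "t \<in> {0..T}"
  shows "(\<lambda>n. X n t) \<longlonglongrightarrow> \<psi> t"
proof (rule ccontr)
  assume "\<not> (\<lambda>n. X n t) \<longlonglongrightarrow> \<psi> t"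
  then obtain e where e: "e > 0" "\<exists>\<^sub>F n in sequentially. \<not> dist (X n t) (\<psi> t) < e"
    unfolding tendsto_iff by (auto simp: not_eventually)
  then have inf: "infinite {n. \<not> dist (X n t) (\<psi> t) < e}" by (simp add: frequently_cofinite flip: cofinite_eq_sequentially)
  define k where "k = enumerate {n. \<not> dist (X n t) (\<psi> t) < e}"
  have k: "strict_mono k" unfolding k_def by (rule strict_mono_enumerate[OF inf])
  have far: "\<not> dist (X (k n) t) (\<psi> t) < e" for n using enumerate_in_set[OF inf, of n] by (simp add: k_def)
  interpret S: approximate_paths T b c "h \<circ> k" "X \<circ> k" "Z \<circ> k" "\<epsilon> \<circ> k" x by (rule approximate_paths_subseq[OF ap k])
  obtain l \<gamma> where l: "strict_mono (l :: nat \<Rightarrow> nat)" "\<And>t. (\<lambda>n. (X \<circ> k) (l n) t) \<longlonglongrightarrow> \<gamma> t"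
    using S.converging_subsequence by blast
  interpret S2: approximate_paths T b c "h \<circ> k \<circ> l" "X \<circ> k \<circ> l" "Z \<circ> k \<circ> l" "\<epsilon> \<circ> k \<circ> l" x
    by (rule approximate_paths_subseq[OF S.approximate_paths_axioms l(1)])
  have "inclusion_solution T b 0 x \<gamma>"
    by (rule S2.limit_is_inclusion_solution) (use l(2) in \<open>simp add: comp_def\<close>)
  then have "\<gamma> t = \<psi> t" using unique t by blast
  then have "eventually (\<lambda>n. dist (X (k (l n)) t) (\<psi> t) < e) sequentially"
    using tendstoD[OF l(2)[of t] e(1)] by simp
  then show False using far by (auto simp: eventually_sequentially)
qed

section \<open>Interpolation of the Euler steps\<close>

context regular_transport
begin

text \<open>The interpolated path has at time \<open>r\<close> the velocity \<open>v\<close> evaluated at the last grid point, so it agrees with the iterated steps at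
the grid times.\<close>

definition cell :: "real \<Rightarrow> real \<Rightarrow> nat" where "cell h r = nat \<lfloor>r / h\<rfloor>"
definition velocity :: "real \<Rightarrow> 'a \<Rightarrow> real \<Rightarrow> 'a" where "velocity h y r = v r (euler h (cell h r) y)"
definition euler_path :: "real \<Rightarrow> 'a \<Rightarrow> real \<Rightarrow> 'a" where
  "euler_path h y r = y + (LINT q:{..r}|lborel. velocity h y q) - (LINT q:{..0}|lborel. velocity h y q)"

abbreviation "c_total \<equiv> LINT r|lborel. c r"

lemma c_integral_le_total: "(LINT q:{s..t}|lborel. c q) \<le> c_total"
  using set_integral_nonneg_mono[OF c_int c_nonneg, of "{s..t}" UNIV] by (simp add: set_lebesgue_integral_def)

lemma euler_bound:
  assumes "0 \<le> h"
  shows "2 + norm (euler h k y) \<le> (2 + norm y) * exp c_total"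
proof -
  have "2 + norm (euler h k y) \<le> (2 + norm y) * exp (LINT q:{0..real k * h}|lborel. c q)"
  proof (induction k)
    case 0
    then show ?case using mult_left_mono[of 1 "exp (LINT q:{0..0}|lborel. c q)" "2 + norm y"] c_integral_nonneg[of 0 0] by simp
  next
    case (Suc k)
    let ?s = "real k * h" and ?t = "real (Suc k) * h" and ?p = "euler h k y"
    define w where "w = (LINT q:{?s..?t}|lborel. c q)"
    have st: "?s \<le> ?t" using assms by (simp add: algebra_simps)
    have "norm (euler h (Suc k) y) \<le> norm ?p + norm (V ?t ?p - V ?s ?p)"
      unfolding euler.simps X_def by (metis add_diff_eq norm_triangle_ineq)
    also have "norm (V ?t ?p - V ?s ?p) \<le> w * (2 + norm ?p)" unfolding w_def by (rule V_diff_bound[OF st])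
    finally have "2 + norm (euler h (Suc k) y) \<le> (2 + norm ?p) * (1 + w)" by (simp add: algebra_simps)
    also have "\<dots> \<le> (2 + norm ?p) * exp w" by (intro mult_left_mono exp_ge_add_one_self) auto
    also have "\<dots> \<le> (2 + norm y) * exp (LINT q:{0..?s}|lborel. c q) * exp w" by (intro mult_right_mono Suc.IH) auto
    also have "\<dots> = (2 + norm y) * exp (LINT q:{0..?t}|lborel. c q)"
      unfolding w_def using st assms
      by (subst set_integral_Icc_split[OF c_int, of 0 ?s ?t]) (auto simp: exp_add)
    finally show ?case .
  qed
  also have "\<dots> \<le> (2 + norm y) * exp c_total"
    by (intro mult_left_mono) (auto intro: c_integral_le_total)
  finally show ?thesis .
qed

lemma velocity_meas: "velocity h y \<in> borel_measurable borel"
proof -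
  have "(\<lambda>r. (\<lambda>k r. v r (euler h k y)) (cell h r) r) \<in> borel_measurable borel"
  proof (rule measurable_compose_countable)
    show "(\<lambda>r. v r (euler h k y)) \<in> borel_measurable borel" for k by (rule v_sect)
    show "cell h \<in> measurable borel (count_space UNIV)"
      unfolding cell_def[abs_def] by measurable
  qed
  then show ?thesis by (simp add: velocity_def[abs_def])
qed

lemma velocity_bound:
  assumes "0 \<le> h"
  shows "norm (velocity h y r) \<le> c r * ((2 + norm y) * exp c_total)"
  unfolding velocity_def
  by (rule order_trans[OF v_growth mult_left_mono[OF euler_bound[OF assms] c_nonneg]])

lemma velocity_int: "0 \<le> h \<Longrightarrow> integrable lborel (velocity h y)"
  by (rule Bochner_Integration.integrable_bound[OF integrable_mult_left[OF c_int, of "(2 + norm y) * exp c_total"]])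
    (use velocity_meas in \<open>auto intro!: AE_I2 order_trans[OF velocity_bound abs_ge_self]\<close>)

lemma path_diff: "0 \<le> h \<Longrightarrow> a \<le> b \<Longrightarrow> euler_path h y b - euler_path h y a = (LINT q:{a..b}|lborel. velocity h y q)"
  using set_integral_atMost_diff[OF velocity_int, of h a b y] by (simp add: euler_path_def)

lemma path_start: "euler_path h y 0 = y" by (simp add: euler_path_def)

lemma path_grid:
  assumes "0 < h"
  shows "euler_path h y (real k * h) = euler h k y"
proof (induction k)
  case 0 show ?case by (simp add: path_start)
next
  case (Suc k)
  let ?s = "real k * h" and ?t = "real (Suc k) * h"
  have st: "?s \<le> ?t" using assms by (simp add: algebra_simps)
  have "(LINT q:{?s..?t}|lborel. velocity h y q) = (LINT q:{?s..?t}|lborel. v q (euler h k y))"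
    unfolding set_lebesgue_integral_def
  proof (rule integral_cong_AE)
    show "AE q in lborel. indicator {?s..?t} q *\<^sub>R velocity h y q = indicator {?s..?t} q *\<^sub>R v q (euler h k y)"
      using AE_lborel_singleton[of ?t]
    proof eventually_elim
      case (elim q)
      have "cell h q = k" if "q \<in> {?s..?t}"
      proof -
        have "\<lfloor>q / h\<rfloor> = int k"
          using that elim assms by (intro floor_unique) (auto simp: field_simps)
        then show ?thesis by (simp add: cell_def)
      qed
      then show ?case by (auto simp: velocity_def indicator_def)
    qed
    show "(\<lambda>q. indicator {?s..?t} q *\<^sub>R velocity h y q) \<in> borel_measurable lborel"
      using velocity_meas by simp
    show "(\<lambda>q. indicator {?s..?t} q *\<^sub>R v q (euler h k y)) \<in> borel_measurable lborel"
      using v_sect by simp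
  qed
  then have "euler_path h y ?t = euler_path h y ?s + (V ?t (euler h k y) - V ?s (euler h k y))"
    using path_diff[of h ?s ?t y] st assms V_diff[OF st] by (simp add: algebra_simps)
  then show ?case using Suc.IH by (simp add: X_def)
qed

lemma path_near_grid:
  assumes "0 < h" and small: "\<And>k. (LINT q:{real k * h..real (Suc k) * h}|lborel. c q) \<le> \<omega>" and "0 \<le> r"
  shows "norm (euler h (cell h r) y - euler_path h y r) \<le> \<omega> * ((2 + norm y) * exp c_total)"
proof -
  let ?k = "cell h r"
  have k: "real ?k * h \<le> r" "r \<le> real (Suc ?k) * h"
  proof -
    have fl: "real ?k = of_int \<lfloor>r / h\<rfloor>" using assms by (simp add: cell_def)
    have "real ?k \<le> r / h" "r / h \<le> real (Suc ?k)" using fl by linarith+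
    then show "real ?k * h \<le> r" "r \<le> real (Suc ?k) * h" using assms(1) by (auto simp: field_simps)
  qed
  have "norm (euler_path h y r - euler_path h y (real ?k * h)) \<le> (LINT q:{real ?k * h..r}|lborel. c q) * ((2 + norm y) * exp c_total)"
    using set_integral_norm_le[of "velocity h y" "(2 + norm y) * exp c_total", OF velocity_int velocity_bound] path_diff[of h "real ?k * h" r y] k assms by simp
  also have "\<dots> \<le> \<omega> * ((2 + norm y) * exp c_total)"
    using order_trans[OF c_integral_mono[of "real ?k * h" "real ?k * h" r "real (Suc ?k) * h"] small[of ?k]] k
    by (intro mult_right_mono) auto
  finally show ?thesis using path_grid[OF assms(1), of y ?k] by (simp add: norm_minus_commute)
qed

end

section \<open>Mollified weak solutions\<close>

locale weakly_continuous =
  fixes f :: "real \<Rightarrow> 'a::euclidean_space \<Rightarrow> real"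
  assumes f_loc: "\<And>t. locally_integrable (f t)"
    and weak_cont: "\<And>q C R. q \<in> borel_measurable borel \<Longrightarrow> (\<And>x. \<bar>q x\<bar> \<le> C) \<Longrightarrow> (\<And>x. R \<le> norm x \<Longrightarrow> q x = 0)
      \<Longrightarrow> continuous_on UNIV (\<lambda>t. LINT x|lborel. q x * f t x)"
begin

text \<open>No joint measurability of \<open>f\<close> is available, only weak continuity in time. Freezing \<open>f\<close> at grid times gives
measurable approximations, which converge because \<open>k z\<close> is an admissible weight.\<close>

lemma param_integral_measurable:
  fixes k :: "real \<times> 'a \<Rightarrow> 'a \<Rightarrow> real"
  assumes k: "case_prod k \<in> borel_measurable ((lborel \<Otimes>\<^sub>M lborel) \<Otimes>\<^sub>M lborel)"
    and bnd: "\<And>z x. \<bar>k z x\<bar> \<le> C z" and supp: "\<And>z x. R z \<le> norm x \<Longrightarrow> k z x = 0"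
  shows "(\<lambda>z. LINT x|lborel. k z x * f (fst z) x) \<in> borel_measurable (lborel \<Otimes>\<^sub>M lborel)"
proof (rule borel_measurable_LIMSEQ_metric)
  fix n :: nat
  show "(\<lambda>z. LINT x|lborel. k z x * f (real_of_int \<lfloor>fst z * (real n + 1)\<rfloor> / (real n + 1)) x) \<in> borel_measurable (lborel \<Otimes>\<^sub>M lborel)"
  proof (rule measurable_compose_countable[where f="\<lambda>i z. LINT x|lborel. k z x * f (real_of_int i / (real n + 1)) x"
        and g="\<lambda>z. \<lfloor>fst z * (real n + 1)\<rfloor>"])
    show "(\<lambda>z. LINT x|lborel. k z x * f (real_of_int i / (real n + 1)) x) \<in> borel_measurable (lborel \<Otimes>\<^sub>M lborel)" for i
    proof (rule lborel.borel_measurable_lebesgue_integral)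
      have "f (real_of_int i / (real n + 1)) \<in> borel_measurable borel" by (rule locally_integrable_measurable[OF f_loc])
      then show "(\<lambda>(z, x). k z x * f (real_of_int i / (real n + 1)) x) \<in> borel_measurable ((lborel \<Otimes>\<^sub>M lborel) \<Otimes>\<^sub>M lborel)"
        using k by (simp add: split_beta')
    qed
  qed measurable
next
  fix z :: "real \<times> 'a"
  have ks: "k z \<in> borel_measurable borel" using measurable_Pair2[OF k, of z] by (simp add: space_pair_measure)
  have cont: "continuous_on UNIV (\<lambda>t. LINT x|lborel. k z x * f t x)" by (rule weak_cont[OF ks bnd supp])
  have "(\<lambda>n. real_of_int \<lfloor>fst z * (real n + 1)\<rfloor> / (real n + 1)) \<longlonglongrightarrow> fst z"
  proof (rule tendsto_sandwich[OF always_eventually always_eventually])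
    show "\<forall>n. fst z - 1 / (real n + 1) \<le> real_of_int \<lfloor>fst z * (real n + 1)\<rfloor> / (real n + 1)"
    proof
      fix n :: nat
      have "fst z * (real n + 1) - 1 \<le> real_of_int \<lfloor>fst z * (real n + 1)\<rfloor>" by linarith
      then have "(fst z * (real n + 1) - 1) / (real n + 1) \<le> real_of_int \<lfloor>fst z * (real n + 1)\<rfloor> / (real n + 1)"
        by (rule divide_right_mono) simp
      then show "fst z - 1 / (real n + 1) \<le> real_of_int \<lfloor>fst z * (real n + 1)\<rfloor> / (real n + 1)"
        by (simp add: diff_divide_distrib)
    qed
    show "\<forall>n. real_of_int \<lfloor>fst z * (real n + 1)\<rfloor> / (real n + 1) \<le> fst z"
    proof
      fix n :: nat
      have "real_of_int \<lfloor>fst z * (real n + 1)\<rfloor> \<le> fst z * (real n + 1)" by linarith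
      then show "real_of_int \<lfloor>fst z * (real n + 1)\<rfloor> / (real n + 1) \<le> fst z" by (simp add: field_simps)
    qed
    have "(\<lambda>n. fst z - inverse (real (Suc n))) \<longlonglongrightarrow> fst z - 0" by (intro tendsto_intros LIMSEQ_inverse_real_of_nat)
    then show "(\<lambda>n. fst z - 1 / (real n + 1)) \<longlonglongrightarrow> fst z" by (simp add: inverse_eq_divide add.commute)
  qed simp
  with cont show "(\<lambda>n. LINT x|lborel. k z x * f (real_of_int \<lfloor>fst z * (real n + 1)\<rfloor> / (real n + 1)) x) \<longlonglongrightarrow> (LINT x|lborel. k z x * f (fst z) x)"
    unfolding continuous_on_sequentially comp_def by simp
qed

end

text \<open>Nonnegative solutions in integrated form: the increments of the moments against smooth compactly supported
\<open>k\<close> are integrals of the flux.\<close>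

locale weak_solution = weakly_continuous f
  for b :: "real \<Rightarrow> 'a::euclidean_space \<Rightarrow> 'a" and c :: "real \<Rightarrow> real" and f :: "real \<Rightarrow> 'a \<Rightarrow> real" and A :: "real \<Rightarrow> real" +
  assumes b_meas: "case_prod b \<in> borel_measurable (lborel \<Otimes>\<^sub>M lborel)"
    and c_int: "integrable lborel c" and c_nonneg: "\<And>r. 0 \<le> c r"
    and b_growth: "\<And>r x. norm (b r x) \<le> c r * (1 + norm x)"
    and f_nonneg: "\<And>t x. 0 \<le> f t x"
    and mass_bound: "\<And>R t. (LINT x:cball 0 R|lborel. f t x) \<le> A R"
    and equation: "\<And>k G s t R. smooth k \<Longrightarrow> (\<And>x. R \<le> norm x \<Longrightarrow> k x = 0) \<Longrightarrow> (\<And>x. (k has_derivative (\<lambda>w. G x \<bullet> w)) (at x))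
      \<Longrightarrow> s \<le> t \<Longrightarrow> (LINT x|lborel. k x * f t x) - (LINT x|lborel. k x * f s x)
        = (LINT r:{s..t}|lborel. LINT x|lborel. (G x \<bullet> b r x) * f r x)"
begin

lemma b_sect: "b r \<in> borel_measurable borel"
  using measurable_Pair2[OF b_meas, of r] by simp

lemma locally_integrable_times_b:
  assumes "locally_integrable q"
  shows "locally_integrable (\<lambda>x. q x *\<^sub>R b r x)"
    and "(LINT x:cball 0 R|lborel. norm (q x *\<^sub>R b r x)) \<le> c r * (1 + \<bar>R\<bar>) * (LINT x:cball 0 R|lborel. \<bar>q x\<bar>)"
proof -
  have bnd: "norm (indicator (cball 0 R) x *\<^sub>R q x *\<^sub>R b r x) \<le> c r * (1 + \<bar>R\<bar>) * norm (indicator (cball 0 R) x *\<^sub>R q x)" for x R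
  proof (cases "norm x \<le> R")
    case True
    have "norm (b r x) \<le> c r * (1 + \<bar>R\<bar>)"
      by (rule order_trans[OF b_growth mult_left_mono]) (use True c_nonneg[of r] in auto)
    then show ?thesis using True mult_right_mono[of "norm (b r x)" "c r * (1 + \<bar>R\<bar>)" "\<bar>q x\<bar>"] by (simp add: mult.commute)
  qed simp
  have int: "integrable lborel (\<lambda>x. indicator (cball 0 R) x *\<^sub>R q x *\<^sub>R b r x)" for R
  proof (rule Bochner_Integration.integrable_bound)
    show "integrable lborel (\<lambda>x. c r * (1 + \<bar>R\<bar>) * norm (indicator (cball 0 R) x *\<^sub>R q x))"
      by (intro integrable_mult_right set_integrable_norm_cball assms)
    show "AE x in lborel. norm (indicator (cball 0 R) x *\<^sub>R q x *\<^sub>R b r x) \<le> norm (c r * (1 + \<bar>R\<bar>) * norm (indicator (cball 0 R) x *\<^sub>R q x))"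
      by (intro AE_I2 order_trans[OF bnd]) (rule order_trans[OF abs_ge_self], simp)
    have "(\<lambda>x. indicator (cball 0 R) x *\<^sub>R q x) \<in> borel_measurable borel"
      using assms borel_measurable_integrable unfolding locally_integrable_def set_integrable_def by fastforce
    from borel_measurable_scaleR[OF this b_sect[of r]]
    show "(\<lambda>x. indicator (cball 0 R) x *\<^sub>R q x *\<^sub>R b r x) \<in> borel_measurable lborel" by simp
  qed
  then show "locally_integrable (\<lambda>x. q x *\<^sub>R b r x)" by (simp add: locally_integrable_def set_integrable_def)
  have "(LINT x|lborel. norm (indicator (cball 0 R) x *\<^sub>R q x *\<^sub>R b r x))
      \<le> (LINT x|lborel. c r * (1 + \<bar>R\<bar>) * norm (indicator (cball 0 R) x *\<^sub>R q x))"
    by (intro integral_mono integrable_norm int integrable_mult_right set_integrable_norm_cball assms bnd)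
  then show "(LINT x:cball 0 R|lborel. norm (q x *\<^sub>R b r x)) \<le> c r * (1 + \<bar>R\<bar>) * (LINT x:cball 0 R|lborel. \<bar>q x\<bar>)"
    by (simp add: set_lebesgue_integral_def abs_mult mult.assoc)
qed

end

lemma conv_inner_eq_sum:
  fixes G h :: "'a::euclidean_space \<Rightarrow> 'a"
  assumes G: "continuous_on UNIV G" "\<And>z. \<delta> \<le> norm z \<Longrightarrow> G z = 0" and h: "locally_integrable h"
  shows "(LINT x|lborel. G (y - x) \<bullet> h x) = (\<Sum>i\<in>Basis. LINT x|lborel. (G (y - x) \<bullet> i) *\<^sub>R (h x \<bullet> i))"
    and "integrable lborel (\<lambda>x. G (y - x) \<bullet> h x)"
    and "continuous_on UNIV (\<lambda>y. LINT x|lborel. G (y - x) \<bullet> h x)"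
proof -
  have hi: "locally_integrable (\<lambda>x. h x \<bullet> i)" for i
    unfolding locally_integrable_def set_integrable_def
  proof
    fix R
    have "integrable lborel (\<lambda>x. (indicator (cball 0 R) x *\<^sub>R h x) \<bullet> i)"
      using h unfolding locally_integrable_def set_integrable_def by (intro integrable_inner_left) blast
    then show "integrable lborel (\<lambda>x. indicator (cball 0 R) x *\<^sub>R (h x \<bullet> i))" by simp
  qed
  have Gi: "continuous_on UNIV (\<lambda>z. G z \<bullet> i)" "\<And>z. \<delta> \<le> norm z \<Longrightarrow> G z \<bullet> i = 0" for i
    using G by (auto intro: continuous_intros)
  have int: "integrable lborel (\<lambda>x. (G (y - x) \<bullet> i) *\<^sub>R (h x \<bullet> i))" for i y
    by (rule conv_integrable[OF Gi hi])
  have eq: "G (y - x) \<bullet> h x = (\<Sum>i\<in>Basis. (G (y - x) \<bullet> i) *\<^sub>R (h x \<bullet> i))" for x y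
    by (simp add: euclidean_inner[of "G (y - x)" "h x"])
  show sum: "(LINT x|lborel. G (y - x) \<bullet> h x) = (\<Sum>i\<in>Basis. LINT x|lborel. (G (y - x) \<bullet> i) *\<^sub>R (h x \<bullet> i))" for y
    unfolding eq by (rule Bochner_Integration.integral_sum) (rule int)
  show "integrable lborel (\<lambda>x. G (y - x) \<bullet> h x)"
    unfolding eq by (rule Bochner_Integration.integrable_sum) (rule int)
  show "continuous_on UNIV (\<lambda>y. LINT x|lborel. G (y - x) \<bullet> h x)"
    unfolding sum by (intro continuous_on_sum conv_continuous[OF Gi hi])
qed

lemma conv_inner_bound:
  fixes G h :: "'a::euclidean_space \<Rightarrow> 'a"
  assumes G: "continuous_on UNIV G" "\<And>z. \<delta> \<le> norm z \<Longrightarrow> G z = 0" and M: "\<And>z. norm (G z) \<le> M"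
    and h: "locally_integrable h" and R: "norm y + \<delta> \<le> R"
  shows "\<bar>LINT x|lborel. G (y - x) \<bullet> h x\<bar> \<le> M * (LINT x:cball 0 R|lborel. norm (h x))"
proof -
  have "norm (LINT x|lborel. G (y - x) \<bullet> h x) \<le> (LINT x|lborel. M * norm (indicator (cball 0 R) x *\<^sub>R h x))"
  proof (rule Bochner_Integration.integral_norm_bound_integral)
    show "integrable lborel (\<lambda>x. G (y - x) \<bullet> h x)" by (rule conv_inner_eq_sum(2)[OF G h])
    show "integrable lborel (\<lambda>x. M * norm (indicator (cball 0 R) x *\<^sub>R h x))"
      by (intro integrable_mult_right set_integrable_norm_cball h)
    show "norm (G (y - x) \<bullet> h x) \<le> M * norm (indicator (cball 0 R) x *\<^sub>R h x)" for x
    proof (cases "norm x \<le> R")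
      case True
      then show ?thesis using order_trans[OF Cauchy_Schwarz_ineq2 mult_right_mono[OF M]] by simp
    next
      case False
      have "norm x \<le> norm (y - x) + norm y" using norm_triangle_ineq2[of x y] by (simp add: norm_minus_commute)
      then have "G (y - x) = 0" using False R by (intro G(2)) linarith
      then show ?thesis using False by simp
    qed
  qed
  then show ?thesis by (simp add: set_lebesgue_integral_def)
qed

lemma lborel_integral_reflect:
  fixes F :: "'a::euclidean_space \<Rightarrow> 'b::euclidean_space"
  assumes "F \<in> borel_measurable borel"
  shows "(LINT x|lborel. F (y - x)) = (LINT x|lborel. F x)"
proof -
  have *: "lborel = distr lborel borel (\<lambda>x::'a. y - x)"
    using lborel_affine[of "-1" y] by (simp add: density_1)
  have "(LINT x|lborel. F x) = (LINT x|distr lborel borel (\<lambda>x. y - x). F x)" by (subst *) (rule refl)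
  also have "\<dots> = (LINT x|lborel. F (y - x))" using assms by (subst integral_distr) auto
  finally show ?thesis by simp
qed

text \<open>The constant \<open>\<sigma>\<close> keeps the mollified density away from zero, so that the quotient \<open>v\<close> is
differentiable with locally bounded derivative.\<close>

locale mollified = weak_solution b c f A
  for b :: "real \<Rightarrow> 'a::euclidean_space \<Rightarrow> 'a" and c f A +
  fixes \<rho> :: "'a \<Rightarrow> real" and G :: "'a \<Rightarrow> 'a" and \<delta> \<sigma> M0 M1 :: real
  assumes \<rho>: "smooth \<rho>" "\<And>z. 0 \<le> \<rho> z" "\<And>z. \<delta> \<le> norm z \<Longrightarrow> \<rho> z = 0" "integral\<^sup>L lborel \<rho> = 1"
    and \<delta>: "0 < \<delta>" "\<delta> \<le> 1" and \<sigma>: "0 < \<sigma>"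
    and G: "\<And>z. (\<rho> has_derivative (\<lambda>w. G z \<bullet> w)) (at z)" "continuous_on UNIV G" "\<And>z. \<delta> \<le> norm z \<Longrightarrow> G z = 0"
    and M0: "\<And>z. \<bar>\<rho> z\<bar> \<le> M0" and M1: "\<And>z. norm (G z) \<le> M1"
begin

definition a :: "real \<Rightarrow> 'a \<Rightarrow> real" where "a r x = f r x + \<sigma>"
definition g :: "real \<Rightarrow> 'a \<Rightarrow> real" where "g r y = (LINT x|lborel. \<rho> (y - x) *\<^sub>R a r x)"
definition J :: "real \<Rightarrow> 'a \<Rightarrow> 'a" where "J r y = (LINT x|lborel. \<rho> (y - x) *\<^sub>R (a r x *\<^sub>R b r x))"
definition D :: "real \<Rightarrow> 'a \<Rightarrow> real" where "D r y = - (LINT x|lborel. (G (y - x) \<bullet> b r x) * f r x)"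
definition v :: "real \<Rightarrow> 'a \<Rightarrow> 'a" where "v r y = J r y /\<^sub>R g r y"
definition g' :: "real \<Rightarrow> 'a \<Rightarrow> 'a \<Rightarrow> real" where "g' r y w = (LINT x|lborel. (G (y - x) \<bullet> w) *\<^sub>R a r x)"
definition J' :: "real \<Rightarrow> 'a \<Rightarrow> 'a \<Rightarrow> 'a" where "J' r y w = (LINT x|lborel. (G (y - x) \<bullet> w) *\<^sub>R (a r x *\<^sub>R b r x))"
definition v' :: "real \<Rightarrow> 'a \<Rightarrow> 'a \<Rightarrow> 'a" where
  "v' r y w = J' r y w /\<^sub>R g r y - (g' r y w / (g r y * g r y)) *\<^sub>R J r y"
definition vol :: "real \<Rightarrow> real" where "vol R = measure lborel (cball (0::'a) R)"
definition mass_a :: "real \<Rightarrow> real" where "mass_a R = A R + \<sigma> * vol R"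

lemma \<rho>_cont: "continuous_on UNIV \<rho>" using \<rho>(1) by (rule smooth_continuous)

lemma vol_nonneg: "0 \<le> vol R" by (simp add: vol_def)

lemma set_integral_const_cball: "(LINT x:cball (0::'a) R|lborel. k) = vol R * k" for k :: real
  by (simp add: set_lebesgue_integral_def vol_def emeasure_bounded_finite)

lemma A_nonneg: "0 \<le> A R"
proof -
  have "0 \<le> (LINT x:cball 0 R|lborel. f 0 x)" unfolding set_lebesgue_integral_def
    by (intro Bochner_Integration.integral_nonneg) (simp add: f_nonneg)
  then show ?thesis using mass_bound[of R 0] by linarith
qed

lemma mass_a_nonneg: "0 \<le> mass_a R" using A_nonneg vol_nonneg \<sigma> by (simp add: mass_a_def)

lemma const_loc: "locally_integrable (\<lambda>x::'a. k::real)"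
  unfolding locally_integrable_def set_integrable_def
  by (auto intro!: integrable_mult_left integrable_real_indicator emeasure_bounded_finite)

lemma a_loc: "locally_integrable (a r)"
  using f_loc[of r] const_loc[of \<sigma>]
  unfolding locally_integrable_def a_def[abs_def] by (auto intro: set_integral_add(1))

lemma a_pos: "\<sigma> \<le> a r x" using f_nonneg[of r x] by (simp add: a_def)

lemma a_mass: "(LINT x:cball 0 R|lborel. \<bar>a r x\<bar>) \<le> mass_a R"
proof -
  have "(LINT x:cball 0 R|lborel. \<bar>a r x\<bar>) = (LINT x:cball 0 R|lborel. f r x + \<sigma>)"
    unfolding a_def using f_nonneg \<sigma> by simp
  also have "\<dots> = (LINT x:cball 0 R|lborel. f r x) + vol R * \<sigma>"
    using f_loc[of r] const_loc[of \<sigma>] unfolding locally_integrable_def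
    by (subst set_integral_add(2)) (auto simp: set_integral_const_cball)
  finally show ?thesis using mass_bound[of R r] by (simp add: mass_a_def mult.commute)
qed

lemma ab_loc: "locally_integrable (\<lambda>x. a r x *\<^sub>R b r x)" by (rule locally_integrable_times_b[OF a_loc])

lemma ab_mass: "(LINT x:cball 0 R|lborel. norm (a r x *\<^sub>R b r x)) \<le> c r * (1 + \<bar>R\<bar>) * mass_a R"
  by (rule order_trans[OF locally_integrable_times_b(2)[OF a_loc] mult_left_mono[OF a_mass]]) (simp add: c_nonneg)

lemma \<rho>_integral: "(LINT x|lborel. \<rho> (y - x)) = 1"
  using lborel_integral_reflect[of \<rho> y] borel_measurable_continuous_onI[OF \<rho>_cont] \<rho>(4) by simp

lemma g_lower: "\<sigma> \<le> g r y"
proof -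
  have "(LINT x|lborel. \<rho> (y - x) *\<^sub>R \<sigma>) \<le> g r y"
    unfolding g_def by (intro integral_mono conv_integrable[OF \<rho>_cont \<rho>(3)] a_loc const_loc)
      (use \<rho>(2) a_pos in \<open>auto intro: mult_left_mono\<close>)
  then show ?thesis by (simp add: \<rho>_integral)
qed

lemma g_pos: "0 < g r y" using g_lower[of r y] \<sigma> by linarith

lemma g_bound: "norm y \<le> R \<Longrightarrow> g r y \<le> M0 * mass_a (R + 1)"
proof -
  assume "norm y \<le> R"
  then have "norm (g r y) \<le> M0 * (LINT x:cball 0 (R + 1)|lborel. norm (a r x))"
    unfolding g_def using \<delta> by (intro conv_bound[OF \<rho>_cont \<rho>(3) M0 a_loc]) auto
  also have "\<dots> \<le> M0 * mass_a (R + 1)"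
    using a_mass order_trans[OF abs_ge_zero M0] by (intro mult_left_mono) auto
  finally show ?thesis by simp
qed

lemma J_bound: "norm (J r y) \<le> c r * (2 + norm y) * g r y"
proof -
  have "norm (J r y) \<le> (LINT x|lborel. c r * (2 + norm y) * (\<rho> (y - x) *\<^sub>R a r x))"
    unfolding J_def
  proof (rule Bochner_Integration.integral_norm_bound_integral)
    show "integrable lborel (\<lambda>x. \<rho> (y - x) *\<^sub>R a r x *\<^sub>R b r x)" by (rule conv_integrable[OF \<rho>_cont \<rho>(3) ab_loc])
    show "integrable lborel (\<lambda>x. c r * (2 + norm y) * (\<rho> (y - x) *\<^sub>R a r x))"
      by (intro integrable_mult_right conv_integrable[OF \<rho>_cont \<rho>(3) a_loc])
    show "norm (\<rho> (y - x) *\<^sub>R a r x *\<^sub>R b r x) \<le> c r * (2 + norm y) * (\<rho> (y - x) *\<^sub>R a r x)" for x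
    proof (cases "norm (y - x) < \<delta>")
      case True
      have "norm x \<le> norm (y - x) + norm y" using norm_triangle_ineq2[of x y] by (simp add: norm_minus_commute)
      then have "norm (b r x) \<le> c r * (2 + norm y)"
        using True \<delta> c_nonneg[of r] by (intro order_trans[OF b_growth mult_left_mono]) auto
      then have "(\<rho> (y - x) * a r x) * norm (b r x) \<le> (\<rho> (y - x) * a r x) * (c r * (2 + norm y))"
        using \<rho>(2) a_pos[of r x] \<sigma> by (intro mult_left_mono) auto
      then show ?thesis using \<rho>(2)[of "y - x"] a_pos[of r x] \<sigma> by (simp add: ac_simps)
    qed (use \<rho>(3) in auto)
  qed
  also have "\<dots> = c r * (2 + norm y) * g r y" by (simp add: g_def)
  finally show ?thesis .
qed

lemma v_growth: "norm (v r y) \<le> c r * (2 + norm y)"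
  using J_bound[of r y] g_pos[of r y] by (simp add: v_def field_simps)

lemma J_eq: "J r y = g r y *\<^sub>R v r y" using g_pos[of r y] by (simp add: v_def)

lemma g_deriv: "(g r has_derivative g' r y) (at y)"
  unfolding g_def[abs_def] g'_def[abs_def] by (rule conv_has_derivative[OF G(1,2) \<rho>(3) G(3) a_loc])

lemma J_deriv: "(J r has_derivative J' r y) (at y)"
  unfolding J_def[abs_def] J'_def[abs_def] by (rule conv_has_derivative[OF G(1,2) \<rho>(3) G(3) ab_loc])

lemma Gw: "continuous_on UNIV (\<lambda>z. G z \<bullet> w)" "\<And>z. \<delta> \<le> norm z \<Longrightarrow> G z \<bullet> w = 0" "\<And>z. \<bar>G z \<bullet> w\<bar> \<le> M1 * norm w"
  using G by (auto intro: continuous_intros order_trans[OF Cauchy_Schwarz_ineq2 mult_right_mono[OF M1]])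

lemma g_cont: "continuous_on UNIV (g r)"
  unfolding g_def[abs_def] by (rule conv_continuous[OF \<rho>_cont \<rho>(3) a_loc])

lemma v_deriv: "(v r has_derivative v' r y) (at y)"
proof -
  have gne: "g r y \<noteq> 0" using g_pos[of r y] by simp
  have "((\<lambda>y. inverse (g r y) *\<^sub>R J r y) has_derivative
      (\<lambda>w. inverse (g r y) *\<^sub>R J' r y w + (- (inverse (g r y) * g' r y w * inverse (g r y))) *\<^sub>R J r y)) (at y)"
    by (rule has_derivative_scaleR[OF Deriv.has_derivative_inverse[OF gne g_deriv] J_deriv])
  moreover have "inverse (g r y) *\<^sub>R J' r y w + (- (inverse (g r y) * g' r y w * inverse (g r y))) *\<^sub>R J r y = v' r y w" for w
    by (simp add: v'_def divide_inverse mult.commute mult.left_commute)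
  ultimately show ?thesis by (simp add: v_def[abs_def])
qed

lemma v'_cont: "continuous_on UNIV (\<lambda>y. v' r y w)"
proof -
  have "continuous_on UNIV (\<lambda>y. J' r y w)" "continuous_on UNIV (\<lambda>y. g' r y w)" "continuous_on UNIV (J r)"
    unfolding J'_def g'_def J_def[abs_def]
    subgoal by (rule conv_continuous[OF Gw(1,2) ab_loc])
    subgoal by (rule conv_continuous[OF Gw(1,2) a_loc])
    subgoal by (rule conv_continuous[OF \<rho>_cont \<rho>(3) ab_loc])
    done
  moreover have "g r y \<noteq> 0" for y using g_pos[of r y] by simp
  ultimately show ?thesis unfolding v'_def by (intro continuous_intros g_cont) auto
qed

definition L :: "real \<Rightarrow> real" where "L R = 2 * (M1 * (2 + \<bar>R\<bar>) * mass_a (R + 1)) / \<sigma>"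

lemma M1_nonneg: "0 \<le> M1" using order_trans[OF norm_ge_zero M1] .

lemma v'_bound:
  assumes y: "norm y \<le> R"
  shows "norm (v' r y w) \<le> L R * c r * norm w"
proof -
  have R: "0 \<le> R" using y norm_ge_zero order_trans by blast
  have inv: "inverse (g r y) \<le> 1 / \<sigma>" using g_lower[of r y] g_pos[of r y] \<sigma> by (simp add: inverse_eq_divide frac_le)
  have "norm (J' r y w) \<le> (M1 * norm w) * (LINT x:cball 0 (R + 1)|lborel. norm (a r x *\<^sub>R b r x))"
    unfolding J'_def using y \<delta> by (intro conv_bound[OF Gw ab_loc]) auto
  also have "\<dots> \<le> (M1 * norm w) * (c r * (1 + \<bar>R + 1\<bar>) * mass_a (R + 1))"
    using M1_nonneg by (intro mult_left_mono ab_mass) auto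
  finally have J': "norm (J' r y w) \<le> (M1 * norm w) * (c r * (2 + \<bar>R\<bar>) * mass_a (R + 1))" using R by (simp add: add.commute)
  have "norm (g' r y w) \<le> (M1 * norm w) * (LINT x:cball 0 (R + 1)|lborel. norm (a r x))"
    unfolding g'_def using y \<delta> by (intro conv_bound[OF Gw a_loc]) auto
  also have "\<dots> \<le> (M1 * norm w) * mass_a (R + 1)"
    using M1_nonneg a_mass by (intro mult_left_mono) auto
  finally have g': "\<bar>g' r y w\<bar> \<le> (M1 * norm w) * mass_a (R + 1)" by simp
  have v: "norm (v r y) \<le> c r * (2 + \<bar>R\<bar>)"
    using y c_nonneg[of r] by (intro order_trans[OF v_growth mult_left_mono]) auto
  have "v' r y w = inverse (g r y) *\<^sub>R (J' r y w - g' r y w *\<^sub>R v r y)"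
    using g_pos[of r y] by (simp add: v'_def v_def scaleR_right_diff_distrib divide_inverse ac_simps)
  then have "norm (v' r y w) = inverse (g r y) * norm (J' r y w - g' r y w *\<^sub>R v r y)" using g_pos[of r y] by simp
  also have "\<dots> \<le> (1 / \<sigma>) * (2 * ((M1 * norm w) * (c r * (2 + \<bar>R\<bar>) * mass_a (R + 1))))"
  proof (rule mult_mono[OF inv])
    have "norm (J' r y w - g' r y w *\<^sub>R v r y) \<le> norm (J' r y w) + \<bar>g' r y w\<bar> * norm (v r y)"
      using norm_triangle_ineq4[of "J' r y w" "g' r y w *\<^sub>R v r y"] by simp
    also have "\<bar>g' r y w\<bar> * norm (v r y) \<le> ((M1 * norm w) * mass_a (R + 1)) * (c r * (2 + \<bar>R\<bar>))"
      using g' v M1_nonneg mass_a_nonneg by (intro mult_mono) auto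
    finally show "norm (J' r y w - g' r y w *\<^sub>R v r y) \<le> 2 * ((M1 * norm w) * (c r * (2 + \<bar>R\<bar>) * mass_a (R + 1)))"
      using J' by (simp add: ac_simps)
  qed (use \<sigma> in auto)
  also have "\<dots> = L R * c r * norm w" by (simp add: L_def ac_simps)
  finally show ?thesis .
qed

lemma kernel_b_measurable:
  fixes k :: "'a \<Rightarrow> 'a"
  assumes "continuous_on UNIV k"
  shows "(\<lambda>(z, x). k (snd z - x) \<bullet> b (fst z) x) \<in> borel_measurable ((lborel \<Otimes>\<^sub>M lborel) \<Otimes>\<^sub>M lborel)"
proof -
  have "(\<lambda>p::(real \<times> 'a) \<times> 'a. case_prod b (fst (fst p), snd p)) \<in> borel_measurable ((lborel \<Otimes>\<^sub>M lborel) \<Otimes>\<^sub>M lborel)"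
    by (rule measurable_compose[OF _ b_meas]) measurable
  moreover have "(\<lambda>p::(real \<times> 'a) \<times> 'a. k (snd (fst p) - snd p)) \<in> borel_measurable ((lborel \<Otimes>\<^sub>M lborel) \<Otimes>\<^sub>M lborel)"
    by (rule measurable_compose[OF _ borel_measurable_continuous_onI[OF assms]]) measurable
  ultimately show ?thesis by (simp add: split_beta')
qed

lemma kernel_b_bound:
  fixes k :: "'a \<Rightarrow> 'a"
  assumes "\<And>z. \<delta> \<le> norm z \<Longrightarrow> k z = 0" "\<And>z. norm (k z) \<le> M"
  shows "\<bar>k (y - x) \<bullet> b r x\<bar> \<le> M * (c r * (2 + norm y))" "norm y + 1 \<le> norm x \<Longrightarrow> k (y - x) \<bullet> b r x = 0"
proof -
  have near: "norm x \<le> norm (y - x) + norm y" using norm_triangle_ineq2[of x y] by (simp add: norm_minus_commute)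
  show "k (y - x) \<bullet> b r x = 0" if "norm y + 1 \<le> norm x" using near that \<delta> assms(1)[of "y - x"] by auto
  have Mn: "0 \<le> M" using order_trans[OF norm_ge_zero assms(2)] .
  show "\<bar>k (y - x) \<bullet> b r x\<bar> \<le> M * (c r * (2 + norm y))"
  proof (cases "norm (y - x) < \<delta>")
    case True
    then have "norm (b r x) \<le> c r * (2 + norm y)"
      using near \<delta> c_nonneg[of r] by (intro order_trans[OF b_growth mult_left_mono]) auto
    then show ?thesis using assms(2) Mn by (intro order_trans[OF Cauchy_Schwarz_ineq2 mult_mono]) auto
  next
    case False then show ?thesis using assms(1)[of "y - x"] Mn c_nonneg[of r] by simp
  qed
qed

lemma kernel_f_measurable:
  fixes k :: "'a \<Rightarrow> 'a"
  assumes k: "continuous_on UNIV k" "\<And>z. \<delta> \<le> norm z \<Longrightarrow> k z = 0"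
  shows "(\<lambda>z. LINT x|lborel. (k (snd z - x) \<bullet> b (fst z) x) * f (fst z) x) \<in> borel_measurable (lborel \<Otimes>\<^sub>M lborel)"
    and "(\<lambda>z. LINT x|lborel. k (snd z - x) \<bullet> b (fst z) x) \<in> borel_measurable (lborel \<Otimes>\<^sub>M lborel)"
proof -
  obtain M where M: "\<And>z. norm (k z) \<le> M" using kernel_bounded[OF k] by blast
  show "(\<lambda>z. LINT x|lborel. (k (snd z - x) \<bullet> b (fst z) x) * f (fst z) x) \<in> borel_measurable (lborel \<Otimes>\<^sub>M lborel)"
    by (rule param_integral_measurable[OF kernel_b_measurable[OF k(1)], where C="\<lambda>z. M * (c (fst z) * (2 + norm (snd z)))" and R="\<lambda>z. norm (snd z) + 1"])
      (use kernel_b_bound[OF k(2) M] in auto)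
  show "(\<lambda>z. LINT x|lborel. k (snd z - x) \<bullet> b (fst z) x) \<in> borel_measurable (lborel \<Otimes>\<^sub>M lborel)"
    by (rule lborel.borel_measurable_lebesgue_integral[OF kernel_b_measurable[OF k(1)]])
qed

lemma b_loc: "locally_integrable (b r)"
  using locally_integrable_times_b(1)[OF const_loc[of 1]] by simp

lemma fb_loc: "locally_integrable (\<lambda>x. f r x *\<^sub>R b r x)"
  by (rule locally_integrable_times_b(1)[OF f_loc])

lemma D_measurable: "case_prod D \<in> borel_measurable (lborel \<Otimes>\<^sub>M lborel)"
  using kernel_f_measurable(1)[OF G(2,3)] by (simp add: D_def split_beta')

lemma g_measurable: "case_prod g \<in> borel_measurable (lborel \<Otimes>\<^sub>M lborel)"
proof -
  have k: "(\<lambda>(z, x). \<rho> (snd z - x)) \<in> borel_measurable (((lborel :: real measure) \<Otimes>\<^sub>M lborel) \<Otimes>\<^sub>M lborel)"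
  proof -
    have "(\<lambda>p::(real \<times> 'a) \<times> 'a. \<rho> (snd (fst p) - snd p)) \<in> borel_measurable ((lborel \<Otimes>\<^sub>M lborel) \<Otimes>\<^sub>M lborel)"
      by (rule measurable_compose[OF _ borel_measurable_continuous_onI[OF \<rho>_cont]]) measurable
    then show ?thesis by (simp add: split_beta')
  qed
  have far: "\<rho> (y - x) = 0" if "norm y + 1 \<le> norm x" for x y :: 'a
    using that norm_triangle_ineq2[of x y] \<delta> by (intro \<rho>(3)) (simp add: norm_minus_commute)
  have 1: "(\<lambda>z::real \<times> 'a. LINT x|lborel. \<rho> (snd z - x) * f (fst z) x) \<in> borel_measurable (lborel \<Otimes>\<^sub>M lborel)"
    by (rule param_integral_measurable[OF k, where C="\<lambda>z. M0" and R="\<lambda>z. norm (snd z) + 1"]) (use M0 far in auto)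
  have "g r y = (LINT x|lborel. \<rho> (y - x) * f r x) + \<sigma>" for r y
  proof -
    have "g r y = (LINT x|lborel. \<rho> (y - x) *\<^sub>R f r x + \<rho> (y - x) *\<^sub>R \<sigma>)" by (simp add: g_def a_def distrib_left)
    also have "\<dots> = (LINT x|lborel. \<rho> (y - x) *\<^sub>R f r x) + (LINT x|lborel. \<rho> (y - x) *\<^sub>R \<sigma>)"
      by (intro Bochner_Integration.integral_add conv_integrable[OF \<rho>_cont \<rho>(3)] f_loc const_loc)
    finally show ?thesis by (simp add: \<rho>_integral)
  qed
  then show ?thesis using 1 by (simp add: split_beta')
qed

lemma v_measurable: "case_prod v \<in> borel_measurable (lborel \<Otimes>\<^sub>M lborel)"
proof (rule borel_measurable_euclidean_space[THEN iffD2], intro ballI)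
  fix i :: 'a assume "i \<in> Basis"
  have ki: "continuous_on UNIV (\<lambda>z. \<rho> z *\<^sub>R i)" "\<And>z. \<delta> \<le> norm z \<Longrightarrow> \<rho> z *\<^sub>R i = 0"
    using \<rho>(3) by (auto intro!: continuous_intros \<rho>_cont)
  have "J r y \<bullet> i = (LINT x|lborel. (\<rho> (y - x) *\<^sub>R i) \<bullet> b r x * f r x) + \<sigma> * (LINT x|lborel. (\<rho> (y - x) *\<^sub>R i) \<bullet> b r x)" for r y
  proof -
    have "J r y \<bullet> i = (LINT x|lborel. (\<rho> (y - x) *\<^sub>R (a r x *\<^sub>R b r x)) \<bullet> i)"
      unfolding J_def by (rule integral_inner_left[symmetric]) (rule conv_integrable[OF \<rho>_cont \<rho>(3) ab_loc])
    also have "\<dots> = (LINT x|lborel. (\<rho> (y - x) *\<^sub>R i) \<bullet> (f r x *\<^sub>R b r x) + \<sigma> * ((\<rho> (y - x) *\<^sub>R i) \<bullet> b r x))"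
      by (intro Bochner_Integration.integral_cong refl) (simp add: a_def inner_commute algebra_simps)
    also have "\<dots> = (LINT x|lborel. (\<rho> (y - x) *\<^sub>R i) \<bullet> (f r x *\<^sub>R b r x)) + (LINT x|lborel. \<sigma> * ((\<rho> (y - x) *\<^sub>R i) \<bullet> b r x))"
      by (intro Bochner_Integration.integral_add integrable_mult_right conv_inner_eq_sum(2)[OF ki] fb_loc b_loc)
    finally show ?thesis by (simp add: ac_simps)
  qed
  then have "v r y \<bullet> i = ((LINT x|lborel. (\<rho> (y - x) *\<^sub>R i) \<bullet> b r x * f r x) + \<sigma> * (LINT x|lborel. (\<rho> (y - x) *\<^sub>R i) \<bullet> b r x)) / g r y" for r y
    by (simp add: v_def divide_inverse mult.commute)
  moreover have "(\<lambda>z. g (fst z) (snd z)) \<in> borel_measurable (lborel \<Otimes>\<^sub>M lborel)" using g_measurable by (simp add: split_beta')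
  ultimately show "(\<lambda>x. case_prod v x \<bullet> i) \<in> borel_measurable (lborel \<Otimes>\<^sub>M lborel)"
    using kernel_f_measurable[OF ki] by (simp add: split_beta')
qed

definition K :: "real \<Rightarrow> real" where "K R = M1 * (2 + \<bar>R\<bar>) * A (R + 1)"

lemma D_eq: "D r y = - (LINT x|lborel. G (y - x) \<bullet> (f r x *\<^sub>R b r x))"
  unfolding D_def by (simp add: mult.commute)

lemma D_bound:
  assumes "norm y \<le> R"
  shows "\<bar>D r y\<bar> \<le> K R * c r"
proof -
  have R: "0 \<le> R" using assms norm_ge_zero order_trans by blast
  have "\<bar>D r y\<bar> \<le> M1 * (LINT x:cball 0 (R + 1)|lborel. norm (f r x *\<^sub>R b r x))"
    unfolding D_eq abs_minus_cancel using assms \<delta> by (intro conv_inner_bound[OF G(2,3) M1 fb_loc]) auto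
  also have "\<dots> \<le> M1 * (c r * (1 + \<bar>R + 1\<bar>) * A (R + 1))"
    using mass_bound[of "R + 1" r] f_nonneg c_nonneg[of r]
    by (intro mult_left_mono M1_nonneg order_trans[OF locally_integrable_times_b(2)[OF f_loc] mult_left_mono]) auto
  also have "\<dots> = K R * c r" using R by (simp add: K_def ac_simps)
  finally show ?thesis .
qed

lemma balance:
  assumes "s \<le> t"
  shows "g t y - g s y = (LINT r:{s..t}|lborel. D r y)"
proof -
  have sm: "smooth (\<lambda>x. \<rho> (y + - x))" by (rule smooth_affine[OF \<rho>(1) bounded_linear_minus[OF bounded_linear_ident]])
  have der: "((\<lambda>x. \<rho> (y - x)) has_derivative (\<lambda>w. - G (y - x) \<bullet> w)) (at x)" for x
  proof -
    have "((\<lambda>x. y - x) has_derivative (\<lambda>w. - w)) (at x)" by (auto intro!: derivative_eq_intros)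
    from has_derivative_compose[OF this G(1)] show ?thesis by simp
  qed
  have far: "\<rho> (y - x) = 0" if "norm y + 1 \<le> norm x" for x :: 'a
    using that norm_triangle_ineq2[of x y] \<delta> by (intro \<rho>(3)) (simp add: norm_minus_commute)
  have split: "g r y = (LINT x|lborel. \<rho> (y - x) * f r x) + (LINT x|lborel. \<rho> (y - x) *\<^sub>R \<sigma>)" for r
  proof -
    have "g r y = (LINT x|lborel. \<rho> (y - x) *\<^sub>R f r x + \<rho> (y - x) *\<^sub>R \<sigma>)" by (simp add: g_def a_def distrib_left)
    also have "\<dots> = (LINT x|lborel. \<rho> (y - x) *\<^sub>R f r x) + (LINT x|lborel. \<rho> (y - x) *\<^sub>R \<sigma>)"
      by (intro Bochner_Integration.integral_add conv_integrable[OF \<rho>_cont \<rho>(3)] f_loc const_loc)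
    finally show ?thesis by simp
  qed
  have "g t y - g s y = (LINT x|lborel. \<rho> (y - x) * f t x) - (LINT x|lborel. \<rho> (y - x) * f s x)"
    unfolding split by simp
  also have "\<dots> = (LINT r:{s..t}|lborel. LINT x|lborel. (- G (y - x) \<bullet> b r x) * f r x)"
    by (rule equation[OF _ far der assms]) (use sm in simp)
  finally show ?thesis by (simp add: D_def)
qed

text \<open>Adding the constant \<open>\<sigma>\<close> to the density produces the additional flux \<open>\<sigma> b\<close>, which is not divergence free. Its
contribution is the only error, and it vanishes with \<open>\<sigma>\<close>.\<close>

definition \<eta> :: "real \<Rightarrow> real" where "\<eta> R = \<sigma> * (M1 * (2 + \<bar>R\<bar>) * vol (R + 1) * vol R)"

lemma parts:
  assumes U: "\<And>z. (U has_derivative (\<lambda>w. GU z \<bullet> w)) (at z)" and GU: "continuous_on UNIV GU"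
    and U0: "\<And>z. R \<le> norm z \<Longrightarrow> U z = 0" and GU0: "\<And>z. R \<le> norm z \<Longrightarrow> GU z = 0" and M: "\<And>z. \<bar>U z\<bar> \<le> M"
  shows "\<bar>(LINT y|lborel. U y * D r y) - (LINT y|lborel. (GU y \<bullet> v r y) * g r y)\<bar> \<le> \<eta> R * M * c r"
proof -
  have Uc: "continuous_on UNIV U" using U has_derivative_continuous continuous_at_imp_continuous_on by blast
  have Mn: "0 \<le> M" using order_trans[OF abs_ge_zero M] .
  let ?P = "\<lambda>y. LINT x|lborel. G (y - x) \<bullet> (a r x *\<^sub>R b r x)" and ?Q = "\<lambda>y. LINT x|lborel. G (y - x) \<bullet> b r x"
  have D: "D r y = - ?P y + \<sigma> * ?Q y" for y
  proof -
    have "?P y = (LINT x|lborel. G (y - x) \<bullet> (f r x *\<^sub>R b r x) + \<sigma> * (G (y - x) \<bullet> b r x))"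
      by (intro Bochner_Integration.integral_cong refl) (simp add: a_def algebra_simps)
    also have "\<dots> = (LINT x|lborel. G (y - x) \<bullet> (f r x *\<^sub>R b r x)) + (LINT x|lborel. \<sigma> * (G (y - x) \<bullet> b r x))"
      by (intro Bochner_Integration.integral_add integrable_mult_right conv_inner_eq_sum(2)[OF G(2,3)] fb_loc b_loc)
    finally show ?thesis unfolding D_eq by simp
  qed
  have Pc: "continuous_on UNIV ?P" and Qc: "continuous_on UNIV ?Q"
    subgoal by (rule conv_inner_eq_sum(3)[OF G(2,3) ab_loc])
    subgoal by (rule conv_inner_eq_sum(3)[OF G(2,3) b_loc])
    done
  have iU: "integrable lborel (\<lambda>y. U y * P y)" if "continuous_on UNIV P" for P :: "'a \<Rightarrow> real"
    by (rule integrable_continuous_bounded_support[of _ R]) (use U0 in \<open>auto intro!: continuous_on_mult Uc that\<close>)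
  note iP = iU[OF Pc] and iQ = iU[OF Qc]
  have "(LINT y|lborel. U y * D r y) = (LINT y|lborel. \<sigma> * (U y * ?Q y) - U y * ?P y)"
    by (intro Bochner_Integration.integral_cong refl) (simp add: D algebra_simps)
  also have "\<dots> = \<sigma> * (LINT y|lborel. U y * ?Q y) - (LINT y|lborel. U y * ?P y)"
    using iP iQ by simp
  also have "(LINT y|lborel. U y * ?P y) = - (LINT y|lborel. GU y \<bullet> J r y)"
    unfolding J_def by (rule conv_integration_by_parts[OF G(1,2) \<rho>(3) G(3) ab_loc U GU U0 GU0])
  finally have eq: "(LINT y|lborel. U y * D r y) - (LINT y|lborel. (GU y \<bullet> v r y) * g r y) = \<sigma> * (LINT y|lborel. U y * ?Q y)"
    by (simp add: J_eq mult.commute)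
  have "norm (LINT y|lborel. U y * ?Q y) \<le> (LINT y|lborel. (M * (M1 * (c r * (2 + \<bar>R\<bar>) * vol (R + 1)))) * indicator (cball (0::'a) R) y)"
  proof (rule Bochner_Integration.integral_norm_bound_integral[OF iQ])
    show "integrable lborel (\<lambda>y. (M * (M1 * (c r * (2 + \<bar>R\<bar>) * vol (R + 1)))) * indicator (cball (0::'a) R) y)"
      by (intro integrable_mult_right integrable_real_indicator emeasure_bounded_finite) auto
    show "norm (U y * ?Q y) \<le> (M * (M1 * (c r * (2 + \<bar>R\<bar>) * vol (R + 1)))) * indicator (cball (0::'a) R) y" for y
    proof (cases "norm y \<le> R")
      case True
      have R: "0 \<le> R" using True norm_ge_zero order_trans by blast
      have "\<bar>?Q y\<bar> \<le> M1 * (LINT x:cball 0 (R + 1)|lborel. norm (b r x))"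
        using True \<delta> by (intro conv_inner_bound[OF G(2,3) M1 b_loc]) auto
      also have "\<dots> \<le> M1 * (c r * (2 + \<bar>R\<bar>) * vol (R + 1))"
        using locally_integrable_times_b(2)[OF const_loc[of 1], where R="R + 1" and r=r] R
        by (intro mult_left_mono M1_nonneg) (simp add: set_integral_const_cball add.commute)
      finally show ?thesis using M[of y] True Mn by (simp add: abs_mult mult_mono)
    qed (use U0 in auto)
  qed
  then have "\<bar>LINT y|lborel. U y * ?Q y\<bar> \<le> (M * (M1 * (c r * (2 + \<bar>R\<bar>) * vol (R + 1)))) * vol R"
    by (simp add: vol_def emeasure_bounded_finite)
  then have "\<sigma> * \<bar>LINT y|lborel. U y * ?Q y\<bar> \<le> \<sigma> * ((M * (M1 * (c r * (2 + \<bar>R\<bar>) * vol (R + 1)))) * vol R)"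
    using \<sigma> by (intro mult_left_mono) auto
  then show ?thesis unfolding eq using \<sigma> by (simp add: abs_mult \<eta>_def ac_simps)
qed

sublocale regular_transport c g D v v' L "\<lambda>R. M0 * mass_a (R + 1)" K \<eta>
proof
  show "0 \<le> K R" for R using M1_nonneg A_nonneg by (simp add: K_def)
  show "0 \<le> L R" for R using M1_nonneg mass_a_nonneg \<sigma> by (simp add: L_def)
  show "0 \<le> g r y" for r y using g_pos[of r y] by simp
qed (fact c_int c_nonneg g_measurable D_measurable v_measurable g_bound D_bound v_growth v_deriv v'_cont v'_bound balance parts)+

text \<open>The value of \<open>v\<close> is a mean of \<open>b r\<close> with the positive weights \<open>\<rho> (y - x) a r x\<close>, supported in the ball.\<close>

lemma v_inner_le:
  assumes "AE x in lborel. x \<in> cball y \<delta> \<longrightarrow> b r x \<bullet> e \<le> q"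
  shows "v r y \<bullet> e \<le> q"
proof -
  have "J r y \<bullet> e = (LINT x|lborel. (\<rho> (y - x) *\<^sub>R (a r x *\<^sub>R b r x)) \<bullet> e)"
    unfolding J_def by (rule integral_inner_left[symmetric]) (rule conv_integrable[OF \<rho>_cont \<rho>(3) ab_loc])
  also have "\<dots> \<le> (LINT x|lborel. q * (\<rho> (y - x) *\<^sub>R a r x))"
  proof (rule integral_mono_AE)
    show "integrable lborel (\<lambda>x. (\<rho> (y - x) *\<^sub>R (a r x *\<^sub>R b r x)) \<bullet> e)"
      by (intro integrable_inner_left conv_integrable[OF \<rho>_cont \<rho>(3) ab_loc])
    show "integrable lborel (\<lambda>x. q * (\<rho> (y - x) *\<^sub>R a r x))"
      by (intro integrable_mult_right conv_integrable[OF \<rho>_cont \<rho>(3) a_loc])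
    show "AE x in lborel. (\<rho> (y - x) *\<^sub>R (a r x *\<^sub>R b r x)) \<bullet> e \<le> q * (\<rho> (y - x) *\<^sub>R a r x)"
      using assms
    proof eventually_elim
      case (elim x)
      show ?case
      proof (cases "x \<in> cball y \<delta>")
        case True
        then have "(\<rho> (y - x) * a r x) * (b r x \<bullet> e) \<le> (\<rho> (y - x) * a r x) * q"
          using elim \<rho>(2)[of "y - x"] a_pos[of r x] \<sigma> by (intro mult_left_mono) auto
        then show ?thesis by (simp add: ac_simps)
      next
        case False
        then have "\<rho> (y - x) = 0" by (intro \<rho>(3)) (simp add: dist_norm)
        then show ?thesis by simp
      qed
    qed
  qed
  also have "\<dots> = q * g r y" by (simp add: g_def)
  finally show ?thesis using g_pos[of r y] unfolding J_eq by (simp add: mult.commute)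
qed

end

context mollified
begin

definition \<eta>0 :: "real \<Rightarrow> real" where "\<eta>0 R = M1 * (2 + \<bar>R\<bar>) * vol (R + 1) * vol R"

lemma \<eta>_eq: "\<eta> R = \<sigma> * \<eta>0 R" by (simp add: \<eta>_def \<eta>0_def)

lemma \<eta>0_nonneg: "0 \<le> \<eta>0 R" using M1_nonneg vol_nonneg by (simp add: \<eta>0_def)

lemma mesh_exists:
  assumes "0 < t" "0 < \<omega>"
  obtains h N where "0 < h" "real N * h = t" "\<And>k. (LINT q:{real k * h..real (Suc k) * h}|lborel. c q) \<le> \<omega>"
proof -
  obtain d where d: "d > 0" "\<And>s t. t - s < d \<Longrightarrow> (LINT r:{s..t}|lborel. c r) < \<omega>"
    using set_integral_Icc_small[OF c_int c_nonneg assms(2)] by blast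
  obtain N :: nat where N: "t / d < real N" using reals_Archimedean2 by blast
  have Np: "0 < real N" using N assms d(1) divide_pos_pos[of t d] by linarith
  show ?thesis
  proof (rule that[of "t / real N" N])
    show "(LINT q:{real k * (t / real N)..real (Suc k) * (t / real N)}|lborel. c q) \<le> \<omega>" for k
    proof (rule less_imp_le[OF d(2)])
      have "t / real N < d" using N Np d(1) by (simp add: field_simps)
      then show "real (Suc k) * (t / real N) - real k * (t / real N) < d"
        by (simp only: left_diff_distrib[symmetric]) simp
    qed
  qed (use assms Np in auto)
qed

text \<open>The mesh is chosen after \<open>\<sigma>\<close> and the mollifier, which makes the part of the error that depends on the mesh as small as desired,
whatever the Lipschitz constant of \<open>v\<close>.\<close>

lemma flow_estimate:
  fixes u :: "'a \<Rightarrow> real"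
  assumes "0 < t" "0 < \<epsilon>" "0 \<le> R0" and R: "(2 + R0) * exp (2 * c_total) \<le> 2 + R"
    and u: "\<And>x. (u has_derivative (\<lambda>w. Gu x \<bullet> w)) (at x)" and Gu: "continuous_on UNIV Gu"
    and \<Lambda>: "\<And>x. norm (Gu x) \<le> \<Lambda>" and M: "\<And>x. \<bar>u x\<bar> \<le> M" and u0: "\<And>x. R0 \<le> norm x \<Longrightarrow> u x = 0"
  shows "\<exists>h>0. (\<forall>k. (LINT q:{real k * h..real (Suc k) * h}|lborel. c q) \<le> \<epsilon>) \<and>
    \<bar>(LINT y|lborel. u y * g t y) - (LINT y|lborel. u (euler_path h y t) * g 0 y)\<bar> \<le> c_total * (\<epsilon> + \<eta> (R + 1) * M) \<and>
    (\<forall>y. R \<le> norm y \<longrightarrow> u (euler_path h y t) = 0) \<and> continuous_on UNIV (\<lambda>y. u (euler_path h y t))"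
proof -
  have tot: "0 \<le> c_total" by (intro Bochner_Integration.integral_nonneg) (simp add: c_nonneg)
  have \<Lambda>0: "0 \<le> \<Lambda>" using order_trans[OF norm_ge_zero \<Lambda>] .
  have M0': "0 \<le> M" using order_trans[OF abs_ge_zero M] .
  have R0: "0 \<le> R"
  proof -
    have "(2 + R0) * 1 \<le> (2 + R0) * exp (2 * c_total)" using tot assms(3) by (intro mult_left_mono) auto
    from order_trans[OF this R] show ?thesis using assms(3) by simp
  qed
  have mass0: "0 \<le> mass R" unfolding mass_def using order_trans[OF abs_ge_zero M0] mass_a_nonneg by simp
  define \<Lambda>' where "\<Lambda>' = \<Lambda> * exp (L R * c_total)"
  \<comment> \<open>The factor of \<open>\<omega>\<close> in the error of \<open>euler_estimate\<close>.\<close>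
  define Q where "Q = \<Lambda>' * L R * (2 + R) * mass R"
  have Q: "0 \<le> Q" using \<Lambda>0 L_nonneg[of R] R0 mass0 by (simp add: Q_def \<Lambda>'_def)
  define \<omega> where "\<omega> = min (min \<epsilon> (1 / 2)) (\<epsilon> / (Q + 1))"
  have \<omega>: "0 < \<omega>" "\<omega> \<le> \<epsilon>" "\<omega> \<le> 1 / 2" "Q * \<omega> \<le> \<epsilon>"
  proof -
    show "0 < \<omega>" using assms(2) Q by (simp add: \<omega>_def)
    have "Q * \<omega> \<le> (Q + 1) * (\<epsilon> / (Q + 1))" using Q \<open>0 < \<omega>\<close> by (intro mult_mono) (auto simp: \<omega>_def)
    then show "Q * \<omega> \<le> \<epsilon>" using Q by simp
    show "\<omega> \<le> \<epsilon>" "\<omega> \<le> 1 / 2" unfolding \<omega>_def by linarith+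
  qed
  obtain h N where h: "0 < h" "real N * h = t" "\<And>k. (LINT q:{real k * h..real (Suc k) * h}|lborel. c q) \<le> \<omega>"
    using mesh_exists[OF assms(1) \<omega>(1)] by blast
  let ?W = "LINT q:{0..real N * h}|lborel. c q"
  have W: "?W \<le> c_total" "0 \<le> ?W" by (rule c_integral_le_total, rule c_integral_nonneg)
  have \<eta>0': "0 \<le> \<eta> (R + 1)" using \<sigma> \<eta>0_nonneg by (simp add: \<eta>_eq)
  have est: "\<bar>(LINT y|lborel. u y * g (real N * h) y) - (LINT y|lborel. u (euler h N y) * g 0 y)\<bar>
      \<le> ?W * (\<Lambda>' * L R * \<omega> * (2 + R) * mass R + \<eta> (R + 1) * M)
    \<and> (\<forall>y. R \<le> norm y \<longrightarrow> u (euler h N y) = 0) \<and> continuous_on UNIV (\<lambda>y. u (euler h N y))"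
  proof (rule euler_estimate[where G=Gu and \<Lambda>=\<Lambda> and \<rho>="2 + R0" and \<omega>=\<omega>])
    show "(2 + R0) * exp (2 * ?W) \<le> 2 + R"
      by (rule order_trans[OF mult_left_mono R]) (use W assms(3) in auto)
    show "\<Lambda> * exp (L R * ?W) \<le> \<Lambda>'" unfolding \<Lambda>'_def
      using W L_nonneg[of R] \<Lambda>0 by (intro mult_left_mono) (auto intro: mult_left_mono)
    show "u x = 0" if "2 + R0 \<le> 2 + norm x" for x using that by (intro u0) simp
  qed (use h \<omega> R0 \<eta>0' u Gu \<Lambda> M assms(3) in auto)
  have "?W * (\<Lambda>' * L R * \<omega> * (2 + R) * mass R + \<eta> (R + 1) * M) \<le> c_total * (\<epsilon> + \<eta> (R + 1) * M)"
  proof (rule mult_mono[OF W(1) _ tot])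
    have eq: "\<Lambda>' * L R * \<omega> * (2 + R) * mass R = Q * \<omega>" by (simp add: Q_def)
    show "\<Lambda>' * L R * \<omega> * (2 + R) * mass R + \<eta> (R + 1) * M \<le> \<epsilon> + \<eta> (R + 1) * M"
      unfolding eq using \<omega>(4) by simp
    show "0 \<le> \<Lambda>' * L R * \<omega> * (2 + R) * mass R + \<eta> (R + 1) * M"
      unfolding eq using Q \<omega>(1) \<eta>0' M0' by simp
  qed
  moreover have "euler_path h y t = euler h N y" for y using path_grid[OF h(1), of y N] h(2) by simp
  ultimately show ?thesis using est h \<omega>(2) order_trans by (intro exI[of _ h]) fastforce
qed

lemma g_split: "g r y = (LINT x|lborel. \<rho> (y - x) * f r x) + \<sigma>"
proof -
  have "g r y = (LINT x|lborel. \<rho> (y - x) *\<^sub>R f r x + \<rho> (y - x) *\<^sub>R \<sigma>)" by (simp add: g_def a_def distrib_left)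
  also have "\<dots> = (LINT x|lborel. \<rho> (y - x) *\<^sub>R f r x) + (LINT x|lborel. \<rho> (y - x) *\<^sub>R \<sigma>)"
    by (intro Bochner_Integration.integral_add conv_integrable[OF \<rho>_cont \<rho>(3)] f_loc const_loc)
  finally show ?thesis by (simp add: \<rho>_integral)
qed

lemma integral_against_g:
  assumes q: "continuous_on UNIV q" "\<And>y. R \<le> norm y \<Longrightarrow> q y = 0" "\<And>y. \<bar>q y\<bar> \<le> M"
  shows "\<bar>(LINT y|lborel. q y * g r y) - (LINT y|lborel. q y * (LINT x|lborel. \<rho> (y - x) * f r x))\<bar> \<le> \<sigma> * (M * vol R)"
proof -
  have qi: "integrable lborel q" by (rule integrable_continuous_bounded_support[OF q(1,2)])
  have cc: "continuous_on UNIV (\<lambda>y. LINT x|lborel. \<rho> (y - x) *\<^sub>R f r x)" by (rule conv_continuous[OF \<rho>_cont \<rho>(3) f_loc])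
  have i: "integrable lborel (\<lambda>y. q y * (LINT x|lborel. \<rho> (y - x) * f r x))"
    by (rule integrable_continuous_bounded_support[of _ R]) (use q cc in \<open>auto intro!: continuous_on_mult\<close>)
  have "(LINT y|lborel. q y * g r y) = (LINT y|lborel. q y * (LINT x|lborel. \<rho> (y - x) * f r x) + q y * \<sigma>)"
    by (simp add: g_split distrib_left)
  also have "\<dots> = (LINT y|lborel. q y * (LINT x|lborel. \<rho> (y - x) * f r x)) + (LINT y|lborel. q y) * \<sigma>"
    using i qi by simp
  finally have eq: "(LINT y|lborel. q y * g r y) - (LINT y|lborel. q y * (LINT x|lborel. \<rho> (y - x) * f r x)) = (LINT y|lborel. q y) * \<sigma>"
    by simp
  have "norm (LINT y|lborel. q y) \<le> (LINT y|lborel. M * indicator (cball (0::'a) R) y)"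
  proof (rule Bochner_Integration.integral_norm_bound_integral[OF qi])
    show "integrable lborel (\<lambda>y. M * indicator (cball (0::'a) R) y)"
      by (intro integrable_mult_right integrable_real_indicator emeasure_bounded_finite) auto
    show "norm (q y) \<le> M * indicator (cball (0::'a) R) y" for y
      using q(2)[of y] q(3)[of y] by (cases "norm y \<le> R") auto
  qed
  also have "\<dots> = M * vol R" by (simp add: vol_def emeasure_bounded_finite)
  finally show ?thesis unfolding eq using \<sigma> by (simp add: abs_mult mult.commute)
qed

end

lemma kernel_average_close:
  fixes q \<rho> :: "'a::euclidean_space \<Rightarrow> real"
  assumes q: "continuous_on UNIV q" and \<rho>: "continuous_on UNIV \<rho>" "\<And>z. 0 \<le> \<rho> z" "\<And>z. \<delta> \<le> norm z \<Longrightarrow> \<rho> z = 0" "integral\<^sup>L lborel \<rho> = 1"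
    and e: "\<And>y. norm (y - x) < \<delta> \<Longrightarrow> \<bar>q y - w\<bar> \<le> e"
  shows "\<bar>(LINT y|lborel. \<rho> (y - x) * q y) - w\<bar> \<le> e"
proof -
  have rc: "continuous_on UNIV (\<lambda>y. \<rho> (y - x))" by (intro continuous_on_compose2[OF \<rho>(1)] continuous_intros) auto
  have \<rho>x0: "\<rho> (y - x) = 0" if "norm x + \<delta> \<le> norm y" for y
    using that norm_triangle_ineq2[of y x] by (intro \<rho>(3)) simp
  have int\<rho>: "integrable lborel (\<lambda>y. \<rho> (y - x))"
    by (rule integrable_continuous_bounded_support[OF rc \<rho>x0])
  have intq: "integrable lborel (\<lambda>y. \<rho> (y - x) * q y)"
    by (rule integrable_continuous_bounded_support[of _ "norm x + \<delta>"]) (use q rc \<rho>x0 in \<open>auto intro!: continuous_on_mult\<close>)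
  have one: "(LINT y|lborel. \<rho> (y - x)) = 1"
    using lborel_integral_translate[OF borel_measurable_continuous_onI[OF \<rho>(1)], of "- x"] \<rho>(4) by simp
  have "(LINT y|lborel. \<rho> (y - x) * q y) - w = (LINT y|lborel. \<rho> (y - x) * q y) - (LINT y|lborel. \<rho> (y - x) * w)"
    using one by simp
  also have "\<dots> = (LINT y|lborel. \<rho> (y - x) * (q y - w))"
    using intq int\<rho> by (simp add: right_diff_distrib)
  also have "norm \<dots> \<le> (LINT y|lborel. \<rho> (y - x) * e)"
  proof (rule Bochner_Integration.integral_norm_bound_integral)
    show "integrable lborel (\<lambda>y. \<rho> (y - x) * (q y - w))" using intq int\<rho> by (simp add: right_diff_distrib)
    show "integrable lborel (\<lambda>y. \<rho> (y - x) * e)" using int\<rho> by simp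
    show "norm (\<rho> (y - x) * (q y - w)) \<le> \<rho> (y - x) * e" for y
      using e[of y] \<rho>(2)[of "y - x"] \<rho>(3)[of "y - x"]
      by (cases "norm (y - x) < \<delta>") (auto simp: abs_mult intro: mult_left_mono)
  qed
  also have "\<dots> = e" using one by simp
  finally show "\<bar>(LINT y|lborel. \<rho> (y - x) * q y) - w\<bar> \<le> e" by simp
qed

text \<open>By Fubini the mollifier can be moved from the solution to the function against which it is integrated, and there it acts
as an averaging operator.\<close>

lemma average_kernel:
  fixes q \<rho> :: "'a::euclidean_space \<Rightarrow> real"
  assumes q: "continuous_on UNIV q" "\<And>y. R \<le> norm y \<Longrightarrow> q y = 0" "\<And>y. \<bar>q y\<bar> \<le> M"
    and \<rho>: "continuous_on UNIV \<rho>" "\<And>z. 0 \<le> \<rho> z" "\<And>z. \<delta> \<le> norm z \<Longrightarrow> \<rho> z = 0" "integral\<^sup>L lborel \<rho> = 1"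
    and f: "locally_integrable f"
  shows "(LINT y|lborel. q y * (LINT x|lborel. \<rho> (y - x) * f x)) = (LINT x|lborel. (LINT y|lborel. \<rho> (y - x) * q y) * f x)" (is ?fub)
    and "(\<lambda>x. LINT y|lborel. \<rho> (y - x) * q y) \<in> borel_measurable borel" (is ?meas)
    and "R + \<delta> \<le> norm x \<Longrightarrow> (LINT y|lborel. \<rho> (y - x) * q y) = 0"
    and "(\<And>y. norm (y - x) < \<delta> \<Longrightarrow> \<bar>q y - w\<bar> \<le> e) \<Longrightarrow> \<bar>(LINT y|lborel. \<rho> (y - x) * q y) - w\<bar> \<le> e"
proof -
  have Mn: "0 \<le> M" using order_trans[OF abs_ge_zero q(3)] .
  note [measurable] = borel_measurable_continuous_onI[OF q(1)] borel_measurable_continuous_onI[OF \<rho>(1)] locally_integrable_measurable[OF f]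
  obtain B where B: "B > 0" "\<And>z. \<bar>\<rho> z\<bar> \<le> B" using kernel_bounded[OF \<rho>(1,3)] by auto
  define \<beta> where "\<beta> x = norm (indicator (cball 0 (R + \<delta>)) x *\<^sub>R f x)" for x
  have \<beta>: "integrable lborel \<beta>" unfolding \<beta>_def by (rule set_integrable_norm_cball[OF f])
  have ind: "integrable lborel (\<lambda>y::'a. c * indicator (cball 0 R) y)" for c :: real
    by (intro integrable_mult_right integrable_real_indicator emeasure_bounded_finite) auto
  have near: "norm x \<le> norm (y - x) + norm y" for x y :: 'a
    using norm_triangle_ineq2[of x y] by (simp add: norm_minus_commute)
  have b: "\<bar>q y * (\<rho> (y - x) * f x)\<bar> \<le> (M * B * indicator (cball 0 R) y) * \<beta> x" for y x
  proof (cases "norm y < R \<and> norm (y - x) < \<delta>")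
    case True
    have "\<bar>q y\<bar> * (\<bar>\<rho> (y - x)\<bar> * \<bar>f x\<bar>) \<le> M * (B * \<bar>f x\<bar>)"
      using q(3) B Mn by (intro mult_mono) auto
    then show ?thesis using True near[of x y] by (simp add: \<beta>_def abs_mult)
  next
    case False
    then have "q y = 0 \<or> \<rho> (y - x) = 0" using q(2) \<rho>(3) by (meson not_less)
    then show ?thesis using Mn B by (auto simp: \<beta>_def)
  qed
  have "(LINT y|lborel. q y * (LINT x|lborel. \<rho> (y - x) * f x)) = (LINT y|lborel. LINT x|lborel. q y * (\<rho> (y - x) * f x))"
    by simp
  also have "\<dots> = (LINT x|lborel. LINT y|lborel. q y * (\<rho> (y - x) * f x))"
    by (rule Fubini_dominated(1)[OF _ b ind \<beta>]) measurable
  also have "\<dots> = (LINT x|lborel. LINT y|lborel. (\<rho> (y - x) * q y) * f x)" by (simp only: ac_simps)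
  finally show ?fub by simp
  have "(\<lambda>(x, y). \<rho> (y - x) * q y) \<in> borel_measurable (lborel \<Otimes>\<^sub>M lborel)" by measurable
  from lborel.borel_measurable_lebesgue_integral[OF this] show ?meas by simp
  show "(LINT y|lborel. \<rho> (y - x) * q y) = 0" if "R + \<delta> \<le> norm x"
  proof -
    have "\<rho> (y - x) * q y = 0" for y
    proof (cases "norm y < R")
      case True then show ?thesis using near[of x y] that by (intro mult_eq_0_iff[THEN iffD2] disjI1 \<rho>(3)) simp
    qed (use q(2) in auto)
    then have "(\<lambda>y. \<rho> (y - x) * q y) = (\<lambda>y. 0)" by (rule ext)
    then show ?thesis by (simp only: integral_zero)
  qed
  show "\<bar>(LINT y|lborel. \<rho> (y - x) * q y) - w\<bar> \<le> e" if e: "\<And>y. norm (y - x) < \<delta> \<Longrightarrow> \<bar>q y - w\<bar> \<le> e"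
    by (rule kernel_average_close[OF q(1) \<rho> e])
qed

context weak_solution
begin

text \<open>One approximation at scale \<open>\<delta>\<close>, stated without the auxiliary objects of the construction: \<open>P y\<close> is the Euler
path from \<open>y\<close>, \<open>H y\<close> its velocity, and \<open>Z y r\<close> the last grid point before \<open>r\<close>, where the velocity was evaluated.\<close>

lemma approximate_flow:
  fixes u :: "'a \<Rightarrow> real"
  assumes "0 < t" "0 \<le> R0" "0 < \<delta>" "\<delta> \<le> 1" and R: "(2 + R0) * exp (2 * (LINT r|lborel. c r)) \<le> 2 + R"
    and u: "\<And>x. (u has_derivative (\<lambda>w. Gu x \<bullet> w)) (at x)" and Gu: "continuous_on UNIV Gu"
    and \<Lambda>: "\<And>x. norm (Gu x) \<le> \<Lambda>" and M: "\<And>x. \<bar>u x\<bar> \<le> M" and u0: "\<And>x. R0 \<le> norm x \<Longrightarrow> u x = 0"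
  shows "\<exists>\<rho> P H Z.
    continuous_on UNIV \<rho> \<and> (\<forall>z. 0 \<le> \<rho> z) \<and> (\<forall>z. \<delta> \<le> norm z \<longrightarrow> \<rho> z = 0) \<and> integral\<^sup>L lborel \<rho> = 1 \<and>
    (\<forall>y. H y \<in> borel_measurable borel \<and> (\<forall>r. norm (H y r) \<le> c r * ((2 + norm y) * exp (LINT r|lborel. c r))) \<and>
      (\<forall>a b. a \<le> b \<longrightarrow> P y b - P y a = (LINT q:{a..b}|lborel. H y q)) \<and> P y 0 = y \<and>
      (\<forall>r\<ge>0. norm (Z y r - P y r) \<le> \<delta> * ((2 + norm y) * exp (LINT r|lborel. c r))) \<and>
      (\<forall>r e q. (AE x in lborel. x \<in> cball (Z y r) \<delta> \<longrightarrow> b r x \<bullet> e \<le> q) \<longrightarrow> H y r \<bullet> e \<le> q)) \<and>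
    \<bar>(LINT y|lborel. u y * (LINT x|lborel. \<rho> (y - x) * f t x)) - (LINT y|lborel. u (P y t) * (LINT x|lborel. \<rho> (y - x) * f 0 x))\<bar>
      \<le> (LINT r|lborel. c r) * (2 * \<delta>) + 2 * \<delta> \<and>
    (\<forall>y. R \<le> norm y \<longrightarrow> u (P y t) = 0) \<and> continuous_on UNIV (\<lambda>y. u (P y t))"
proof -
  obtain \<rho> :: "'a \<Rightarrow> real" where \<rho>: "smooth \<rho>" "\<And>x. 0 \<le> \<rho> x" "\<And>x. \<delta> \<le> norm x \<Longrightarrow> \<rho> x = 0" "integral\<^sup>L lborel \<rho> = 1"
    using mollifier_exists[OF assms(3)] by blast
  obtain G where G: "\<And>x. (\<rho> has_derivative (\<lambda>v. G x \<bullet> v)) (at x)" "continuous_on UNIV G"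
    using smooth_gradient[OF \<rho>(1)] by blast
  \<comment> \<open>On the sphere of radius \<open>\<delta>\<close> the gradient vanishes by continuity.\<close>
  have G0: "G z = 0" if "\<delta> \<le> norm z" for z
  proof -
    have *: "G z = 0" if "\<delta> < norm z" for z
      by (rule gradient_zero_outside[OF G(1), of "2 + \<delta>"]) (use \<rho>(3) that in auto)
    show ?thesis
    proof (cases "\<delta> < norm z")
      case False
      then have eq: "norm z = \<delta>" using that by simp
      have z0: "z \<noteq> 0" using eq assms(3) by auto
      have lim: "(\<lambda>n. (1 + inverse (real (Suc n))) *\<^sub>R z) \<longlonglongrightarrow> (1 + 0) *\<^sub>R z"
        by (intro tendsto_intros LIMSEQ_inverse_real_of_nat)
      then have "(\<lambda>n. G ((1 + inverse (real (Suc n))) *\<^sub>R z)) \<longlonglongrightarrow> G z"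
        using G(2) unfolding continuous_on_sequentially comp_def by simp
      moreover have "G ((1 + inverse (real (Suc n))) *\<^sub>R z) = 0" for n
        using eq assms(3) by (intro *) (simp add: field_simps)
      ultimately have "(\<lambda>n. 0) \<longlonglongrightarrow> G z" by simp
      then show ?thesis by (simp add: LIMSEQ_const_iff)
    qed (use * in auto)
  qed
  obtain M0 where M0: "\<And>z. \<bar>\<rho> z\<bar> \<le> M0" using kernel_bounded[where k=\<rho> and \<delta>=\<delta>, OF smooth_continuous[OF \<rho>(1)] \<rho>(3)] by auto
  obtain M1 where M1: "\<And>z. norm (G z) \<le> M1" using kernel_bounded[where k=G and \<delta>=\<delta>, OF G(2) G0] by auto
  define E where "E = M1 * (2 + \<bar>R + 1\<bar>) * measure lborel (cball (0::'a) (R + 1 + 1)) * measure lborel (cball (0::'a) (R + 1))"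
  define S where "S = M * measure lborel (cball (0::'a) R)"
  have Mn: "0 \<le> M" using order_trans[OF abs_ge_zero M] .
  have M1n: "0 \<le> M1" using order_trans[OF norm_ge_zero M1] .
  have E: "0 \<le> E * M" and S: "0 \<le> S" using Mn M1n by (simp_all add: E_def S_def)
  \<comment> \<open>The errors that \<open>\<sigma>\<close> causes are \<open>\<sigma> E M\<close> in the continuity equation and \<open>\<sigma> S\<close> in passing from \<open>g\<close> to \<open>\<rho> * f\<close>.\<close>
  define \<sigma> where "\<sigma> = \<delta> / (1 + E * M + S)"
  have \<sigma>: "0 < \<sigma>" using assms(3) E S by (simp add: \<sigma>_def)
  have \<sigma>E: "\<sigma> * (E * M) \<le> \<delta>" "\<sigma> * S \<le> \<delta>"
    using assms(3) E S by (simp_all add: \<sigma>_def divide_le_eq)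
  interpret m: mollified b c f A \<rho> G \<delta> \<sigma> M0 M1
    by unfold_locales (use \<rho> G G0 M0 M1 \<sigma> assms(3,4) in auto)
  have \<eta>: "m.\<eta> (R + 1) * M \<le> \<delta>" using \<sigma>E(1) by (simp add: m.\<eta>_def m.vol_def E_def ac_simps)
  have tot: "0 \<le> (LINT r|lborel. c r)" by (intro Bochner_Integration.integral_nonneg) (simp add: c_nonneg)
  have RR: "R0 \<le> R"
  proof -
    have "(2 + R0) * 1 \<le> (2 + R0) * exp (2 * (LINT r|lborel. c r))" using tot assms(2) by (intro mult_left_mono) auto
    from order_trans[OF this R] show ?thesis by simp
  qed
  obtain h where h: "0 < h" "\<And>k. (LINT q:{real k * h..real (Suc k) * h}|lborel. c q) \<le> \<delta>"
    and est: "\<bar>(LINT y|lborel. u y * m.g t y) - (LINT y|lborel. u (m.euler_path h y t) * m.g 0 y)\<bar> \<le> (LINT r|lborel. c r) * (\<delta> + m.\<eta> (R + 1) * M)"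
    and far: "\<And>y. R \<le> norm y \<Longrightarrow> u (m.euler_path h y t) = 0" and cont: "continuous_on UNIV (\<lambda>y. u (m.euler_path h y t))"
    using m.flow_estimate[OF assms(1,3,2) R u Gu \<Lambda> M u0] by auto
  have uc: "continuous_on UNIV u" using u has_derivative_continuous continuous_at_imp_continuous_on by blast
  have S1: "\<bar>(LINT y|lborel. u y * m.g t y) - (LINT y|lborel. u y * (LINT x|lborel. \<rho> (y - x) * f t x))\<bar> \<le> \<delta>"
    by (rule order_trans[OF m.integral_against_g[OF uc, of R M]]) (use u0 RR M \<sigma>E(2) in \<open>auto simp: m.vol_def S_def\<close>)
  have S2: "\<bar>(LINT y|lborel. u (m.euler_path h y t) * m.g 0 y) - (LINT y|lborel. u (m.euler_path h y t) * (LINT x|lborel. \<rho> (y - x) * f 0 x))\<bar> \<le> \<delta>"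
    by (rule order_trans[OF m.integral_against_g[OF cont, of R M]]) (use far M \<sigma>E(2) in \<open>auto simp: m.vol_def S_def\<close>)
  have "(LINT r|lborel. c r) * (\<delta> + m.\<eta> (R + 1) * M) \<le> (LINT r|lborel. c r) * (2 * \<delta>)"
    using \<eta> tot by (intro mult_left_mono) auto
  then have err: "\<bar>(LINT y|lborel. u y * (LINT x|lborel. \<rho> (y - x) * f t x)) - (LINT y|lborel. u (m.euler_path h y t) * (LINT x|lborel. \<rho> (y - x) * f 0 x))\<bar>
      \<le> (LINT r|lborel. c r) * (2 * \<delta>) + 2 * \<delta>"
    using est S1 S2 by linarith
  have H: "(AE x in lborel. x \<in> cball (m.euler h (m.cell h r) y) \<delta> \<longrightarrow> b r x \<bullet> e \<le> q) \<longrightarrow> m.velocity h y r \<bullet> e \<le> q" for y r e q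
    unfolding m.velocity_def using m.v_inner_le by blast
  have Z: "norm (m.euler h (m.cell h r) y - m.euler_path h y r) \<le> \<delta> * ((2 + norm y) * exp (LINT r|lborel. c r))" if "0 \<le> r" for y r
    by (rule m.path_near_grid[OF h that])
  have h0: "0 \<le> h" using h(1) by simp
  show ?thesis
    by (rule exI[of _ \<rho>], rule exI[of _ "m.euler_path h"], rule exI[of _ "m.velocity h"], rule exI[of _ "\<lambda>y r. m.euler h (m.cell h r) y"],
        intro conjI allI)
      (use \<rho> err far cont H Z m.velocity_meas m.velocity_bound[OF h0] m.path_diff[OF h0] m.path_start smooth_continuous[OF \<rho>(1)] in \<open>auto\<close>)
qed

end

section \<open>Transport along the flow\<close>

text \<open>Moving the mollifiers to the test functions turns the estimate of \<open>approximate_flow\<close> into a comparison of the moments of \<open>S n\<close> at time \<open>t\<close>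
and of \<open>U n\<close> at time \<open>0\<close>. Here \<open>S n\<close> is a mean of \<open>u\<close>, and \<open>U n\<close> is a mean of \<open>u\<close> at the end points of
polygons that start near \<open>x\<close>; they converge to \<open>u x\<close> and \<open>u (\<phi> t x)\<close>. The function \<open>W\<close> is a Borel
representative of \<open>u \<circ> \<phi> t\<close>, obtained as the limit of the \<open>U n\<close>, since \<open>\<phi>\<close> is not known to be measurable.\<close>

lemma weak_solution_transported:
  fixes b Bf :: "real \<Rightarrow> real^'d \<Rightarrow> real^'d" and \<phi> :: "real \<Rightarrow> real^'d \<Rightarrow> real^'d" and u :: "real^'d \<Rightarrow> real"
  assumes ws: "weak_solution b c f A" and T: "0 < T" and c0: "\<And>r. r \<notin> {0..T} \<Longrightarrow> c r = 0"
    and Bf: "AE r in lborel. r \<in> {0..T} \<longrightarrow> (AE x in lborel. Bf r x = b r x)"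
    and unique: "AE x in lborel. \<forall>\<gamma>. inclusion_solution T Bf 0 x \<gamma> \<longrightarrow> (\<forall>t\<in>{0..T}. \<gamma> t = \<phi> t x)"
    and t: "0 < t" "t \<le> T"
    and u: "\<And>x. (u has_derivative (\<lambda>w. Gu x \<bullet> w)) (at x)" and Gu: "continuous_on UNIV Gu"
    and u0: "\<And>x. R0 \<le> norm x \<Longrightarrow> u x = 0" and Gu0: "\<And>x. R0 \<le> norm x \<Longrightarrow> Gu x = 0" and R0: "0 \<le> R0"
  obtains W where "W \<in> borel_measurable borel" "AE x in lborel. W x = u (\<phi> t x)" "integrable lborel (\<lambda>x. W x * f 0 x)"
    "(LINT x|lborel. W x * f 0 x) = (LINT x|lborel. u x * f t x)"
proof -
  interpret weak_solution b c f A by fact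
  define ct where "ct = (LINT r|lborel. c r)"
  have uc: "continuous_on UNIV u" using u has_derivative_continuous continuous_at_imp_continuous_on by blast
  obtain M where M: "\<And>x. \<bar>u x\<bar> \<le> M" using kernel_bounded[where k=u and \<delta>=R0, OF uc u0] by auto
  obtain \<Lambda> where \<Lambda>: "\<Lambda> > 0" "\<And>x. norm (Gu x) \<le> \<Lambda>" using kernel_bounded[where k=Gu and \<delta>=R0, OF Gu Gu0] by auto
  have tot: "0 \<le> ct" unfolding ct_def by (intro Bochner_Integration.integral_nonneg) (simp add: c_nonneg)
  define R where "R = (2 + R0) * exp (2 * ct) - 2"
  have RR: "R0 \<le> R"
  proof -
    have "(2 + R0) * 1 \<le> (2 + R0) * exp (2 * ct)" using tot R0 by (intro mult_left_mono) auto
    then show ?thesis by (simp add: R_def)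
  qed
  define \<delta> where "\<delta> n = inverse (real (Suc n))" for n
  have \<delta>: "0 < \<delta> n" "\<delta> n \<le> 1" for n by (simp_all add: \<delta>_def inverse_le_1_iff)
  have \<delta>0: "\<delta> \<longlonglongrightarrow> 0" unfolding \<delta>_def by (rule LIMSEQ_inverse_real_of_nat)
  define good where "good n \<rho> P H Z \<longleftrightarrow>
    continuous_on UNIV \<rho> \<and> (\<forall>z. 0 \<le> \<rho> z) \<and> (\<forall>z. \<delta> n \<le> norm z \<longrightarrow> \<rho> z = 0) \<and> integral\<^sup>L lborel \<rho> = 1 \<and>
    (\<forall>y. H y \<in> borel_measurable borel \<and> (\<forall>r. norm (H y r) \<le> c r * ((2 + norm y) * exp ct)) \<and>
      (\<forall>a b. a \<le> b \<longrightarrow> P y b - P y a = (LINT q:{a..b}|lborel. H y q)) \<and> P y 0 = y \<and>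
      (\<forall>r\<ge>0. norm (Z y r - P y r) \<le> \<delta> n * ((2 + norm y) * exp ct)) \<and>
      (\<forall>r e q. (AE x in lborel. x \<in> cball (Z y r) (\<delta> n) \<longrightarrow> b r x \<bullet> e \<le> q) \<longrightarrow> H y r \<bullet> e \<le> q)) \<and>
    \<bar>(LINT y|lborel. u y * (LINT x|lborel. \<rho> (y - x) * f t x)) - (LINT y|lborel. u (P y t) * (LINT x|lborel. \<rho> (y - x) * f 0 x))\<bar>
      \<le> ct * (2 * \<delta> n) + 2 * \<delta> n \<and>
    (\<forall>y. R \<le> norm y \<longrightarrow> u (P y t) = 0) \<and> continuous_on UNIV (\<lambda>y. u (P y t))"
    for n and \<rho> :: "real^'d \<Rightarrow> real" and P H Z :: "real^'d \<Rightarrow> real \<Rightarrow> real^'d"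
  have "(2 + R0) * exp (2 * ct) \<le> 2 + R" by (simp add: R_def)
  then have "\<exists>\<rho> P H Z. good n \<rho> P H Z" for n
    unfolding good_def ct_def by (intro approximate_flow[OF t(1) R0 \<delta> _ u Gu \<Lambda>(2) M u0])
  then obtain \<rho> P H Z where good: "\<And>n. good n (\<rho> n) (P n) (H n) (Z n)" by metis
  have \<rho>: "\<And>n. continuous_on UNIV (\<rho> n)" "\<And>n z. 0 \<le> \<rho> n z" "\<And>n z. \<delta> n \<le> norm z \<Longrightarrow> \<rho> n z = 0" "\<And>n. integral\<^sup>L lborel (\<rho> n) = 1"
    and H: "\<And>n y. H n y \<in> borel_measurable borel" "\<And>n y r. norm (H n y r) \<le> c r * ((2 + norm y) * exp ct)"
    and P: "\<And>n y a b. a \<le> b \<Longrightarrow> P n y b - P n y a = (LINT q:{a..b}|lborel. H n y q)" "\<And>n y. P n y 0 = y"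
    and Z: "\<And>n y r. 0 \<le> r \<Longrightarrow> norm (Z n y r - P n y r) \<le> \<delta> n * ((2 + norm y) * exp ct)"
    and est: "\<And>n. \<bar>(LINT y|lborel. u y * (LINT x|lborel. \<rho> n (y - x) * f t x)) - (LINT y|lborel. u (P n y t) * (LINT x|lborel. \<rho> n (y - x) * f 0 x))\<bar>
      \<le> ct * (2 * \<delta> n) + 2 * \<delta> n"
    and far: "\<And>n y. R \<le> norm y \<Longrightarrow> u (P n y t) = 0" and cont: "\<And>n. continuous_on UNIV (\<lambda>y. u (P n y t))"
    using good unfolding good_def by blast+
  have hull: "H n y r \<bullet> e \<le> q" if "AE x in lborel. x \<in> cball (Z n y r) (\<delta> n) \<longrightarrow> b r x \<bullet> e \<le> q" for n y r e q
    using good[of n, unfolded good_def] that by blast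
  define S where "S n x = (LINT y|lborel. \<rho> n (y - x) * u y)" for n x
  define U where "U n x = (LINT y|lborel. \<rho> n (y - x) * u (P n y t))" for n x
  have u0R: "u y = 0" if "R \<le> norm y" for y using u0 that RR by simp
  have aS1: "(LINT y|lborel. u y * (LINT x|lborel. \<rho> n (y - x) * f s x)) = (LINT x|lborel. S n x * f s x)" for n s
    unfolding S_def by (rule average_kernel(1)[OF uc u0R M \<rho> f_loc])
  have aS2: "S n \<in> borel_measurable borel" for n
    unfolding S_def[abs_def] by (rule average_kernel(2)[OF uc u0R M \<rho> f_loc])
  have aS3: "S n x = 0" if "R + \<delta> n \<le> norm x" for n x
    unfolding S_def by (rule average_kernel(3)[OF uc u0R M \<rho> f_loc that])
  have aS4: "\<bar>S n x - w\<bar> \<le> e" if "\<And>y. norm (y - x) < \<delta> n \<Longrightarrow> \<bar>u y - w\<bar> \<le> e" for n x w e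
    unfolding S_def by (rule average_kernel(4)[OF uc u0R M \<rho> f_loc that])
  have aU1: "(LINT y|lborel. u (P n y t) * (LINT x|lborel. \<rho> n (y - x) * f s x)) = (LINT x|lborel. U n x * f s x)" for n s
    unfolding U_def by (rule average_kernel(1)[OF cont far M \<rho> f_loc])
  have aU2: "U n \<in> borel_measurable borel" for n
    unfolding U_def[abs_def] by (rule average_kernel(2)[OF cont far M \<rho> f_loc])
  have aU3: "U n x = 0" if "R + \<delta> n \<le> norm x" for n x
    unfolding U_def by (rule average_kernel(3)[OF cont far M \<rho> f_loc that])
  have aU4: "\<bar>U n x - w\<bar> \<le> e" if "\<And>y. norm (y - x) < \<delta> n \<Longrightarrow> \<bar>u (P n y t) - w\<bar> \<le> e" for n x w e
    unfolding U_def by (rule average_kernel(4)[OF cont far M \<rho> f_loc that])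
  have hull': "AE r in lborel. r \<in> {0..T} \<longrightarrow> (\<forall>n y. in_hull (Bf r) (Z n y r) (\<delta> n) (H n y r))"
    using Bf
  proof eventually_elim
    case (elim r)
    show ?case
    proof (intro impI allI)
      fix n y assume "r \<in> {0..T}"
      with elim have ae: "AE x in lborel. Bf r x = b r x" by blast
      show "in_hull (Bf r) (Z n y r) (\<delta> n) (H n y r)"
        unfolding in_hull_def
      proof (intro allI conjI impI)
        fix i q
        show "H n y r $ i \<le> q" if le: "\<forall>x\<in>cball (Z n y r) (\<delta> n). Bf r x $ i \<le> q"
        proof -
          have "AE x in lborel. x \<in> cball (Z n y r) (\<delta> n) \<longrightarrow> b r x \<bullet> axis i 1 \<le> q"
            using ae
          proof eventually_elim
            case (elim x)
            show ?case unfolding elim[symmetric] inner_axis using le by simp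
          qed
          from hull[OF this] have "H n y r \<bullet> axis i 1 \<le> q" .
          then show ?thesis by (simp add: inner_axis)
        qed
        show "q \<le> H n y r $ i" if le: "\<forall>x\<in>cball (Z n y r) (\<delta> n). q \<le> Bf r x $ i"
        proof -
          have "AE x in lborel. x \<in> cball (Z n y r) (\<delta> n) \<longrightarrow> b r x \<bullet> (- axis i 1) \<le> - q"
            using ae
          proof eventually_elim
            case (elim x)
            show ?case unfolding elim[symmetric] inner_minus_right inner_axis using le by simp
          qed
          from hull[OF this] have "H n y r \<bullet> (- axis i 1) \<le> - q" .
          then show ?thesis by (simp add: inner_axis)
        qed
      qed
    qed
  qed
  have U_lim: "(\<lambda>n. U n x) \<longlonglongrightarrow> u (\<phi> t x)"
    if uq: "\<forall>\<gamma>. inclusion_solution T Bf 0 x \<gamma> \<longrightarrow> (\<forall>t\<in>{0..T}. \<gamma> t = \<phi> t x)" for x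
  proof -
    have paths: "(\<lambda>n. P n (y n) t) \<longlonglongrightarrow> \<phi> t x" if y: "\<And>n. norm (y n - x) \<le> \<delta> n" for y
    proof -
      define C where "C = (3 + norm x) * exp ct"
      have yn: "(2 + norm (y n)) * exp ct \<le> C" for n
        unfolding C_def using norm_triangle_ineq2[of "y n" x] y[of n] \<delta>(2)[of n] by (intro mult_right_mono) auto
      have y_lim: "y \<longlonglongrightarrow> x"
        by (rule LIM_zero_cancel, rule Lim_null_comparison[OF _ \<delta>0]) (use y in auto)
      have C: "0 \<le> C" by (simp add: C_def)
      have "approximate_paths T Bf (\<lambda>r. c r * C) (\<lambda>n. H n (y n)) (\<lambda>n. P n (y n)) (\<lambda>n r. if 0 \<le> r then Z n (y n) r else P n (y n) r) \<delta> x"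
      proof
        show "norm (H n (y n) r) \<le> c r * C" for n r
          by (rule order_trans[OF H(2) mult_left_mono[OF yn c_nonneg]])
        show "(\<lambda>n. P n (y n) 0) \<longlonglongrightarrow> x" using y_lim by (simp add: P(2))
        show "(\<lambda>n. (if 0 \<le> r then Z n (y n) r else P n (y n) r) - P n (y n) r) \<longlonglongrightarrow> 0" for r
        proof (rule Lim_null_comparison)
          have "norm ((if 0 \<le> r then Z n (y n) r else P n (y n) r) - P n (y n) r) \<le> \<delta> n * C" for n
            using order_trans[OF Z mult_left_mono[OF yn less_imp_le[OF \<delta>(1)]]] C \<delta>(1)[of n] by (cases "0 \<le> r") auto
          then show "\<forall>\<^sub>F n in sequentially. norm ((if 0 \<le> r then Z n (y n) r else P n (y n) r) - P n (y n) r) \<le> \<delta> n * C" by simp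
          show "(\<lambda>n. \<delta> n * C) \<longlonglongrightarrow> 0" using tendsto_mult_left_zero[OF \<delta>0] by simp
        qed
        show "AE r in lborel. r \<in> {0..T} \<longrightarrow> (\<forall>n. in_hull (Bf r) (if 0 \<le> r then Z n (y n) r else P n (y n) r) (\<delta> n) (H n (y n) r))"
          using hull' by eventually_elim auto
      qed (use T c_int c_nonneg c0 C H(1) P(1) \<delta>0 in auto)
      then show ?thesis
        by (rule approximate_paths_converge[where \<psi>="\<lambda>t. \<phi> t x"]) (use uq t in auto)
    qed
    show ?thesis
      unfolding tendsto_iff
    proof (intro allI impI)
      fix e :: real assume "0 < e"
      \<comment> \<open>The mean over starting points near \<open>x\<close> requires convergence uniform in them. The sequence \<open>y\<close> picks at each
        stage a starting point with a large deviation, if there is one; as the polygons from \<open>y n\<close> converge, this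
        happens only finitely often.\<close>
      define bad where "bad n y \<longleftrightarrow> norm (y - x) < \<delta> n \<and> e / 2 < \<bar>u (P n y t) - u (\<phi> t x)\<bar>" for n y
      define y where "y n = (if \<exists>z. bad n z then SOME z. bad n z else x)" for n
      have bad_y: "bad n (y n)" if "bad n z" for n z
        using someI[of "bad n" z] that unfolding y_def by auto
      have "norm (y n - x) \<le> \<delta> n" for n
      proof (cases "\<exists>z. bad n z")
        case True
        then obtain z where "bad n z" by blast
        from bad_y[OF this] show ?thesis by (simp add: bad_def)
      next
        case False then show ?thesis using \<delta>(1)[of n] by (simp add: y_def)
      qed
      from paths[of y, OF this] have "(\<lambda>n. u (P n (y n) t)) \<longlonglongrightarrow> u (\<phi> t x)"
        using uc unfolding continuous_on_sequentially comp_def by simp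
      then have "\<forall>\<^sub>F n in sequentially. dist (u (P n (y n) t)) (u (\<phi> t x)) < e / 2"
        using \<open>0 < e\<close> by (intro tendstoD) auto
      then show "\<forall>\<^sub>F n in sequentially. dist (U n x) (u (\<phi> t x)) < e"
      proof eventually_elim
        case (elim n)
        have nb: "\<not> bad n z" for z using bad_y[of n z] elim by (auto simp: bad_def dist_real_def)
        have "\<bar>u (P n z t) - u (\<phi> t x)\<bar> \<le> e / 2" if "norm (z - x) < \<delta> n" for z
          using nb[of z] that by (simp add: bad_def not_less)
        then have "\<bar>U n x - u (\<phi> t x)\<bar> \<le> e / 2" by (rule aU4)
        then show ?case using \<open>0 < e\<close> by (simp add: dist_real_def)
      qed
    qed
  qed
  have S_lim: "(\<lambda>n. S n x) \<longlonglongrightarrow> u x" for x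
  proof (rule LIM_zero_cancel, rule Lim_null_comparison)
    have Lip: "\<bar>u y - u x\<bar> \<le> \<Lambda> * norm (y - x)" for y
    proof -
      have "norm (Gu z \<bullet> w) \<le> \<Lambda> * norm w" for z w
        using order_trans[OF Cauchy_Schwarz_ineq2[of "Gu z" w] mult_right_mono[OF \<Lambda>(2)[of z] norm_ge_zero]] by simp
      then show ?thesis
        using has_derivative_imp_lipschitz[of UNIV u "\<lambda>x v. Gu x \<bullet> v" \<Lambda> x y] u \<Lambda>(1) by simp
    qed
    have "\<bar>S n x - u x\<bar> \<le> \<Lambda> * \<delta> n" for n
    proof (rule aS4)
      show "\<bar>u y - u x\<bar> \<le> \<Lambda> * \<delta> n" if "norm (y - x) < \<delta> n" for y
        by (rule order_trans[OF Lip]) (use that \<Lambda>(1) in \<open>auto intro: mult_left_mono\<close>)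
    qed
    then show "\<forall>\<^sub>F n in sequentially. norm (S n x - u x) \<le> \<Lambda> * \<delta> n" by simp
    show "(\<lambda>n. \<Lambda> * \<delta> n) \<longlonglongrightarrow> 0" using tendsto_mult_right_zero[OF \<delta>0] by simp
  qed
  have dom_int: "integrable lborel (\<lambda>x. M * norm (indicator (cball 0 (R + 1)) x *\<^sub>R f s x))" for s
    by (intro integrable_mult_right set_integrable_norm_cball f_loc)
  have Mn: "0 \<le> M" using order_trans[OF abs_ge_zero M] .
  have dom: "\<bar>Q x * f s x\<bar> \<le> M * norm (indicator (cball 0 (R + 1)) x *\<^sub>R f s x)"
    if "\<bar>Q x\<bar> \<le> M" "R + 1 \<le> norm x \<Longrightarrow> Q x = 0" for Q s x
    using that mult_right_mono[OF that(1), of "\<bar>f s x\<bar>"] Mn by (cases "norm x \<le> R + 1") (auto simp: abs_mult)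
  have fm: "f s \<in> borel_measurable borel" for s by (rule locally_integrable_measurable[OF f_loc])
  have Ub: "\<bar>U n x\<bar> \<le> M" "R + 1 \<le> norm x \<Longrightarrow> U n x = 0" for n x
    using aU4[of x n 0 M] M aU3[of n x] \<delta>(2)[of n] by auto
  have Sb: "\<bar>S n x\<bar> \<le> M" "R + 1 \<le> norm x \<Longrightarrow> S n x = 0" for n x
    using aS4[of x n 0 M] M aS3[of n x] \<delta>(2)[of n] by auto
  define W where "W x = lim (\<lambda>n. U n x)" for x
  have W_meas: "W \<in> borel_measurable borel" unfolding W_def by (rule borel_measurable_lim_metric) (rule aU2)
  have U_W: "AE x in lborel. (\<lambda>n. U n x) \<longlonglongrightarrow> W x \<and> W x = u (\<phi> t x)"
    using unique
  proof eventually_elim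
    case (elim x)
    from U_lim[OF elim] show ?case by (simp add: W_def limI)
  qed
  have limU: "(\<lambda>n. LINT x|lborel. U n x * f 0 x) \<longlonglongrightarrow> (LINT x|lborel. W x * f 0 x)" and W_int: "integrable lborel (\<lambda>x. W x * f 0 x)"
  proof -
    have ae: "AE x in lborel. (\<lambda>n. U n x * f 0 x) \<longlonglongrightarrow> W x * f 0 x"
      using U_W by eventually_elim (auto intro: tendsto_mult_right)
    have bd: "AE x in lborel. norm (U n x * f 0 x) \<le> M * norm (indicator (cball 0 (R + 1)) x *\<^sub>R f 0 x)" for n
      using dom[of "U n", OF Ub] by simp
    have m1: "(\<lambda>x. W x * f 0 x) \<in> borel_measurable lborel" using W_meas fm by simp
    have m2: "(\<lambda>x. U n x * f 0 x) \<in> borel_measurable lborel" for n using aU2 fm by simp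
    show "(\<lambda>n. LINT x|lborel. U n x * f 0 x) \<longlonglongrightarrow> (LINT x|lborel. W x * f 0 x)"
      by (rule integral_dominated_convergence[OF m1 m2 dom_int ae bd])
    show "integrable lborel (\<lambda>x. W x * f 0 x)"
      by (rule integrable_dominated_convergence[OF m1 m2 dom_int ae bd])
  qed
  have limS: "(\<lambda>n. LINT x|lborel. S n x * f t x) \<longlonglongrightarrow> (LINT x|lborel. u x * f t x)"
  proof (rule integral_dominated_convergence[OF _ _ dom_int])
    show "(\<lambda>x. u x * f t x) \<in> borel_measurable lborel" using borel_measurable_continuous_onI[OF uc] fm by simp
    show "(\<lambda>x. S n x * f t x) \<in> borel_measurable lborel" for n using aS2 fm by simp
    show "AE x in lborel. (\<lambda>n. S n x * f t x) \<longlonglongrightarrow> u x * f t x" by (intro AE_I2 tendsto_mult_right S_lim)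
    show "AE x in lborel. norm (S n x * f t x) \<le> M * norm (indicator (cball 0 (R + 1)) x *\<^sub>R f t x)" for n
      using dom[of "S n", OF Sb] by simp
  qed
  have "(\<lambda>n. (LINT x|lborel. S n x * f t x) - (LINT x|lborel. U n x * f 0 x)) \<longlonglongrightarrow> 0"
  proof (rule Lim_null_comparison)
    have "\<bar>(LINT x|lborel. S n x * f t x) - (LINT x|lborel. U n x * f 0 x)\<bar> \<le> ct * (2 * \<delta> n) + 2 * \<delta> n" for n
      using est[of n] unfolding aS1 aU1 .
    then show "\<forall>\<^sub>F n in sequentially. norm ((LINT x|lborel. S n x * f t x) - (LINT x|lborel. U n x * f 0 x)) \<le> ct * (2 * \<delta> n) + 2 * \<delta> n" by simp
    have "(\<lambda>n. ct * (2 * \<delta> n) + 2 * \<delta> n) \<longlonglongrightarrow> ct * (2 * 0) + 2 * 0" by (intro tendsto_intros \<delta>0)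
    then show "(\<lambda>n. ct * (2 * \<delta> n) + 2 * \<delta> n) \<longlonglongrightarrow> 0" by simp
  qed
  moreover have "(\<lambda>n. (LINT x|lborel. S n x * f t x) - (LINT x|lborel. U n x * f 0 x)) \<longlonglongrightarrow> (LINT x|lborel. u x * f t x) - (LINT x|lborel. W x * f 0 x)"
    by (intro tendsto_diff limS limU)
  ultimately have "(LINT x|lborel. W x * f 0 x) = (LINT x|lborel. u x * f t x)"
    using LIMSEQ_unique by fastforce
  moreover have "AE x in lborel. W x = u (\<phi> t x)" using U_W by eventually_elim simp
  ultimately show ?thesis using that W_meas W_int by blast
qed

section \<open>Smooth cut-off functions of intervals\<close>

lemma primitive_has_derivative:
  fixes \<eta> :: "real \<Rightarrow> real"
  assumes "continuous_on UNIV \<eta>" "integrable lborel \<eta>"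
  shows "((\<lambda>t. LINT q:{..t}|lborel. \<eta> q) has_real_derivative \<eta> t) (at t)"
proof -
  let ?K = "\<lambda>t. LINT q:{..t}|lborel. \<eta> q"
  have "((\<lambda>x. integral {t - 1..x} \<eta>) has_real_derivative \<eta> t) (at t within {t - 1..t + 1})"
    by (rule integral_has_real_derivative) (auto intro: continuous_on_subset[OF assms(1)])
  then have "((\<lambda>x. integral {t - 1..x} \<eta>) has_real_derivative \<eta> t) (at t)"
    by (simp add: at_within_Icc_at)
  then have "((\<lambda>x. ?K (t - 1) + integral {t - 1..x} \<eta>) has_real_derivative \<eta> t) (at t)"
    by (auto intro!: derivative_eq_intros)
  then show ?thesis
  proof (rule has_field_derivative_transform_within_open[where S="{t - 1<..}"])
    fix x assume "x \<in> {t - 1<..}"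
    then have "?K x - ?K (t - 1) = (LINT q:{t - 1..x}|lborel. \<eta> q)" by (intro set_integral_atMost_diff assms) auto
    also have "\<dots> = integral {t - 1..x} \<eta>"
      by (rule set_borel_integral_eq_integral(2)) (rule set_integrable_of_integrable[OF assms(2)], simp)
    finally show "?K (t - 1) + integral {t - 1..x} \<eta> = ?K x" by simp
  qed auto
qed

text \<open>If \<open>K\<close> is the primitive of a mollifier, then \<open>\<theta> t = K (t - a) - K (t - b)\<close>. Its derivative, a difference of two mollifiers,
turns a weak time derivative into a difference of approximate point evaluations.\<close>

lemma smooth_interval_indicator:
  fixes a b r :: real
  assumes r: "0 < r" and ab: "a \<le> b"
  obtains \<theta> \<rho> where "smooth \<theta>" "\<And>t. (\<theta> has_real_derivative (\<rho> (t - a) - \<rho> (t - b))) (at t)"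
    "continuous_on UNIV \<rho>" "\<And>z. 0 \<le> \<rho> z" "\<And>z. r \<le> \<bar>z\<bar> \<Longrightarrow> \<rho> z = 0" "integral\<^sup>L lborel \<rho> = 1"
    "\<And>t. 0 \<le> \<theta> t" "\<And>t. \<theta> t \<le> 1" "\<And>t. a + r \<le> t \<Longrightarrow> t \<le> b - r \<Longrightarrow> \<theta> t = 1" "\<And>t. t \<le> a - r \<or> b + r \<le> t \<Longrightarrow> \<theta> t = 0"
proof -
  obtain \<rho> :: "real \<Rightarrow> real" where \<rho>: "smooth \<rho>" "\<And>x. 0 \<le> \<rho> x" "\<And>x. r \<le> norm x \<Longrightarrow> \<rho> x = 0" "integral\<^sup>L lborel \<rho> = 1"
    using mollifier_exists[OF r] by blast
  have c: "continuous_on UNIV \<rho>" by (rule smooth_continuous[OF \<rho>(1)])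
  have i: "integrable lborel \<rho>" by (rule integrable_continuous_bounded_support[OF c \<rho>(3)])
  define K where "K t = (LINT q:{..t}|lborel. \<rho> q)" for t
  have K': "(K has_real_derivative \<rho> t) (at t)" for t
    unfolding K_def[abs_def] by (rule primitive_has_derivative[OF c i])
  have Ks: "smooth K" by (rule smooth_antiderivative[OF \<rho>(1) K'])
  have mono: "K s \<le> K t" if "s \<le> t" for s t
    unfolding K_def by (rule set_integral_nonneg_mono[OF i \<rho>(2)]) (use that in auto)
  have K0: "K t = 0" if "t \<le> - r" for t
  proof -
    have "(\<lambda>q. indicator {..t} q *\<^sub>R \<rho> q) = (\<lambda>q. 0)" using \<rho>(3) that r by (auto simp: indicator_def fun_eq_iff)
    then show ?thesis by (simp only: K_def set_lebesgue_integral_def integral_zero)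
  qed
  have K1: "K t = 1" if "r \<le> t" for t
  proof -
    have "(\<lambda>q. indicator {..t} q *\<^sub>R \<rho> q) = \<rho>" using \<rho>(3) that r by (auto simp: indicator_def fun_eq_iff)
    then show ?thesis using \<rho>(4) by (simp only: K_def set_lebesgue_integral_def)
  qed
  have Kb: "0 \<le> K t" "K t \<le> 1" for t
    using mono[of "min t (- r)" t] K0[of "min t (- r)"] mono[of t "max t r"] K1[of "max t r"] by auto
  define \<theta> where "\<theta> t = K (t - a) - K (t - b)" for t
  show ?thesis
  proof (rule that[of \<theta> \<rho>])
    have shift: "smooth (\<lambda>t. K (t - e))" for e
      using smooth_affine[OF Ks bounded_linear_ident, of "- e"] by simp
    have "smooth (\<lambda>t. K (t - a) + (- 1) * K (t - b))"
      by (intro smooth.add smooth.mult smooth.const shift)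
    then show "smooth \<theta>" by (simp add: \<theta>_def[abs_def])
    show "(\<theta> has_real_derivative (\<rho> (t - a) - \<rho> (t - b))) (at t)" for t
    proof -
      have "((\<lambda>t. K (t - e)) has_real_derivative \<rho> (t - e) * 1) (at t)" for e
        by (rule DERIV_chain2[OF K']) (auto intro!: derivative_eq_intros)
      from DERIV_diff[OF this[of a] this[of b]] show ?thesis by (simp add: \<theta>_def[abs_def])
    qed
    show "0 \<le> \<theta> t" "\<theta> t \<le> 1" for t using mono[of "t - b" "t - a"] ab Kb[of "t - a"] Kb[of "t - b"] by (auto simp: \<theta>_def)
    show "\<theta> t = 1" if "a + r \<le> t" "t \<le> b - r" for t using K1[of "t - a"] K0[of "t - b"] that by (simp add: \<theta>_def)
    show "\<theta> t = 0" if "t \<le> a - r \<or> b + r \<le> t" for t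
    proof -
      have "r \<le> t - a" if "b + r \<le> t" using that ab by linarith
      moreover have "t - b \<le> - r" if "t \<le> a - r" using that ab by linarith
      ultimately show ?thesis using that K0[of "t - a"] K0[of "t - b"] K1[of "t - a"] K1[of "t - b"] by (auto simp: \<theta>_def)
    qed
  qed (use c \<rho> in auto)
qed

lemma tendsto_box_indicator:
  fixes \<theta> :: "nat \<Rightarrow> real \<Rightarrow> real"
  assumes r: "r \<longlonglongrightarrow> (0::real)"
    and 1: "\<And>n t. a + r n \<le> t \<Longrightarrow> t \<le> b - r n \<Longrightarrow> \<theta> n t = 1" and 0: "\<And>n t. t \<le> a - r n \<or> b + r n \<le> t \<Longrightarrow> \<theta> n t = 0"
    and t: "t \<noteq> a" "t \<noteq> b"
  shows "(\<lambda>n. \<theta> n t) \<longlonglongrightarrow> indicator {a..b} t"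
proof (rule tendsto_eventually)
  define e where "e = min \<bar>t - a\<bar> \<bar>t - b\<bar>"
  have "0 < e" using t by (simp add: e_def)
  then have "\<forall>\<^sub>F n in sequentially. r n < e" using r by (rule order_tendstoD(2)[rotated])
  then show "\<forall>\<^sub>F n in sequentially. \<theta> n t = indicator {a..b} t"
  proof eventually_elim
    case (elim n)
    show ?case
    proof (cases "t \<in> {a..b}")
      case True
      then have "a + r n \<le> t" "t \<le> b - r n" using elim t by (auto simp: e_def abs_if split: if_splits)
      then show ?thesis using 1 True by simp
    next
      case False
      then have "t \<le> a - r n \<or> b + r n \<le> t" using elim t by (auto simp: e_def abs_if split: if_splits)
      then show ?thesis using 0 False by simp
    qed
  qed
qed

section \<open>Distributional solutions in integrated form\<close>

text \<open>Freezing a solution before \<open>0\<close> and after \<open>T\<close> extends it to all times; the field is extended by zero.\<close>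

definition time_clamp :: "real \<Rightarrow> real \<Rightarrow> real" where "time_clamp T t = max 0 (min T t)"

lemma time_clamp_mem: "0 < T \<Longrightarrow> time_clamp T t \<in> {0..T}" by (auto simp: time_clamp_def)

lemma time_clamp_id: "t \<in> {0..T} \<Longrightarrow> time_clamp T t = t" by (auto simp: time_clamp_def)

lemma time_clamp_cont: "continuous_on UNIV (time_clamp T)"
  unfolding time_clamp_def by (intro continuous_intros)

lemma real_of_ereal_ge_1: "1 \<le> p \<Longrightarrow> p \<noteq> \<infinity> \<Longrightarrow> 1 \<le> real_of_ereal p"
  by (cases p) auto

lemma Lp_loc_integrable:
  fixes g :: "'a::euclidean_space \<Rightarrow> real"
  assumes g: "Lp_loc p g" and p: "1 \<le> p"
  shows "set_integrable lebesgue (cball 0 R) g"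
proof -
  have gm: "g \<in> borel_measurable lebesgue" using g by (simp add: Lp_loc_def)
  have K: "compact (cball (0::'a) R)" by simp
  have ind: "integrable lebesgue (\<lambda>x::'a. M * indicator (cball 0 R) x)" for M :: real
    using emeasure_bounded_finite[of "cball (0::'a) R"]
    by (intro integrable_mult_right integrable_real_indicator) auto
  have im: "(\<lambda>x. indicator (cball 0 R) x *\<^sub>R g x) \<in> borel_measurable lebesgue"
    using gm by (intro borel_measurable_scaleR borel_measurable_indicator) auto
  show ?thesis
  proof (cases "p = \<infinity>")
    case True
    then have "\<exists>M. AE x in lebesgue. x \<in> cball 0 R \<longrightarrow> \<bar>g x\<bar> \<le> M"
      using g[unfolded Lp_loc_def, THEN conjunct2, rule_format, OF K] by simp
    then obtain M where M: "AE x in lebesgue. x \<in> cball 0 R \<longrightarrow> \<bar>g x\<bar> \<le> M" by blast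
    show ?thesis unfolding set_integrable_def
      by (rule Bochner_Integration.integrable_bound[OF ind[of M] im]) (use M in \<open>eventually_elim, auto simp: indicator_def\<close>)
  next
    case False
    define P where "P = real_of_ereal p"
    have P: "1 \<le> P" unfolding P_def by (rule real_of_ereal_ge_1[OF p False])
    have int: "integrable lebesgue (\<lambda>x. indicator (cball 0 R) x *\<^sub>R (\<bar>g x\<bar> powr P))"
      using g K False by (auto simp: Lp_loc_def P_def set_integrable_def)
    have le: "\<bar>g x\<bar> \<le> 1 + \<bar>g x\<bar> powr P" for x
    proof (cases "\<bar>g x\<bar> \<le> 1")
      case True then show ?thesis using powr_ge_zero[of "\<bar>g x\<bar>" P] by linarith
    next
      case False then show ?thesis using powr_mono[OF P, of "\<bar>g x\<bar>"] by simp
    qed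
    show ?thesis unfolding set_integrable_def
      by (rule Bochner_Integration.integrable_bound[OF Bochner_Integration.integrable_add[OF ind[of 1] int] im])
        (use le in \<open>auto simp: indicator_def intro!: AE_I2\<close>)
  qed
qed

text \<open>For finite \<open>p\<close>, local convergence in \<open>L\<^sup>p\<close> implies local convergence in \<open>L\<^sup>1\<close>, because \<open>z \<le> e + e powr (1 - p) z powr p\<close> for \<open>z \<ge> 0\<close> and
every \<open>e > 0\<close>; for \<open>p = \<infinity>\<close> the weight \<open>q\<close> is itself one of the functions that define the topology.\<close>

lemma C_Lp_loc_weakly_continuous:
  fixes f :: "real \<Rightarrow> 'a::euclidean_space \<Rightarrow> real"
  assumes f: "C_Lp_loc T p f" and p: "1 \<le> p"
    and q: "q \<in> borel_measurable borel" "\<And>x. \<bar>q x\<bar> \<le> C" "\<And>x. R \<le> norm x \<Longrightarrow> q x = 0"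
  shows "continuous_on {0..T} (\<lambda>t. LINT x|lebesgue. f t x * q x)"
proof -
  have C0: "0 \<le> C" using order_trans[OF abs_ge_zero q(2)] .
  have qm: "q \<in> borel_measurable lebesgue" using q(1) by (simp add: measurable_completion)
  have ind: "integrable lebesgue (\<lambda>x::'a. M * indicator (cball 0 R) x)" for M :: real
    using emeasure_bounded_finite[of "cball (0::'a) R"]
    by (intro integrable_mult_right integrable_real_indicator) auto
  have q_ind: "\<bar>q x\<bar> \<le> C * indicator (cball 0 R) x" for x
    using q(2)[of x] q(3)[of x] by (cases "norm x \<le> R") auto
  show ?thesis
  proof (cases "p = \<infinity>")
    case True
    have "integrable lebesgue q"
      by (rule Bochner_Integration.integrable_bound[OF ind[of C] qm]) (use q_ind C0 in \<open>auto intro!: AE_I2\<close>)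
    moreover have "bounded {x. q x \<noteq> 0}"
    proof (rule bounded_subset[OF bounded_cball])
      show "{x. q x \<noteq> 0} \<subseteq> cball 0 R"
      proof
        fix x assume "x \<in> {x. q x \<noteq> 0}"
        then have "\<not> R \<le> norm x" using q(3) by auto
        then show "x \<in> cball 0 R" by simp
      qed
    qed
    ultimately show ?thesis using f True by (auto simp: C_Lp_loc_def)
  next
    case False
    define P where "P = real_of_ereal p"
    have P: "1 \<le> P" unfolding P_def by (rule real_of_ereal_ge_1[OF p False])
    let ?K = "cball (0::'a) R"
    have fL: "Lp_loc p (f t)" if "t \<in> {0..T}" for t using f that by (auto simp: C_Lp_loc_def)
    have fm: "f t \<in> borel_measurable lebesgue" if "t \<in> {0..T}" for t using fL[OF that] by (simp add: Lp_loc_def)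
    have fP: "integrable lebesgue (\<lambda>x. indicator ?K x *\<^sub>R (\<bar>f t x\<bar> powr P))" if "t \<in> {0..T}" for t
      using fL[OF that] False by (auto simp: Lp_loc_def P_def set_integrable_def)
    have f1: "integrable lebesgue (\<lambda>x. indicator ?K x *\<^sub>R f t x)" if "t \<in> {0..T}" for t
      using Lp_loc_integrable[OF fL[OF that] p, of R] by (simp add: set_integrable_def)
    have fq: "integrable lebesgue (\<lambda>x. f t x * q x)" if "t \<in> {0..T}" for t
    proof (rule Bochner_Integration.integrable_bound[of _ "\<lambda>x. C * (indicator ?K x *\<^sub>R f t x)"])
      show "AE x in lebesgue. norm (f t x * q x) \<le> norm (C * (indicator ?K x *\<^sub>R f t x))"
      proof (rule AE_I2)
        fix x
        have "\<bar>f t x\<bar> * \<bar>q x\<bar> \<le> \<bar>f t x\<bar> * (C * indicator ?K x)" by (rule mult_left_mono[OF q_ind abs_ge_zero])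
        then show "norm (f t x * q x) \<le> norm (C * (indicator ?K x *\<^sub>R f t x))"
          using C0 by (simp add: abs_mult ac_simps)
      qed
    qed (use f1[OF that] fm[OF that] qm in auto)
    show ?thesis
      unfolding continuous_on_def
    proof
      fix t0 assume t0: "t0 \<in> {0..T}"
      define I where "I t = (LINT x:?K|lebesgue. \<bar>f t x - f t0 x\<bar> powr P)" for t
      have I0: "(I \<longlongrightarrow> 0) (at t0 within {0..T})"
        using f False t0 unfolding C_Lp_loc_def I_def P_def by auto
      have dP: "integrable lebesgue (\<lambda>x. indicator ?K x *\<^sub>R (\<bar>f t x - f t0 x\<bar> powr P))" if t: "t \<in> {0..T}" for t
      proof (rule Bochner_Integration.integrable_bound)
        show "integrable lebesgue (\<lambda>x. 2 powr P * (indicator ?K x *\<^sub>R (\<bar>f t x\<bar> powr P) + indicator ?K x *\<^sub>R (\<bar>f t0 x\<bar> powr P)))"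
          using fP[OF t] fP[OF t0] by (intro integrable_mult_right Bochner_Integration.integrable_add)
        show "(\<lambda>x. indicator ?K x *\<^sub>R (\<bar>f t x - f t0 x\<bar> powr P)) \<in> borel_measurable lebesgue"
          using fm[OF t] fm[OF t0] by (intro borel_measurable_scaleR borel_measurable_indicator) auto
        have "\<bar>a - b\<bar> powr P \<le> 2 powr P * (\<bar>a\<bar> powr P + \<bar>b\<bar> powr P)" for a b :: real
        proof -
          have "\<bar>a - b\<bar> powr P \<le> (2 * max \<bar>a\<bar> \<bar>b\<bar>) powr P" using P by (intro powr_mono2) auto
          also have "\<dots> = 2 powr P * (max \<bar>a\<bar> \<bar>b\<bar>) powr P" by (simp add: powr_mult)
          also have "\<dots> \<le> 2 powr P * (\<bar>a\<bar> powr P + \<bar>b\<bar> powr P)"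
            by (intro mult_left_mono) (auto simp: max_def)
          finally show ?thesis .
        qed
        then show "AE x in lebesgue. norm (indicator ?K x *\<^sub>R (\<bar>f t x - f t0 x\<bar> powr P))
            \<le> norm (2 powr P * (indicator ?K x *\<^sub>R (\<bar>f t x\<bar> powr P) + indicator ?K x *\<^sub>R (\<bar>f t0 x\<bar> powr P)))"
          by (auto intro!: AE_I2 simp: indicator_def)
      qed
      define vol where "vol = measure lebesgue ?K"
      have est: "\<bar>(LINT x|lebesgue. f t x * q x) - (LINT x|lebesgue. f t0 x * q x)\<bar> \<le> C * (e * vol + e powr (1 - P) * I t)"
        if t: "t \<in> {0..T}" and e: "0 < e" for t e
      proof -
        have young: "\<bar>d\<bar> \<le> e + e powr (1 - P) * \<bar>d\<bar> powr P" for d :: real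
        proof (cases "\<bar>d\<bar> \<le> e")
          case True then show ?thesis by (intro add_increasing2) auto
        next
          case False
          then have d: "0 < \<bar>d\<bar>" "e \<le> \<bar>d\<bar>" using e by auto
          have "\<bar>d\<bar> = \<bar>d\<bar> powr (1 - P) * \<bar>d\<bar> powr P" using d(1) by (simp flip: powr_add)
          also have "\<dots> \<le> e powr (1 - P) * \<bar>d\<bar> powr P"
            using powr_mono2'[of "1 - P" e "\<bar>d\<bar>"] P e d by (intro mult_right_mono) auto
          finally show ?thesis using e by simp
        qed
        have "(LINT x|lebesgue. f t x * q x) - (LINT x|lebesgue. f t0 x * q x) = (LINT x|lebesgue. f t x * q x - f t0 x * q x)"
          using fq[OF t] fq[OF t0] by simp
        also have "norm \<dots> \<le> (LINT x|lebesgue. C * (e * indicator ?K x + e powr (1 - P) * (indicator ?K x *\<^sub>R (\<bar>f t x - f t0 x\<bar> powr P))))"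
        proof (rule Bochner_Integration.integral_norm_bound_integral)
          show "integrable lebesgue (\<lambda>x. f t x * q x - f t0 x * q x)" using fq[OF t] fq[OF t0] by simp
          show "integrable lebesgue (\<lambda>x. C * (e * indicator ?K x + e powr (1 - P) * (indicator ?K x *\<^sub>R (\<bar>f t x - f t0 x\<bar> powr P))))"
            by (intro integrable_mult_right Bochner_Integration.integrable_add dP[OF t] ind)
          fix x
          have "norm (f t x * q x - f t0 x * q x) = \<bar>f t x - f t0 x\<bar> * \<bar>q x\<bar>"
            by (simp add: left_diff_distrib[symmetric] abs_mult)
          also have "\<dots> \<le> (e + e powr (1 - P) * \<bar>f t x - f t0 x\<bar> powr P) * (C * indicator ?K x)"
            using young q_ind[of x] C0 by (intro mult_mono) (auto intro: order_trans[OF abs_ge_zero young])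
          also have "\<dots> = C * (e * indicator ?K x + e powr (1 - P) * (indicator ?K x *\<^sub>R (\<bar>f t x - f t0 x\<bar> powr P)))"
            by (simp add: algebra_simps)
          finally show "norm (f t x * q x - f t0 x * q x) \<le> C * (e * indicator ?K x + e powr (1 - P) * (indicator ?K x *\<^sub>R (\<bar>f t x - f t0 x\<bar> powr P)))" .
        qed
        also have "\<dots> = C * (e * vol + e powr (1 - P) * I t)"
          using dP[OF t] ind[of e] by (simp add: I_def set_lebesgue_integral_def vol_def emeasure_bounded_finite)
        finally show ?thesis by simp
      qed
      show "((\<lambda>t. LINT x|lebesgue. f t x * q x) \<longlongrightarrow> (LINT x|lebesgue. f t0 x * q x)) (at t0 within {0..T})"
        unfolding tendsto_iff
      proof (intro allI impI)
        fix \<epsilon> :: real assume "0 < \<epsilon>"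
        define e where "e = \<epsilon> / (2 * (C * vol + 1))"
        have v0: "0 \<le> C * vol" using C0 by (simp add: vol_def)
        have e: "0 < e" using \<open>0 < \<epsilon>\<close> v0 by (simp add: e_def add_nonneg_pos)
        have e1: "C * (e * vol) < \<epsilon>"
        proof -
          have "C * (e * vol) = e * (C * vol)" by simp
          also have "\<dots> < e * (2 * (C * vol + 1))" using e v0 by (intro mult_strict_left_mono) auto
          also have "\<dots> = \<epsilon>" using v0 by (simp add: e_def)
          finally show ?thesis .
        qed
        have "((\<lambda>t. C * (e * vol + e powr (1 - P) * I t)) \<longlongrightarrow> C * (e * vol + e powr (1 - P) * 0)) (at t0 within {0..T})"
          by (intro tendsto_intros I0)
        then have "\<forall>\<^sub>F t in at t0 within {0..T}. C * (e * vol + e powr (1 - P) * I t) < \<epsilon>"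
          using e1 by (intro order_tendstoD(2)) auto
        moreover have "\<forall>\<^sub>F t in at t0 within {0..T}. t \<in> {0..T}" by (auto simp: eventually_at_filter)
        ultimately show "\<forall>\<^sub>F t in at t0 within {0..T}. dist (LINT x|lebesgue. f t x * q x) (LINT x|lebesgue. f t0 x * q x) < \<epsilon>"
        proof eventually_elim
          case (elim t)
          then show ?case using est[OF elim(2) e] by (simp add: dist_real_def)
        qed
      qed
    qed
  qed
qed

text \<open>Transfers integrals of Lebesgue measurable functions to Borel representatives, for which product measurability and Fubini
are available.\<close>

lemma lebesgue_lborel_integral_cong:
  fixes g h :: "'a::euclidean_space \<Rightarrow> real"
  assumes "h \<in> borel_measurable borel" "AE x in lborel. g x = h x"
  shows "(LINT x|lebesgue. g x) = (LINT x|lborel. h x)" "integrable lebesgue g \<longleftrightarrow> integrable lborel h"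
proof -
  have ae: "AE x in lebesgue. h x = g x" using AE_completion[OF assms(2)] by (auto simp: eq_commute)
  have hm: "h \<in> borel_measurable lebesgue" using assms(1) by (simp add: measurable_completion)
  have gm: "g \<in> borel_measurable lebesgue" by (rule borel_measurable_AE[OF hm ae])
  have "(LINT x|lebesgue. g x) = (LINT x|lebesgue. h x)"
    by (rule integral_cong_AE[OF gm hm]) (use ae in \<open>auto simp: eq_commute\<close>)
  also have "\<dots> = (LINT x|lborel. h x)" using assms(1) by (intro integral_completion) simp
  finally show "(LINT x|lebesgue. g x) = (LINT x|lborel. h x)" .
  have "integrable lebesgue g \<longleftrightarrow> integrable lebesgue h"
    by (rule integrable_cong_AE[OF gm hm]) (use ae in \<open>auto simp: eq_commute\<close>)
  also have "\<dots> \<longleftrightarrow> integrable lborel h" using assms(1) by (intro integrable_completion) simp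
  finally show "integrable lebesgue g \<longleftrightarrow> integrable lborel h" .
qed

lemma representative_weakly_continuous:
  fixes f F :: "real \<Rightarrow> 'a::euclidean_space \<Rightarrow> real"
  assumes f: "C_Lp_loc T p f" and p: "1 \<le> p" and T: "0 < T"
    and F: "\<And>t. F t \<in> borel_measurable borel" "\<And>t. AE x in lborel. f (time_clamp T t) x = F t x"
  shows "weakly_continuous F"
proof
  have fL: "Lp_loc p (f (time_clamp T t))" for t using f time_clamp_mem[OF T] by (auto simp: C_Lp_loc_def)
  show "locally_integrable (F t)" for t
    unfolding locally_integrable_def set_integrable_def
  proof
    fix R
    have ae: "AE x in lborel. indicator (cball 0 R) x *\<^sub>R f (time_clamp T t) x = indicator (cball 0 R) x *\<^sub>R F t x"
      using F(2)[of t] by eventually_elim simp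
    have m: "(\<lambda>x. indicator (cball 0 R) x *\<^sub>R F t x) \<in> borel_measurable borel"
      using F(1)[of t] by (intro borel_measurable_scaleR borel_measurable_indicator) auto
    have "integrable lebesgue (\<lambda>x. indicator (cball 0 R) x *\<^sub>R f (time_clamp T t) x)"
      using Lp_loc_integrable[OF fL p] by (simp add: set_integrable_def)
    then show "integrable lborel (\<lambda>x. indicator (cball 0 R) x *\<^sub>R F t x)"
      by (rule lebesgue_lborel_integral_cong(2)[OF m ae, THEN iffD1])
  qed
  show "continuous_on UNIV (\<lambda>t. LINT x|lborel. q x * F t x)"
    if q: "q \<in> borel_measurable borel" "\<And>x. \<bar>q x\<bar> \<le> C" "\<And>x. R \<le> norm x \<Longrightarrow> q x = 0" for q C R
  proof -
    have "continuous_on {0..T} (\<lambda>t. LINT x|lebesgue. f t x * q x)" by (rule C_Lp_loc_weakly_continuous[OF f p q])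
    then have "continuous_on UNIV (\<lambda>t. LINT x|lebesgue. f (time_clamp T t) x * q x)"
      by (rule continuous_on_compose2[OF _ time_clamp_cont]) (use time_clamp_mem[OF T] in auto)
    moreover have "(LINT x|lebesgue. f (time_clamp T t) x * q x) = (LINT x|lborel. q x * F t x)" for t
    proof (rule lebesgue_lborel_integral_cong(1))
      show "(\<lambda>x. q x * F t x) \<in> borel_measurable borel" using q(1) F(1)[of t] by simp
      show "AE x in lborel. f (time_clamp T t) x * q x = q x * F t x" using F(2)[of t] by eventually_elim simp
    qed
    ultimately show ?thesis by simp
  qed
qed

lemma distributional_solution_tested:
  fixes b :: "real \<Rightarrow> real^'d \<Rightarrow> real^'d" and \<theta> \<theta>' :: "real \<Rightarrow> real" and k :: "real^'d \<Rightarrow> real"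
  assumes sol: "distributional_solution T b f"
    and \<theta>: "smooth \<theta>" "\<And>t. (\<theta> has_real_derivative \<theta>' t) (at t)" "\<And>t. t \<notin> {a..a'} \<Longrightarrow> \<theta> t = 0" and a: "0 < a" "a' < T"
    and k: "smooth k" "\<And>x. (k has_derivative (\<lambda>w. G x \<bullet> w)) (at x)" "\<And>x. R \<le> norm x \<Longrightarrow> k x = 0"
  shows "(LINT t|lebesgue_on {0..T}. LINT x|lebesgue. f t x * (\<theta>' t * k x + \<theta> t * (G x \<bullet> b t x))) = 0"
proof -
  define \<psi> where "\<psi> z = \<theta> (fst z) * k (snd z)" for z :: "real \<times> (real^'d)"
  have "smooth (\<lambda>z::real \<times> (real^'d). \<theta> (0 + fst z))" "smooth (\<lambda>z::real \<times> (real^'d). k (0 + snd z))"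
    by (rule smooth_affine[OF \<theta>(1) bounded_linear_fst], rule smooth_affine[OF k(1) bounded_linear_snd])
  then have sm: "smooth \<psi>" unfolding \<psi>_def[abs_def] by (intro smooth.mult) simp_all
  have "test_fun ({0<..<T} \<times> UNIV) \<psi>"
  proof (rule test_fun_smooth[OF sm, of "{a..a'} \<times> cball 0 R"])
    show "\<psi> z = 0" if "z \<notin> {a..a'} \<times> cball 0 R" for z
      using that \<theta>(3)[of "fst z"] k(3)[of "snd z"] by (cases z) (auto simp: \<psi>_def)
  qed (use a in \<open>auto intro: compact_Times\<close>)
  moreover have "frechet_derivative \<psi> (at (t, x)) (1, w) = \<theta>' t * k x + \<theta> t * (G x \<bullet> w)" for t x w
  proof -
    have "((\<lambda>z::real \<times> (real^'d). \<theta> (fst z)) has_derivative (\<lambda>h. \<theta>' t * fst h)) (at (t, x))"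
      by (rule has_derivative_compose[of fst fst "(t, x)" UNIV \<theta> "(*) (\<theta>' t)"])
        (use \<theta>(2)[of t] in \<open>auto simp: has_field_derivative_def intro!: derivative_intros\<close>)
    moreover have "((\<lambda>z::real \<times> (real^'d). k (snd z)) has_derivative (\<lambda>h. G x \<bullet> snd h)) (at (t, x))"
      by (rule has_derivative_compose[of snd snd "(t, x)" UNIV k "\<lambda>w. G x \<bullet> w"])
        (use k(2)[of x] in \<open>auto intro!: derivative_intros\<close>)
    ultimately have "(\<psi> has_derivative (\<lambda>h. \<theta> (fst (t, x)) * (G x \<bullet> snd h) + (\<theta>' t * fst h) * k (snd (t, x)))) (at (t, x))"
      unfolding \<psi>_def[abs_def] by (rule has_derivative_mult)
    from frechet_derivative_at[OF this, symmetric] show ?thesis by simp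
  qed
  ultimately show ?thesis using sol unfolding distributional_solution_def by auto
qed

text \<open>Letting the smoothed indicators of \<open>{a..a'}\<close> converge turns the tested equation into the integrated one for
\<open>0 < a \<le> a' < T\<close>. Continuity of the moments extends it to the closed interval, and outside of it both sides are constant.\<close>

lemma distributional_equation:
  fixes b bb :: "real \<Rightarrow> real^'d \<Rightarrow> real^'d" and f F :: "real \<Rightarrow> real^'d \<Rightarrow> real"
  assumes sol: "distributional_solution T b f" and T: "0 < T"
    and wc: "weakly_continuous F" and F: "\<And>t. AE x in lborel. f (time_clamp T t) x = F t x" "\<And>t. F t = F (time_clamp T t)"
    and bb: "case_prod bb \<in> borel_measurable (lborel \<Otimes>\<^sub>M lborel)" "\<And>r x. norm (bb r x) \<le> c r * (1 + norm x)"
    and c: "integrable lborel c" "\<And>r. 0 \<le> c r" "\<And>r. r \<notin> {0..T} \<Longrightarrow> c r = 0"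
    and b: "AE r in lborel. r \<in> {0..T} \<longrightarrow> (AE x in lborel. b r x = bb r x)"
    and mass: "\<And>R t. (LINT x:cball 0 R|lborel. \<bar>F t x\<bar>) \<le> A R"
    and k: "smooth k" "\<And>x. R \<le> norm x \<Longrightarrow> k x = 0" "\<And>x. (k has_derivative (\<lambda>w. G x \<bullet> w)) (at x)" and st: "s \<le> t"
  shows "(LINT x|lborel. k x * F t x) - (LINT x|lborel. k x * F s x) = (LINT r:{s..t}|lborel. LINT x|lborel. (G x \<bullet> bb r x) * F r x)"
    and "integrable lborel (\<lambda>r. LINT x|lborel. (G x \<bullet> bb r x) * F r x)"
    and "\<And>r. integrable lborel (\<lambda>x. (G x \<bullet> bb r x) * F r x)"
proof -
  interpret weakly_continuous F by fact
  have kc: "continuous_on UNIV k" by (rule smooth_continuous[OF k(1)])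
  have Gc: "continuous_on UNIV G"
  proof -
    obtain G' where G': "\<And>x. (k has_derivative (\<lambda>v. G' x \<bullet> v)) (at x)" "continuous_on UNIV G'"
      using smooth_gradient[OF k(1)] by blast
    have "G x = G' x" for x
    proof -
      have "(\<lambda>v. G x \<bullet> v) = (\<lambda>v. G' x \<bullet> v)" by (rule has_derivative_unique[OF k(3) G'(1)])
      then show ?thesis by (metis inner_commute vector_eq_rdot)
    qed
    then show ?thesis using G'(2) by simp
  qed
  have G0: "G x = 0" if "R + 1 \<le> norm x" for x
    by (rule gradient_zero_outside[OF k(3), of "2 + R"]) (use k(2) that in auto)
  obtain M where M: "M > 0" "\<And>x. \<bar>k x\<bar> \<le> M" using kernel_bounded[where k=k and \<delta>=R, OF kc k(2)] by auto
  obtain M1 where M1: "M1 > 0" "\<And>x. norm (G x) \<le> M1" using kernel_bounded[where k=G and \<delta>="R + 1", OF Gc G0] by auto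
  note [measurable] = borel_measurable_continuous_onI[OF kc] borel_measurable_continuous_onI[OF Gc]
  have Fm: "F r \<in> borel_measurable borel" for r by (rule locally_integrable_measurable[OF f_loc])
  have bbm: "bb r \<in> borel_measurable borel" for r using measurable_Pair2[OF bb(1), of r] by simp
  define F0 where "F0 r = (LINT x|lborel. k x * F r x)" for r
  define \<Gamma> where "\<Gamma> r = (LINT x|lborel. (G x \<bullet> bb r x) * F r x)" for r
  have F0c: "continuous_on UNIV F0" unfolding F0_def by (rule weak_cont[OF _ M(2) k(2)]) auto
  have Gb: "\<bar>G x \<bullet> bb r x\<bar> \<le> M1 * (c r * (2 + \<bar>R\<bar>))" for x r
  proof (cases "R + 1 \<le> norm x")
    case True then show ?thesis using G0 M1 c(2)[of r] by simp
  next
    case False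
    then have "norm (bb r x) \<le> c r * (2 + \<bar>R\<bar>)" using c(2)[of r] by (intro order_trans[OF bb(2) mult_left_mono]) auto
    then show ?thesis using M1 by (intro order_trans[OF Cauchy_Schwarz_ineq2 mult_mono]) auto
  qed
  have \<Gamma>m: "\<Gamma> \<in> borel_measurable borel"
  proof -
    have "(\<lambda>z. LINT x|lborel. (G x \<bullet> bb (fst z) x) * F (fst z) x) \<in> borel_measurable (lborel \<Otimes>\<^sub>M (lborel :: (real^'d) measure))"
    proof (rule param_integral_measurable[where C="\<lambda>z. M1 * (c (fst z) * (2 + \<bar>R\<bar>))" and R="\<lambda>z. R + 1"])
      have "(\<lambda>p::(real \<times> (real^'d)) \<times> (real^'d). case_prod bb (fst (fst p), snd p)) \<in> borel_measurable ((lborel \<Otimes>\<^sub>M lborel) \<Otimes>\<^sub>M lborel)"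
        by (rule measurable_compose[OF _ bb(1)]) measurable
      then have "(\<lambda>p::(real \<times> (real^'d)) \<times> (real^'d). G (snd p) \<bullet> bb (fst (fst p)) (snd p)) \<in> borel_measurable ((lborel \<Otimes>\<^sub>M lborel) \<Otimes>\<^sub>M lborel)"
        by simp
      then show "(\<lambda>(z::real \<times> (real^'d), x). G x \<bullet> bb (fst z) x) \<in> borel_measurable ((lborel \<Otimes>\<^sub>M lborel) \<Otimes>\<^sub>M lborel)"
        by (simp add: split_beta')
    qed (use Gb G0 in auto)
    from measurable_Pair1[OF this, of 0] show ?thesis by (simp add: \<Gamma>_def[abs_def])
  qed
  have F_int: "integrable lborel (\<lambda>x. indicator (cball 0 (R + 1)) x *\<^sub>R \<bar>F r x\<bar>)" for r
    using set_integrable_norm_cball[OF f_loc, of "R + 1" r] by (simp add: abs_mult)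
  have GF_le: "norm ((G x \<bullet> bb r x) * F r x) \<le> M1 * (c r * (2 + \<bar>R\<bar>)) * (indicator (cball 0 (R + 1)) x *\<^sub>R \<bar>F r x\<bar>)" for r x
  proof (cases "norm x \<le> R + 1")
    case True then show ?thesis using mult_right_mono[OF Gb[of x r] abs_ge_zero[of "F r x"]] by (simp add: abs_mult)
  next
    case False then show ?thesis using G0[of x] by simp
  qed
  have GF_int: "integrable lborel (\<lambda>x. (G x \<bullet> bb r x) * F r x)" for r
    by (rule Bochner_Integration.integrable_bound[OF integrable_mult_right[OF F_int[of r], of "M1 * (c r * (2 + \<bar>R\<bar>))"]])
      (use Fm bbm order_trans[OF GF_le abs_ge_self] in auto)
  have \<Gamma>b: "\<bar>\<Gamma> r\<bar> \<le> c r * (M1 * (2 + \<bar>R\<bar>) * A (R + 1))" for r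
  proof -
    have "norm (\<Gamma> r) \<le> (LINT x|lborel. M1 * (c r * (2 + \<bar>R\<bar>)) * (indicator (cball 0 (R + 1)) x *\<^sub>R \<bar>F r x\<bar>))"
      unfolding \<Gamma>_def
      by (rule Bochner_Integration.integral_norm_bound_integral[OF GF_int integrable_mult_right[OF F_int] GF_le])
    also have "\<dots> = M1 * (c r * (2 + \<bar>R\<bar>)) * (LINT x:cball 0 (R + 1)|lborel. \<bar>F r x\<bar>)"
      by (simp add: set_lebesgue_integral_def)
    also have "\<dots> \<le> M1 * (c r * (2 + \<bar>R\<bar>)) * A (R + 1)" using M1 c(2)[of r] mass by (intro mult_left_mono) auto
    finally show ?thesis by (simp add: ac_simps)
  qed
  have \<Gamma>i: "integrable lborel \<Gamma>"
    by (rule Bochner_Integration.integrable_bound[OF integrable_mult_left[OF c(1), of "M1 * (2 + \<bar>R\<bar>) * A (R + 1)"]])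
      (use \<Gamma>m order_trans[OF \<Gamma>b abs_ge_self] in auto)
  have \<Gamma>0: "\<Gamma> r = 0" if "r \<notin> {0..T}" for r using \<Gamma>b[of r] c(3)[OF that] by simp
  have inner: "F0 a - F0 a' + (LINT r:{a..a'}|lborel. \<Gamma> r) = 0" if a: "0 < a" "a \<le> a'" "a' < T" for a a'
  proof -
    define r where "r n = min (a / 2) ((T - a') / 2) * inverse (real (Suc n))" for n
    have m: "0 < min (a / 2) ((T - a') / 2)" using a by auto
    have r: "0 < r n" "r n < a" "r n < T - a'" for n
    proof -
      show "0 < r n" using m by (simp add: r_def)
      have "r n \<le> min (a / 2) ((T - a') / 2) * 1" unfolding r_def using m by (intro mult_left_mono) (auto simp: inverse_le_1_iff)
      then show "r n < a" "r n < T - a'" using a by auto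
    qed
    have r0: "r \<longlonglongrightarrow> 0" unfolding r_def using tendsto_mult_right_zero[OF LIMSEQ_inverse_real_of_nat] by blast
    have "\<forall>n. \<exists>\<theta> \<rho>. smooth \<theta> \<and> (\<forall>t. (\<theta> has_real_derivative (\<rho> (t - a) - \<rho> (t - a'))) (at t)) \<and>
      continuous_on UNIV \<rho> \<and> (\<forall>z. 0 \<le> \<rho> z) \<and> (\<forall>z. r n \<le> \<bar>z\<bar> \<longrightarrow> \<rho> z = 0) \<and> integral\<^sup>L lborel \<rho> = 1 \<and>
      (\<forall>t. 0 \<le> \<theta> t \<and> \<theta> t \<le> 1) \<and> (\<forall>t. a + r n \<le> t \<longrightarrow> t \<le> a' - r n \<longrightarrow> \<theta> t = 1) \<and> (\<forall>t. t \<le> a - r n \<or> a' + r n \<le> t \<longrightarrow> \<theta> t = 0)"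
    proof
      fix n
      show "\<exists>\<theta> \<rho>. smooth \<theta> \<and> (\<forall>t. (\<theta> has_real_derivative (\<rho> (t - a) - \<rho> (t - a'))) (at t)) \<and>
      continuous_on UNIV \<rho> \<and> (\<forall>z. 0 \<le> \<rho> z) \<and> (\<forall>z. r n \<le> \<bar>z\<bar> \<longrightarrow> \<rho> z = 0) \<and> integral\<^sup>L lborel \<rho> = 1 \<and>
      (\<forall>t. 0 \<le> \<theta> t \<and> \<theta> t \<le> 1) \<and> (\<forall>t. a + r n \<le> t \<longrightarrow> t \<le> a' - r n \<longrightarrow> \<theta> t = 1) \<and> (\<forall>t. t \<le> a - r n \<or> a' + r n \<le> t \<longrightarrow> \<theta> t = 0)"
        using smooth_interval_indicator[OF r(1)[of n] a(2)] by metis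
    qed
    then obtain \<theta> \<rho> where \<theta>: "\<And>n. smooth (\<theta> n)" "\<And>n t. (\<theta> n has_real_derivative (\<rho> n (t - a) - \<rho> n (t - a'))) (at t)"
      and \<rho>: "\<And>n. continuous_on UNIV (\<rho> n)" "\<And>n z. 0 \<le> \<rho> n z" "\<And>n z. r n \<le> \<bar>z\<bar> \<Longrightarrow> \<rho> n z = 0" "\<And>n. integral\<^sup>L lborel (\<rho> n) = 1"
      and \<theta>b: "\<And>n t. 0 \<le> \<theta> n t" "\<And>n t. \<theta> n t \<le> 1" "\<And>n t. a + r n \<le> t \<Longrightarrow> t \<le> a' - r n \<Longrightarrow> \<theta> n t = 1"
        "\<And>n t. t \<le> a - r n \<or> a' + r n \<le> t \<Longrightarrow> \<theta> n t = 0"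
      by metis
    have \<theta>m: "\<theta> n \<in> borel_measurable borel" for n by (rule borel_measurable_continuous_onI[OF smooth_continuous[OF \<theta>(1)]])
    have \<theta>\<Gamma>: "integrable lborel (\<lambda>t. \<theta> n t * \<Gamma> t)" for n
    proof (rule Bochner_Integration.integrable_bound[OF \<Gamma>i])
      show "AE t in lborel. norm (\<theta> n t * \<Gamma> t) \<le> norm (\<Gamma> t)"
        using \<theta>b(1,2) by (auto simp: abs_mult intro!: mult_left_le_one_le)
    qed (use \<theta>m \<Gamma>m in simp)
    have \<rho>avg: "integrable lborel (\<lambda>t. \<rho> n (t - e) * F0 t)" for n e
    proof (rule integrable_continuous_bounded_support[of _ "norm e + r n"])
      show "continuous_on UNIV (\<lambda>t. \<rho> n (t - e) * F0 t)"
        by (intro continuous_on_mult F0c continuous_on_compose2[OF \<rho>(1)] continuous_intros) auto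
      show "\<rho> n (t - e) * F0 t = 0" if "norm e + r n \<le> norm t" for t
        using that \<rho>(3)[of n "t - e"] by auto
    qed
    have zero: "(LINT t|lborel. \<rho> n (t - a) * F0 t) - (LINT t|lborel. \<rho> n (t - a') * F0 t) + (LINT t|lborel. \<theta> n t * \<Gamma> t) = 0" for n
    proof -
      define \<theta>' where "\<theta>' t = \<rho> n (t - a) - \<rho> n (t - a')" for t
      define I where "I t = (LINT x|lebesgue. f t x * (\<theta>' t * k x + \<theta> n t * (G x \<bullet> b t x)))" for t
      define \<Psi> where "\<Psi> t = indicator {0..T} t * (\<theta>' t * F0 t + \<theta> n t * \<Gamma> t)" for t
      have "(LINT t|lebesgue_on {0..T}. I t) = 0"
        unfolding I_def
      proof (rule distributional_solution_tested[OF sol \<theta>(1) _ _ _ _ k(1,3,2), where a="a - r n" and a'="a' + r n"])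
        show "(\<theta> n has_real_derivative \<theta>' t) (at t)" for t using \<theta>(2)[of n t] by (simp add: \<theta>'_def)
        show "\<theta> n t = 0" if "t \<notin> {a - r n..a' + r n}" for t using that by (intro \<theta>b(4)) auto
      qed (use r[of n] in auto)
      then have "(LINT t|lebesgue. indicator {0..T} t *\<^sub>R I t) = 0"
        by (subst (asm) integral_restrict_space) auto
      moreover have "(LINT t|lebesgue. indicator {0..T} t *\<^sub>R I t) = (LINT t|lborel. \<Psi> t)"
      proof (rule lebesgue_lborel_integral_cong(1))
        have "\<theta>' \<in> borel_measurable borel"
          unfolding \<theta>'_def using \<rho>(1) by (intro borel_measurable_continuous_onI continuous_on_diff continuous_on_compose2[OF \<rho>(1)] continuous_intros) auto
        then show "\<Psi> \<in> borel_measurable borel"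
          unfolding \<Psi>_def using \<theta>m \<Gamma>m borel_measurable_continuous_onI[OF F0c] by simp
        show "AE t in lborel. indicator {0..T} t *\<^sub>R I t = \<Psi> t"
          using b
        proof eventually_elim
          case (elim t)
          show ?case
          proof (cases "t \<in> {0..T}")
            case True
            have i1: "integrable lborel (\<lambda>x. \<theta>' t * (k x * F t x))"
            proof (rule integrable_mult_right)
              have "continuous_on UNIV (\<lambda>z. k (- z))"
                by (rule continuous_on_compose2[OF kc continuous_on_minus[OF continuous_on_id]]) auto
              from conv_integrable[OF this _ f_loc, of R 0] show "integrable lborel (\<lambda>x. k x * F t x)"
                using k(2) by simp
            qed
            have i2: "integrable lborel (\<lambda>x. \<theta> n t * ((G x \<bullet> bb t x) * F t x))"
              by (rule integrable_mult_right[OF GF_int])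
            have "I t = (LINT x|lborel. \<theta>' t * (k x * F t x) + \<theta> n t * ((G x \<bullet> bb t x) * F t x))"
              unfolding I_def
            proof (rule lebesgue_lborel_integral_cong(1))
              show "(\<lambda>x. \<theta>' t * (k x * F t x) + \<theta> n t * ((G x \<bullet> bb t x) * F t x)) \<in> borel_measurable borel"
                using Fm bbm by simp
              have "AE x in lborel. b t x = bb t x" using elim True by blast
              then show "AE x in lborel. f t x * (\<theta>' t * k x + \<theta> n t * (G x \<bullet> b t x)) = \<theta>' t * (k x * F t x) + \<theta> n t * ((G x \<bullet> bb t x) * F t x)"
                using F(1)[of t] by eventually_elim (simp add: time_clamp_id[OF True] algebra_simps)
            qed
            also have "\<dots> = \<theta>' t * F0 t + \<theta> n t * \<Gamma> t"
              using i1 i2 by (simp add: F0_def \<Gamma>_def)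
            finally show ?thesis using True by (simp add: \<Psi>_def)
          qed (simp add: \<Psi>_def)
        qed
      qed
      moreover have "\<Psi> t = (\<rho> n (t - a) * F0 t - \<rho> n (t - a') * F0 t) + \<theta> n t * \<Gamma> t" for t
      proof (cases "t \<in> {0..T}")
        case True then show ?thesis by (simp add: \<Psi>_def \<theta>'_def left_diff_distrib)
      next
        case False
        then have "r n \<le> \<bar>t - a\<bar>" "r n \<le> \<bar>t - a'\<bar>" using r[of n] a by auto
        then show ?thesis using False \<rho>(3) \<Gamma>0[OF False] by (simp add: \<Psi>_def)
      qed
      ultimately show ?thesis using \<rho>avg \<theta>\<Gamma> by simp
    qed
    have avg_lim: "(\<lambda>n. LINT t|lborel. \<rho> n (t - e) * F0 t) \<longlonglongrightarrow> F0 e" for e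
      unfolding tendsto_iff
    proof (intro allI impI)
      fix \<epsilon> :: real assume "0 < \<epsilon>"
      then obtain d where d: "d > 0" "\<And>y. dist y e < d \<Longrightarrow> dist (F0 y) (F0 e) < \<epsilon> / 2"
        using F0c unfolding continuous_on_iff by (metis UNIV_I half_gt_zero)
      have "\<forall>\<^sub>F n in sequentially. r n < d" using r0 d(1) by (rule order_tendstoD(2))
      then show "\<forall>\<^sub>F n in sequentially. dist (LINT t|lborel. \<rho> n (t - e) * F0 t) (F0 e) < \<epsilon>"
      proof eventually_elim
        case (elim n)
        have "\<bar>(LINT t|lborel. \<rho> n (t - e) * F0 t) - F0 e\<bar> \<le> \<epsilon> / 2"
        proof (rule kernel_average_close[where \<delta>="r n"])
          show "\<bar>F0 y - F0 e\<bar> \<le> \<epsilon> / 2" if "norm (y - e) < r n" for y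
            using d(2)[of y] elim that by (simp add: dist_real_def)
        qed (use F0c \<rho> in auto)
        then show ?case using \<open>0 < \<epsilon>\<close> by (simp add: dist_real_def)
      qed
    qed
    have \<theta>lim: "(\<lambda>n. LINT t|lborel. \<theta> n t * \<Gamma> t) \<longlonglongrightarrow> (LINT r|lborel. indicator {a..a'} r * \<Gamma> r)"
    proof (rule integral_dominated_convergence[where w="\<lambda>t. \<bar>\<Gamma> t\<bar>"])
      show "AE t in lborel. (\<lambda>n. \<theta> n t * \<Gamma> t) \<longlonglongrightarrow> indicator {a..a'} t * \<Gamma> t"
        using AE_lborel_singleton[of a] AE_lborel_singleton[of a']
        by eventually_elim (intro tendsto_mult_right tendsto_box_indicator[OF r0 \<theta>b(3,4)], auto)
      show "AE t in lborel. norm (\<theta> n t * \<Gamma> t) \<le> \<bar>\<Gamma> t\<bar>" for n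
        using \<theta>b(1,2) by (auto simp: abs_mult intro!: mult_left_le_one_le)
    qed (use \<theta>m \<Gamma>m \<Gamma>i in auto)
    have "(\<lambda>n. (LINT t|lborel. \<rho> n (t - a) * F0 t) - (LINT t|lborel. \<rho> n (t - a') * F0 t) + (LINT t|lborel. \<theta> n t * \<Gamma> t))
        \<longlonglongrightarrow> F0 a - F0 a' + (LINT r|lborel. indicator {a..a'} r * \<Gamma> r)"
      by (intro tendsto_intros avg_lim \<theta>lim)
    then have "(\<lambda>n::nat. 0) \<longlonglongrightarrow> F0 a - F0 a' + (LINT r|lborel. indicator {a..a'} r * \<Gamma> r)" by (simp add: zero)
    then show ?thesis by (simp add: set_lebesgue_integral_def LIMSEQ_const_iff)
  qed
  \<comment> \<open>The assertion is that \<open>\<Phi>\<close> is constant: on the open interval by \<open>inner\<close>, on its closure by continuity, and outside by freezing.\<close>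
  define \<Phi> where "\<Phi> t = F0 t - (LINT r:{..t}|lborel. \<Gamma> r)" for t
  have prim: "(LINT r:{..t}|lborel. \<Gamma> r) - (LINT r:{..s}|lborel. \<Gamma> r) = (LINT r:{s..t}|lborel. \<Gamma> r)" if "s \<le> t" for s t
    by (rule set_integral_atMost_diff[OF \<Gamma>i that])
  have \<Phi>c: "continuous_on UNIV \<Phi>"
  proof -
    have "continuous_on UNIV (\<lambda>t. LINT r:{..t}|lborel. \<Gamma> r)"
    proof (rule continuous_of_integral_modulus[of "\<lambda>r. \<bar>\<Gamma> r\<bar>"])
      show "norm ((LINT r:{..t}|lborel. \<Gamma> r) - (LINT r:{..s}|lborel. \<Gamma> r)) \<le> (LINT r:{s..t}|lborel. \<bar>\<Gamma> r\<bar>)" if "s \<le> t" for s t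
        unfolding prim[OF that] using integral_norm_bound[of lborel "\<lambda>r. indicator {s..t} r *\<^sub>R \<Gamma> r"]
        by (simp add: set_lebesgue_integral_def abs_mult)
    qed (use \<Gamma>i in auto)
    then show ?thesis unfolding \<Phi>_def by (intro continuous_on_diff F0c)
  qed
  have \<Phi>in: "\<Phi> u = \<Phi> (T / 2)" if "u \<in> {0<..<T}" for u
    using inner[of u "T / 2"] inner[of "T / 2" u] prim[of u "T / 2"] prim[of "T / 2" u] that T
    by (cases "u \<le> T / 2") (auto simp: \<Phi>_def)
  have \<Phi>cl: "\<Phi> u = \<Phi> (T / 2)" if "u \<in> {0..T}" for u
  proof (rule continuous_constant_on_closure[where S="{0<..<T}" and f=\<Phi>])
    show "continuous_on (closure {0<..<T}) \<Phi>" by (rule continuous_on_subset[OF \<Phi>c]) simp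
    show "\<Phi> x = \<Phi> (T / 2)" if "x \<in> {0<..<T}" for x by (rule \<Phi>in[OF that])
    show "u \<in> closure {0<..<T}" using that T by simp
  qed
  have \<Phi>out: "\<Phi> u = \<Phi> (time_clamp T u)" for u
  proof -
    have z: "(LINT r:{p..p'}|lborel. \<Gamma> r) = 0" if "p' \<le> 0 \<or> T \<le> p" for p p'
    proof -
      have "(LINT r|lborel. indicator {p..p'} r *\<^sub>R \<Gamma> r) = (LINT r::real|lborel. 0)"
      proof (rule integral_cong_AE)
        show "AE r in lborel. indicator {p..p'} r *\<^sub>R \<Gamma> r = 0"
          using AE_lborel_singleton[of 0] AE_lborel_singleton[of T]
        proof eventually_elim
          case (elim r)
          have "\<Gamma> r = 0" if "r \<in> {p..p'}" using elim that \<open>p' \<le> 0 \<or> T \<le> p\<close> by (intro \<Gamma>0) auto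
          then show ?case by (simp add: indicator_def)
        qed
      qed (use \<Gamma>m in auto)
      then show ?thesis by (simp add: set_lebesgue_integral_def)
    qed
    have F0u: "F0 u = F0 (time_clamp T u)" unfolding F0_def using F(2)[of u] by simp
    consider "u < 0" | "T < u" | "u \<in> {0..T}" by fastforce
    then show ?thesis
    proof cases
      case 1
      then have "time_clamp T u = 0" using T by (simp add: time_clamp_def)
      then show ?thesis using F0u z[of 0 u] prim[of u 0] 1 by (simp add: \<Phi>_def)
    next
      case 2
      then have "time_clamp T u = T" using T by (simp add: time_clamp_def)
      then show ?thesis using F0u z[of u T] prim[of T u] 2 by (simp add: \<Phi>_def)
    qed (simp add: time_clamp_id)
  qed
  have "\<Phi> s = \<Phi> t" using \<Phi>out[of s] \<Phi>out[of t] \<Phi>cl[OF time_clamp_mem[OF T, of s]] \<Phi>cl[OF time_clamp_mem[OF T, of t]] by simp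
  then have "F0 t - F0 s = (LINT r:{s..t}|lborel. \<Gamma> r)" using prim[OF st] by (simp add: \<Phi>_def)
  then show "(LINT x|lborel. k x * F t x) - (LINT x|lborel. k x * F s x) = (LINT r:{s..t}|lborel. LINT x|lborel. (G x \<bullet> bb r x) * F r x)"
    by (simp add: F0_def \<Gamma>_def)
  show "integrable lborel (\<lambda>r. LINT x|lborel. (G x \<bullet> bb r x) * F r x)" using \<Gamma>i by (simp add: \<Gamma>_def[abs_def])
  show "integrable lborel (\<lambda>x. (G x \<bullet> bb r x) * F r x)" for r by (rule GF_int)
qed

section \<open>Test functions and Borel representatives\<close>

lemma smooth_prod: "(\<And>i. i \<in> I \<Longrightarrow> smooth (q i)) \<Longrightarrow> smooth (\<lambda>x. \<Prod>i\<in>I. q i x)"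
  by (induction I rule: infinite_finite_induct) (auto intro: smooth.const smooth.mult)

lemma bounded_subset_cball_zero: "bounded (S :: 'a::real_normed_vector set) \<Longrightarrow> \<exists>R. S \<subseteq> cball 0 R"
  unfolding bounded_iff by (metis mem_cball_0 subsetI)

lemma AE_coordinate_neq:
  fixes i :: "'a::euclidean_space"
  assumes "i \<in> Basis"
  shows "AE x in lborel. x \<bullet> i \<noteq> e"
proof -
  have "negligible {x::'a. x \<bullet> i = e}" using negligible_standard_hyperplane[OF assms] by blast
  then have "AE x in lebesgue. x \<notin> {x::'a. x \<bullet> i = e}" by (intro AE_not_in) (simp add: negligible_iff_null_sets)
  then show ?thesis by (simp add: AE_completion_iff)
qed

text \<open>Products of smoothed indicators of the sides converge to the indicator of the box, except on its boundary.\<close>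

lemma integral_zero_on_boxes:
  fixes w :: "'a::euclidean_space \<Rightarrow> real"
  assumes w: "locally_integrable w" and zero: "\<And>u. test_fun UNIV u \<Longrightarrow> (LINT x|lborel. u x * w x) = 0"
  shows "(LINT x:cbox a b|lborel. w x) = 0"
proof (cases "cbox a b = {}")
  case True then show ?thesis by (simp add: set_lebesgue_integral_def)
next
  case False
  then have ab: "a \<bullet> i \<le> b \<bullet> i" if "i \<in> Basis" for i using that by (simp add: box_ne_empty)
  define r where "r n = inverse (real (Suc n))" for n
  have r: "0 < r n" "r n \<le> 1" for n by (simp_all add: r_def inverse_le_1_iff)
  have r0: "r \<longlonglongrightarrow> 0" unfolding r_def by (rule LIMSEQ_inverse_real_of_nat)
  define good where "good i n th \<longleftrightarrow> smooth th \<and> (\<forall>t. 0 \<le> th t) \<and> (\<forall>t. th t \<le> 1) \<and>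
    (\<forall>t. a \<bullet> i + r n \<le> t \<longrightarrow> t \<le> b \<bullet> i - r n \<longrightarrow> th t = 1) \<and> (\<forall>t. t \<le> a \<bullet> i - r n \<or> b \<bullet> i + r n \<le> t \<longrightarrow> th t = 0)"
    for i n and th :: "real \<Rightarrow> real"
  define \<theta> where "\<theta> i n = (SOME th. good i n th)" for i n
  have "good i n (\<theta> i n)" if i: "i \<in> Basis" for i n
  proof -
    obtain th :: "real \<Rightarrow> real" where "smooth th" "\<And>t. 0 \<le> th t" "\<And>t. th t \<le> 1"
      "\<And>t. a \<bullet> i + r n \<le> t \<Longrightarrow> t \<le> b \<bullet> i - r n \<Longrightarrow> th t = 1" "\<And>t. t \<le> a \<bullet> i - r n \<or> b \<bullet> i + r n \<le> t \<Longrightarrow> th t = 0"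
      by (rule smooth_interval_indicator[OF r(1)[of n] ab[OF i]]) blast
    then have "good i n th" unfolding good_def by blast
    then show ?thesis unfolding \<theta>_def by (rule someI[of "good i n"])
  qed
  then have \<theta>: "\<And>i n. i \<in> Basis \<Longrightarrow> smooth (\<theta> i n)" "\<And>i n t. i \<in> Basis \<Longrightarrow> 0 \<le> \<theta> i n t" "\<And>i n t. i \<in> Basis \<Longrightarrow> \<theta> i n t \<le> 1"
    "\<And>i n t. i \<in> Basis \<Longrightarrow> a \<bullet> i + r n \<le> t \<Longrightarrow> t \<le> b \<bullet> i - r n \<Longrightarrow> \<theta> i n t = 1"
    "\<And>i n t. i \<in> Basis \<Longrightarrow> t \<le> a \<bullet> i - r n \<or> b \<bullet> i + r n \<le> t \<Longrightarrow> \<theta> i n t = 0"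
    unfolding good_def by blast+
  define u where "u n x = (\<Prod>i\<in>Basis. \<theta> i n (x \<bullet> i))" for n and x :: 'a
  have us: "smooth (u n)" for n
  proof -
    have "smooth (\<lambda>x::'a. \<theta> i n (0 + x \<bullet> i))" if "i \<in> Basis" for i
      by (rule smooth_affine[OF \<theta>(1)[OF that] bounded_linear_inner_left])
    then show ?thesis unfolding u_def[abs_def] by (intro smooth_prod) simp
  qed
  have out: "u n x = 0" if x: "x \<notin> cbox (a - One) (b + One)" for n x
  proof -
    have "x \<in> cbox (a - One) (b + One)" if "\<forall>i\<in>Basis. a \<bullet> i - 1 \<le> x \<bullet> i \<and> x \<bullet> i \<le> b \<bullet> i + 1"
      using that by (simp add: mem_box inner_diff_left inner_add_left)
    then obtain i where i: "i \<in> Basis" "x \<bullet> i < a \<bullet> i - 1 \<or> b \<bullet> i + 1 < x \<bullet> i"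
      using x by (meson not_le)
    then have "\<theta> i n (x \<bullet> i) = 0" using r(2)[of n] by (intro \<theta>(5)) auto
    then show ?thesis unfolding u_def using i(1) by (intro prod_zero) auto
  qed
  have test: "test_fun UNIV (u n)" for n
    by (rule test_fun_smooth[OF us, of "cbox (a - One) (b + One)"]) (use out in auto)
  have bnd: "\<bar>u n x\<bar> \<le> 1" for n x
  proof -
    have "\<bar>u n x\<bar> = (\<Prod>i\<in>Basis. \<bar>\<theta> i n (x \<bullet> i)\<bar>)" unfolding u_def by (rule abs_prod)
    also have "\<dots> \<le> 1" using \<theta>(2,3) by (intro prod_le_1) auto
    finally show ?thesis .
  qed
  obtain R where R: "cbox (a - One) (b + One) \<subseteq> cball 0 R" using bounded_subset_cball_zero[OF bounded_cbox] by blast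
  have wm: "w \<in> borel_measurable borel" by (rule locally_integrable_measurable[OF w])
  have um: "u n \<in> borel_measurable borel" for n by (rule borel_measurable_continuous_onI[OF smooth_continuous[OF us]])
  have "(\<lambda>n. LINT x|lborel. u n x * w x) \<longlonglongrightarrow> (LINT x|lborel. indicator (cbox a b) x * w x)"
  proof (rule integral_dominated_convergence[where w="\<lambda>x. norm (indicator (cball 0 R) x *\<^sub>R w x)"])
    have "AE x in lborel. \<forall>i\<in>Basis. x \<bullet> i \<noteq> a \<bullet> i \<and> x \<bullet> i \<noteq> b \<bullet> i"
      by (rule AE_finite_allI[OF finite_Basis], rule AE_conjI; rule AE_coordinate_neq)
    then show "AE x in lborel. (\<lambda>n. u n x * w x) \<longlonglongrightarrow> indicator (cbox a b) x * w x"
    proof eventually_elim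
      case (elim x)
      have "(\<lambda>n. u n x) \<longlonglongrightarrow> (\<Prod>i\<in>Basis. indicator {a \<bullet> i..b \<bullet> i} (x \<bullet> i))"
        unfolding u_def by (intro tendsto_prod tendsto_box_indicator[OF r0 \<theta>(4,5)]) (use elim in auto)
      also have "(\<Prod>i\<in>Basis. indicator {a \<bullet> i..b \<bullet> i} (x \<bullet> i)) = (indicator (cbox a b) x :: real)"
        by (auto simp: indicator_def mem_box intro!: prod.neutral prod_zero)
      finally show ?case by (rule tendsto_mult_right)
    qed
    show "AE x in lborel. norm (u n x * w x) \<le> norm (indicator (cball 0 R) x *\<^sub>R w x)" for n
    proof (rule AE_I2)
      fix x
      show "norm (u n x * w x) \<le> norm (indicator (cball 0 R) x *\<^sub>R w x)"
      proof (cases "x \<in> cball 0 R")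
        case True then show ?thesis using mult_right_mono[OF bnd[of n x] abs_ge_zero[of "w x"]] by (simp add: abs_mult)
      next
        case False then have "u n x = 0" using R by (intro out) blast
        then show ?thesis by simp
      qed
    qed
    show "integrable lborel (\<lambda>x. norm (indicator (cball 0 R) x *\<^sub>R w x))" by (rule set_integrable_norm_cball[OF w])
  qed (use wm um in auto)
  then have "(\<lambda>n::nat. 0) \<longlonglongrightarrow> (LINT x|lborel. indicator (cbox a b) x * w x)" using zero[OF test] by simp
  then show ?thesis by (simp add: set_lebesgue_integral_def LIMSEQ_const_iff)
qed

text \<open>A function is almost everywhere the limit of its means over small boxes.\<close>

lemma test_functions_separate:
  fixes w :: "'a::euclidean_space \<Rightarrow> real"
  assumes w: "locally_integrable w" and zero: "\<And>u. test_fun UNIV u \<Longrightarrow> (LINT x|lborel. u x * w x) = 0"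
  shows "AE x in lborel. w x = 0"
proof -
  have si: "set_integrable lborel (cbox a b) w" for a b
  proof -
    obtain R where R: "cbox a b \<subseteq> cball 0 R" using bounded_subset_cball_zero[OF bounded_cbox] by blast
    have "set_integrable lborel (cball 0 R) w" using w by (simp add: locally_integrable_def)
    then show ?thesis by (rule set_integrable_subset) (use R in auto)
  qed
  have int: "w integrable_on cbox a b" "integral (cbox a b) w = 0" for a b
    using set_borel_integral_eq_integral[OF si] integral_zero_on_boxes[OF w zero] by auto
  obtain N where N: "negligible N" "\<And>x e. \<lbrakk>x \<notin> N; 0 < e\<rbrakk> \<Longrightarrow>
               \<exists>d>0. \<forall>h. 0 < h \<and> h < d \<longrightarrow> norm(integral (cbox x (x + h *\<^sub>R One)) w /\<^sub>R h ^ DIM('a) - w x) < e"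
    using integrable_ccontinuous_explicit[of w, OF int(1)] by blast
  have "w x = 0" if x: "x \<notin> N" for x
  proof (rule ccontr)
    assume "w x \<noteq> 0"
    then obtain d where "d > 0" "\<forall>h. 0 < h \<and> h < d \<longrightarrow> norm(integral (cbox x (x + h *\<^sub>R One)) w /\<^sub>R h ^ DIM('a) - w x) < \<bar>w x\<bar>"
      using N(2)[OF x, of "\<bar>w x\<bar>"] by auto
    then have "norm (integral (cbox x (x + (d / 2) *\<^sub>R One)) w /\<^sub>R (d / 2) ^ DIM('a) - w x) < \<bar>w x\<bar>" by auto
    then show False by (simp add: int(2))
  qed
  moreover have "AE x in lebesgue. x \<notin> N" using N(1) by (intro AE_not_in) (simp add: negligible_iff_null_sets)
  ultimately have "AE x in lebesgue. w x = 0" by (auto elim: eventually_mono)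
  then show ?thesis by (rule AE_completion_iff[THEN iffD1])
qed

lemma test_fun_gradient:
  fixes u :: "'a::euclidean_space \<Rightarrow> real"
  assumes "test_fun UNIV u"
  obtains G R where "\<And>x. (u has_derivative (\<lambda>w. G x \<bullet> w)) (at x)" "continuous_on UNIV G" "0 \<le> R"
    "\<And>x. R \<le> norm x \<Longrightarrow> u x = 0" "\<And>x. R \<le> norm x \<Longrightarrow> G x = 0"
proof -
  have "C_k (Suc 0) u" using assms by (auto simp: test_fun_def)
  then have d: "\<And>x. u differentiable (at x)" "\<And>v. continuous_on UNIV (\<lambda>x. frechet_derivative u (at x) v)" by auto
  define G where "G x = (\<Sum>i\<in>Basis. frechet_derivative u (at x) i *\<^sub>R i)" for x
  have der: "(u has_derivative frechet_derivative u (at x)) (at x)" for x using d(1) frechet_derivative_works by blast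
  have G: "frechet_derivative u (at x) w = G x \<bullet> w" for x w
  proof -
    interpret bounded_linear "frechet_derivative u (at x)" using der by (rule has_derivative_bounded_linear)
    have "frechet_derivative u (at x) w = frechet_derivative u (at x) (\<Sum>i\<in>Basis. (w \<bullet> i) *\<^sub>R i)" by (simp add: euclidean_representation)
    also have "\<dots> = G x \<bullet> w"
      by (simp only: sum scaleR G_def inner_sum_left) (simp add: inner_commute mult.commute)
    finally show ?thesis .
  qed
  have der': "(u has_derivative (\<lambda>w. G x \<bullet> w)) (at x)" for x
  proof -
    have "frechet_derivative u (at x) = (\<lambda>w. G x \<bullet> w)" by (rule ext) (rule G)
    then show ?thesis using der[of x] by simp
  qed
  have "bounded (closure {z. u z \<noteq> 0})" using assms by (auto simp: test_fun_def compact_imp_bounded)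
  then obtain R where R: "\<And>x. x \<in> closure {z. u z \<noteq> 0} \<Longrightarrow> norm x \<le> R" by (auto simp: bounded_iff)
  have u0: "\<bar>R\<bar> + 1 \<le> norm x \<Longrightarrow> u x = 0" for x
  proof (rule ccontr)
    assume that: "\<bar>R\<bar> + 1 \<le> norm x" and "u x \<noteq> 0"
    then have "x \<in> closure {z. u z \<noteq> 0}" by (intro subsetD[OF closure_subset]) simp
    from R[OF this] show False using that by linarith
  qed
  show ?thesis
  proof (rule that[of G "\<bar>R\<bar> + 2"])
    show "continuous_on UNIV G" unfolding G_def by (intro continuous_intros d)
    show "G x = 0" if "\<bar>R\<bar> + 2 \<le> norm x" for x
      by (rule gradient_zero_outside[OF der', of "\<bar>R\<bar> + 3"]) (use u0 that in auto)
    show "u x = 0" if "\<bar>R\<bar> + 2 \<le> norm x" for x by (rule u0) (use that in linarith)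
  qed (use der' in auto)
qed

text \<open>Only the integrals of the equation see the new field. For almost every time it agrees with \<open>b\<close> almost everywhere, so both
have the same means, and bounds for the given \<open>b\<close> on a ball remain bounds for these means. The inclusion keeps the
given \<open>b\<close>, whose envelopes do depend on null sets.\<close>

lemma borel_representative_of_field:
  fixes b :: "real \<Rightarrow> real^'d \<Rightarrow> real^'d" and C0 :: "real \<Rightarrow> real"
  assumes b: "(\<lambda>z. b (fst z) (snd z)) \<in> borel_measurable (lebesgue_on ({0..T} \<times> UNIV))"
    and C0: "integrable (lebesgue_on {0..T}) C0" "\<forall>t\<in>{0..T}. 0 \<le> C0 t"
    and growth: "AE z in lebesgue_on ({0..T} \<times> UNIV). norm (b (fst z) (snd z)) \<le> C0 (fst z) * (1 + norm (snd z))"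
  obtains bb c where "case_prod bb \<in> borel_measurable (lborel \<Otimes>\<^sub>M lborel)" "\<And>r x. norm (bb r x) \<le> c r * (1 + norm x)"
    "integrable lborel c" "\<And>r. 0 \<le> c r" "\<And>r. r \<notin> {0..T} \<Longrightarrow> c r = 0"
    "AE r in lborel. r \<in> {0..T} \<longrightarrow> (AE x in lborel. b r x = bb r x)"
proof -
  define S :: "(real \<times> (real^'d)) set" where "S = {0..T} \<times> UNIV"
  have "closed S" unfolding S_def by (intro closed_Times) auto
  then have S: "S \<in> sets lebesgue" by (simp add: lborelD borel_closed)
  define be where "be z = indicator S z *\<^sub>R b (fst z) (snd z)" for z
  have bem: "be \<in> borel_measurable lebesgue"
    using b borel_measurable_restrict_space_iff[of S lebesgue "\<lambda>z. b (fst z) (snd z)"] S by (simp add: be_def[abs_def] S_def)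
  have "\<exists>b1\<in>borel_measurable lborel. AE z in lborel. be z $ i = b1 z" for i
  proof (rule completion_ex_borel_measurable_real)
    have "(\<lambda>z. be z \<bullet> axis i 1) \<in> borel_measurable lebesgue" using bem by simp
    then show "(\<lambda>z. be z $ i) \<in> borel_measurable lebesgue" by (simp add: inner_axis)
  qed
  then obtain b1 where b1: "\<And>i. b1 i \<in> borel_measurable lborel" "\<And>i. AE z in lborel. be z $ i = b1 i z" by metis
  define B where "B z = (\<Sum>i\<in>UNIV. b1 i z *\<^sub>R axis i (1::real))" for z
  have Bm: "B \<in> borel_measurable (lborel \<Otimes>\<^sub>M lborel)"
    using b1(1) unfolding B_def lborel_prod by (intro borel_measurable_sum borel_measurable_scaleR) auto
  have "AE z in lborel. \<forall>i. be z $ i = b1 i z" by (rule AE_all_countable[THEN iffD2], rule allI, rule b1(2))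
  then have be_B: "AE z in lborel. be z = B z"
  proof eventually_elim
    case (elim z)
    show ?case unfolding B_def using elim by (simp add: vec_eq_iff axis_def if_distrib[of "\<lambda>x. _ * x"] cong: if_cong)
  qed
  have "\<exists>c1\<in>borel_measurable lborel. AE r in lborel. indicator {0..T} r *\<^sub>R C0 r = c1 r"
    using borel_measurable_restrict_space_iff[of "{0..T}" lebesgue C0, THEN iffD1] borel_measurable_integrable[OF C0(1)]
    by (intro completion_ex_borel_measurable_real) simp
  then obtain c1 where c1: "c1 \<in> borel_measurable borel" "AE r in lborel. indicator {0..T} r *\<^sub>R C0 r = c1 r" by auto
  define c where "c r = indicator {0..T} r * max 0 (c1 r)" for r
  have cm: "c \<in> borel_measurable borel" unfolding c_def using c1(1) by simp
  have C0c: "AE r in lborel. indicator {0..T} r *\<^sub>R C0 r = c r"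
    using c1(2)
  proof eventually_elim
    case (elim r)
    show ?case
    proof (cases "r \<in> {0..T}")
      case True
      have "0 \<le> C0 r" using True C0(2) by blast
      moreover have "C0 r = c1 r" using True elim by simp
      ultimately show ?thesis using True by (simp add: c_def)
    qed (simp add: c_def)
  qed
  have c_int: "integrable lborel c"
  proof -
    have "integrable lebesgue (\<lambda>r. indicator {0..T} r *\<^sub>R C0 r)"
      using C0(1) by (subst integrable_restrict_space[symmetric]) auto
    then show ?thesis by (rule lebesgue_lborel_integral_cong(2)[OF cm C0c, THEN iffD1])
  qed
  \<comment> \<open>Truncation makes the growth bound hold everywhere instead of almost everywhere.\<close>
  define bb where "bb r x = (if r \<in> {0..T} \<and> norm (B (r, x)) \<le> c r * (1 + norm x) then B (r, x) else 0)" for r x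
  have "AE z in lebesgue. z \<in> S \<longrightarrow> norm (b (fst z) (snd z)) \<le> C0 (fst z) * (1 + norm (snd z))"
    using growth S by (simp add: S_def AE_restrict_space_iff)
  then have gr: "AE z in lborel. z \<in> S \<longrightarrow> norm (b (fst z) (snd z)) \<le> C0 (fst z) * (1 + norm (snd z))"
    by (rule AE_completion_iff[THEN iffD1])
  have "AE z in lborel \<Otimes>\<^sub>M lborel. be z = B z \<and> (z \<in> S \<longrightarrow> norm (b (fst z) (snd z)) \<le> C0 (fst z) * (1 + norm (snd z)))"
    unfolding lborel_prod using be_B gr by eventually_elim blast
  from lborel_pair.AE_pair[OF this]
  have "AE r in lborel. AE x in lborel. be (r, x) = B (r, x) \<and> ((r, x) \<in> S \<longrightarrow> norm (b r x) \<le> C0 r * (1 + norm x))" by simp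
  then have fin: "AE r in lborel. r \<in> {0..T} \<longrightarrow> (AE x in lborel. b r x = bb r x)"
    using C0c
  proof eventually_elim
    case (elim r)
    show ?case
    proof
      assume r: "r \<in> {0..T}"
      show "AE x in lborel. b r x = bb r x"
        using elim(1)
      proof eventually_elim
        case (elim x)
        have "be (r, x) = b r x" "C0 r = c r" using r \<open>indicator {0..T} r *\<^sub>R C0 r = c r\<close> by (simp_all add: be_def S_def)
        moreover have "norm (b r x) \<le> C0 r * (1 + norm x)" using elim r by (simp add: S_def)
        ultimately have 1: "b r x = B (r, x)" and "norm (B (r, x)) \<le> c r * (1 + norm x)" using elim by metis+
        then show ?case unfolding 1 bb_def using r by simp
      qed
    qed
  qed
  have cp: "0 \<le> c r" for r by (simp add: c_def)
  show ?thesis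
  proof (rule that[of bb c])
    have cz: "(\<lambda>z::real \<times> (real^'d). c (fst z) * (1 + norm (snd z))) \<in> borel_measurable (lborel \<Otimes>\<^sub>M lborel)"
      by (intro borel_measurable_times borel_measurable_add borel_measurable_const measurable_compose[OF measurable_fst] measurable_compose[OF measurable_snd])
        (use cm in auto)
    have "(\<lambda>z. if fst z \<in> {0..T} \<and> norm (B z) \<le> c (fst z) * (1 + norm (snd z)) then B z else 0) \<in> borel_measurable (lborel \<Otimes>\<^sub>M lborel)"
    proof (rule measurable_If[OF Bm borel_measurable_const])
      have "{z \<in> space (lborel \<Otimes>\<^sub>M lborel). norm (B z) \<le> c (fst z) * (1 + norm (snd z))} \<in> sets (lborel \<Otimes>\<^sub>M lborel)"
        by (rule borel_measurable_le[OF measurable_compose[OF Bm borel_measurable_norm] cz])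
      moreover have "{z \<in> space (lborel \<Otimes>\<^sub>M lborel). fst z \<in> {0..T}} \<in> sets (lborel \<Otimes>\<^sub>M (lborel :: (real^'d) measure))"
      proof -
        have "fst -` {0..T} \<inter> space (lborel \<Otimes>\<^sub>M (lborel :: (real^'d) measure)) \<in> sets (lborel \<Otimes>\<^sub>M lborel)"
          by (rule measurable_sets[OF measurable_fst]) simp
        moreover have "fst -` {0..T} \<inter> space (lborel \<Otimes>\<^sub>M (lborel :: (real^'d) measure)) = {z \<in> space (lborel \<Otimes>\<^sub>M lborel). fst z \<in> {0..T}}"
          by blast
        ultimately show ?thesis by simp
      qed
      ultimately show "{z \<in> space (lborel \<Otimes>\<^sub>M lborel). fst z \<in> {0..T} \<and> norm (B z) \<le> c (fst z) * (1 + norm (snd z))} \<in> sets (lborel \<Otimes>\<^sub>M lborel)"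
        by (rule back_subst[of "\<lambda>X. X \<in> sets (lborel \<Otimes>\<^sub>M lborel)", OF sets.Int]) blast
    qed
    moreover have "case_prod bb = (\<lambda>z. if fst z \<in> {0..T} \<and> norm (B z) \<le> c (fst z) * (1 + norm (snd z)) then B z else 0)"
      by (rule ext) (simp add: bb_def split_beta)
    ultimately show "case_prod bb \<in> borel_measurable (lborel \<Otimes>\<^sub>M lborel)" by simp
    show "norm (bb r x) \<le> c r * (1 + norm x)" for r x using cp[of r] by (simp add: bb_def)
      show "c r = 0" if "r \<notin> {0..T}" for r using that by (simp add: c_def)
  qed (fact c_int cp fin)+
qed

section \<open>Signed solutions\<close>

text \<open>With \<open>e = 1\<close> and \<open>e = - 1\<close> these are the positive and the negative part of \<open>F\<close>. The equation is linear, so it passes from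
\<open>F\<close> and \<open>\<bar>F\<bar>\<close> to them, and nonnegativity is what the mollification needs.\<close>

lemma weak_solution_half_sum:
  fixes F :: "real \<Rightarrow> real^'d \<Rightarrow> real" and e :: real
  assumes T: "0 < T" and e: "\<bar>e\<bar> = 1"
    and sol: "distributional_solution T b f" "distributional_solution T b (\<lambda>t x. \<bar>f t x\<bar>)"
    and wc: "weakly_continuous F" "weakly_continuous (\<lambda>t x. \<bar>F t x\<bar>)"
    and F: "\<And>t. AE x in lborel. f (time_clamp T t) x = F t x" "\<And>t. F t = F (time_clamp T t)"
    and bb: "case_prod bb \<in> borel_measurable (lborel \<Otimes>\<^sub>M lborel)" "\<And>r x. norm (bb r x) \<le> c r * (1 + norm x)"
    and c: "integrable lborel c" "\<And>r. 0 \<le> c r" "\<And>r. r \<notin> {0..T} \<Longrightarrow> c r = 0"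
    and b: "AE r in lborel. r \<in> {0..T} \<longrightarrow> (AE x in lborel. b r x = bb r x)"
    and mass: "\<And>R t. (LINT x:cball 0 R|lborel. \<bar>F t x\<bar>) \<le> A R"
  shows "weak_solution bb c (\<lambda>t x. (\<bar>F t x\<bar> + e * F t x) / 2) A"
proof -
  interpret F: weakly_continuous F by fact
  interpret aF: weakly_continuous "\<lambda>t x. \<bar>F t x\<bar>" by fact
  let ?H = "\<lambda>t x. (\<bar>F t x\<bar> + e * F t x) / 2"
  have abs_ae: "AE x in lborel. \<bar>f (time_clamp T t) x\<bar> = \<bar>F t x\<bar>" for t using F(1)[of t] by eventually_elim simp
  have abs_cl: "(\<lambda>x. \<bar>F t x\<bar>) = (\<lambda>x. \<bar>F (time_clamp T t) x\<bar>)" for t using F(2)[of t] by simp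
  have mass': "(LINT x:cball 0 R|lborel. \<bar>\<bar>F t x\<bar>\<bar>) \<le> A R" for R t using mass[of R t] by simp
  have half: "(LINT x|lborel. Q x * ?H t x) = ((LINT x|lborel. Q x * \<bar>F t x\<bar>) + e * (LINT x|lborel. Q x * F t x)) / 2"
    if "integrable lborel (\<lambda>x. Q x * \<bar>F t x\<bar>)" "integrable lborel (\<lambda>x. Q x * F t x)" for Q t
  proof -
    have "(LINT x|lborel. Q x * ?H t x) = (LINT x|lborel. (Q x * \<bar>F t x\<bar> + e * (Q x * F t x)) / 2)"
      by (intro Bochner_Integration.integral_cong refl) (simp add: algebra_simps add_divide_distrib)
    also have "\<dots> = ((LINT x|lborel. Q x * \<bar>F t x\<bar>) + e * (LINT x|lborel. Q x * F t x)) / 2"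
      using that by simp
    finally show ?thesis .
  qed
  have Qint: "integrable lborel (\<lambda>x. Q x * h x)"
    if "Q \<in> borel_measurable borel" "\<And>x. \<bar>Q x\<bar> \<le> C" "\<And>x. R \<le> norm x \<Longrightarrow> Q x = 0" "locally_integrable h" for Q h :: "real^'d \<Rightarrow> real" and C R
  proof (rule Bochner_Integration.integrable_bound)
    show "integrable lborel (\<lambda>x. C * norm (indicator (cball 0 R) x *\<^sub>R h x))"
      by (intro integrable_mult_right set_integrable_norm_cball that(4))
    show "(\<lambda>x. Q x * h x) \<in> borel_measurable lborel" using that(1) locally_integrable_measurable[OF that(4)] by simp
    show "AE x in lborel. norm (Q x * h x) \<le> norm (C * norm (indicator (cball 0 R) x *\<^sub>R h x))"
    proof (rule AE_I2)
      fix x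
      have C: "0 \<le> C" using order_trans[OF abs_ge_zero that(2)] .
      show "norm (Q x * h x) \<le> norm (C * norm (indicator (cball 0 R) x *\<^sub>R h x))"
      proof (cases "norm x \<le> R")
        case True then show ?thesis using mult_right_mono[OF that(2)[of x] abs_ge_zero[of "h x"]] C by (simp add: abs_mult)
      next
        case False then show ?thesis using that(3)[of x] by simp
      qed
    qed
  qed
  have H_nonneg: "0 \<le> ?H t x" and H_le: "?H t x \<le> \<bar>F t x\<bar>" for t x
  proof -
    have "\<bar>e * F t x\<bar> = \<bar>F t x\<bar>" using e by (simp add: abs_mult)
    moreover have "0 \<le> (\<bar>z\<bar> + y) / 2 \<and> (\<bar>z\<bar> + y) / 2 \<le> \<bar>z\<bar>" if "\<bar>y\<bar> = \<bar>z\<bar>" for y z :: real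
      using that by (auto simp: abs_if split: if_splits)
    ultimately show "0 \<le> ?H t x" "?H t x \<le> \<bar>F t x\<bar>" by blast+
  qed
  have H_loc: "locally_integrable (?H t)" for t
    unfolding locally_integrable_def set_integrable_def
  proof
    fix R
    have i: "integrable lborel (\<lambda>x. indicator (cball 0 R) x *\<^sub>R \<bar>F t x\<bar>)" "integrable lborel (\<lambda>x. indicator (cball 0 R) x *\<^sub>R F t x)"
      using aF.f_loc[of t] F.f_loc[of t] unfolding locally_integrable_def set_integrable_def by blast+
    have "integrable lborel (\<lambda>x. (1 / 2) * (indicator (cball 0 R) x *\<^sub>R \<bar>F t x\<bar> + e * (indicator (cball 0 R) x *\<^sub>R F t x)))"
      by (intro integrable_mult_right Bochner_Integration.integrable_add i)
    then show "integrable lborel (\<lambda>x. indicator (cball 0 R) x *\<^sub>R ?H t x)"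
      by (rule Bochner_Integration.integrable_cong[THEN iffD1, rotated 2]) (auto simp: algebra_simps add_divide_distrib)
  qed
  show ?thesis
  proof
    show "continuous_on UNIV (\<lambda>t. LINT x|lborel. q x * ?H t x)"
      if q: "q \<in> borel_measurable borel" "\<And>x. \<bar>q x\<bar> \<le> C" "\<And>x. R \<le> norm x \<Longrightarrow> q x = 0" for q C R
    proof -
      have "(\<lambda>t. LINT x|lborel. q x * ?H t x) = (\<lambda>t. ((LINT x|lborel. q x * \<bar>F t x\<bar>) + e * (LINT x|lborel. q x * F t x)) / 2)"
        by (intro ext half Qint[OF q] aF.f_loc F.f_loc)
      moreover have "continuous_on UNIV (\<lambda>t. ((LINT x|lborel. q x * \<bar>F t x\<bar>) + e * (LINT x|lborel. q x * F t x)) / 2)"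
        using aF.weak_cont[OF q] F.weak_cont[OF q] by (intro continuous_intros) auto
      ultimately show ?thesis by (simp only:)
    qed
    show "(LINT x:cball 0 R|lborel. ?H t x) \<le> A R" for R t
    proof (rule order_trans[OF _ mass[of R t]])
      show "(LINT x:cball 0 R|lborel. ?H t x) \<le> (LINT x:cball 0 R|lborel. \<bar>F t x\<bar>)"
        using H_loc[of t] aF.f_loc[of t] H_le unfolding locally_integrable_def by (intro set_integral_mono) auto
    qed
    show "(LINT x|lborel. k x * ?H t x) - (LINT x|lborel. k x * ?H s x) = (LINT r:{s..t}|lborel. LINT x|lborel. (G x \<bullet> bb r x) * ?H r x)"
      if k: "smooth k" "\<And>x. R \<le> norm x \<Longrightarrow> k x = 0" "\<And>x. (k has_derivative (\<lambda>w. G x \<bullet> w)) (at x)" and st: "s \<le> t" for k G s t R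
    proof -
      have eqF1: "(LINT x|lborel. k x * F t x) - (LINT x|lborel. k x * F s x) = (LINT r:{s..t}|lborel. LINT x|lborel. (G x \<bullet> bb r x) * F r x)"
        by (rule distributional_equation(1)[OF sol(1) T wc(1) F bb c b mass k st])
      have eqF2: "integrable lborel (\<lambda>r. LINT x|lborel. (G x \<bullet> bb r x) * F r x)"
        by (rule distributional_equation(2)[OF sol(1) T wc(1) F bb c b mass k st])
      have eqF3: "integrable lborel (\<lambda>x. (G x \<bullet> bb r x) * F r x)" for r
        by (rule distributional_equation(3)[OF sol(1) T wc(1) F bb c b mass k st])
      have eqA1: "(LINT x|lborel. k x * \<bar>F t x\<bar>) - (LINT x|lborel. k x * \<bar>F s x\<bar>) = (LINT r:{s..t}|lborel. LINT x|lborel. (G x \<bullet> bb r x) * \<bar>F r x\<bar>)"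
        by (rule distributional_equation(1)[OF sol(2) T wc(2) abs_ae abs_cl bb c b mass' k st])
      have eqA2: "integrable lborel (\<lambda>r. LINT x|lborel. (G x \<bullet> bb r x) * \<bar>F r x\<bar>)"
        by (rule distributional_equation(2)[OF sol(2) T wc(2) abs_ae abs_cl bb c b mass' k st])
      have eqA3: "integrable lborel (\<lambda>x. (G x \<bullet> bb r x) * \<bar>F r x\<bar>)" for r
        by (rule distributional_equation(3)[OF sol(2) T wc(2) abs_ae abs_cl bb c b mass' k st])
      have kc: "continuous_on UNIV k" by (rule smooth_continuous[OF k(1)])
      obtain M where M: "\<And>x. \<bar>k x\<bar> \<le> M" using kernel_bounded[where k=k and \<delta>=R, OF kc k(2)] by auto
      note ki = Qint[OF borel_measurable_continuous_onI[OF kc] M k(2)]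
      have hk: "(LINT x|lborel. k x * ?H t x) = ((LINT x|lborel. k x * \<bar>F t x\<bar>) + e * (LINT x|lborel. k x * F t x)) / 2" for t
        by (intro half ki aF.f_loc F.f_loc)
      have hG: "(LINT x|lborel. (G x \<bullet> bb r x) * ?H r x) = ((LINT x|lborel. (G x \<bullet> bb r x) * \<bar>F r x\<bar>) + e * (LINT x|lborel. (G x \<bullet> bb r x) * F r x)) / 2" for r
        by (intro half eqA3 eqF3)
      have "(LINT r:{s..t}|lborel. LINT x|lborel. (G x \<bullet> bb r x) * ?H r x)
          = ((LINT r:{s..t}|lborel. LINT x|lborel. (G x \<bullet> bb r x) * \<bar>F r x\<bar>) + e * (LINT r:{s..t}|lborel. LINT x|lborel. (G x \<bullet> bb r x) * F r x)) / 2"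
        unfolding hG using set_integrable_of_integrable[OF eqA2, where A="{s..t}"] set_integrable_of_integrable[OF eqF2, where A="{s..t}"]
        by (simp add: set_integral_add(2))
      also have "\<dots> = (((LINT x|lborel. k x * \<bar>F t x\<bar>) - (LINT x|lborel. k x * \<bar>F s x\<bar>)) + e * ((LINT x|lborel. k x * F t x) - (LINT x|lborel. k x * F s x))) / 2"
        by (simp only: eqA1 eqF1)
      also have "\<dots> = (LINT x|lborel. k x * ?H t x) - (LINT x|lborel. k x * ?H s x)"
        unfolding hk by (simp add: algebra_simps diff_divide_distrib add_divide_distrib)
      finally show ?thesis by simp
    qed
  qed (use bb c H_nonneg H_loc in auto)
qed

lemma test_fun_times_integrable:
  fixes u h :: "real^'d \<Rightarrow> real"
  assumes u: "test_fun UNIV u"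
  shows test_fun_measurable: "u \<in> borel_measurable borel"
    and "locally_integrable h \<Longrightarrow> integrable lborel (\<lambda>x. u x * h x)"
proof -
  obtain G R where G: "\<And>x. (u has_derivative (\<lambda>w. G x \<bullet> w)) (at x)" "continuous_on UNIV G" "0 \<le> R"
    "\<And>x. R \<le> norm x \<Longrightarrow> u x = 0" "\<And>x. R \<le> norm x \<Longrightarrow> G x = 0"
    using test_fun_gradient[OF u] by blast
  have uc: "continuous_on UNIV u" using G(1) has_derivative_continuous continuous_at_imp_continuous_on by blast
  then show "u \<in> borel_measurable borel" by (rule borel_measurable_continuous_onI)
  have "continuous_on UNIV (\<lambda>z. u (- z))" by (rule continuous_on_compose2[OF uc continuous_on_minus[OF continuous_on_id]]) auto
  from conv_integrable[OF this, of R h 0] show "integrable lborel (\<lambda>x. u x * h x)" if "locally_integrable h"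
    using that G(4) by simp
qed

theorem corollary4p1:
  fixes T :: real
    and b :: "real \<Rightarrow> real^'d \<Rightarrow> real^'d"
    and C0 C1 :: "real \<Rightarrow> real"
    and \<phi> :: "real \<Rightarrow> real \<Rightarrow> real^'d \<Rightarrow> real^'d"
    and f :: "real \<Rightarrow> real^'d \<Rightarrow> real"
  assumes "T > 0"
    and "(\<lambda>z. b (fst z) (snd z)) \<in> borel_measurable (lebesgue_on ({0..T} \<times> UNIV))"
    and "integrable (lebesgue_on {0..T}) C0" and "\<forall>t\<in>{0..T}. 0 \<le> C0 t"
    and "integrable (lebesgue_on {0..T}) C1" and "\<forall>t\<in>{0..T}. 0 \<le> C1 t"
    and "AE z in lebesgue_on ({0..T} \<times> UNIV).
           norm (b (fst z) (snd z)) \<le> C0 (fst z) * (1 + norm (snd z))"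
    and "AE t in lebesgue_on {0..T}. mono (\<lambda>x. b t x + C1 t *\<^sub>R x)"
    and "regular_lagrangian_flow T b \<phi>"
    and "distributional_solution T b f"
    and "distributional_solution T b (\<lambda>t x. \<bar>f t x\<bar>)"
  shows "duality_solution T \<phi> (f 0) f \<and>
         (\<forall>g. duality_solution T \<phi> (f 0) g \<longrightarrow> (\<forall>t\<in>{0..T}. AE x in lebesgue. g t x = f t x))"
proof -
  note T = assms(1) and sol = assms(10,11)
  obtain bb c where bb: "case_prod bb \<in> borel_measurable (lborel \<Otimes>\<^sub>M lborel)" "\<And>r x. norm (bb r x) \<le> c r * (1 + norm x)"
    and c: "integrable lborel c" "\<And>r. 0 \<le> c r" "\<And>r. r \<notin> {0..T} \<Longrightarrow> c r = 0"
    and b: "AE r in lborel. r \<in> {0..T} \<longrightarrow> (AE x in lborel. b r x = bb r x)"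
    using borel_representative_of_field[OF assms(2,3,4,7)] by blast
  obtain p where p: "1 \<le> p" "C_Lp_loc T p f" using sol(1) unfolding distributional_solution_def by blast
  obtain p' where p': "1 \<le> p'" "C_Lp_loc T p' (\<lambda>t x. \<bar>f t x\<bar>)" using sol(2) unfolding distributional_solution_def by blast
  have fL: "Lp_loc p (f t)" if "t \<in> {0..T}" for t using p(2) that by (auto simp: C_Lp_loc_def)
  have "\<exists>F0\<in>borel_measurable lborel. AE x in lborel. f (time_clamp T t) x = F0 x" for t
    using fL[OF time_clamp_mem[OF T, of t]] by (intro completion_ex_borel_measurable_real) (simp add: Lp_loc_def)
  then obtain F' where F': "\<And>t. F' t \<in> borel_measurable borel" "\<And>t. AE x in lborel. f (time_clamp T t) x = F' t x" by (metis measurable_lborel2)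
  define F where "F t = F' (time_clamp T t)" for t
  have cl: "time_clamp T (time_clamp T t) = time_clamp T t" for t by (rule time_clamp_id[OF time_clamp_mem[OF T]])
  have Fm: "F t \<in> borel_measurable borel" and F_ae: "AE x in lborel. f (time_clamp T t) x = F t x" and F_cl: "F t = F (time_clamp T t)" for t
    using F'(1) F'(2)[of "time_clamp T t"] by (simp_all add: F_def cl)
  have F_ae': "AE x in lborel. f t x = F t x" if "t \<in> {0..T}" for t using F_ae[of t] time_clamp_id[OF that] by simp
  have wc: "weakly_continuous F" by (rule representative_weakly_continuous[OF p(2,1) T Fm F_ae])
  have wc': "weakly_continuous (\<lambda>t x. \<bar>F t x\<bar>)"
  proof (rule representative_weakly_continuous[OF p'(2,1) T])
    show "(\<lambda>x. \<bar>F t x\<bar>) \<in> borel_measurable borel" for t using Fm[of t] by simp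
    show "AE x in lborel. \<bar>f (time_clamp T t) x\<bar> = \<bar>F t x\<bar>" for t using F_ae[of t] by eventually_elim simp
  qed
  have "\<exists>A. \<forall>t. (LINT x:cball 0 R|lborel. \<bar>F t x\<bar>) \<le> A" for R
  proof -
    define m where "m t = (LINT x|lborel. indicator (cball 0 R) x * \<bar>F t x\<bar>)" for t
    have "continuous_on UNIV m"
      unfolding m_def by (rule weakly_continuous.weak_cont[OF wc', where C=1 and R="R + 1"]) (auto simp: indicator_def)
    then have "bounded (m ` {0..T})"
      by (intro compact_imp_bounded compact_continuous_image) (auto intro: continuous_on_subset)
    then obtain A where A: "\<And>t. t \<in> {0..T} \<Longrightarrow> \<bar>m t\<bar> \<le> A" unfolding bounded_iff by fastforce
    have "m t \<le> A" for t
    proof -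
      have "m t = m (time_clamp T t)" unfolding m_def using F_cl[of t] by simp
      then show ?thesis using A[OF time_clamp_mem[OF T, of t]] by linarith
    qed
    then show ?thesis by (intro exI[of _ A]) (simp add: m_def set_lebesgue_integral_def)
  qed
  then obtain A where mass: "\<And>R t. (LINT x:cball 0 R|lborel. \<bar>F t x\<bar>) \<le> A R" by metis
  define H where "H e t x = (\<bar>F t x\<bar> + e * F t x) / 2" for e :: real and t x
  have ws: "weak_solution bb c (H e) A" if "\<bar>e\<bar> = 1" for e
    unfolding H_def[abs_def]
    by (rule weak_solution_half_sum[OF T that sol wc wc' F_ae F_cl bb c b mass])
  have F_H: "F t x = H 1 t x - H (- 1) t x" for t x by (simp add: H_def field_simps)
  have flow: "AE x in lborel. inclusion_solution T b 0 x (\<lambda>t. \<phi> t 0 x) \<and>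
      (\<forall>\<gamma>. inclusion_solution T b 0 x \<gamma> \<longrightarrow> (\<forall>t\<in>{0..T}. \<gamma> t = \<phi> t 0 x))"
    by (rule AE_completion_iff[THEN iffD1], rule bspec[OF assms(9)[unfolded regular_lagrangian_flow_def]]) (use T in simp)
  then have unique: "AE x in lborel. \<forall>\<gamma>. inclusion_solution T b 0 x \<gamma> \<longrightarrow> (\<forall>t\<in>{0..T}. \<gamma> t = \<phi> t 0 x)"
    by eventually_elim blast
  have transported: "\<exists>W. W \<in> borel_measurable borel \<and> (AE x in lborel. W x = u (\<phi> t 0 x)) \<and>
      integrable lborel (\<lambda>x. W x * H e 0 x) \<and> (LINT x|lborel. W x * H e 0 x) = (LINT x|lborel. u x * H e t x)"
    if u: "test_fun UNIV u" and e: "\<bar>e\<bar> = 1" and t: "t \<in> {0..T}" for u e t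
  proof -
    interpret weak_solution bb c "H e" A by (rule ws[OF e])
    obtain G R where G: "\<And>x. (u has_derivative (\<lambda>w. G x \<bullet> w)) (at x)" "continuous_on UNIV G" "0 \<le> R"
      "\<And>x. R \<le> norm x \<Longrightarrow> u x = 0" "\<And>x. R \<le> norm x \<Longrightarrow> G x = 0"
      using test_fun_gradient[OF u] by blast
    show ?thesis
    proof (cases "t = 0")
      case True
      have "integrable lborel (\<lambda>x. u x * H e 0 x)" by (rule test_fun_times_integrable(2)[OF u f_loc])
      moreover have "AE x in lborel. u x = u (\<phi> t 0 x)"
        using flow by eventually_elim (simp add: True inclusion_solution_def)
      ultimately show ?thesis using True test_fun_measurable[OF u] by (intro exI[of _ u]) simp
    next
      case False
      obtain W where "W \<in> borel_measurable borel" "AE x in lborel. W x = u (\<phi> t 0 x)" "integrable lborel (\<lambda>x. W x * H e 0 x)"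
        "(LINT x|lborel. W x * H e 0 x) = (LINT x|lborel. u x * H e t x)"
        by (rule weak_solution_transported[OF ws[OF e] T c(3) b unique _ _ G(1,2,4,5,3), where t=t]) (use t False in auto)
      then show ?thesis by blast
    qed
  qed
  \<comment> \<open>The identity for \<open>f\<close> is the difference of those for its positive and its negative part.\<close>
  have dual: "integrable lebesgue (\<lambda>x. flow_op \<phi> 0 t u x * f 0 x) \<and>
      (LINT x|lebesgue. u x * f t x) = (LINT x|lebesgue. flow_op \<phi> 0 t u x * f 0 x)"
    if u: "test_fun UNIV u" and t: "t \<in> {0..T}" for u t
  proof -
    obtain W1 where W1: "W1 \<in> borel_measurable borel" "AE x in lborel. W1 x = u (\<phi> t 0 x)" "integrable lborel (\<lambda>x. W1 x * H 1 0 x)"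
      "(LINT x|lborel. W1 x * H 1 0 x) = (LINT x|lborel. u x * H 1 t x)"
      using transported[OF u _ t, of 1] by auto
    obtain W2 where W2: "W2 \<in> borel_measurable borel" "AE x in lborel. W2 x = u (\<phi> t 0 x)" "integrable lborel (\<lambda>x. W2 x * H (- 1) 0 x)"
      "(LINT x|lborel. W2 x * H (- 1) 0 x) = (LINT x|lborel. u x * H (- 1) t x)"
      using transported[OF u _ t, of "- 1"] by auto
    interpret P: weak_solution bb c "H 1" A by (rule ws) simp
    interpret N: weak_solution bb c "H (- 1)" A by (rule ws) simp
    have Hm: "H e s \<in> borel_measurable borel" for e s unfolding H_def[abs_def] using Fm[of s] by simp
    have m: "(\<lambda>x. W1 x * H 1 0 x - W2 x * H (- 1) 0 x) \<in> borel_measurable borel" using W1(1) W2(1) Hm by simp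
    have ae: "AE x in lborel. flow_op \<phi> 0 t u x * f 0 x = W1 x * H 1 0 x - W2 x * H (- 1) 0 x"
    proof -
      have "AE x in lborel. f 0 x = F 0 x" using F_ae'[of 0] T by simp
      then show ?thesis
        using W1(2) W2(2) by eventually_elim (simp add: flow_op_def F_H right_diff_distrib)
    qed
    note um = test_fun_measurable[OF u] and ui = test_fun_times_integrable(2)[OF u]
    have "(LINT x|lebesgue. u x * f t x) = (LINT x|lborel. u x * H 1 t x - u x * H (- 1) t x)"
    proof (rule lebesgue_lborel_integral_cong(1))
      show "(\<lambda>x. u x * H 1 t x - u x * H (- 1) t x) \<in> borel_measurable borel"
        using Hm um by simp
      show "AE x in lborel. u x * f t x = u x * H 1 t x - u x * H (- 1) t x"
        using F_ae'[OF t] by eventually_elim (simp add: F_H right_diff_distrib)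
    qed
    also have "\<dots> = (LINT x|lborel. W1 x * H 1 0 x - W2 x * H (- 1) 0 x)"
      using ui[OF P.f_loc[of t]] ui[OF N.f_loc[of t]] W1(3,4) W2(3,4) by simp
    also have "\<dots> = (LINT x|lebesgue. flow_op \<phi> 0 t u x * f 0 x)"
      by (rule lebesgue_lborel_integral_cong(1)[OF m ae, symmetric])
    finally show ?thesis using lebesgue_lborel_integral_cong(2)[OF m ae] W1(3) W2(3) by simp
  qed
  have Lp1: "Lp_loc 1 (f t)" if t: "t \<in> {0..T}" for t
    unfolding Lp_loc_def
  proof (intro conjI allI impI)
    show "f t \<in> borel_measurable lebesgue" using fL[OF t] by (simp add: Lp_loc_def)
    fix K :: "(real^'d) set" assume K: "compact K"
    obtain R where R: "K \<subseteq> cball 0 R" using bounded_subset_cball_zero[OF compact_imp_bounded[OF K]] by blast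
    have "set_integrable lebesgue (cball 0 R) (f t)" by (rule Lp_loc_integrable[OF fL[OF t] p(1)])
    then have "set_integrable lebesgue K (f t)"
      by (rule set_integrable_subset) (use K R in \<open>auto simp: compact_imp_closed borel_closed\<close>)
    then show "if (1::ereal) = \<infinity> then \<exists>M. AE x in lebesgue. x \<in> K \<longrightarrow> \<bar>f t x\<bar> \<le> M
        else set_integrable lebesgue K (\<lambda>x. \<bar>f t x\<bar> powr real_of_ereal 1)"
      by (simp add: set_integrable_abs)
  qed
  have "duality_solution T \<phi> (f 0) f"
    unfolding duality_solution_def is_adjoint_def using Lp1 dual by blast
  moreover have "AE x in lebesgue. g t x = f t x" if g: "duality_solution T \<phi> (f 0) g" and t: "t \<in> {0..T}" for g t
  proof -
    have gt: "is_adjoint \<phi> t 0 (f 0) (g t)" using g t by (simp add: duality_solution_def)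
    then have gL: "Lp_loc 1 (g t)" by (simp add: is_adjoint_def)
    have "\<exists>g0\<in>borel_measurable lborel. AE x in lborel. g t x = g0 x"
      using gL by (intro completion_ex_borel_measurable_real) (simp add: Lp_loc_def)
    then obtain g0 where g0: "g0 \<in> borel_measurable borel" "AE x in lborel. g t x = g0 x" by auto
    have g0_loc: "locally_integrable g0"
      unfolding locally_integrable_def set_integrable_def
    proof
      fix R
      have ae: "AE x in lborel. indicator (cball 0 R) x *\<^sub>R g t x = indicator (cball 0 R) x *\<^sub>R g0 x" using g0(2) by eventually_elim simp
      have m: "(\<lambda>x. indicator (cball 0 R) x *\<^sub>R g0 x) \<in> borel_measurable borel"
        using g0(1) by (intro borel_measurable_scaleR borel_measurable_indicator) auto
      have "integrable lebesgue (\<lambda>x. indicator (cball 0 R) x *\<^sub>R g t x)"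
        using Lp_loc_integrable[OF gL, of R] by (simp add: set_integrable_def)
      then show "integrable lborel (\<lambda>x. indicator (cball 0 R) x *\<^sub>R g0 x)"
        by (rule lebesgue_lborel_integral_cong(2)[OF m ae, THEN iffD1])
    qed
    have F_loc: "locally_integrable (F t)" by (rule weakly_continuous.f_loc[OF wc])
    have diff_loc: "locally_integrable (\<lambda>x. g0 x - F t x)"
      using g0_loc F_loc unfolding locally_integrable_def by (auto intro: set_integral_diff(1))
    have "AE x in lborel. g0 x - F t x = 0"
    proof (rule test_functions_separate[OF diff_loc])
      fix u :: "real^'d \<Rightarrow> real" assume u: "test_fun UNIV u"
      note um = test_fun_measurable[OF u] and ui = test_fun_times_integrable(2)[OF u]
      have "(LINT x|lborel. u x * g0 x) = (LINT x|lebesgue. u x * g t x)"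
        by (rule lebesgue_lborel_integral_cong(1)[symmetric]) (use um g0 in \<open>auto elim!: eventually_mono\<close>)
      also have "\<dots> = (LINT x|lebesgue. u x * f t x)"
        using gt u dual[OF u t] by (auto simp: is_adjoint_def)
      also have "\<dots> = (LINT x|lborel. u x * F t x)"
        by (rule lebesgue_lborel_integral_cong(1)) (use um Fm F_ae'[OF t] in \<open>auto elim!: eventually_mono\<close>)
      finally show "(LINT x|lborel. u x * (g0 x - F t x)) = 0"
        using ui[OF g0_loc] ui[OF F_loc] by (simp add: right_diff_distrib)
    qed
    then have "AE x in lborel. g t x = f t x"
      using g0(2) F_ae'[OF t] by eventually_elim simp
    then show ?thesis by (rule AE_completion)
  qed
  ultimately show ?thesis by blast
qed

end
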